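(* Let $M$ be a $\mathrm{II}_1$-factor with its canonical trace $\tau$. For $t\in(0,\infty)$, let $M^t$ be the amplification of $M$ by $t$. Then $$h(M^t)=\frac1{t^2}h(M).$$
   Context: The amplification $M^t$ of a $\mathrm{II}_1$-factor $M$ is (up to isomorphism) $p(M\otimes\mathbb M_k(\mathbb C))p$, where $k\ge t$ is an integer and $p\in M\otimes\mathbb M_k(\mathbb C)$ is a projection with $(\tau\otimes\mathrm{Tr})(p)=t$ ($\mathrm{Tr}$ unnormalized); for $t\le 1$ it is $pMp$ with $\tau(p)=t$. It is a $\mathrm{II}_1$-factor, equipped with its canonical tracial state. $1$-bounded entropy $h$ of a tracial von Neumann algebra $(M,\tau)$ (finite von Neumann algebra with faithful normal tracial state): For a tuple $x=(x_1,\dots,x_d)$ put $\|x\|_\infty=\max_j\|x_j\|$ (operator norm) and $\|x\|_2=(\sum_j\tau(|x_j|^2))^{1/2}$; $\mathbb M_n(\mathbb C)$ carries the normalized trace $\mathrm{tr}_n$. Let $\mathbb C\langle t_1,\dots,t_d\rangle$ be the noncommutative polynomials with $t_j^*=t_j$. The law of a self-adjoint tuple $x\in M_{\mathrm{sa}}^d$ is $\ell_x(f)=\tau(f(x))$. $\Sigma_{d,R}$ is the set of laws of self-adjoint $d$-tuples $x$ in tracial von Neumann algebras with $\|x\|_\infty\le R$, with the topology of pointwise convergence. For $\mathcal O\subseteq\Sigma_{d,R}$ open, $\Gamma_R^{(n)}(\mathcal O)=\{X\in\mathbb M_n(\mathbb C)_{\mathrm{sa}}^d:\|X\|_\infty\le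 R,\ \ell_X\in\mathcal O\}$. For $\Omega\subseteq\mathbb M_n(\mathbb C)^d$, $K_\varepsilon^{\mathrm{orb}}(\Omega)$ is the minimal cardinality of a set $\Xi\subseteq\mathbb M_n(\mathbb C)^d$ such that for every $A\in\Omega$ there are $B\in\Xi$ and an $n\times n$ unitary $V$ with $\|A-VBV^*\|_2<\varepsilon$. For $x\in M_{\mathrm{sa}}^d$ with $W^*(x)=M$ and $\|x\|_\infty<R$, $$h(M)=h(x)=\sup_{\varepsilon>0}\inf_{\mathcal O\ni\ell_x}\limsup_{n\to\infty}\frac1{n^2}\log K_\varepsilon^{\mathrm{orb}}(\Gamma_R^{(n)}(\mathcal O))$$ (with $\log 0=-\infty$), which depends only on $(M,\tau)$. In general (also for $M$ not finitely generated, and agreeing with the value $h(x)$ whenever $M=W^*(x)$ for a finite self-adjoint tuple $x$), $$h(M)=\sup_{x,\varepsilon}\ \inf_{y,\mathcal O}\ \limsup_{n\to\infty}\frac1{n^2}\log K_\varepsilon^{\mathrm{orb}}(\Gamma_2^{(n)}(x:\mathcal O)),$$ where $x$ and $y$ range over finite tuples of self-adjoint contractions in $M$, $\varepsilon>0$, $\mathcal O$ ranges over neighborhoods of the joint law $\ell_{x,y}$, and $\Gamma_2^{(n)}(x:\mathcal O)$ is the projection of $\Gamma_2^{(n)}(\mathcal O)$ onto the coordinates of $x$. Values lie in $[-\infty,\infty]$. *)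

theory Defs
  imports
    "HOL-Analysis.Analysis"
    "HOL-Library.Extended_Nat"
    "HOL-Library.Poly_Mapping"
    "Jordan_Normal_Form.Matrix"
    "Jordan_Normal_Form.Schur_Decomposition"
begin

section \<open>Complex Hilbert spaces\<close>

text \<open>The inner product is linear in its first argument.\<close>

class complex_hilbert_space = banach +
  fixes scaleC :: "complex \<Rightarrow> 'a \<Rightarrow> 'a" (infixr "*\<^sub>C" 75)
    and cinner :: "'a \<Rightarrow> 'a \<Rightarrow> complex"
  assumes scaleC_add_right: "c *\<^sub>C (v + w) = c *\<^sub>C v + c *\<^sub>C w"
    and scaleC_add_left: "(c + d) *\<^sub>C v = c *\<^sub>C v + d *\<^sub>C v"
    and scaleC_scaleC: "c *\<^sub>C d *\<^sub>C v = (c * d) *\<^sub>C v"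
    and scaleC_of_real: "complex_of_real r *\<^sub>C v = r *\<^sub>R v"
    and cinner_commute: "cinner v w = cnj (cinner w v)"
    and cinner_add_left: "cinner (u + v) w = cinner u w + cinner v w"
    and cinner_scaleC_left: "cinner (c *\<^sub>C v) w = c * cinner v w"
    and cinner_self: "cinner v v = complex_of_real ((norm v)\<^sup>2)"

lemma norm_scaleC: "norm (c *\<^sub>C v) = cmod c * norm v"
  for v :: "'a::complex_hilbert_space"
proof -
  have "cinner (c *\<^sub>C v) (c *\<^sub>C v) = c * cnj c * cinner v v"
    by (metis cinner_commute cinner_scaleC_left complex_cnj_mult mult.assoc)
  hence "complex_of_real ((norm (c *\<^sub>C v))\<^sup>2) = complex_of_real ((cmod c * norm v)\<^sup>2)"
    by (simp only: cinner_self complex_norm_square[symmetric] of_real_mult[symmetric]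
        of_real_power[symmetric] power_mult_distrib)
  hence "(norm (c *\<^sub>C v))\<^sup>2 = (cmod c * norm v)\<^sup>2"
    by (simp only: of_real_eq_iff)
  thus ?thesis
    by (simp add: power2_eq_iff_nonneg)
qed

lemma bounded_linear_scaleC: "bounded_linear (\<lambda>v::'a::complex_hilbert_space. c *\<^sub>C v)"
proof (rule bounded_linear_intro[where K = "cmod c"])
  fix r and v w :: 'a
  show "c *\<^sub>C (v + w) = c *\<^sub>C v + c *\<^sub>C w"
    by (rule scaleC_add_right)
  show "c *\<^sub>C (r *\<^sub>R v) = r *\<^sub>R (c *\<^sub>C v)"
    by (simp add: scaleC_of_real[symmetric] scaleC_scaleC mult.commute)
  show "norm (c *\<^sub>C v) \<le> norm v * cmod c"
    by (simp add: norm_scaleC)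
qed

text \<open>The Hilbert space direct sum of \<^term>\<open>CARD('n)\<close> copies of a Hilbert space, i.e. its tensor
  product with \<open>\<complex>\<^sup>k\<close>.\<close>

instantiation Finite_Cartesian_Product.vec :: (complex_hilbert_space, finite) complex_hilbert_space
begin

definition scaleC_vec :: "complex \<Rightarrow> 'a ^ 'b \<Rightarrow> 'a ^ 'b" where
  "scaleC_vec c v = vec_lambda (\<lambda>i. c *\<^sub>C vec_nth v i)"

definition cinner_vec :: "'a ^ 'b \<Rightarrow> 'a ^ 'b \<Rightarrow> complex" where
  "cinner_vec v w = (\<Sum>i\<in>UNIV. cinner (vec_nth v i) (vec_nth w i))"

instance
proof
  fix c d :: complex and r :: real and u v w :: "'a ^ 'b"
  show "c *\<^sub>C (v + w) = c *\<^sub>C v + c *\<^sub>C w"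
    by (simp add: scaleC_vec_def Finite_Cartesian_Product.vec_eq_iff scaleC_add_right)
  show "(c + d) *\<^sub>C v = c *\<^sub>C v + d *\<^sub>C v"
    by (simp add: scaleC_vec_def Finite_Cartesian_Product.vec_eq_iff scaleC_add_left)
  show "c *\<^sub>C d *\<^sub>C v = (c * d) *\<^sub>C v"
    by (simp add: scaleC_vec_def Finite_Cartesian_Product.vec_eq_iff scaleC_scaleC)
  show "complex_of_real r *\<^sub>C v = r *\<^sub>R v"
    by (simp add: scaleC_vec_def Finite_Cartesian_Product.vec_eq_iff scaleC_of_real)
  show "cinner v w = cnj (cinner w v)"
    unfolding cinner_vec_def cnj_sum by (intro sum.cong refl cinner_commute)
  show "cinner (u + v) w = cinner u w + cinner v w"
    by (simp add: cinner_vec_def cinner_add_left sum.distrib)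
  show "cinner (c *\<^sub>C v) w = c * cinner v w"
    by (simp add: cinner_vec_def scaleC_vec_def cinner_scaleC_left sum_distrib_left)
  show "cinner v v = complex_of_real ((norm v)\<^sup>2)"
    by (simp add: cinner_vec_def cinner_self norm_vec_def L2_set_def sum_nonneg)
qed

end


section \<open>Bounded operators\<close>

text \<open>Bounded operators are elements of the library type of bounded \<^emph>\<open>real\<close>-linear maps, whose norm
  is the operator norm; complex linearity is a separate condition.\<close>

type_synonym 'h operator = "'h \<Rightarrow>\<^sub>L 'h"

definition complex_linear :: "'h::complex_hilbert_space operator \<Rightarrow> bool" where
  "complex_linear T \<longleftrightarrow> (\<forall>c v. blinfun_apply T (c *\<^sub>C v) = c *\<^sub>C blinfun_apply T v)"

lift_definition scaleC_op ::
  "complex \<Rightarrow> 'h::complex_hilbert_space operator \<Rightarrow> 'h operator"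
  is "\<lambda>c T v. c *\<^sub>C T v"
  by (rule bounded_linear_compose[OF bounded_linear_scaleC])

text \<open>\<open>is_adjoint S T\<close> says \<open>S = T\<^sup>*\<close>; the adjoint is unique.\<close>

definition is_adjoint ::
  "'h::complex_hilbert_space operator \<Rightarrow> 'h operator \<Rightarrow> bool" where
  "is_adjoint S T \<longleftrightarrow> (\<forall>v w. cinner (blinfun_apply T v) w = cinner v (blinfun_apply S w))"

definition self_adjoint :: "'h::complex_hilbert_space operator \<Rightarrow> bool" where
  "self_adjoint T \<longleftrightarrow> is_adjoint T T"

definition projection :: "'h::complex_hilbert_space operator \<Rightarrow> bool" where
  "projection p \<longleftrightarrow> complex_linear p \<and> self_adjoint p \<and> p o\<^sub>L p = p"

text \<open>The usual order; only used for self-adjoint operators.\<close>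

definition op_le :: "'h::complex_hilbert_space operator \<Rightarrow> 'h operator \<Rightarrow> bool" where
  "op_le S T \<longleftrightarrow>
     (\<forall>v. Re (cinner (blinfun_apply S v) v) \<le> Re (cinner (blinfun_apply T v) v))"


section \<open>Tracial von Neumann algebras and \<open>II\<^sub>1\<close>-factors\<close>

definition von_neumann_algebra :: "'h::complex_hilbert_space operator set \<Rightarrow> bool" where
  "von_neumann_algebra M \<longleftrightarrow>
     (\<forall>T\<in>M. complex_linear T) \<and>
     id_blinfun \<in> M \<and>
     (\<forall>S\<in>M. \<forall>T\<in>M. S + T \<in> M) \<and>
     (\<forall>c. \<forall>T\<in>M. scaleC_op c T \<in> M) \<and>
     (\<forall>S\<in>M. \<forall>T\<in>M. S o\<^sub>L T \<in> M) \<and>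
     (\<forall>T\<in>M. \<exists>S\<in>M. is_adjoint S T) \<and>
     closedin strong_operator_topology M"

text \<open>Normality: suprema of bounded increasing nets of positive elements are preserved.\<close>

definition normal_functional ::
  "'h::complex_hilbert_space operator set \<Rightarrow> ('h operator \<Rightarrow> complex) \<Rightarrow> bool" where
  "normal_functional M \<tau> \<longleftrightarrow>
     (\<forall>D S. D \<noteq> {} \<and> D \<subseteq> M \<and>
        (\<forall>T\<in>D. self_adjoint T \<and> op_le 0 T) \<and>
        (\<forall>T\<^sub>1\<in>D. \<forall>T\<^sub>2\<in>D. \<exists>T\<in>D. op_le T\<^sub>1 T \<and> op_le T\<^sub>2 T) \<and>
        S \<in> M \<and> self_adjoint S \<and> (\<forall>T\<in>D. op_le T S) \<and>
        (\<forall>U\<in>M. self_adjoint U \<and> (\<forall>T\<in>D. op_le T U) \<longrightarrow> op_le S U)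
        \<longrightarrow> Re (\<tau> S) = (SUP T\<in>D. Re (\<tau> T)))"

definition faithful_normal_tracial_state ::
  "'h::complex_hilbert_space operator set \<Rightarrow> ('h operator \<Rightarrow> complex) \<Rightarrow> bool" where
  "faithful_normal_tracial_state M \<tau> \<longleftrightarrow>
     (\<forall>S\<in>M. \<forall>T\<in>M. \<tau> (S + T) = \<tau> S + \<tau> T) \<and>
     (\<forall>c. \<forall>T\<in>M. \<tau> (scaleC_op c T) = c * \<tau> T) \<and>
     \<tau> id_blinfun = 1 \<and>
     (\<forall>S\<in>M. \<forall>T\<in>M. is_adjoint S T \<longrightarrow> Im (\<tau> (S o\<^sub>L T)) = 0 \<and> 0 \<le> Re (\<tau> (S o\<^sub>L T))) \<and>
     (\<forall>S\<in>M. \<forall>T\<in>M. is_adjoint S T \<and> \<tau> (S o\<^sub>L T) = 0 \<longrightarrow> T = 0) \<and>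
     (\<forall>S\<in>M. \<forall>T\<in>M. \<tau> (S o\<^sub>L T) = \<tau> (T o\<^sub>L S)) \<and>
     normal_functional M \<tau>"

definition tracial_von_neumann_algebra ::
  "'h::complex_hilbert_space operator set \<Rightarrow> ('h operator \<Rightarrow> complex) \<Rightarrow> bool" where
  "tracial_von_neumann_algebra M \<tau> \<longleftrightarrow>
     von_neumann_algebra M \<and> faithful_normal_tracial_state M \<tau>"

definition factor :: "'h::complex_hilbert_space operator set \<Rightarrow> bool" where
  "factor M \<longleftrightarrow> von_neumann_algebra M \<and>
     (\<forall>T\<in>M. (\<forall>S\<in>M. S o\<^sub>L T = T o\<^sub>L S) \<longrightarrow> (\<exists>c. T = scaleC_op c id_blinfun))"

text \<open>A \<open>II\<^sub>1\<close>-factor is an infinite-dimensional factor with a faithful normal tracial state,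
  and this state is then unique. Here \<^const>\<open>span\<close> is the real span, which does not affect finiteness
  of the dimension.\<close>

definition II1_factor ::
  "'h::complex_hilbert_space operator set \<Rightarrow> ('h operator \<Rightarrow> complex) \<Rightarrow> bool" where
  "II1_factor M \<tau> \<longleftrightarrow>
     factor M \<and> tracial_von_neumann_algebra M \<tau> \<and> \<not> (\<exists>B. finite B \<and> M \<subseteq> span B)"


section \<open>Amplifications\<close>

text \<open>With \<open>k = CARD('k)\<close>, operators on \<open>H \<otimes> \<complex>\<^sup>k\<close> are identified with \<open>k \<times> k\<close> matrices of
  operators on \<open>H\<close>, and \<open>M \<otimes> M\<^sub>k(\<complex>)\<close> with the matrices having all entries in \<open>M\<close>.\<close>

lift_definition op_entry ::
  "'k \<Rightarrow> 'k \<Rightarrow> ('h::complex_hilbert_space ^ 'k::finite) operator \<Rightarrow> 'h operator"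
  is "\<lambda>i j T v. vec_nth (T (axis j v)) i"
proof -
  fix i j :: 'k and T :: "'h ^ 'k \<Rightarrow> 'h ^ 'k"
  assume T: "bounded_linear T"
  have "bounded_linear (axis j :: 'h \<Rightarrow> 'h ^ 'k)"
  proof (rule bounded_linear_intro[where K = 1])
    fix r and v w :: 'h
    show "axis j (v + w) = axis j v + axis j w"
      by (simp add: axis_def Finite_Cartesian_Product.vec_eq_iff)
    show "axis j (r *\<^sub>R v) = r *\<^sub>R axis j v"
      by (simp add: axis_def Finite_Cartesian_Product.vec_eq_iff)
    show "norm (axis j v) \<le> norm v * 1"
      by (simp add: axis_def norm_vec_def L2_set_def if_distrib[of norm]
          if_distrib[of "\<lambda>x. x\<^sup>2"] cong: if_cong)
  qed
  from bounded_linear_compose[OF T this]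
  show "bounded_linear (\<lambda>v. vec_nth (T (axis j v)) i)"
    by (rule bounded_linear_compose[OF bounded_linear_vec_nth])
qed

definition matrix_amplification ::
  "'h::complex_hilbert_space operator set \<Rightarrow> ('h ^ 'k::finite) operator set" where
  "matrix_amplification M = {T. \<forall>i j. op_entry i j T \<in> M}"

text \<open>\<open>\<tau> \<otimes> Tr\<close>, with \<open>Tr\<close> unnormalized.\<close>

definition matrix_trace ::
  "('h::complex_hilbert_space operator \<Rightarrow> complex) \<Rightarrow> ('h ^ 'k::finite) operator \<Rightarrow> complex" where
  "matrix_trace \<tau> T = (\<Sum>i\<in>UNIV. \<tau> (op_entry i i T))"

text \<open>The algebra \<open>pNp\<close>; its unit is \<open>p\<close>.\<close>

definition corner ::
  "'h::complex_hilbert_space operator \<Rightarrow> 'h operator set \<Rightarrow> 'h operator set" where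
  "corner p N = (\<lambda>T. p o\<^sub>L T o\<^sub>L p) ` N"

text \<open>\<open>represents_amplification M \<tau> t p\<close> says that \<open>p (M \<otimes> M\<^sub>k(\<complex>)) p\<close> is a model of \<open>M\<^sup>t\<close>;
  the condition \<open>t \<le> k\<close> is implied. For \<open>k = 1\<close> these are the models \<open>pMp\<close>.\<close>

definition represents_amplification ::
  "'h::complex_hilbert_space operator set \<Rightarrow> ('h operator \<Rightarrow> complex) \<Rightarrow> real \<Rightarrow>
     ('h ^ 'k::finite) operator \<Rightarrow> bool" where
  "represents_amplification M \<tau> t p \<longleftrightarrow>
     p \<in> matrix_amplification M \<and> projection p \<and> matrix_trace \<tau> p = complex_of_real t"

definition amplification ::
  "'h::complex_hilbert_space operator set \<Rightarrow> ('h ^ 'k::finite) operator \<Rightarrow>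
     ('h ^ 'k) operator set" where
  "amplification M p = corner p (matrix_amplification M)"

definition amplification_trace ::
  "('h::complex_hilbert_space operator \<Rightarrow> complex) \<Rightarrow> real \<Rightarrow>
     ('h ^ 'k::finite) operator \<Rightarrow> complex" where
  "amplification_trace \<tau> t T = matrix_trace \<tau> T / complex_of_real t"


section \<open>Noncommutative laws\<close>

text \<open>A word \<open>[i\<^sub>1, \<dots>, i\<^sub>l]\<close> stands for the monomial \<open>t\<^bsub>i\<^sub>1\<^esub> \<cdots> t\<^bsub>i\<^sub>l\<^esub>\<close>, with letters counted
  from 0.\<close>

type_synonym ncpoly = "nat list \<Rightarrow>\<^sub>0 complex"

definition ncpolys :: "nat \<Rightarrow> ncpoly set" where
  "ncpolys d = {f. \<forall>w\<in>Poly_Mapping.keys f. set w \<subseteq> {..<d}}"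

text \<open>Laws of \<open>d\<close>-tuples are functions on \<^term>\<open>ncpolys d\<close>, extended by 0 to the whole type. The
  topology of the function type is that of pointwise convergence. The algebra has unit \<open>e\<close>, which
  is the value of the empty monomial.\<close>

type_synonym nclaw = "ncpoly \<Rightarrow> complex"

definition eval_op ::
  "'h::complex_hilbert_space operator \<Rightarrow> 'h operator list \<Rightarrow> ncpoly \<Rightarrow> 'h operator" where
  "eval_op e x f =
     (\<Sum>w\<in>Poly_Mapping.keys f.
        scaleC_op (Poly_Mapping.lookup f w) (foldr (\<lambda>i T. x ! i o\<^sub>L T) w e))"

definition law_op ::
  "'h::complex_hilbert_space operator \<Rightarrow> ('h operator \<Rightarrow> complex) \<Rightarrow> 'h operator list \<Rightarrow> nclaw" where
  "law_op e \<tau> x = (\<lambda>f. if f \<in> ncpolys (length x) then \<tau> (eval_op e x f) else 0)"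

definition eval_mat :: "nat \<Rightarrow> complex mat list \<Rightarrow> ncpoly \<Rightarrow> complex mat" where
  "eval_mat n X f =
     Matrix.mat n n (\<lambda>ij. \<Sum>w\<in>Poly_Mapping.keys f.
       Poly_Mapping.lookup f w * foldr (\<lambda>i A. X ! i * A) w (1\<^sub>m n) $$ ij)"

definition normalized_trace :: "nat \<Rightarrow> complex mat \<Rightarrow> complex" where
  "normalized_trace n A = (\<Sum>i<n. A $$ (i, i)) / of_nat n"

definition law_mat :: "nat \<Rightarrow> complex mat list \<Rightarrow> nclaw" where
  "law_mat n X = (\<lambda>f. if f \<in> ncpolys (length X) then normalized_trace n (eval_mat n X f) else 0)"


section \<open>Matricial microstates and orbital covering numbers\<close>

definition mat_op_norm :: "complex mat \<Rightarrow> real" where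
  "mat_op_norm A =
     (SUP v\<in>{v \<in> carrier_vec (dim_col A). sqrt (Re (v \<bullet>c v)) \<le> 1}.
        sqrt (Re ((A *\<^sub>v v) \<bullet>c (A *\<^sub>v v))))"

definition mat_tuples :: "nat \<Rightarrow> nat \<Rightarrow> complex mat list set" where
  "mat_tuples n d = {X. length X = d \<and> set X \<subseteq> carrier_mat n n}"

definition tuple_norm2 :: "nat \<Rightarrow> complex mat list \<Rightarrow> real" where
  "tuple_norm2 n X = sqrt (\<Sum>A\<leftarrow>X. Re (normalized_trace n (mat_adjoint A * A)))"

definition unitary_mat :: "nat \<Rightarrow> complex mat \<Rightarrow> bool" where
  "unitary_mat n V \<longleftrightarrow>
     V \<in> carrier_mat n n \<and> mat_adjoint V * V = 1\<^sub>m n \<and> V * mat_adjoint V = 1\<^sub>m n"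

text \<open>\<open>U\<close> is an open set of the ambient function space; the law of a matrix tuple of norm at most
  \<open>R\<close> lies in \<open>\<Sigma>\<^bsub>d,R\<^esub>\<close>, so only the relatively open subset \<open>U \<inter> \<Sigma>\<^bsub>d,R\<^esub>\<close> matters.\<close>

definition microstates :: "nat \<Rightarrow> nat \<Rightarrow> real \<Rightarrow> nclaw set \<Rightarrow> complex mat list set" where
  "microstates n d R U =
     {X \<in> mat_tuples n d.
        (\<forall>A\<in>set X. mat_adjoint A = A \<and> mat_op_norm A \<le> R) \<and> law_mat n X \<in> U}"

definition orbital_cover ::
  "nat \<Rightarrow> nat \<Rightarrow> real \<Rightarrow> complex mat list set \<Rightarrow> complex mat list set \<Rightarrow> bool" where
  "orbital_cover n d \<epsilon> \<Omega> \<Xi> \<longleftrightarrow> \<Xi> \<subseteq> mat_tuples n d \<and>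
     (\<forall>A\<in>\<Omega>. \<exists>B\<in>\<Xi>. \<exists>V. unitary_mat n V \<and>
        tuple_norm2 n (map2 (\<lambda>A\<^sub>j B\<^sub>j. A\<^sub>j - V * B\<^sub>j * mat_adjoint V) A B) < \<epsilon>)"

definition orbital_covering_number ::
  "nat \<Rightarrow> nat \<Rightarrow> real \<Rightarrow> complex mat list set \<Rightarrow> enat" where
  "orbital_covering_number n d \<epsilon> \<Omega> =
     Inf {enat (card \<Xi>) | \<Xi>. finite \<Xi> \<and> orbital_cover n d \<epsilon> \<Omega> \<Xi>}"

definition log_enat :: "enat \<Rightarrow> ereal" where
  "log_enat k =
     (case k of enat m \<Rightarrow> if m = 0 then -\<infinity> else ereal (ln (real m)) | \<infinity> \<Rightarrow> \<infinity>)"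


section \<open>One-bounded entropy\<close>

definition sa_contractions ::
  "'h::complex_hilbert_space operator set \<Rightarrow> 'h operator set" where
  "sa_contractions M = {T \<in> M. self_adjoint T \<and> norm T \<le> 1}"

text \<open>Projecting onto the coordinates of \<open>x\<close> is \<^term>\<open>take (length x)\<close>.\<close>

definition one_bounded_entropy ::
  "'h::complex_hilbert_space operator set \<Rightarrow> 'h operator \<Rightarrow> ('h operator \<Rightarrow> complex) \<Rightarrow> ereal"
  where
  "one_bounded_entropy M e \<tau> =
     (SUP (x, \<epsilon>) \<in> {(x, \<epsilon>). set x \<subseteq> sa_contractions M \<and> 0 < \<epsilon>}.
      INF (y, U) \<in> {(y, U). set y \<subseteq> sa_contractions M \<and> open U \<and> law_op e \<tau> (x @ y) \<in> U}.
        limsup (\<lambda>n. ereal (1 / (real n)\<^sup>2) *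
          log_enat (orbital_covering_number n (length x) \<epsilon>
            (take (length x) ` microstates n (length x + length y) 2 U))))"

end

theory Submission
  imports Defs
begin

text \<open>Let \<open>q\<close> be the projection with \<open>M\<^sup>t = q N q\<close>, where \<open>N = M \<otimes> M\<^sub>k(\<complex>)\<close>, and let \<open>e\<close> be a
  diagonal matrix unit, so that \<open>M = e N e\<close>. Since \<open>M\<close> is a factor, there are finitely many
  \<open>a\<^sub>l \<in> q N e\<close> with \<open>\<Sum> a\<^sub>l\<^sup>* a\<^sub>l \<le> e\<close> close to \<open>e\<close> in the 2-norm, and \<open>b\<^sub>j \<in> q N e\<close> with
  \<open>\<Sum> b\<^sub>j b\<^sub>j\<^sup>* = q\<close>. Take an \<open>m \<times> m\<close> microstate of a tuple \<open>x\<close> in \<open>q N q\<close> together with the elements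
  \<open>a\<^sub>l y a\<^sub>l'\<^sup>*\<close> and \<open>b\<^sub>j a\<^sub>l\<^sup>*\<close>. The block matrix modelling \<open>(a\<^sub>l a\<^sub>l'\<^sup>*)\<close> is close to a projection of rank
  \<open>n = \<lfloor>m \<rho>\<rfloor>\<close> with \<open>\<rho> = \<tau>(e) / \<tau>(q)\<close>, and compression to its range yields \<open>n \<times> n\<close> microstates of the
  elements \<open>b\<^sub>j\<^sup>* x\<^sub>i b\<^sub>j'\<close> of \<open>e N e\<close>. As \<open>\<Sum> b\<^sub>j b\<^sub>j\<^sup>* = q\<close>, these determine the unitary orbit of the
  original microstate of \<open>x\<close> up to a small error, so an orbital covering for the compressed tuple gives
  one for \<open>x\<close>. Rescaling \<open>n\<^sup>2\<close> to \<open>m\<^sup>2\<close> gives \<open>h(q N q) \<le> \<rho>\<^sup>2 h(e N e)\<close>; the roles of \<open>q\<close> and \<open>e\<close> can be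
  exchanged, and the two inequalities together are the equality.\<close>

section \<open>Tracial star algebras\<close>

text \<open>Two obstacles shape the proof. Laws control matrices only in the 2-norm, while
  microstates must have operator norm at most 2. Matrices that model elements of N are therefore cut
  down by functional calculus (\<open>clipping\<close>); this moves them little, because their
  moments stay bounded. Boundedness itself is expressed by \<open>bd\<close> through 2-norms alone,
  so that operators and matrices share one calculus.

  Secondly, the sum of a_l^* a_l only approaches e. The size of the microstates tends to infinity
  for a fixed family a before the family improves, so every operator norm bound has to be uniform in
  the number of the a_l; raw block matrices violate this and their clipped versions satisfy it. The
  order of choices fits the alternation of supremum and infimum: the b_j are part of the compressed
  tuple and are fixed before the target neighbourhood is given, while the a_l and the extra letters
  may depend on it.\<close>

class complex_star_algebra = ring +
  fixes cscale :: "complex \<Rightarrow> 'a \<Rightarrow> 'a" (infixr "\<star>" 75)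
    and adj :: "'a \<Rightarrow> 'a"
  assumes cscale_add_right: "c \<star> (x + y) = c \<star> x + c \<star> y"
    and cscale_add_left: "(c + d) \<star> x = c \<star> x + d \<star> x"
    and cscale_cscale: "c \<star> d \<star> x = (c * d) \<star> x"
    and cscale_one [simp]: "1 \<star> x = x"
    and cscale_mult_left: "(c \<star> x) * y = c \<star> (x * y)"
    and cscale_mult_right: "x * (c \<star> y) = c \<star> (x * y)"
    and adj_adj [simp]: "adj (adj x) = x"
    and adj_add: "adj (x + y) = adj x + adj y"
    and adj_mult: "adj (x * y) = adj y * adj x"
    and adj_cscale: "adj (c \<star> x) = cnj c \<star> adj x"
begin

lemma cscale_zero_right [simp]: "c \<star> 0 = 0"
  using cscale_add_right[of c 0 0] by simp

lemma cscale_zero_left [simp]: "0 \<star> x = 0"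
  using cscale_add_left[of 0 0 x] by simp

lemma cscale_eq_0D: assumes "c \<star> x = 0" "c \<noteq> 0" shows "x = 0"
proof -
  have "x = (1 / c) \<star> c \<star> x" using assms(2) by (simp add: cscale_cscale)
  thus ?thesis by (simp add: assms(1))
qed

lemma cscale_minus_one: "(-1) \<star> x = - x"
  using cscale_add_left[of 1 "-1" x] by (simp add: eq_neg_iff_add_eq_0 add.commute)

lemma cscale_minus_right: "c \<star> (- x) = - (c \<star> x)"
  using cscale_add_right[of c x "- x"] by (simp add: eq_neg_iff_add_eq_0 add.commute)

lemma cscale_minus_left: "(- c) \<star> x = - (c \<star> x)"
  using cscale_add_left[of c "- c" x] by (simp add: eq_neg_iff_add_eq_0 add.commute)

lemma cscale_diff_right: "c \<star> (x - y) = c \<star> x - c \<star> y"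
  using cscale_add_right[of c x "- y"] by (simp add: cscale_minus_right)

lemma adj_zero [simp]: "adj 0 = 0"
  using adj_add[of 0 0] by simp

lemma adj_minus: "adj (- x) = - adj x"
  using adj_add[of x "- x"] by (simp add: eq_neg_iff_add_eq_0 add.commute)

lemma adj_diff: "adj (x - y) = adj x - adj y"
  using adj_add[of x "- y"] by (simp add: adj_minus)

lemma adj_sum: "adj (\<Sum>i\<in>A. f i) = (\<Sum>i\<in>A. adj (f i))"
  by (induction A rule: infinite_finite_induct) (auto simp: adj_add)

lemma cscale_sum: "c \<star> (\<Sum>i\<in>A. f i) = (\<Sum>i\<in>A. c \<star> f i)"
  by (induction A rule: infinite_finite_induct) (auto simp: cscale_add_right)

end

text \<open>The carrier \<open>P\<close> is a set inside a type because the algebra is a subset of a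
  type of operators. No value of \<tau> on a unit is prescribed, so that the unnormalised trace on
  matrices of all sizes at once is an instance.\<close>

locale tracial =
  fixes P :: "'a::complex_star_algebra set" and \<tau> :: "'a \<Rightarrow> complex"
  assumes P_zero [simp, intro]: "0 \<in> P"
    and P_add [simp, intro]: "x \<in> P \<Longrightarrow> y \<in> P \<Longrightarrow> x + y \<in> P"
    and P_cscale [simp, intro]: "x \<in> P \<Longrightarrow> c \<star> x \<in> P"
    and P_mult [simp, intro]: "x \<in> P \<Longrightarrow> y \<in> P \<Longrightarrow> x * y \<in> P"
    and P_adj [simp, intro]: "x \<in> P \<Longrightarrow> adj x \<in> P"
    and tr_add: "x \<in> P \<Longrightarrow> y \<in> P \<Longrightarrow> \<tau> (x + y) = \<tau> x + \<tau> y"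
    and tr_cscale: "x \<in> P \<Longrightarrow> \<tau> (c \<star> x) = c * \<tau> x"
    and tr_comm: "x \<in> P \<Longrightarrow> y \<in> P \<Longrightarrow> \<tau> (x * y) = \<tau> (y * x)"
    and tr_Im: "x \<in> P \<Longrightarrow> Im (\<tau> (adj x * x)) = 0"
    and tr_pos: "x \<in> P \<Longrightarrow> 0 \<le> Re (\<tau> (adj x * x))"
begin

lemma P_minus [simp, intro]: "x \<in> P \<Longrightarrow> - x \<in> P"
  using P_cscale[of x "-1"] by (simp add: cscale_minus_one)

lemma P_diff [simp, intro]: "x \<in> P \<Longrightarrow> y \<in> P \<Longrightarrow> x - y \<in> P"
  using P_add[of x "- y"] by simp

lemma P_sum [simp, intro]: "(\<And>i. i \<in> A \<Longrightarrow> f i \<in> P) \<Longrightarrow> (\<Sum>i\<in>A. f i) \<in> P"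
  by (induction A rule: infinite_finite_induct) auto

lemma tr_zero [simp]: "\<tau> 0 = 0"
  using tr_cscale[of 0 0] by simp

lemma tr_minus: "x \<in> P \<Longrightarrow> \<tau> (- x) = - \<tau> x"
  using tr_cscale[of x "-1"] by (simp add: cscale_minus_one)

lemma tr_diff: "x \<in> P \<Longrightarrow> y \<in> P \<Longrightarrow> \<tau> (x - y) = \<tau> x - \<tau> y"
  using tr_add[of x "- y"] by (simp add: tr_minus)

lemma tr_sum: "(\<And>i. i \<in> A \<Longrightarrow> f i \<in> P) \<Longrightarrow> \<tau> (\<Sum>i\<in>A. f i) = (\<Sum>i\<in>A. \<tau> (f i))"
  by (induction A rule: infinite_finite_induct) (auto simp: tr_add)

definition nrm :: "'a \<Rightarrow> real" where "nrm x = sqrt (Re (\<tau> (adj x * x)))"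

lemma nrm_ge0 [simp]: "x \<in> P \<Longrightarrow> 0 \<le> nrm x"
  using tr_pos by (simp add: nrm_def)

lemma nrm_sq: "x \<in> P \<Longrightarrow> (nrm x)\<^sup>2 = Re (\<tau> (adj x * x))"
  using tr_pos by (simp add: nrm_def)

lemma tr_adj_self: "x \<in> P \<Longrightarrow> \<tau> (adj x * x) = complex_of_real ((nrm x)\<^sup>2)"
  using tr_Im by (simp add: nrm_sq complex_eq_iff)

lemma nrm_zero [simp]: "nrm 0 = 0"
  by (simp add: nrm_def)

lemma nrm_minus [simp]: "nrm (- x) = nrm x"
  by (simp add: nrm_def adj_minus)

lemma nrm_minus_commute: "nrm (x - y) = nrm (y - x)"
  using nrm_minus[of "x - y"] by simp

lemma nrm_cscale: "x \<in> P \<Longrightarrow> nrm (c \<star> x) = cmod c * nrm x"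
proof -
  assume x: "x \<in> P"
  have "\<tau> (adj (c \<star> x) * (c \<star> x)) = (cnj c * c) * \<tau> (adj x * x)"
    using x by (simp add: adj_cscale cscale_mult_left cscale_mult_right cscale_cscale tr_cscale)
  also have "\<dots> = complex_of_real ((cmod c)\<^sup>2 * (nrm x)\<^sup>2)"
    using x by (simp add: tr_adj_self complex_norm_square mult.commute del: of_real_power)
  finally have "nrm (c \<star> x) = sqrt ((cmod c * nrm x)\<^sup>2)"
    by (simp add: nrm_def[of "c \<star> x"] power_mult_distrib del: of_real_mult of_real_power)
  thus ?thesis using x by simp
qed

lemma nrm_adj: "x \<in> P \<Longrightarrow> nrm (adj x) = nrm x"
  using tr_comm[of x "adj x"] by (simp add: nrm_def)

lemma expand_sq:
  assumes "x \<in> P" "y \<in> P"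
  shows "\<tau> (adj (x + c \<star> y) * (x + c \<star> y)) =
    \<tau> (adj x * x) + c * \<tau> (adj x * y) + cnj c * \<tau> (adj y * x) + c * cnj c * \<tau> (adj y * y)"
  using assms
  by (simp add: adj_add adj_cscale distrib_left distrib_right cscale_mult_left cscale_mult_right
      cscale_cscale tr_add tr_cscale algebra_simps)

text \<open>Polarisation: the trace of \<open>adj z * z\<close> is real for z = x + c y, and c = 1
  and c = \<i> determine the imaginary and the real part of the difference.\<close>

lemma tr_hermitian:
  assumes "x \<in> P" "y \<in> P"
  shows "\<tau> (adj y * x) = cnj (\<tau> (adj x * y))"
proof -
  let ?a = "\<tau> (adj x * y)" and ?b = "\<tau> (adj y * x)"
  have im: "Im (c * ?a + cnj c * ?b) = 0" for c
    using arg_cong[OF expand_sq[OF assms, of c], of Im] assms tr_Im[of "x + c \<star> y"]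
      tr_Im[of x] tr_Im[of y] by (simp add: P_add P_cscale)
  from im[of 1] im[of \<i>] show ?thesis
    by (simp add: complex_eq_iff)
qed

lemma Cauchy_Schwarz_adj:
  assumes "x \<in> P" "y \<in> P"
  shows "cmod (\<tau> (adj x * y)) \<le> nrm x * nrm y"
proof -
  let ?a = "\<tau> (adj x * y)"
  have pos: "0 \<le> (nrm x)\<^sup>2 + 2 * Re (c * ?a) + (cmod c)\<^sup>2 * (nrm y)\<^sup>2" for c
  proof -
    have "0 \<le> Re (\<tau> (adj (x + c \<star> y) * (x + c \<star> y)))"
      using assms by (intro tr_pos) auto
    also have "\<dots> = Re (\<tau> (adj x * x)) + Re (c * ?a + cnj c * \<tau> (adj y * x)) + Re (c * cnj c * \<tau> (adj y * y))"
      by (simp add: expand_sq[OF assms])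
    also have "c * cnj c * \<tau> (adj y * y) = complex_of_real ((cmod c)\<^sup>2 * (nrm y)\<^sup>2)"
      using assms by (simp add: tr_adj_self complex_norm_square[symmetric] del: of_real_power of_real_mult)
        (simp add: complex_norm_square)
    also have "Re (c * ?a + cnj c * \<tau> (adj y * x)) = 2 * Re (c * ?a)"
      by (simp add: tr_hermitian[OF assms])
    finally show ?thesis using assms by (simp add: nrm_sq)
  qed
  have x0: "0 \<le> nrm x" and y0: "0 \<le> nrm y" using assms by auto
  have key: "0 \<le> (nrm x)\<^sup>2 - 2 * s * cmod ?a + s\<^sup>2 * (nrm y)\<^sup>2" if "s \<ge> 0" for s
  proof (cases "?a = 0")
    case True thus ?thesis by simp
  next
    case False
    \<comment> \<open>The phase is chosen so that \<open>c * ?a\<close> is the negative number -s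
      |?a|.\<close>
    define c where "c = - complex_of_real s * cnj ?a / cmod ?a"
    have "c * ?a = - complex_of_real (s * cmod ?a)"
      using False complex_norm_square[of ?a]
      by (simp add: c_def field_simps power2_eq_square)
    hence "Re (c * ?a) = - s * cmod ?a" by simp
    moreover have "cmod c = s" using False that by (simp add: c_def norm_mult norm_divide)
    ultimately show ?thesis using pos[of c] by simp
  qed
  show ?thesis
  proof (cases "nrm y = 0")
    case True
    have "cmod ?a = 0"
    proof (rule ccontr)
      assume "cmod ?a \<noteq> 0"
      hence "cmod ?a > 0" by simp
      \<comment> \<open>\<open>nrm\<close> is only a seminorm here, so y with
        \<open>nrm y = 0\<close> is treated separately; this s makes the quadratic expression equal
        to -1.\<close>
      with key[of "((nrm x)\<^sup>2 + 1) / (2 * cmod ?a)"] show False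
        using True by (simp add: field_simps)
    qed
    thus ?thesis using True by simp
  next
    case False
    hence yp: "nrm y > 0" using y0 by linarith
    have "0 \<le> (nrm x)\<^sup>2 - 2 * (cmod ?a / (nrm y)\<^sup>2) * cmod ?a + (cmod ?a / (nrm y)\<^sup>2)\<^sup>2 * (nrm y)\<^sup>2"
      by (rule key) simp
    also have "\<dots> = (nrm x)\<^sup>2 - (cmod ?a)\<^sup>2 / (nrm y)\<^sup>2"
      using yp by (simp add: field_simps power2_eq_square)
    finally have "(cmod ?a)\<^sup>2 \<le> (nrm x * nrm y)\<^sup>2"
      using yp by (simp add: field_simps power_mult_distrib)
    thus ?thesis using x0 y0 by (simp add: abs_le_square_iff[symmetric])
  qed
qed

lemma Cauchy_Schwarz:
  assumes "x \<in> P" "y \<in> P"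
  shows "cmod (\<tau> (x * y)) \<le> nrm x * nrm y"
  using Cauchy_Schwarz_adj[of "adj x" y] assms by (simp add: nrm_adj)

lemma nrm_add:
  assumes "x \<in> P" "y \<in> P"
  shows "nrm (x + y) \<le> nrm x + nrm y"
proof -
  have "(nrm (x + y))\<^sup>2 = (nrm x)\<^sup>2 + 2 * Re (\<tau> (adj x * y)) + (nrm y)\<^sup>2"
    using assms expand_sq[OF assms, of 1] tr_hermitian[OF assms]
    by (simp add: nrm_sq P_add)
  also have "\<dots> \<le> (nrm x)\<^sup>2 + 2 * (nrm x * nrm y) + (nrm y)\<^sup>2"
    using Cauchy_Schwarz_adj[OF assms] complex_Re_le_cmod[of "\<tau> (adj x * y)"] by simp
  also have "\<dots> = (nrm x + nrm y)\<^sup>2" by (simp add: power2_eq_square algebra_simps)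
  finally show ?thesis using assms by (simp add: power2_le_iff_abs_le)
qed

lemma nrm_diff: "x \<in> P \<Longrightarrow> y \<in> P \<Longrightarrow> nrm (x - y) \<le> nrm x + nrm y"
  using nrm_add[of x "- y"] by simp

lemma nrm_triangle: "x \<in> P \<Longrightarrow> y \<in> P \<Longrightarrow> z \<in> P \<Longrightarrow> nrm (x - z) \<le> nrm (x - y) + nrm (y - z)"
  using nrm_add[of "x - y" "y - z"] by simp

lemma nrm_sum: "(\<And>i. i \<in> A \<Longrightarrow> f i \<in> P) \<Longrightarrow> nrm (\<Sum>i\<in>A. f i) \<le> (\<Sum>i\<in>A. nrm (f i))"
proof (induction A rule: infinite_finite_induct)
  case (insert a A)
  have "nrm (f a + sum f A) \<le> nrm (f a) + nrm (sum f A)"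
    using insert by (intro nrm_add P_sum) auto
  thus ?case using insert by force
qed auto

text \<open>This replaces the operator norm, so that operators and matrices can be treated alike.\<close>

definition bd :: "real \<Rightarrow> 'a \<Rightarrow> bool" where
  "bd c x \<longleftrightarrow> x \<in> P \<and> 0 \<le> c \<and> (\<forall>y\<in>P. nrm (x * y) \<le> c * nrm y)"

lemma bdI: "x \<in> P \<Longrightarrow> 0 \<le> c \<Longrightarrow> (\<And>y. y \<in> P \<Longrightarrow> nrm (x * y) \<le> c * nrm y) \<Longrightarrow> bd c x"
  by (simp add: bd_def)

lemma bd_P: "bd c x \<Longrightarrow> x \<in> P" and bd_ge0: "bd c x \<Longrightarrow> 0 \<le> c"
  and bdD: "bd c x \<Longrightarrow> y \<in> P \<Longrightarrow> nrm (x * y) \<le> c * nrm y"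
  by (auto simp: bd_def)

lemma bd_mono: assumes "bd c x" "c \<le> d" shows "bd d x"
proof (rule bdI)
  fix y assume y: "y \<in> P"
  show "nrm (x * y) \<le> d * nrm y"
    using bdD[OF assms(1) y] mult_right_mono[OF assms(2) nrm_ge0[OF y]] by linarith
qed (use assms in \<open>auto simp: bd_def\<close>)

lemma bd_zero: "0 \<le> c \<Longrightarrow> bd c 0"
  by (simp add: bd_def)

lemma bd_mult:
  assumes "bd c x" "bd d y" shows "bd (c * d) (x * y)"
proof (rule bdI)
  fix z assume z: "z \<in> P"
  have "nrm (x * y * z) \<le> c * nrm (y * z)"
    using bdD[OF assms(1), of "y * z"] z bd_P[OF assms(2)] by (simp add: mult.assoc)
  also have "\<dots> \<le> c * (d * nrm z)"
    using bdD[OF assms(2) z] bd_ge0[OF assms(1)] by (rule mult_left_mono)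
  finally show "nrm (x * y * z) \<le> c * d * nrm z" by simp
qed (use assms in \<open>auto simp: bd_def\<close>)

lemma bd_add:
  assumes "bd c x" "bd d y" shows "bd (c + d) (x + y)"
proof (rule bdI)
  fix z assume z: "z \<in> P"
  have "nrm ((x + y) * z) \<le> nrm (x * z) + nrm (y * z)"
    using nrm_add[of "x * z" "y * z"] z assms by (simp add: distrib_right bd_P)
  also have "\<dots> \<le> (c + d) * nrm z"
    using bdD[OF assms(1) z] bdD[OF assms(2) z] by (simp add: distrib_right)
  finally show "nrm ((x + y) * z) \<le> (c + d) * nrm z" .
qed (use assms in \<open>auto simp: bd_def\<close>)

lemma bd_cscale:
  assumes "bd c x" shows "bd (cmod a * c) (a \<star> x)"
proof (rule bdI)
  fix z assume z: "z \<in> P"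
  show "nrm ((a \<star> x) * z) \<le> cmod a * c * nrm z"
    using mult_left_mono[OF bdD[OF assms z] norm_ge_zero[of a]] z bd_P[OF assms]
    by (simp add: cscale_mult_left nrm_cscale)
qed (use assms in \<open>auto simp: bd_def\<close>)

lemma bd_minus: "bd c x \<Longrightarrow> bd c (- x)"
  using bd_cscale[of c x "-1"] by (simp add: cscale_minus_one)

lemma bd_diff: "bd c x \<Longrightarrow> bd d y \<Longrightarrow> bd (c + d) (x - y)"
  using bd_add[OF _ bd_minus, of c x d y] by simp

lemma bd_sum: "(\<And>i. i \<in> A \<Longrightarrow> bd (c i) (f i)) \<Longrightarrow> bd (\<Sum>i\<in>A. c i) (\<Sum>i\<in>A. f i)"
  by (induction A rule: infinite_finite_induct) (auto intro: bd_zero bd_add)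

text \<open>The square of the 2-norm of x^* y is the inner product of y with x x^* y. Cauchy-Schwarz
  and the bound for x leave one factor of that 2-norm to cancel.\<close>

lemma bd_adj:
  assumes "bd c x" shows "bd c (adj x)"
proof (rule bdI)
  fix y assume y: "y \<in> P"
  have x: "x \<in> P" using assms by (rule bd_P)
  have "(nrm (adj x * y))\<^sup>2 = Re (\<tau> (adj y * (x * (adj x * y))))"
    using x y by (simp add: nrm_sq adj_mult mult.assoc)
  also have "\<dots> \<le> nrm y * nrm (x * (adj x * y))"
    using Cauchy_Schwarz_adj[of y "x * (adj x * y)"] x y complex_Re_le_cmod order_trans by blast
  also have "\<dots> \<le> nrm y * (c * nrm (adj x * y))"
    using x y by (intro mult_left_mono bdD[OF assms]) auto
  finally have "nrm (adj x * y) * nrm (adj x * y) \<le> (c * nrm y) * nrm (adj x * y)"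
    by (simp add: power2_eq_square mult_ac)
  moreover have "0 \<le> nrm (adj x * y)" "0 \<le> c * nrm y" using x y bd_ge0[OF assms] by auto
  ultimately show "nrm (adj x * y) \<le> c * nrm y"
    by (cases "nrm (adj x * y) = 0") auto
qed (use assms in \<open>auto simp: bd_def\<close>)

lemma bdD_right:
  assumes "bd c x" "y \<in> P" shows "nrm (y * x) \<le> c * nrm y"
  using bdD[OF bd_adj[OF assms(1)], of "adj y"] nrm_adj[of "y * x"] nrm_adj[of y] assms bd_P[OF assms(1)]
  by (simp add: adj_mult)

text \<open>The nontrivial half of the C^*-identity in terms of \<open>bd\<close>.\<close>

lemma bd_of_adj_mult:
  assumes "x \<in> P" "0 \<le> c" "bd (c\<^sup>2) (adj x * x)" shows "bd c x"
proof (rule bdI)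
  fix y assume y: "y \<in> P"
  have "(nrm (x * y))\<^sup>2 = Re (\<tau> (adj y * (adj x * x * y)))"
    using assms y by (simp add: nrm_sq adj_mult mult.assoc)
  also have "\<dots> \<le> nrm y * nrm (adj x * x * y)"
    using Cauchy_Schwarz_adj[of y "adj x * x * y"] assms(1) y complex_Re_le_cmod order_trans by blast
  also have "\<dots> \<le> nrm y * (c\<^sup>2 * nrm y)"
    using y by (intro mult_left_mono bdD[OF assms(3)]) auto
  finally have "(nrm (x * y))\<^sup>2 \<le> (c * nrm y)\<^sup>2" by (simp add: power2_eq_square mult_ac)
  thus "nrm (x * y) \<le> c * nrm y"
    using assms y by (simp add: abs_le_square_iff[symmetric])
qed (use assms in auto)

lemma bd_projection:
  assumes "q \<in> P" "adj q = q" "q * q = q" shows "bd 1 q"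
proof (rule bdI)
  fix y assume y: "y \<in> P"
  have "(nrm (q * y))\<^sup>2 = Re (\<tau> (adj y * (q * y)))"
    using assms y by (simp add: nrm_sq adj_mult mult.assoc) (metis mult.assoc)
  also have "\<dots> \<le> nrm y * nrm (q * y)"
    using Cauchy_Schwarz_adj[of y "q * y"] assms y complex_Re_le_cmod order_trans by blast
  finally have "nrm (q * y) * nrm (q * y) \<le> nrm y * nrm (q * y)" by (simp add: power2_eq_square)
  moreover have "0 \<le> nrm (q * y)" "0 \<le> nrm y" using assms y by auto
  ultimately show "nrm (q * y) \<le> 1 * nrm y" by (cases "nrm (q * y) = 0") auto
qed (use assms in auto)

lemma bd_isometry:
  assumes "v \<in> P" "q \<in> P" "adj q = q" "q * q = q" "adj v * v = q" shows "bd 1 v"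
  using bd_of_adj_mult[of v 1] bd_projection[OF assms(2-4)] by (simp add: assms(1,5))

text \<open>The left side is the squared 2-norm of the column with entries b_i^* y, that is, the
  inner product of y with the sum of the b_i b_i^* applied to y.\<close>

lemma col_bound:
  assumes b: "\<And>i. i \<in> I \<Longrightarrow> b i \<in> P" and "bd c (\<Sum>i\<in>I. b i * adj (b i))" and y: "y \<in> P"
  shows "(\<Sum>i\<in>I. (nrm (adj (b i) * y))\<^sup>2) \<le> c * (nrm y)\<^sup>2"
proof -
  have "(\<Sum>i\<in>I. (nrm (adj (b i) * y))\<^sup>2) = Re (\<tau> (\<Sum>i\<in>I. adj y * (b i * adj (b i) * y)))"
    using b y by (simp add: nrm_sq adj_mult mult.assoc tr_sum)
  also have "(\<Sum>i\<in>I. adj y * (b i * adj (b i) * y)) = adj y * ((\<Sum>i\<in>I. b i * adj (b i)) * y)"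
    by (simp add: sum_distrib_left sum_distrib_right)
  also have "Re (\<tau> \<dots>) \<le> nrm y * nrm ((\<Sum>i\<in>I. b i * adj (b i)) * y)"
    using Cauchy_Schwarz_adj[of y "(\<Sum>i\<in>I. b i * adj (b i)) * y"] b y complex_Re_le_cmod order_trans
    by (metis (no_types, lifting) P_adj P_mult P_sum)
  also have "\<dots> \<le> nrm y * (c * nrm y)"
    using y by (intro mult_left_mono bdD[OF assms(2)]) auto
  finally show ?thesis by (simp add: power2_eq_square mult_ac)
qed

text \<open>The sum is the row of the b_i times a diagonal matrix with entries x times the column of
  the b'_i^*, of norms sqrt c, k and sqrt c. The proof pairs with z and applies Cauchy-Schwarz first
  in the trace and then over the index i.\<close>

lemma bd_sandwich_sum:
  assumes b: "\<And>i. i \<in> I \<Longrightarrow> b i \<in> P" "bd c (\<Sum>i\<in>I. b i * adj (b i))"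
    and b': "\<And>i. i \<in> I \<Longrightarrow> b' i \<in> P" "bd c (\<Sum>i\<in>I. b' i * adj (b' i))"
    and x: "bd k x"
  shows "bd (k * c) (\<Sum>i\<in>I. b i * x * adj (b' i))"
proof (rule bdI)
  have xP: "x \<in> P" using x by (rule bd_P)
  show "(\<Sum>i\<in>I. b i * x * adj (b' i)) \<in> P" using b b' xP by auto
  show "0 \<le> k * c" using bd_ge0[OF x] bd_ge0[OF b(2)] by simp
  fix y assume y: "y \<in> P"
  let ?S = "\<Sum>i\<in>I. b i * x * adj (b' i)"
  define z where "z = ?S * y"
  have zP: "z \<in> P" using b b' xP y by (auto simp: z_def)
  have k0: "0 \<le> k" and c0: "0 \<le> c" using x b(2) by (auto simp: bd_def)
  have "(nrm z)\<^sup>2 = Re (\<tau> (adj z * z))" using zP by (rule nrm_sq)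
  also have "adj z * z = (\<Sum>i\<in>I. adj (adj (b i) * z) * (x * (adj (b' i) * y)))"
  proof -
    have "adj z * z = adj z * (\<Sum>i\<in>I. b i * (x * (adj (b' i) * y)))"
      unfolding z_def by (simp only: sum_distrib_right mult.assoc)
    thus ?thesis by (simp add: sum_distrib_left adj_mult mult.assoc)
  qed
  also have "Re (\<tau> \<dots>) = (\<Sum>i\<in>I. Re (\<tau> (adj (adj (b i) * z) * (x * (adj (b' i) * y)))))"
    using b b' xP y zP by (subst tr_sum) auto
  also have "\<dots> \<le> (\<Sum>i\<in>I. nrm (adj (b i) * z) * (k * nrm (adj (b' i) * y)))"
  proof (rule sum_mono)
    fix i assume i: "i \<in> I"
    have "Re (\<tau> (adj (adj (b i) * z) * (x * (adj (b' i) * y)))) \<le> nrm (adj (b i) * z) * nrm (x * (adj (b' i) * y))"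
      using Cauchy_Schwarz_adj[of "adj (b i) * z" "x * (adj (b' i) * y)"] b b' xP y zP i
        complex_Re_le_cmod order_trans by blast
    also have "\<dots> \<le> nrm (adj (b i) * z) * (k * nrm (adj (b' i) * y))"
      using b b' y zP i by (intro mult_left_mono bdD[OF x]) auto
    finally show "Re (\<tau> (adj (adj (b i) * z) * (x * (adj (b' i) * y)))) \<le> \<dots>" .
  qed
  also have "\<dots> = k * (\<Sum>i\<in>I. nrm (adj (b i) * z) * nrm (adj (b' i) * y))"
    by (simp add: sum_distrib_left mult_ac)
  also have "\<dots> \<le> k * (L2_set (\<lambda>i. nrm (adj (b i) * z)) I * L2_set (\<lambda>i. nrm (adj (b' i) * y)) I)"
    using L2_set_mult_ineq[of "\<lambda>i. nrm (adj (b i) * z)" "\<lambda>i. nrm (adj (b' i) * y)" I] b b' y zP k0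
    by (intro mult_left_mono) (auto simp: abs_of_nonneg)
  also have "\<dots> \<le> k * ((sqrt c * nrm z) * (sqrt c * nrm y))"
  proof (intro mult_left_mono mult_mono k0)
    show "L2_set (\<lambda>i. nrm (adj (b i) * z)) I \<le> sqrt c * nrm z"
      using real_sqrt_le_mono[OF col_bound[OF b zP]] zP
      by (simp add: L2_set_def real_sqrt_mult abs_of_nonneg)
    show "L2_set (\<lambda>i. nrm (adj (b' i) * y)) I \<le> sqrt c * nrm y"
      using real_sqrt_le_mono[OF col_bound[OF b' y]] y
      by (simp add: L2_set_def real_sqrt_mult abs_of_nonneg)
  qed (use zP y c0 in auto)
  also have "\<dots> = (k * c * nrm y) * nrm z" using c0 by (simp add: mult_ac) 
  finally have "nrm z * nrm z \<le> (k * c * nrm y) * nrm z" by (simp add: power2_eq_square)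
  moreover have "0 \<le> nrm z" "0 \<le> k * c * nrm y" using zP k0 c0 y by auto
  ultimately show "nrm (?S * y) \<le> k * c * nrm y"
    unfolding z_def[symmetric] by (cases "nrm z = 0") auto
qed

end

section \<open>Asymptotic calculus in the 2-norm\<close>

context tracial begin

text \<open>\<kappa> rescales an unnormalised matrix trace: for m x m matrices modelling p N p it
  will be m / \<tau>(p), so that Tr / \<kappa> corresponds to \<tau>. The absolute value keeps all
  quotients nonnegative without an assumption on the sign.\<close>

definition null :: "('w \<Rightarrow> real) \<Rightarrow> 'w filter \<Rightarrow> ('w \<Rightarrow> 'a) \<Rightarrow> bool" where
  "null \<kappa> Fl F \<longleftrightarrow> (\<forall>\<omega>. F \<omega> \<in> P) \<and> ((\<lambda>\<omega>. nrm (F \<omega>) / sqrt \<bar>\<kappa> \<omega>\<bar>) \<longlongrightarrow> 0) Fl"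

text \<open>An operator norm bound, hence free of \<kappa>; \<open>sbd\<close> is the bound in the
  rescaled 2-norm. Along a filter both ask for one constant valid eventually, which for iterated
  limits means uniformity in the outer index.\<close>

definition bnd :: "'w filter \<Rightarrow> ('w \<Rightarrow> 'a) \<Rightarrow> bool" where
  "bnd Fl F \<longleftrightarrow> (\<forall>\<omega>. F \<omega> \<in> P) \<and> (\<exists>c. \<forall>\<^sub>F \<omega> in Fl. bd c (F \<omega>))"

definition sbd :: "('w \<Rightarrow> real) \<Rightarrow> 'w filter \<Rightarrow> ('w \<Rightarrow> 'a) \<Rightarrow> bool" where
  "sbd \<kappa> Fl F \<longleftrightarrow> (\<forall>\<omega>. F \<omega> \<in> P) \<and> (\<exists>c. \<forall>\<^sub>F \<omega> in Fl. nrm (F \<omega>) / sqrt \<bar>\<kappa> \<omega>\<bar> \<le> c)"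

definition asy :: "('w \<Rightarrow> real) \<Rightarrow> 'w filter \<Rightarrow> ('w \<Rightarrow> 'a) \<Rightarrow> ('w \<Rightarrow> 'a) \<Rightarrow> bool" where
  "asy \<kappa> Fl F G \<longleftrightarrow> (\<forall>\<omega>. F \<omega> \<in> P) \<and> (\<forall>\<omega>. G \<omega> \<in> P) \<and> null \<kappa> Fl (\<lambda>\<omega>. F \<omega> - G \<omega>)"

lemma null_P: "null \<kappa> Fl F \<Longrightarrow> F \<omega> \<in> P"
  and bnd_P: "bnd Fl F \<Longrightarrow> F \<omega> \<in> P"
  and sbd_P: "sbd \<kappa> Fl F \<Longrightarrow> F \<omega> \<in> P"
  by (auto simp: null_def bnd_def sbd_def asy_def)

lemma null_by_bound:
  assumes "\<And>\<omega>. F \<omega> \<in> P" "\<forall>\<^sub>F \<omega> in Fl. nrm (F \<omega>) / sqrt \<bar>\<kappa> \<omega>\<bar> \<le> g \<omega>" "(g \<longlongrightarrow> 0) Fl"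
  shows "null \<kappa> Fl F"
  unfolding null_def
proof (intro conjI allI tendsto_sandwich[OF _ assms(2) tendsto_const assms(3)])
  show "\<forall>\<^sub>F \<omega> in Fl. 0 \<le> nrm (F \<omega>) / sqrt \<bar>\<kappa> \<omega>\<bar>"
    using assms(1) by (intro always_eventually) auto
qed (use assms in auto)

lemma null_limit: "null \<kappa> Fl F \<Longrightarrow> ((\<lambda>\<omega>. nrm (F \<omega>) / sqrt \<bar>\<kappa> \<omega>\<bar>) \<longlongrightarrow> 0) Fl"
  by (simp add: null_def)

lemma null_add: 
  assumes "null \<kappa> Fl F" "null \<kappa> Fl G" shows "null \<kappa> Fl (\<lambda>\<omega>. F \<omega> + G \<omega>)"
proof (rule null_by_bound)
  show "\<forall>\<^sub>F \<omega> in Fl. nrm (F \<omega> + G \<omega>) / sqrt \<bar>\<kappa> \<omega>\<bar> \<le> nrm (F \<omega>) / sqrt \<bar>\<kappa> \<omega>\<bar> + nrm (G \<omega>) / sqrt \<bar>\<kappa> \<omega>\<bar>"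
    using nrm_add[OF null_P[OF assms(1)] null_P[OF assms(2)]]
    by (intro always_eventually) (auto simp: add_divide_distrib[symmetric] intro!: divide_right_mono)
  show "((\<lambda>\<omega>. nrm (F \<omega>) / sqrt \<bar>\<kappa> \<omega>\<bar> + nrm (G \<omega>) / sqrt \<bar>\<kappa> \<omega>\<bar>) \<longlongrightarrow> 0) Fl"
    using tendsto_add[OF null_limit[OF assms(1)] null_limit[OF assms(2)]] by simp
qed (use null_P[OF assms(1)] null_P[OF assms(2)] in auto)

lemma null_cscale: assumes "null \<kappa> Fl F" shows "null \<kappa> Fl (\<lambda>\<omega>. c \<star> F \<omega>)"
proof (rule null_by_bound)
  show "\<forall>\<^sub>F \<omega> in Fl. nrm (c \<star> F \<omega>) / sqrt \<bar>\<kappa> \<omega>\<bar> \<le> cmod c * (nrm (F \<omega>) / sqrt \<bar>\<kappa> \<omega>\<bar>)"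
    using nrm_cscale[OF null_P[OF assms]] by (intro always_eventually) auto
  show "((\<lambda>\<omega>. cmod c * (nrm (F \<omega>) / sqrt \<bar>\<kappa> \<omega>\<bar>)) \<longlongrightarrow> 0) Fl"
    using tendsto_mult[OF tendsto_const null_limit[OF assms]] by fastforce
qed (use null_P[OF assms(1)] in auto)

lemma null_minus: "null \<kappa> Fl F \<Longrightarrow> null \<kappa> Fl (\<lambda>\<omega>. - F \<omega>)"
  by (auto simp: null_def)

lemma null_zero: "null \<kappa> Fl (\<lambda>\<omega>. 0)"
  by (simp add: null_def)

lemma null_adj: "null \<kappa> Fl F \<Longrightarrow> null \<kappa> Fl (\<lambda>\<omega>. adj (F \<omega>))"
  by (auto simp: null_def nrm_adj)

lemma null_mult_left:
  assumes "bnd Fl F" "null \<kappa> Fl G" shows "null \<kappa> Fl (\<lambda>\<omega>. F \<omega> * G \<omega>)"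
proof -
  obtain c where c: "\<forall>\<^sub>F \<omega> in Fl. bd c (F \<omega>)" using assms by (auto simp: bnd_def)
  show ?thesis
  proof (rule null_by_bound)
    show "\<forall>\<^sub>F \<omega> in Fl. nrm (F \<omega> * G \<omega>) / sqrt \<bar>\<kappa> \<omega>\<bar> \<le> c * (nrm (G \<omega>) / sqrt \<bar>\<kappa> \<omega>\<bar>)"
      using c by eventually_elim
        (use bdD null_P[OF assms(2)] in \<open>auto intro!: divide_right_mono\<close>)
    show "((\<lambda>\<omega>. c * (nrm (G \<omega>) / sqrt \<bar>\<kappa> \<omega>\<bar>)) \<longlongrightarrow> 0) Fl"
      using tendsto_mult[OF tendsto_const null_limit[OF assms(2)]] by fastforce
  qed (use null_P[OF assms(2)] bnd_P[OF assms(1)] in auto)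
qed

lemma bnd_adj: "bnd Fl F \<Longrightarrow> bnd Fl (\<lambda>\<omega>. adj (F \<omega>))"
  unfolding bnd_def by (auto elim!: eventually_mono intro: bd_adj)

lemma null_mult_right:
  assumes "bnd Fl F" "null \<kappa> Fl G" shows "null \<kappa> Fl (\<lambda>\<omega>. G \<omega> * F \<omega>)"
  using null_adj[OF null_mult_left[OF bnd_adj[OF assms(1)] null_adj[OF assms(2)]]]
  by (simp add: adj_mult)

lemma bndI: "(\<And>\<omega>. F \<omega> \<in> P) \<Longrightarrow> \<forall>\<^sub>F \<omega> in Fl. bd c (F \<omega>) \<Longrightarrow> bnd Fl F"
  by (auto simp: bnd_def)

lemma bnd_add: assumes "bnd Fl F" "bnd Fl G" shows "bnd Fl (\<lambda>\<omega>. F \<omega> + G \<omega>)"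
proof -
  obtain c d where "\<forall>\<^sub>F \<omega> in Fl. bd c (F \<omega>)" "\<forall>\<^sub>F \<omega> in Fl. bd d (G \<omega>)"
    using assms by (auto simp: bnd_def)
  hence "\<forall>\<^sub>F \<omega> in Fl. bd (c + d) (F \<omega> + G \<omega>)" by eventually_elim (rule bd_add)
  thus ?thesis using assms by (auto simp: bnd_def)
qed

lemma bnd_mult: assumes "bnd Fl F" "bnd Fl G" shows "bnd Fl (\<lambda>\<omega>. F \<omega> * G \<omega>)"
proof -
  obtain c d where "\<forall>\<^sub>F \<omega> in Fl. bd c (F \<omega>)" "\<forall>\<^sub>F \<omega> in Fl. bd d (G \<omega>)"
    using assms by (auto simp: bnd_def)
  hence "\<forall>\<^sub>F \<omega> in Fl. bd (c * d) (F \<omega> * G \<omega>)" by eventually_elim (rule bd_mult)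
  thus ?thesis using assms by (auto simp: bnd_def)
qed

lemma bnd_cscale: assumes "bnd Fl F" shows "bnd Fl (\<lambda>\<omega>. c \<star> F \<omega>)"
proof -
  obtain d where "\<forall>\<^sub>F \<omega> in Fl. bd d (F \<omega>)" using assms by (auto simp: bnd_def)
  hence "\<forall>\<^sub>F \<omega> in Fl. bd (cmod c * d) (c \<star> F \<omega>)" by eventually_elim (rule bd_cscale)
  thus ?thesis using assms by (auto simp: bnd_def)
qed

lemma bnd_const: "bd c x \<Longrightarrow> bnd Fl (\<lambda>\<omega>. x)"
  by (rule bndI[of _ c]) (simp_all add: bd_P)

lemma bnd_diff: "bnd Fl F \<Longrightarrow> bnd Fl G \<Longrightarrow> bnd Fl (\<lambda>\<omega>. F \<omega> - G \<omega>)"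
  using bnd_add[of Fl F "\<lambda>\<omega>. (-1) \<star> G \<omega>"] bnd_cscale[of Fl G "-1"] by (simp add: cscale_minus_one)

lemma bnd_sum: "(\<And>i. i \<in> A \<Longrightarrow> bnd Fl (F i)) \<Longrightarrow> bnd Fl (\<lambda>\<omega>. \<Sum>i\<in>A. F i \<omega>)"
  by (induction A rule: infinite_finite_induct) (auto intro: bnd_add bnd_const[of 0] bd_zero)

lemma asy_refl: "(\<And>\<omega>. F \<omega> \<in> P) \<Longrightarrow> asy \<kappa> Fl F F"
  by (simp add: asy_def null_zero)

lemma asy_sym: "asy \<kappa> Fl F G \<Longrightarrow> asy \<kappa> Fl G F"
  using null_minus[of \<kappa> Fl "\<lambda>\<omega>. F \<omega> - G \<omega>"] by (simp add: asy_def)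

lemma asy_trans: "asy \<kappa> Fl F G \<Longrightarrow> asy \<kappa> Fl G H \<Longrightarrow> asy \<kappa> Fl F H"
  using null_add[of \<kappa> Fl "\<lambda>\<omega>. F \<omega> - G \<omega>" "\<lambda>\<omega>. G \<omega> - H \<omega>"] by (simp add: asy_def)

lemma asy_add: "asy \<kappa> Fl F F' \<Longrightarrow> asy \<kappa> Fl G G' \<Longrightarrow> asy \<kappa> Fl (\<lambda>\<omega>. F \<omega> + G \<omega>) (\<lambda>\<omega>. F' \<omega> + G' \<omega>)"
  using null_add[of \<kappa> Fl "\<lambda>\<omega>. F \<omega> - F' \<omega>" "\<lambda>\<omega>. G \<omega> - G' \<omega>"]
  by (simp only: asy_def add_diff_add P_add simp_thms)

lemma asy_sum: "(\<And>i. i \<in> A \<Longrightarrow> asy \<kappa> Fl (F i) (G i)) \<Longrightarrow>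
    asy \<kappa> Fl (\<lambda>\<omega>. \<Sum>i\<in>A. F i \<omega>) (\<lambda>\<omega>. \<Sum>i\<in>A. G i \<omega>)"
  by (induction A rule: infinite_finite_induct) (auto intro: asy_refl asy_add)

lemma asy_cscale: "asy \<kappa> Fl F F' \<Longrightarrow> asy \<kappa> Fl (\<lambda>\<omega>. c \<star> F \<omega>) (\<lambda>\<omega>. c \<star> F' \<omega>)"
  using null_cscale[of \<kappa> Fl "\<lambda>\<omega>. F \<omega> - F' \<omega>" c] by (simp add: asy_def cscale_diff_right)

lemma asy_adj: "asy \<kappa> Fl F F' \<Longrightarrow> asy \<kappa> Fl (\<lambda>\<omega>. adj (F \<omega>)) (\<lambda>\<omega>. adj (F' \<omega>))"
  using null_adj[of \<kappa> Fl "\<lambda>\<omega>. F \<omega> - F' \<omega>"] by (simp add: asy_def adj_diff)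

text \<open>Telescoping as (F - F') G + F' (G - G') decides which two of the four factors have to be
  bounded in operator norm.\<close>

lemma asy_mult:
  assumes "asy \<kappa> Fl F F'" "asy \<kappa> Fl G G'" "bnd Fl F'" "bnd Fl G"
  shows "asy \<kappa> Fl (\<lambda>\<omega>. F \<omega> * G \<omega>) (\<lambda>\<omega>. F' \<omega> * G' \<omega>)"
proof -
  have "null \<kappa> Fl (\<lambda>\<omega>. (F \<omega> - F' \<omega>) * G \<omega> + F' \<omega> * (G \<omega> - G' \<omega>))"
  proof (rule null_add)
    show "null \<kappa> Fl (\<lambda>\<omega>. (F \<omega> - F' \<omega>) * G \<omega>)"
      by (rule null_mult_right[OF assms(4)]) (use assms(1) in \<open>simp add: asy_def\<close>)
    show "null \<kappa> Fl (\<lambda>\<omega>. F' \<omega> * (G \<omega> - G' \<omega>))"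
      by (rule null_mult_left[OF assms(3)]) (use assms(2) in \<open>simp add: asy_def\<close>)
  qed
  moreover have "(F \<omega> - F' \<omega>) * G \<omega> + F' \<omega> * (G \<omega> - G' \<omega>) = F \<omega> * G \<omega> - F' \<omega> * G' \<omega>" for \<omega>
    by (simp add: algebra_simps)
  ultimately show ?thesis using assms(1,2) by (simp add: asy_def)
qed

lemma sbd_mult_left: assumes "bnd Fl F" "sbd \<kappa> Fl G" shows "sbd \<kappa> Fl (\<lambda>\<omega>. F \<omega> * G \<omega>)"
proof -
  obtain c d where c: "\<forall>\<^sub>F \<omega> in Fl. bd c (F \<omega>)" and d: "\<forall>\<^sub>F \<omega> in Fl. nrm (G \<omega>) / sqrt \<bar>\<kappa> \<omega>\<bar> \<le> d"
    using assms by (auto simp: bnd_def sbd_def)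
  have "\<forall>\<^sub>F \<omega> in Fl. nrm (F \<omega> * G \<omega>) / sqrt \<bar>\<kappa> \<omega>\<bar> \<le> c * d"
    using c d
  proof eventually_elim
    case (elim \<omega>)
    have "nrm (F \<omega> * G \<omega>) / sqrt \<bar>\<kappa> \<omega>\<bar> \<le> c * nrm (G \<omega>) / sqrt \<bar>\<kappa> \<omega>\<bar>"
      using bdD[OF elim(1) sbd_P[OF assms(2)]] by (intro divide_right_mono) auto
    also have "\<dots> \<le> c * d" using mult_left_mono[OF elim(2) bd_ge0[OF elim(1)]] by simp
    finally show ?case .
  qed
  thus ?thesis using assms by (auto simp: sbd_def bnd_def)
qed

lemma sbd_asy: assumes "asy \<kappa> Fl F F'" "sbd \<kappa> Fl F'" shows "sbd \<kappa> Fl F"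
proof -
  obtain d where d: "\<forall>\<^sub>F \<omega> in Fl. nrm (F' \<omega>) / sqrt \<bar>\<kappa> \<omega>\<bar> \<le> d" using assms by (auto simp: sbd_def)
  have "((\<lambda>\<omega>. nrm (F \<omega> - F' \<omega>) / sqrt \<bar>\<kappa> \<omega>\<bar>) \<longlongrightarrow> 0) Fl"
    using assms by (simp add: asy_def null_def)
  hence "\<forall>\<^sub>F \<omega> in Fl. nrm (F \<omega> - F' \<omega>) / sqrt \<bar>\<kappa> \<omega>\<bar> < 1"
    by (rule order_tendstoD) simp
  with d have "\<forall>\<^sub>F \<omega> in Fl. nrm (F \<omega>) / sqrt \<bar>\<kappa> \<omega>\<bar> \<le> 1 + d"
  proof eventually_elim
    case (elim \<omega>)
    have "nrm (F \<omega>) \<le> nrm (F \<omega> - F' \<omega>) + nrm (F' \<omega>)"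
      using nrm_add[of "F \<omega> - F' \<omega>" "F' \<omega>"] assms by (simp add: asy_def)
    hence "nrm (F \<omega>) / sqrt \<bar>\<kappa> \<omega>\<bar> \<le> (nrm (F \<omega> - F' \<omega>) + nrm (F' \<omega>)) / sqrt \<bar>\<kappa> \<omega>\<bar>"
      by (rule divide_right_mono) auto
    hence "nrm (F \<omega>) / sqrt \<bar>\<kappa> \<omega>\<bar> \<le> nrm (F \<omega> - F' \<omega>) / sqrt \<bar>\<kappa> \<omega>\<bar> + nrm (F' \<omega>) / sqrt \<bar>\<kappa> \<omega>\<bar>"
      by (simp add: add_divide_distrib)
    thus ?case using elim by linarith
  qed
  thus ?thesis using assms unfolding sbd_def asy_def by blast
qed

text \<open>Under the trace a product of two factors is controlled by Cauchy-Schwarz, so 2-norm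
  bounds suffice where \<open>asy_mult\<close> asks for operator norm bounds.\<close>

lemma trace_asy:
  assumes FF: "asy \<kappa> Fl F F'" and GG: "asy \<kappa> Fl G G'" and "sbd \<kappa> Fl F'" "sbd \<kappa> Fl G"
  shows "((\<lambda>\<omega>. (\<tau> (F \<omega> * G \<omega>) - \<tau> (F' \<omega> * G' \<omega>)) / of_real (\<kappa> \<omega>)) \<longlongrightarrow> 0) Fl"
proof -
  obtain c d where c: "\<forall>\<^sub>F \<omega> in Fl. nrm (F' \<omega>) / sqrt \<bar>\<kappa> \<omega>\<bar> \<le> c"
    and d: "\<forall>\<^sub>F \<omega> in Fl. nrm (G \<omega>) / sqrt \<bar>\<kappa> \<omega>\<bar> \<le> d"
    using assms by (auto simp: sbd_def)
  let ?f = "\<lambda>\<omega>. nrm (F \<omega> - F' \<omega>) / sqrt \<bar>\<kappa> \<omega>\<bar>" and ?g = "\<lambda>\<omega>. nrm (G \<omega> - G' \<omega>) / sqrt \<bar>\<kappa> \<omega>\<bar>"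
  have P: "F \<omega> \<in> P" "F' \<omega> \<in> P" "G \<omega> \<in> P" "G' \<omega> \<in> P" for \<omega> using FF GG by (auto simp: asy_def)
  have "\<forall>\<^sub>F \<omega> in Fl. norm ((\<tau> (F \<omega> * G \<omega>) - \<tau> (F' \<omega> * G' \<omega>)) / of_real (\<kappa> \<omega>)) \<le> ?f \<omega> * d + c * ?g \<omega>"
    using c d
  proof eventually_elim
    case (elim \<omega>)
    have "\<tau> (F \<omega> * G \<omega>) - \<tau> (F' \<omega> * G' \<omega>) = \<tau> ((F \<omega> - F' \<omega>) * G \<omega>) + \<tau> (F' \<omega> * (G \<omega> - G' \<omega>))"
      using P[of \<omega>] by (simp add: left_diff_distrib right_diff_distrib tr_diff)
    hence "cmod (\<tau> (F \<omega> * G \<omega>) - \<tau> (F' \<omega> * G' \<omega>)) \<le>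
        nrm (F \<omega> - F' \<omega>) * nrm (G \<omega>) + nrm (F' \<omega>) * nrm (G \<omega> - G' \<omega>)"
      using Cauchy_Schwarz[of "F \<omega> - F' \<omega>" "G \<omega>"] Cauchy_Schwarz[of "F' \<omega>" "G \<omega> - G' \<omega>"] P[of \<omega>]
      by (auto intro!: norm_triangle_le add_mono)
    hence "norm ((\<tau> (F \<omega> * G \<omega>) - \<tau> (F' \<omega> * G' \<omega>)) / of_real (\<kappa> \<omega>)) \<le>
        (nrm (F \<omega> - F' \<omega>) * nrm (G \<omega>) + nrm (F' \<omega>) * nrm (G \<omega> - G' \<omega>)) / (sqrt \<bar>\<kappa> \<omega>\<bar> * sqrt \<bar>\<kappa> \<omega>\<bar>)"
      by (simp add: norm_divide divide_right_mono)
    also have "\<dots> = ?f \<omega> * (nrm (G \<omega>) / sqrt \<bar>\<kappa> \<omega>\<bar>) + (nrm (F' \<omega>) / sqrt \<bar>\<kappa> \<omega>\<bar>) * ?g \<omega>"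
      by (simp add: add_divide_distrib)
    also have "\<dots> \<le> ?f \<omega> * d + c * ?g \<omega>"
      using elim P[of \<omega>] by (intro add_mono mult_left_mono mult_right_mono) auto
    finally show ?case .
  qed
  moreover have "((\<lambda>\<omega>. ?f \<omega> * d + c * ?g \<omega>) \<longlongrightarrow> 0 * d + c * 0) Fl"
    using FF GG by (intro tendsto_intros) (auto simp: asy_def null_def)
  hence "((\<lambda>\<omega>. ?f \<omega> * d + c * ?g \<omega>) \<longlongrightarrow> 0) Fl" by simp
  with calculation show ?thesis by (rule Lim_null_comparison)
qed

lemma trace_asy_limit:
  assumes "asy \<kappa> Fl F F'" "asy \<kappa> Fl G G'" "sbd \<kappa> Fl F'" "sbd \<kappa> Fl G"
    and "((\<lambda>\<omega>. \<tau> (F' \<omega> * G' \<omega>) / of_real (\<kappa> \<omega>)) \<longlongrightarrow> l) Fl"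
  shows "((\<lambda>\<omega>. \<tau> (F \<omega> * G \<omega>) / of_real (\<kappa> \<omega>)) \<longlongrightarrow> l) Fl"
  using tendsto_add[OF trace_asy[OF assms(1-4)] assms(5)] by (simp add: diff_divide_distrib)

lemma nrm_asy_limit:
  assumes "asy \<kappa> Fl F G" "((\<lambda>\<omega>. nrm (G \<omega>) / sqrt \<bar>\<kappa> \<omega>\<bar>) \<longlongrightarrow> l) Fl"
  shows "((\<lambda>\<omega>. nrm (F \<omega>) / sqrt \<bar>\<kappa> \<omega>\<bar>) \<longlongrightarrow> l) Fl"
proof (rule Lim_transform[OF assms(2)])
  have P: "F \<omega> \<in> P" "G \<omega> \<in> P" for \<omega> using assms by (auto simp: asy_def)
  have *: "\<bar>nrm (F \<omega>) - nrm (G \<omega>)\<bar> \<le> nrm (F \<omega> - G \<omega>)" for \<omega>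
    using nrm_add[of "F \<omega> - G \<omega>" "G \<omega>"] nrm_add[of "G \<omega> - F \<omega>" "F \<omega>"] P[of \<omega>]
      nrm_minus_commute[of "F \<omega>" "G \<omega>"] by simp
  show "((\<lambda>\<omega>. nrm (F \<omega>) / sqrt \<bar>\<kappa> \<omega>\<bar> - nrm (G \<omega>) / sqrt \<bar>\<kappa> \<omega>\<bar>) \<longlongrightarrow> 0) Fl"
  proof (rule Lim_null_comparison)
    show "\<forall>\<^sub>F \<omega> in Fl. norm (nrm (F \<omega>) / sqrt \<bar>\<kappa> \<omega>\<bar> - nrm (G \<omega>) / sqrt \<bar>\<kappa> \<omega>\<bar>)
        \<le> nrm (F \<omega> - G \<omega>) / sqrt \<bar>\<kappa> \<omega>\<bar>"
    proof (intro always_eventually allI)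
      fix \<omega>
      have "norm (nrm (F \<omega>) / sqrt \<bar>\<kappa> \<omega>\<bar> - nrm (G \<omega>) / sqrt \<bar>\<kappa> \<omega>\<bar>) =
          \<bar>nrm (F \<omega>) - nrm (G \<omega>)\<bar> / sqrt \<bar>\<kappa> \<omega>\<bar>"
        by (simp only: diff_divide_distrib[symmetric] real_norm_def abs_divide real_sqrt_abs2) simp
      thus "norm (nrm (F \<omega>) / sqrt \<bar>\<kappa> \<omega>\<bar> - nrm (G \<omega>) / sqrt \<bar>\<kappa> \<omega>\<bar>)
        \<le> nrm (F \<omega> - G \<omega>) / sqrt \<bar>\<kappa> \<omega>\<bar>"
        using divide_right_mono[OF *[of \<omega>], of "sqrt \<bar>\<kappa> \<omega>\<bar>"] by simp
    qed
    show "((\<lambda>\<omega>. nrm (F \<omega> - G \<omega>) / sqrt \<bar>\<kappa> \<omega>\<bar>) \<longlongrightarrow> 0) Fl"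
      using assms(1) by (simp add: asy_def null_def)
  qed
qed

lemma trace_bound_limit:
  assumes "\<And>\<omega>. F \<omega> \<in> P" "((\<lambda>\<omega>. \<tau> (adj (F \<omega>) * F \<omega>) / of_real (\<kappa> \<omega>)) \<longlongrightarrow> l) Fl" "\<And>\<omega>. 0 \<le> \<kappa> \<omega>"
  shows "((\<lambda>\<omega>. nrm (F \<omega>) / sqrt \<bar>\<kappa> \<omega>\<bar>) \<longlongrightarrow> sqrt (Re l)) Fl"
proof -
  have "((\<lambda>\<omega>. sqrt (Re (\<tau> (adj (F \<omega>) * F \<omega>) / of_real (\<kappa> \<omega>)))) \<longlongrightarrow> sqrt (Re l)) Fl"
    using assms(2) by (intro tendsto_intros)
  moreover have "sqrt (Re (\<tau> (adj (F \<omega>) * F \<omega>) / of_real (\<kappa> \<omega>))) = nrm (F \<omega>) / sqrt \<bar>\<kappa> \<omega>\<bar>" for \<omega>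
    using assms by (simp add: nrm_def real_sqrt_divide)
  ultimately show ?thesis by simp
qed

lemma sbd_of_limit:
  assumes "\<And>\<omega>. F \<omega> \<in> P" "((\<lambda>\<omega>. nrm (F \<omega>) / sqrt \<bar>\<kappa> \<omega>\<bar>) \<longlongrightarrow> l) Fl"
  shows "sbd \<kappa> Fl F"
proof -
  have "\<forall>\<^sub>F \<omega> in Fl. nrm (F \<omega>) / sqrt \<bar>\<kappa> \<omega>\<bar> < l + 1"
    using order_tendstoD(2)[OF assms(2), of "l + 1"] by simp
  hence "\<forall>\<^sub>F \<omega> in Fl. nrm (F \<omega>) / sqrt \<bar>\<kappa> \<omega>\<bar> \<le> l + 1"
    by eventually_elim simp
  thus ?thesis using assms(1) unfolding sbd_def by blast
qed

end

section \<open>Finitely supported matrices\<close>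

text \<open>Matrices of all formats live in one non-unital star algebra; identity matrices become
  projections.\<close>

typedef finmat = "{f :: nat \<Rightarrow> nat \<Rightarrow> complex. \<exists>N. \<forall>i j. N \<le> i \<or> N \<le> j \<longrightarrow> f i j = 0}"
  morphisms ent Finmat
  by (rule exI[of _ "\<lambda>i j. 0"]) simp

definition fits :: "nat \<Rightarrow> nat \<Rightarrow> finmat \<Rightarrow> bool" where
  "fits m n A \<longleftrightarrow> (\<forall>i j. m \<le> i \<or> n \<le> j \<longrightarrow> ent A i j = 0)"

lemma fits_ex: "\<exists>N. \<forall>M\<ge>N. fits M M A"
proof -
  obtain N where N: "\<forall>i j. N \<le> i \<or> N \<le> j \<longrightarrow> ent A i j = 0"
    using ent[of A] by auto
  show ?thesis by (rule exI[of _ N]) (use N in \<open>auto simp: fits_def\<close>)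
qed

lemma fits_ex2: "\<exists>N. fits N N A \<and> fits N N B"
  by (metis fits_ex nle_le)

lemma fits_ex3: "\<exists>N. fits N N A \<and> fits N N B \<and> fits N N C"
proof -
  obtain a b c where "\<forall>M\<ge>a. fits M M A" "\<forall>M\<ge>b. fits M M B" "\<forall>M\<ge>c. fits M M C"
    using fits_ex by metis
  thus ?thesis by (intro exI[of _ "max a (max b c)"]) auto
qed

lemma fits_mono: "fits m n A \<Longrightarrow> m \<le> m' \<Longrightarrow> n \<le> n' \<Longrightarrow> fits m' n' A"
  by (auto simp: fits_def)

lemma ent_Finmat: "(\<And>i j. N \<le> i \<or> N \<le> j \<Longrightarrow> f i j = 0) \<Longrightarrow> ent (Finmat f) = f"
  by (rule Finmat_inverse) blast

lemma finmat_eqI: "(\<And>i j. ent A i j = ent B i j) \<Longrightarrow> A = B"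
  by (metis ent_inverse ext)

instantiation finmat :: ring
begin
definition zero_finmat where "0 = Finmat (\<lambda>i j. 0)"
definition plus_finmat where "A + B = Finmat (\<lambda>i j. ent A i j + ent B i j)"
definition uminus_finmat where "- A = Finmat (\<lambda>i j. - ent A i j)"
definition minus_finmat where "A - B = Finmat (\<lambda>i j. ent A i j - ent B i j)"
definition times_finmat where
  "A * B = Finmat (\<lambda>i j. \<Sum>k | ent A i k \<noteq> 0. ent A i k * ent B k j)"

lemma ent_zero [simp]: "ent 0 i j = 0"
  by (simp add: zero_finmat_def ent_Finmat)

lemma ent_add [simp]: "ent (A + B) i j = ent A i j + ent B i j"
proof -
  obtain N where "fits N N A \<and> fits N N B" using fits_ex2 by blast
  thus ?thesis by (simp add: plus_finmat_def, subst ent_Finmat[of N]) (auto simp: fits_def)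
qed

lemma ent_uminus [simp]: "ent (- A) i j = - ent A i j"
proof -
  obtain N where "fits N N A" using fits_ex by blast
  thus ?thesis by (simp add: uminus_finmat_def, subst ent_Finmat[of N]) (auto simp: fits_def)
qed

lemma ent_minus [simp]: "ent (A - B) i j = ent A i j - ent B i j"
proof -
  obtain N where "fits N N A \<and> fits N N B" using fits_ex2 by blast
  thus ?thesis by (simp add: minus_finmat_def, subst ent_Finmat[of N]) (auto simp: fits_def)
qed

lemma ent_mult_raw: "ent (A * B) i j = (\<Sum>k | ent A i k \<noteq> 0. ent A i k * ent B k j)"
proof -
  obtain N where N: "fits N N A \<and> fits N N B" using fits_ex2 by blast
  show ?thesis
    unfolding times_finmat_def by (subst ent_Finmat[of N]) (use N in \<open>auto simp: fits_def\<close>)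
qed

lemma ent_mult_left:
  assumes "fits m n A" shows "ent (A * B) i j = (\<Sum>k<n. ent A i k * ent B k j)"
  unfolding ent_mult_raw
  by (rule sum.mono_neutral_left) (use assms in \<open>auto simp: fits_def\<close>, meson not_le)

lemma ent_mult_right:
  assumes "fits n m B" shows "ent (A * B) i j = (\<Sum>k<n. ent A i k * ent B k j)"
proof -
  obtain N where N: "\<forall>M\<ge>N. fits M M A" using fits_ex by blast
  define M where "M = max N n"
  have "ent (A * B) i j = (\<Sum>k<M. ent A i k * ent B k j)"
    by (rule ent_mult_left[of M M]) (simp add: N M_def)
  also have "\<dots> = (\<Sum>k<n. ent A i k * ent B k j)"
    by (rule sum.mono_neutral_right) (use assms in \<open>auto simp: fits_def not_le M_def not_less\<close>)
  finally show ?thesis .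
qed

instance
proof
  fix A B C :: finmat
  show "A + B + C = A + (B + C)" "A + B = B + A" "0 + A = A" "- A + A = 0" "A - B = A + - B"
    by (rule finmat_eqI, simp)+
  obtain N where N: "fits N N A" "fits N N B" "fits N N C" using fits_ex3 by blast
  have AB: "fits N N (A * B)"
    using N by (auto simp: fits_def ent_mult_left[OF N(1)])
  show "A * B * C = A * (B * C)"
  proof (rule finmat_eqI)
    fix i j
    have "ent (A * B * C) i j = (\<Sum>k<N. (\<Sum>l<N. ent A i l * ent B l k) * ent C k j)"
      by (simp add: ent_mult_left[OF AB] ent_mult_left[OF N(1)])
    also have "\<dots> = (\<Sum>k<N. \<Sum>l<N. ent A i l * (ent B l k * ent C k j))"
      by (simp add: sum_distrib_right mult.assoc)
    also have "\<dots> = (\<Sum>l<N. \<Sum>k<N. ent A i l * (ent B l k * ent C k j))"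
      by (rule sum.swap)
    also have "\<dots> = ent (A * (B * C)) i j"
      by (simp add: ent_mult_left[OF N(1)] ent_mult_left[OF N(2)] sum_distrib_left)
    finally show "ent (A * B * C) i j = ent (A * (B * C)) i j" .
  qed
  show "(A + B) * C = A * C + B * C"
    by (rule finmat_eqI) (simp add: ent_mult_right[OF N(3)] distrib_right sum.distrib)
  show "A * (B + C) = A * B + A * C"
    by (rule finmat_eqI) (simp add: ent_mult_left[OF N(1)] distrib_left sum.distrib)
qed

end

lemma ent_sum [simp]: "ent (\<Sum>x\<in>S. f x) i j = (\<Sum>x\<in>S. ent (f x) i j)"
  by (induction S rule: infinite_finite_induct) auto

instantiation finmat :: complex_star_algebra
begin
definition cscale_finmat where "c \<star> A = Finmat (\<lambda>i j. c * ent A i j)"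
definition adj_finmat where "adj A = Finmat (\<lambda>i j. cnj (ent A j i))"

lemma ent_cscale [simp]: "ent (c \<star> A) i j = c * ent A i j"
proof -
  obtain N where "fits N N A" using fits_ex by blast
  thus ?thesis by (simp add: cscale_finmat_def, subst ent_Finmat[of N]) (auto simp: fits_def)
qed

lemma ent_adj [simp]: "ent (adj A) i j = cnj (ent A j i)"
proof -
  obtain N where "fits N N A" using fits_ex by blast
  thus ?thesis by (simp add: adj_finmat_def, subst ent_Finmat[of N]) (auto simp: fits_def)
qed

instance
proof
  fix A B :: finmat and c d :: complex
  obtain N where N: "fits N N A" "fits N N B" using fits_ex2 by blast
  have cA: "fits N N (c \<star> A)" and aB: "fits N N (adj B)"
    using N by (auto simp: fits_def)
  show "c \<star> (A + B) = c \<star> A + c \<star> B" "(c + d) \<star> A = c \<star> A + d \<star> A" "c \<star> d \<star> A = (c * d) \<star> A"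
    "1 \<star> A = A" "adj (adj A) = A" "adj (A + B) = adj A + adj B" "adj (c \<star> A) = cnj c \<star> adj A"
    by (rule finmat_eqI, simp add: algebra_simps)+
  show "(c \<star> A) * B = c \<star> (A * B)"
    by (rule finmat_eqI) (simp add: ent_mult_left[OF cA] ent_mult_left[OF N(1)] sum_distrib_left mult.assoc)
  show "A * (c \<star> B) = c \<star> (A * B)"
    by (rule finmat_eqI) (simp add: ent_mult_left[OF N(1)] sum_distrib_left mult_ac)
  show "adj (A * B) = adj B * adj A"
    by (rule finmat_eqI) (simp add: ent_mult_left[OF aB] ent_mult_right[OF N(2)] mult.commute)
qed

end

lemma fits_zero [simp]: "fits m n 0"
  and fits_add: "fits m n A \<Longrightarrow> fits m n B \<Longrightarrow> fits m n (A + B)"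
  and fits_minus: "fits m n A \<Longrightarrow> fits m n B \<Longrightarrow> fits m n (A - B)"
  and fits_cscale: "fits m n A \<Longrightarrow> fits m n (c \<star> A)"
  and fits_adj: "fits m n A \<Longrightarrow> fits n m (adj A)"
  by (auto simp: fits_def)

lemma fits_sum: "(\<And>x. x \<in> S \<Longrightarrow> fits m n (f x)) \<Longrightarrow> fits m n (\<Sum>x\<in>S. f x)"
  by (auto simp: fits_def intro!: sum.neutral)

lemma fits_mult: assumes "fits m k A" "fits l n B" shows "fits m n (A * B)"
  using assms by (auto simp: fits_def ent_mult_left[OF assms(1)])

definition Tr :: "finmat \<Rightarrow> complex" where "Tr A = (\<Sum>i | ent A i i \<noteq> 0. ent A i i)"

lemma Tr_eq: assumes "fits m n A" "m \<le> N \<or> n \<le> N" shows "Tr A = (\<Sum>i<N. ent A i i)"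
  unfolding Tr_def
proof (rule sum.mono_neutral_left)
  show "{i. ent A i i \<noteq> 0} \<subseteq> {..<N}"
    using assms unfolding fits_def by (metis (mono_tags, lifting) lessThan_iff linorder_not_less
        mem_Collect_eq order_trans subsetI)
qed auto

lemma Tr_adj_mult:
  assumes "fits m n A"
  shows "Tr (adj A * A) = complex_of_real (\<Sum>i<m. \<Sum>j<n. (cmod (ent A i j))\<^sup>2)"
proof -
  have "fits n n (adj A * A)" using fits_mult[OF fits_adj[OF assms] assms] .
  hence "Tr (adj A * A) = (\<Sum>j<n. ent (adj A * A) j j)" by (rule Tr_eq) simp
  also have "\<dots> = (\<Sum>j<n. \<Sum>i<m. cnj (ent A i j) * ent A i j)"
    by (simp add: ent_mult_right[OF assms])
  also have "\<dots> = (\<Sum>i<m. \<Sum>j<n. cnj (ent A i j) * ent A i j)"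
    by (rule sum.swap)
  finally show ?thesis by (simp add: complex_norm_square mult.commute del: of_real_power)
qed

interpretation fm: tracial UNIV Tr
proof
  fix A B :: finmat and c :: complex
  obtain N where N: "fits N N A" "fits N N B" using fits_ex2 by blast
  show "Tr (A + B) = Tr A + Tr B"
    by (simp add: Tr_eq[OF N(1), of N] Tr_eq[OF N(2), of N] Tr_eq[OF fits_add[OF N], of N] sum.distrib)
  show "Tr (c \<star> A) = c * Tr A"
    by (simp add: Tr_eq[OF N(1), of N] Tr_eq[OF fits_cscale[OF N(1)], of N] sum_distrib_left)
  have "Tr (A * B) = (\<Sum>i<N. \<Sum>k<N. ent A i k * ent B k i)"
    by (simp add: Tr_eq[OF fits_mult[OF N], of N] ent_mult_left[OF N(1)])
  also have "\<dots> = (\<Sum>k<N. \<Sum>i<N. ent A i k * ent B k i)" by (rule sum.swap)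
  also have "\<dots> = Tr (B * A)"
    by (simp add: Tr_eq[OF fits_mult[OF N(2,1)], of N] ent_mult_left[OF N(2)] mult.commute)
  finally show "Tr (A * B) = Tr (B * A)" .
  show "Im (Tr (adj A * A)) = 0" "0 \<le> Re (Tr (adj A * A))"
    by (auto simp: Tr_adj_mult[OF N(1)] sum_nonneg)
qed auto

lemma nrm_finmat_sq:
  assumes "fits m n A" shows "(fm.nrm A)\<^sup>2 = (\<Sum>i<m. \<Sum>j<n. (cmod (ent A i j))\<^sup>2)"
  by (simp add: fm.nrm_sq Tr_adj_mult[OF assms])

lemma nrm_finmat_eq_0: "fm.nrm A = 0 \<longleftrightarrow> A = 0"
proof
  assume A: "fm.nrm A = 0"
  obtain N where N: "fits N N A" using fits_ex by blast
  have z: "(\<Sum>i<N. \<Sum>j<N. (cmod (ent A i j))\<^sup>2) = 0"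
    using nrm_finmat_sq[OF N] A by simp
  have "ent A i j = 0" for i j
  proof (cases "i < N \<and> j < N")
    case True
    have "(\<Sum>j<N. (cmod (ent A i j))\<^sup>2) = 0"
      using z True by (subst (asm) sum_nonneg_eq_0_iff) (auto intro: sum_nonneg)
    thus ?thesis using True by (subst (asm) sum_nonneg_eq_0_iff) auto
  qed (use N in \<open>auto simp: fits_def\<close>)
  thus "A = 0" by (intro finmat_eqI) simp
qed simp

section \<open>Diagonal matrices and the identity matrices\<close>

definition diagm :: "nat \<Rightarrow> (nat \<Rightarrow> complex) \<Rightarrow> finmat" where
  "diagm n f = Finmat (\<lambda>i j. if i = j \<and> i < n then f i else 0)"

abbreviation idm :: "nat \<Rightarrow> finmat" where "idm n \<equiv> diagm n (\<lambda>_. 1)"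

lemma ent_diagm [simp]: "ent (diagm n f) i j = (if i = j \<and> i < n then f i else 0)"
  unfolding diagm_def by (subst ent_Finmat[of n]) auto

lemma fits_diagm: "fits n n (diagm n f)"
  by (simp add: fits_def)

lemma diagm_mult_ent: "ent (diagm n f * A) i j = (if i < n then f i * ent A i j else 0)"
proof -
  have "ent (diagm n f * A) i j = (\<Sum>k<n. if k = i then f i * ent A i j else 0)"
    by (subst ent_mult_left[OF fits_diagm], rule sum.cong) auto
  thus ?thesis by simp
qed

lemma mult_diagm_ent: "ent (A * diagm n f) i j = (if j < n then ent A i j * f j else 0)"
proof -
  have "ent (A * diagm n f) i j = (\<Sum>k<n. if k = j then ent A i j * f j else 0)"
    by (subst ent_mult_right[OF fits_diagm], rule sum.cong) auto
  thus ?thesis by simp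
qed

lemma diagm_mult: "diagm n f * diagm n g = diagm n (\<lambda>i. f i * g i)"
  by (rule finmat_eqI) (simp add: diagm_mult_ent)

lemma diagm_diff: "diagm n f - diagm n g = diagm n (\<lambda>i. f i - g i)"
  and diagm_adj: "adj (diagm n f) = diagm n (\<lambda>i. cnj (f i))"
  by (rule finmat_eqI, simp)+

lemma idm_mult_left: "fits m n A \<Longrightarrow> idm m * A = A"
  and idm_mult_right: "fits m n A \<Longrightarrow> A * idm n = A"
  by (rule finmat_eqI, auto simp: diagm_mult_ent mult_diagm_ent fits_def)+

lemma idm_idem [simp]: "idm n * idm n = idm n"
  and adj_idm [simp]: "adj (idm n) = idm n"
  by (simp_all add: diagm_mult diagm_adj)

lemma Tr_diagm: "Tr (diagm n f) = (\<Sum>i<n. f i)"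
  by (simp add: Tr_eq[OF fits_diagm, of n n])

lemma bd_idm: "fm.bd 1 (idm n)"
  by (rule fm.bd_projection) auto

lemma nrm_diagm_sq: "(fm.nrm (diagm n f))\<^sup>2 = (\<Sum>i<n. (cmod (f i))\<^sup>2)"
  by (simp add: fm.nrm_sq diagm_adj diagm_mult Tr_diagm complex_norm_square[symmetric] mult.commute[of "cnj _"])

lemma nrm_idm: "fm.nrm (idm n) = sqrt (real n)"
  using nrm_diagm_sq[of n "\<lambda>_. 1"] by (simp add: real_sqrt_unique)

lemma bd_diagm:
  assumes "\<And>i. i < n \<Longrightarrow> cmod (f i) \<le> c" "0 \<le> c" shows "fm.bd c (diagm n f)"
proof (rule fm.bdI)
  fix B :: finmat
  obtain N where N: "\<forall>M\<ge>N. fits M M B" using fits_ex by blast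
  define M where "M = max N n"
  have B: "fits M M B" and D: "fits M M (diagm n f)"
    using N by (auto simp: M_def intro: fits_mono[OF fits_diagm])
  have "(fm.nrm (diagm n f * B))\<^sup>2 = (\<Sum>i<M. \<Sum>j<M. (cmod (if i < n then f i * ent B i j else 0))\<^sup>2)"
    by (simp add: nrm_finmat_sq[OF fits_mult[OF D B]] diagm_mult_ent)
  also have "\<dots> \<le> (\<Sum>i<M. \<Sum>j<M. c\<^sup>2 * (cmod (ent B i j))\<^sup>2)"
    using assms by (intro sum_mono) (auto simp: norm_mult power_mult_distrib intro!: mult_right_mono power_mono)
  also have "\<dots> = (c * fm.nrm B)\<^sup>2"
    by (simp add: nrm_finmat_sq[OF B] power_mult_distrib sum_distrib_left)
  finally show "fm.nrm (diagm n f * B) \<le> c * fm.nrm B"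
    using assms(2) by (simp add: abs_le_square_iff[symmetric])
qed (use assms in auto)

definition unitm :: "nat \<Rightarrow> nat \<Rightarrow> finmat" where
  "unitm a b = Finmat (\<lambda>i j. if i = a \<and> j = b then 1 else 0)"

lemma ent_unitm [simp]: "ent (unitm a b) i j = (if i = a \<and> j = b then 1 else 0)"
  unfolding unitm_def by (subst ent_Finmat[of "Suc (max a b)"]) auto

text \<open>A finitely supported matrix is a finite combination of matrix units, and each matrix
  unit is a partial isometry.\<close>

lemma bd_ex: "\<exists>c. fm.bd c A"
proof -
  obtain N where N: "fits N N A" using fits_ex by blast
  have u: "fm.bd 1 (unitm a b)" for a b
  proof (rule fm.bd_isometry[of _ "unitm b b"])
    show "adj (unitm a b) * unitm a b = unitm b b"
    proof (rule finmat_eqI)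
      fix i j
      have "fits (Suc a) (Suc b) (unitm a b)" by (auto simp: fits_def)
      thus "ent (adj (unitm a b) * unitm a b) i j = ent (unitm b b) i j"
        by (simp add: ent_mult_right) 
    qed
    show "unitm b b * unitm b b = unitm b b"
    proof (rule finmat_eqI)
      fix i j
      have "fits (Suc b) (Suc b) (unitm b b)" by (auto simp: fits_def)
      thus "ent (unitm b b * unitm b b) i j = ent (unitm b b) i j"
        by (simp add: ent_mult_right)
    qed
    show "adj (unitm b b) = unitm b b" by (rule finmat_eqI) auto
  qed auto
  have "A = (\<Sum>a<N. \<Sum>b<N. ent A a b \<star> unitm a b)"
  proof (rule finmat_eqI)
    fix i j
    have *: "(\<Sum>b<N. ent A a b * (if i = a \<and> j = b then 1 else 0)) = (if a = i \<and> j < N then ent A i j else 0)" for a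
      by (cases "a = i") (auto simp: if_distrib cong: if_cong)
    have "ent (\<Sum>a<N. \<Sum>b<N. ent A a b \<star> unitm a b) i j = (\<Sum>a<N. if a = i \<and> j < N then ent A i j else 0)"
      using * by simp
    also have "\<dots> = ent A i j"
      using N by (cases "j < N") (auto simp: fits_def)
    finally show "ent A i j = ent (\<Sum>a<N. \<Sum>b<N. ent A a b \<star> unitm a b) i j" by simp
  qed
  moreover have "fm.bd (\<Sum>a<N. \<Sum>b<N. cmod (ent A a b) * 1) (\<Sum>a<N. \<Sum>b<N. ent A a b \<star> unitm a b)"
    by (intro fm.bd_sum fm.bd_cscale u)
  ultimately show ?thesis by metis
qed

section \<open>Translation between carrier matrices and \<open>finmat\<close>\<close>

definition emb :: "complex Matrix.mat \<Rightarrow> finmat" where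
  "emb A = Finmat (\<lambda>i j. if i < dim_row A \<and> j < dim_col A then A $$ (i, j) else 0)"

definition tomat :: "nat \<Rightarrow> finmat \<Rightarrow> complex Matrix.mat" where
  "tomat n F = Matrix.mat n n (\<lambda>ij. ent F (fst ij) (snd ij))"

lemma ent_emb: "ent (emb A) i j = (if i < dim_row A \<and> j < dim_col A then A $$ (i, j) else 0)"
  unfolding emb_def by (subst ent_Finmat[of "max (dim_row A) (dim_col A)"]) auto

lemma fits_emb: "A \<in> carrier_mat m n \<Longrightarrow> fits m n (emb A)"
  by (auto simp: fits_def ent_emb)

lemma tomat_carrier [simp]: "tomat n F \<in> carrier_mat n n"
  by (simp add: tomat_def)

lemma emb_tomat: "fits n n F \<Longrightarrow> emb (tomat n F) = F"
  by (rule finmat_eqI) (auto simp: ent_emb tomat_def fits_def not_less)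

lemma emb_inj:
  assumes "A \<in> carrier_mat m n" "B \<in> carrier_mat m n" "emb A = emb B" shows "A = B"
proof (rule eq_matI)
  fix i j assume "i < dim_row B" "j < dim_col B"
  thus "A $$ (i, j) = B $$ (i, j)"
    using assms(1,2) arg_cong[OF assms(3), of "\<lambda>F. ent F i j"] by (simp add: ent_emb)
qed (use assms in auto)

lemma emb_mult:
  assumes "A \<in> carrier_mat m k" "B \<in> carrier_mat k n" shows "emb (A * B) = emb A * emb B"
proof (rule finmat_eqI)
  fix i j
  show "ent (emb (A * B)) i j = ent (emb A * emb B) i j"
    using assms unfolding ent_mult_left[OF fits_emb[OF assms(1)]]
    by (auto simp: ent_emb scalar_prod_def lessThan_atLeast0 intro!: sum.cong)
qed

lemma emb_minus:
  assumes "A \<in> carrier_mat m n" "B \<in> carrier_mat m n" shows "emb (A - B) = emb A - emb B"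
  using assms by (intro finmat_eqI) (auto simp: ent_emb)

lemma emb_one: "emb (1\<^sub>m n) = idm n"
  by (rule finmat_eqI) (auto simp: ent_emb)

lemma mat_adjoint_carrier: "A \<in> carrier_mat m n \<Longrightarrow> mat_adjoint A \<in> carrier_mat n m"
  by (auto simp: mat_adjoint_def mat_of_rows_def)

lemma emb_adjoint: "emb (mat_adjoint A) = adj (emb A)"
  by (rule finmat_eqI) (auto simp: ent_emb mat_adjoint_def mat_of_rows_def)

lemma normalized_trace_emb:
  assumes "A \<in> carrier_mat n n" shows "normalized_trace n A = Tr (emb A) / of_nat n"
  using assms by (simp add: normalized_trace_def Tr_eq[OF fits_emb[OF assms], of n] ent_emb)

lemma unitary_mat_emb:
  "unitary_mat n V \<longleftrightarrow> V \<in> carrier_mat n n \<and> adj (emb V) * emb V = idm n \<and> emb V * adj (emb V) = idm n"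
proof (cases "V \<in> carrier_mat n n")
  case V: True
  have a: "mat_adjoint V \<in> carrier_mat n n" by (rule mat_adjoint_carrier[OF V])
  have "mat_adjoint V * V = 1\<^sub>m n \<longleftrightarrow> adj (emb V) * emb V = idm n"
    using emb_inj[of "mat_adjoint V * V" n n "1\<^sub>m n"] V a
    by (auto simp: emb_mult[OF a V] emb_adjoint emb_one[symmetric])
       (metis emb_adjoint emb_mult)
  moreover have "V * mat_adjoint V = 1\<^sub>m n \<longleftrightarrow> emb V * adj (emb V) = idm n"
    using emb_inj[of "V * mat_adjoint V" n n "1\<^sub>m n"] V a
    by (auto simp: emb_mult[OF V a] emb_adjoint emb_one[symmetric])
       (metis emb_adjoint emb_mult)
  ultimately show ?thesis using V by (simp add: unitary_mat_def)
qed (simp add: unitary_mat_def)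

lemma tuple_norm2_emb:
  assumes "set X \<subseteq> carrier_mat n n"
  shows "tuple_norm2 n X = sqrt (\<Sum>A\<leftarrow>X. (fm.nrm (emb A))\<^sup>2 / real n)"
proof -
  have "Re (normalized_trace n (mat_adjoint A * A)) = (fm.nrm (emb A))\<^sup>2 / real n"
    if "A \<in> carrier_mat n n" for A
    using normalized_trace_emb[OF mult_carrier_mat[OF mat_adjoint_carrier[OF that] that]]
    by (simp add: emb_mult[OF mat_adjoint_carrier[OF that] that] emb_adjoint fm.nrm_sq)
  hence "map (\<lambda>A. Re (normalized_trace n (mat_adjoint A * A))) X = map (\<lambda>A. (fm.nrm (emb A))\<^sup>2 / real n) X"
    using assms by (intro map_cong) auto
  thus ?thesis unfolding tuple_norm2_def by (simp only:)
qed

lemma scalar_prod_conjugate_self: "Re (v \<bullet>c v) = (\<Sum>i<dim_vec v. (cmod (v $ i))\<^sup>2)"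
  for v :: "complex Matrix.vec"
proof -
  have "v \<bullet>c v = (\<Sum>i<dim_vec v. v $ i * cnj (v $ i))"
    by (simp add: scalar_prod_def lessThan_atLeast0)
  also have "\<dots> = complex_of_real (\<Sum>i<dim_vec v. (cmod (v $ i))\<^sup>2)"
    by (simp add: complex_norm_square del: of_real_power)
  finally show ?thesis by simp
qed

text \<open>A matrix acts on Y column by column, and the squared 2-norm of Y is the sum over its
  columns; conversely a vector is a matrix with one column. So testing on vectors and testing on
  matrices give the same bound.\<close>

lemma mat_op_norm_le_iff:
  assumes A: "A \<in> carrier_mat n n" and R: "0 \<le> R"
  shows "mat_op_norm A \<le> R \<longleftrightarrow> fm.bd R (emb A)"
proof -
  let ?N = "\<lambda>v::complex Matrix.vec. sqrt (Re (v \<bullet>c v))"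
  define S where "S = {v \<in> carrier_vec n. ?N v \<le> 1}"
  have op: "mat_op_norm A = (SUP v\<in>S. ?N (A *\<^sub>v v))"
    using A by (simp add: mat_op_norm_def S_def)
  define col where "col v = Finmat (\<lambda>i j. if i < n \<and> j = 0 then v $ i else 0)" for v :: "complex Matrix.vec"
  have ent_col: "ent (col v) i j = (if i < n \<and> j = 0 then v $ i else 0)" for v i j
    unfolding col_def by (subst ent_Finmat[of "Suc n"]) auto
  have fits_col: "fits n 1 (col v)" for v by (auto simp: fits_def ent_col)
  have N_col: "?N v = fm.nrm (col v)" if "v \<in> carrier_vec n" for v
  proof -
    have "(fm.nrm (col v))\<^sup>2 = Re (v \<bullet>c v)"
      using that by (simp add: nrm_finmat_sq[OF fits_col] ent_col scalar_prod_conjugate_self)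
    thus ?thesis by (metis UNIV_I fm.nrm_ge0 real_sqrt_abs abs_of_nonneg)
  qed
  have col_mult: "col (A *\<^sub>v v) = emb A * col v" if "v \<in> carrier_vec n" for v
    using A that
    by (intro finmat_eqI) (auto simp: ent_mult_left[OF fits_emb[OF A]] ent_col ent_emb scalar_prod_def
        lessThan_atLeast0 intro!: sum.cong)
  have Av: "A *\<^sub>v v \<in> carrier_vec n" if "v \<in> carrier_vec n" for v using A that by simp
  obtain c where c: "fm.bd c (emb A)" using bd_ex by blast
  have bounded: "?N (A *\<^sub>v v) \<le> k" if "v \<in> S" "fm.bd k (emb A)" for v k
  proof -
    have v: "v \<in> carrier_vec n" "?N v \<le> 1" using that by (auto simp: S_def)
    have "?N (A *\<^sub>v v) = fm.nrm (emb A * col v)" using N_col[OF Av[OF v(1)]] col_mult[OF v(1)] by simp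
    also have "\<dots> \<le> k * fm.nrm (col v)" by (rule fm.bdD[OF that(2)]) simp
    also have "\<dots> \<le> k * 1" using v fm.bd_ge0[OF that(2)] N_col[OF v(1)] by (intro mult_left_mono) auto
    finally show ?thesis by simp
  qed
  have zS: "0\<^sub>v n \<in> S" by (simp add: S_def)
  have bdd: "bdd_above ((\<lambda>v. ?N (A *\<^sub>v v)) ` S)"
    using bounded[OF _ c] by (intro bdd_aboveI[of _ c]) blast
  show ?thesis
  proof
    assume "fm.bd R (emb A)"
    thus "mat_op_norm A \<le> R" unfolding op using zS bounded by (intro cSUP_least) auto
  next
    assume le: "mat_op_norm A \<le> R"
    have vec: "fm.nrm (emb A * col v) \<le> R * fm.nrm (col v)" if v: "v \<in> carrier_vec n" for v
    proof (cases "fm.nrm (col v) = 0")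
      case True
      hence "col v = 0" by (simp add: nrm_finmat_eq_0)
      thus ?thesis by simp
    next
      case False
      define s where "s = fm.nrm (col v)"
      have s: "s > 0" using False fm.nrm_ge0[of "col v"] by (simp add: s_def less_le)
      define w where "w = complex_of_real (1 / s) \<cdot>\<^sub>v v"
      have w: "w \<in> carrier_vec n" using v by (simp add: w_def)
      have cw: "col w = complex_of_real (1 / s) \<star> col v"
        using v by (intro finmat_eqI) (auto simp: ent_col w_def)
      have "fm.nrm (col w) = 1" using s by (simp add: cw fm.nrm_cscale norm_divide s_def[symmetric])
      hence "w \<in> S" using w N_col[OF w] by (simp add: S_def)
      hence "?N (A *\<^sub>v w) \<le> R" using cSUP_upper[OF _ bdd] le unfolding op by fastforce
      moreover have "?N (A *\<^sub>v w) = fm.nrm (emb A * col v) / s"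
        using N_col[OF Av[OF w]] col_mult[OF w] s
        by (simp add: cw cscale_mult_right fm.nrm_cscale norm_divide)
      ultimately show ?thesis using s by (simp add: field_simps s_def)
    qed
    show "fm.bd R (emb A)"
    proof (rule fm.bdI)
      fix Y :: finmat
      obtain N where N: "\<forall>M\<ge>N. fits M M Y" using fits_ex by blast
      define M where "M = max N n"
      have Y: "fits M M Y" and nM: "n \<le> M" using N by (auto simp: M_def)
      have EA: "fits n n (emb A)" by (rule fits_emb[OF A])
      have AY: "fits n M (emb A * Y)" using fits_mult[OF EA Y] .
      define v where "v j = Matrix.vec n (\<lambda>k. ent Y k j)" for j
      have vc: "v j \<in> carrier_vec n" for j by (simp add: v_def)
      have e: "ent (emb A * Y) i j = ent (emb A * col (v j)) i 0" for i j
        by (auto simp: ent_mult_left[OF EA] ent_col v_def)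
      have "(fm.nrm (emb A * Y))\<^sup>2 = (\<Sum>j<M. \<Sum>i<n. (cmod (ent (emb A * Y) i j))\<^sup>2)"
        unfolding nrm_finmat_sq[OF AY] by (rule sum.swap)
      also have "\<dots> = (\<Sum>j<M. (fm.nrm (emb A * col (v j)))\<^sup>2)"
        using e by (simp add: nrm_finmat_sq[OF fits_mult[OF EA fits_col]])
      also have "\<dots> \<le> (\<Sum>j<M. (R * fm.nrm (col (v j)))\<^sup>2)"
        by (intro sum_mono power_mono vec[OF vc]) auto
      also have "\<dots> = R\<^sup>2 * (\<Sum>j<M. \<Sum>i<n. (cmod (ent Y i j))\<^sup>2)"
        by (simp add: power_mult_distrib sum_distrib_left nrm_finmat_sq[OF fits_col] ent_col v_def)
      also have "(\<Sum>j<M. \<Sum>i<n. (cmod (ent Y i j))\<^sup>2) = (\<Sum>i<n. \<Sum>j<M. (cmod (ent Y i j))\<^sup>2)"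
        by (rule sum.swap)
      also have "\<dots> \<le> (\<Sum>i<M. \<Sum>j<M. (cmod (ent Y i j))\<^sup>2)"
        using nM by (intro sum_mono2) (auto intro: sum_nonneg)
      also have "\<dots> = (fm.nrm Y)\<^sup>2" by (simp add: nrm_finmat_sq[OF Y])
      finally have "(fm.nrm (emb A * Y))\<^sup>2 \<le> (R * fm.nrm Y)\<^sup>2"
        using R by (simp add: power_mult_distrib mult_left_mono)
      thus "fm.nrm (emb A * Y) \<le> R * fm.nrm Y"
        using R by (simp add: abs_le_square_iff[symmetric])
    qed (use R in auto)
  qed
qed

section \<open>Spectral theory of matrices\<close>

text \<open>If all diagonal entries of a Schur form b vanished, b would be strictly triangular and
  Tr(b b) = 0. This equals Tr(F F), the squared 2-norm of F, which is not zero. So some eigenvalue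
  is nonzero, and it is real because F is self-adjoint.\<close>

lemma hermitian_eigenvector:
  assumes F: "fits n n F" "adj F = F" "F \<noteq> 0"
  obtains v and \<mu> :: real where "fits n 1 v" "v \<noteq> 0" "\<mu> \<noteq> 0" "F * v = complex_of_real \<mu> \<star> v"
proof -
  define A where "A = tomat n F"
  have A: "A \<in> carrier_mat n n" by (simp add: A_def)
  have embA: "emb A = F" by (simp add: A_def emb_tomat F)
  obtain as where as: "char_poly A = (\<Prod>a\<leftarrow>as. [:- a, 1:])" using char_poly_factorized[OF A] by blast
  obtain B Pm Q where d: "schur_decomposition A as = (B, Pm, Q)" by (metis prod_cases3)
  have sim: "similar_mat_wit A B Pm Q" and ut: "upper_triangular B" and diag: "diag_mat B = as"
    using schur_decomposition[OF A as d] by auto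
  from similar_mat_witD2[OF A sim] have QP: "Q * Pm = 1\<^sub>m n" and APBQ: "A = Pm * B * Q"
    and car: "B \<in> carrier_mat n n" "Pm \<in> carrier_mat n n" "Q \<in> carrier_mat n n" by auto
  have "\<exists>a\<in>set as. a \<noteq> 0"
  proof (rule ccontr)
    assume "\<not> ?thesis"
    hence z: "\<And>i. i < n \<Longrightarrow> B $$ (i, i) = 0"
      using diag car(1) by (auto simp: diag_mat_def)
    define b where "b = emb B"
    have fb: "fits n n b" using car by (simp add: b_def fits_emb)
    have "ent b i k * ent b k i = 0" for i k
    proof (cases "i < n \<and> k < n \<and> i \<noteq> k")
      case True
      hence "k < i \<or> i < k" by auto
      thus ?thesis using ut car True
        by (auto simp: b_def ent_emb upper_triangular_def)
    qed (use z car in \<open>auto simp: b_def ent_emb\<close>)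
    hence Trbb: "Tr (b * b) = 0"
      by (simp add: Tr_eq[OF fits_mult[OF fb fb], of n] ent_mult_left[OF fb])
    have F_eq: "F = emb Pm * b * emb Q"
      proof -
      have "emb (Pm * B * Q) = emb (Pm * B) * emb Q"
        using car by (intro emb_mult[of _ n n _ n]) auto
      also have "emb (Pm * B) = emb Pm * emb B"
        using car by (intro emb_mult[of _ n n _ n]) auto
      finally show ?thesis by (simp add: embA[symmetric] APBQ b_def)
    qed
    have QP': "emb Q * emb Pm = idm n"
      using arg_cong[OF QP, of emb] car by (simp add: emb_mult[of _ n n _ n] emb_one)
    have "F * F = emb Pm * (b * (emb Q * emb Pm) * b * emb Q)"
      by (simp add: F_eq mult.assoc)
    hence "F * F = emb Pm * (b * b * emb Q)" using idm_mult_right[OF fb] by (simp add: QP')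
    hence "Tr (F * F) = Tr ((b * b * emb Q) * emb Pm)" by (simp add: fm.tr_comm)
    also have "\<dots> = Tr (b * b)"
      using idm_mult_right[OF fb] by (simp add: mult.assoc QP')
    finally have "Tr (adj F * F) = 0" using Trbb F(2) by simp
    hence "fm.nrm F = 0" by (simp add: fm.nrm_def)
    thus False using F(3) by (simp add: nrm_finmat_eq_0)
  qed
  then obtain a where a: "a \<in> set as" "a \<noteq> 0" by blast
  have "poly (char_poly A) a = 0"
    unfolding as poly_prod_list using a by (auto simp: prod_list_zero_iff)
  hence "eigenvalue A a" using eigenvalue_root_char_poly[OF A] by simp
  then obtain w where "eigenvector A w a" by (auto simp: eigenvalue_def)
  hence w: "w \<in> carrier_vec n" "w \<noteq> 0\<^sub>v n" "A *\<^sub>v w = a \<cdot>\<^sub>v w"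
    using A by (auto simp: eigenvector_def)
  define v where "v = Finmat (\<lambda>i j. if i < n \<and> j = 0 then w $ i else 0)"
  have ent_v: "ent v i j = (if i < n \<and> j = 0 then w $ i else 0)" for i j
    unfolding v_def by (subst ent_Finmat[of "Suc n"]) auto
  have fv: "fits n 1 v" by (auto simp: fits_def ent_v)
  have v0: "v \<noteq> 0"
  proof
    assume "v = 0"
    hence "w $ i = 0" if "i < n" for i using ent_v[of i 0] that by simp
    hence "w = 0\<^sub>v n" using w(1) by (intro eq_vecI) auto
    thus False using w(2) by simp
  qed
  have Fv: "F * v = a \<star> v"
  proof (rule finmat_eqI)
    fix i j
    have "(\<Sum>k<n. A $$ (i, k) * w $ k) = a * w $ i" if "i < n"
      using arg_cong[OF w(3), of "\<lambda>u. u $ i"] A w(1) that by (simp add: scalar_prod_def lessThan_atLeast0)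
    moreover have "ent F i k = A $$ (i, k)" if "i < n" "k < n" for k
      using that by (simp add: A_def tomat_def)
    moreover have "ent F i k = 0" if "\<not> i < n" for k using F(1) that by (auto simp: fits_def)
    ultimately show "ent (F * v) i j = ent (a \<star> v) i j"
      by (auto simp: ent_mult_left[OF F(1)] ent_v)
  qed
  \<comment> \<open>The quadratic form at the eigenvector is a |v|^2 and is its own conjugate; hence
    a is real.\<close>
  have "Tr (adj v * (F * v)) = a * Tr (adj v * v)" by (simp add: Fv cscale_mult_right fm.tr_cscale)
  hence 1: "Tr (adj v * (F * v)) = a * complex_of_real ((fm.nrm v)\<^sup>2)" by (simp add: fm.tr_adj_self)
  have 2: "Tr (adj v * (F * v)) = cnj (Tr (adj v * (F * v)))"
    using fm.tr_hermitian[of "F * v" v] F(2) by (simp add: adj_mult mult.assoc)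
  have "cnj a * complex_of_real ((fm.nrm v)\<^sup>2) = cnj (Tr (adj v * (F * v)))"
    unfolding 1 by (simp del: of_real_power)
  hence "cnj a * complex_of_real ((fm.nrm v)\<^sup>2) = a * complex_of_real ((fm.nrm v)\<^sup>2)"
    using 1 2 by argo
  moreover have "fm.nrm v \<noteq> 0" using v0 by (simp add: nrm_finmat_eq_0)
  ultimately have "cnj a = a" by (auto simp del: of_real_power)
  hence aR: "complex_of_real (Re a) = a" by (simp add: complex_eq_iff)
  show thesis
  proof (rule that[OF fv v0, of "Re a"])
    show "Re a \<noteq> 0" using aR a(2) by auto
    show "F * v = complex_of_real (Re a) \<star> v" unfolding aR by (rule Fv)
  qed
qed

text \<open>Comparison of 2-norms: |U| = sqrt k, and |1_n U| is at most |1_n| = sqrt n because U has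
  norm at most 1.\<close>

lemma isometry_rank_le:
  assumes "fits n k U" "adj U * U = idm k" shows "k \<le> n"
proof -
  have "fm.bd 1 U" by (rule fm.bd_isometry[of _ "idm k"]) (use assms in auto)
  hence "fm.nrm (idm n * U) \<le> 1 * fm.nrm (idm n)" by (rule fm.bdD_right) simp
  moreover have "fm.nrm U = sqrt (real k)"
    by (simp add: fm.nrm_def assms(2) Tr_diagm)
  ultimately show ?thesis by (simp add: idm_mult_left[OF assms(1)] nrm_idm)
qed

text \<open>Take an isometry U of eigenvectors with the largest possible number of columns. The
  remainder G vanishes on the range of U; if it were not zero, an eigenvector of G for a nonzero
  eigenvalue would be orthogonal to U, an eigenvector of F too, and could be appended.\<close>

lemma spectral_nonzero:
  assumes F: "fits n n F" "adj F = F"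
  shows "\<exists>k U. \<exists>\<mu> :: nat \<Rightarrow> real. fits n k U \<and> adj U * U = idm k \<and>
    F = U * diagm k (\<lambda>i. of_real (\<mu> i)) * adj U"
proof -
  define good where "good k U \<mu> \<longleftrightarrow> fits n k U \<and> adj U * U = idm k \<and>
      F * U = U * diagm k (\<lambda>i. of_real (\<mu> i))" for k U and \<mu> :: "nat \<Rightarrow> real"
  have g0: "good 0 0 (\<lambda>_. 0)"
    unfolding good_def by (auto intro!: finmat_eqI)
  define K where "K = (GREATEST k. \<exists>U \<mu>. good k U \<mu>)"
  have bound: "\<forall>k. (\<exists>U \<mu>. good k U \<mu>) \<longrightarrow> k \<le> n"
    unfolding good_def using isometry_rank_le by blast
  have "\<exists>U \<mu>. good K U \<mu>"
    unfolding K_def by (rule GreatestI_nat[of "\<lambda>k. \<exists>U \<mu>. good k U \<mu>" 0 n]) (use g0 bound in auto)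
  then obtain U \<mu> where g: "good K U \<mu>" by blast
  hence U: "fits n K U" "adj U * U = idm K" "F * U = U * diagm K (\<lambda>i. of_real (\<mu> i))"
    by (auto simp: good_def)
  let ?D = "diagm K (\<lambda>i. complex_of_real (\<mu> i))"
  define G where "G = F - U * ?D * adj U"
  have "G = 0"
  proof (rule ccontr)
    assume G0: "G \<noteq> 0"
    have fG: "fits n n G" unfolding G_def
      by (intro fits_minus F fits_mult[OF fits_mult[OF U(1) fits_diagm] fits_adj[OF U(1)]])
    have aG: "adj G = G" by (simp add: G_def adj_diff adj_mult F diagm_adj mult.assoc)
    obtain v and \<nu> :: real where v: "fits n 1 v" "v \<noteq> 0" "\<nu> \<noteq> 0" "G * v = complex_of_real \<nu> \<star> v"
      using hermitian_eigenvector[OF fG aG G0] .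
    have "G * U = F * U - U * ?D * (adj U * U)"
      by (simp add: G_def left_diff_distrib mult.assoc)
    also have "U * ?D * (adj U * U) = U * ?D"
      by (simp add: U(2) mult.assoc diagm_mult)
    finally have GU: "G * U = 0" by (simp add: U(3))
    have "complex_of_real \<nu> \<star> (adj U * v) = adj U * (G * v)" by (simp add: v(4) cscale_mult_right)
    also have "\<dots> = adj (G * U) * v" by (simp add: adj_mult aG mult.assoc)
    also have "\<dots> = 0" by (simp add: GU)
    finally have "complex_of_real \<nu> \<star> (adj U * v) = 0" .
    hence Uv: "adj U * v = 0"
      by (rule cscale_eq_0D) (use v(3) in simp)
    have Fv: "F * v = complex_of_real \<nu> \<star> v"
    proof -
      have "G * v = F * v - U * ?D * (adj U * v)"
        unfolding G_def left_diff_distrib by (simp only: mult.assoc)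
      thus ?thesis unfolding Uv v(4) by simp
    qed
    define s where "s = fm.nrm v"
    have "s \<noteq> 0" "0 \<le> s" using v(2) by (simp_all add: s_def nrm_finmat_eq_0)
    hence s: "s > 0" by simp
    define u where "u = complex_of_real (1 / s) \<star> v"
    have u1: "fits n 1 u" unfolding u_def by (rule fits_cscale[OF v(1)])
    have "F * u = complex_of_real (1 / s) \<star> complex_of_real \<nu> \<star> v"
      unfolding u_def cscale_mult_right Fv ..
    also have "\<dots> = complex_of_real \<nu> \<star> u"
      unfolding u_def cscale_cscale by (rule arg_cong[of _ _ "\<lambda>c. c \<star> v"], rule mult.commute)
    finally have u2: "F * u = complex_of_real \<nu> \<star> u" .
    have "adj U * u = 0" unfolding u_def cscale_mult_right Uv by simp
    note u = u1 u2 this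
    have uu: "adj u * u = idm 1"
    proof (rule finmat_eqI)
      fix i j
      have "fm.nrm u = cmod (complex_of_real (1 / s)) * s"
        unfolding u_def s_def by (rule fm.nrm_cscale) simp
      also have "\<dots> = 1" using s by (simp add: norm_divide)
      finally have "Tr (adj u * u) = 1" using fm.tr_adj_self[of u] by simp
      moreover have fu: "fits 1 1 (adj u * u)" by (rule fits_mult[OF fits_adj[OF u(1)] u(1)])
      ultimately have "ent (adj u * u) 0 0 = 1" using Tr_eq[OF fu, of 1] by simp
      moreover have "ent (adj u * u) i j = 0" if "1 \<le> i \<or> 1 \<le> j"
        using fu that unfolding fits_def by blast
      ultimately show "ent (adj u * u) i j = ent (idm 1) i j"
        by (cases "1 \<le> i \<or> 1 \<le> j") (auto simp: not_le)
    qed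
    \<comment> \<open>A row with its single entry in column K, so that \<open>u * e\<close> places u
      as a new last column next to U.\<close>
    define e where "e = unitm 0 K"
    have fe: "fits 1 (Suc K) e" by (auto simp: e_def fits_def)
    define W where "W = U + u * e"
    have fW: "fits n (Suc K) W"
      unfolding W_def by (intro fits_add fits_mult[OF u(1) fe] fits_mono[OF U(1)]) auto
    have eU: "e * adj e = idm 1" "idm 1 * e = e" "adj e * e = unitm K K" "e * diagm K f = 0" for f
    proof -
      show "e * adj e = idm 1"
        by (rule finmat_eqI, unfold ent_mult_left[OF fe]) (auto simp: e_def)
      show "idm 1 * e = e" by (rule idm_mult_left[OF fe])
      show "adj e * e = unitm K K"
        by (rule finmat_eqI, unfold ent_mult_right[OF fe]) (auto simp: e_def)
      show "e * diagm K f = 0" by (rule finmat_eqI) (auto simp: mult_diagm_ent e_def)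
    qed
    have uU: "adj u * U = 0" using arg_cong[OF u(3), of adj] by (simp add: adj_mult)
    have WW: "adj W * W = idm (Suc K)"
    proof -
      have "adj W * W = adj U * U + (adj U * u) * e + adj e * (adj u * U) + adj e * (adj u * u) * e"
        by (simp add: W_def adj_add adj_mult algebra_simps)
      also have "\<dots> = idm K + adj e * e"
        using eU(2) by (simp add: U(2) u(3) uU uu mult.assoc del: One_nat_def)
      also have "\<dots> = idm (Suc K)" unfolding eU(3) by (rule finmat_eqI) auto
      finally show ?thesis .
    qed
    define \<mu>' where "\<mu>' = \<mu>(K := \<nu>)"
    have FW: "F * W = W * diagm (Suc K) (\<lambda>i. of_real (\<mu>' i))"
    proof -
      have d: "diagm (Suc K) (\<lambda>i. complex_of_real (\<mu>' i)) = ?D + complex_of_real \<nu> \<star> unitm K K"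
        by (rule finmat_eqI) (auto simp: \<mu>'_def)
      have Uu: "U * unitm K K = 0"
      proof (rule finmat_eqI)
        fix i j show "ent (U * unitm K K) i j = ent 0 i j"
          using U(1) by (simp add: ent_mult_left[OF U(1)])
      qed
      have eK: "e * unitm K K = e"
        by (rule finmat_eqI, unfold ent_mult_left[OF fe]) (auto simp: e_def)
      have "W * diagm (Suc K) (\<lambda>i. of_real (\<mu>' i)) = U * ?D + complex_of_real \<nu> \<star> (U * unitm K K)
          + u * (e * ?D) + complex_of_real \<nu> \<star> (u * (e * unitm K K))"
        unfolding d W_def by (simp add: algebra_simps cscale_mult_right cscale_add_right)
      also have "\<dots> = F * U + F * u * e" by (simp add: Uu eU(4) eK U(3) u(2) cscale_mult_left)
      finally show ?thesis by (simp add: W_def distrib_left mult.assoc)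
    qed
    have "good (Suc K) W \<mu>'" using fW WW FW by (simp add: good_def)
    hence "Suc K \<le> K"
      unfolding K_def by (intro Greatest_le_nat[of "\<lambda>k. \<exists>U \<mu>. good k U \<mu>" _ n]) (use bound in auto)
    thus False by simp
  qed
  hence "F = U * ?D * adj U" by (simp add: G_def)
  with U(1,2) show ?thesis by blast
qed

text \<open>Shifting F by more than its norm leaves no kernel. On the complement E of the
  eigenvectors found by \<open>spectral_nonzero\<close> the shifted matrix is 0, so F E = -d E with
  d > c, and the bound c for F forces E = 0.\<close>

theorem spectral_theorem:
  assumes F: "fits n n F" "adj F = F"
  obtains U and \<nu> :: "nat \<Rightarrow> real" where "fits n n U" "adj U * U = idm n" "U * adj U = idm n"
    "F = U * diagm n (\<lambda>i. of_real (\<nu> i)) * adj U"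
proof -
  obtain c where c: "fm.bd c F" using bd_ex by blast
  define d where "d = c + 1"
  define G where "G = F + complex_of_real d \<star> idm n"
  have G: "fits n n G" "adj G = G"
    using F by (auto simp: G_def fits_add fits_cscale fits_diagm adj_add adj_cscale)
  obtain k U \<mu> where U: "fits n k U" "adj U * U = idm k"
    "G = U * diagm k (\<lambda>i. complex_of_real (\<mu> i)) * adj U"
    using spectral_nonzero[OF G] by blast
  define E where "E = idm n - U * adj U"
  have "adj U * E = 0"
    by (simp add: E_def right_diff_distrib mult.assoc[symmetric] U(2) idm_mult_left[OF fits_adj[OF U(1)]]
        idm_mult_right[OF fits_adj[OF U(1)]])
  hence GE: "G * E = 0" by (simp add: U(3) mult.assoc)
  have nE: "idm n * E = E"
    by (simp add: E_def right_diff_distrib mult.assoc[symmetric] idm_mult_left[OF U(1)])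
  have "F * E = - (complex_of_real d \<star> E)"
    using GE nE by (simp add: G_def distrib_right cscale_mult_left eq_neg_iff_add_eq_0)
  hence "d * fm.nrm E = fm.nrm (F * E)"
    using fm.bd_ge0[OF c] by (simp add: fm.nrm_cscale d_def)
  also have "\<dots> \<le> c * fm.nrm E" by (rule fm.bdD[OF c]) simp
  finally have "fm.nrm E \<le> 0" by (simp add: d_def algebra_simps)
  hence "fm.nrm E = 0" using fm.nrm_ge0[OF UNIV_I, of E] by linarith
  hence "E = 0" by (simp add: nrm_finmat_eq_0)
  hence UU: "U * adj U = idm n" by (simp add: E_def)
  have "Tr (U * adj U) = Tr (adj U * U)" by (rule fm.tr_comm) auto
  hence "complex_of_nat n = of_nat k" by (simp add: UU U(2) Tr_diagm)
  hence k: "k = n" by simp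
  have "F = G - complex_of_real d \<star> (U * idm n * adj U)"
    using U(1) by (simp add: G_def UU k idm_mult_right)
  also have "\<dots> = U * diagm n (\<lambda>i. of_real (\<mu> i - d)) * adj U"
  proof -
    have "diagm n (\<lambda>i. complex_of_real (\<mu> i - d)) =
        diagm n (\<lambda>i. complex_of_real (\<mu> i)) - complex_of_real d \<star> idm n"
      by (rule finmat_eqI) simp
    thus ?thesis unfolding U(3) k
      by (simp add: left_diff_distrib right_diff_distrib cscale_mult_left cscale_mult_right)
  qed
  finally show thesis using that[of U "\<lambda>i. \<mu> i - d"] U UU k by simp
qed

text \<open>The function is given by its values at the indices of the eigenvectors, not on the
  spectrum; products and differences then are pointwise, and sets of indices may split an
  eigenspace.\<close>

definition fcalc :: "nat \<Rightarrow> finmat \<Rightarrow> (nat \<Rightarrow> real) \<Rightarrow> finmat" where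
  "fcalc n U g = U * diagm n (\<lambda>i. of_real (g i)) * adj U"

locale unitary_finmat =
  fixes n :: nat and U :: finmat
  assumes fits_U: "fits n n U" and UU: "adj U * U = idm n" "U * adj U = idm n"
begin

lemma fits_fcalc: "fits n n (fcalc n U g)"
  unfolding fcalc_def by (rule fits_mult[OF fits_mult[OF fits_U fits_diagm] fits_adj[OF fits_U]])

lemma bd_U: "fm.bd 1 U"
  by (rule fm.bd_isometry[of _ "idm n"]) (simp_all add: UU)

lemma adj_fcalc [simp]: "adj (fcalc n U g) = fcalc n U g"
  by (simp add: fcalc_def adj_mult diagm_adj mult.assoc)

lemma fcalc_mult: "fcalc n U g * fcalc n U h = fcalc n U (\<lambda>i. g i * h i)"
proof -
  have "fcalc n U g * fcalc n U h =
      U * (diagm n (\<lambda>i. of_real (g i)) * (adj U * U) * diagm n (\<lambda>i. of_real (h i))) * adj U"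
    by (simp add: fcalc_def mult.assoc)
  thus ?thesis by (simp add: UU diagm_mult fcalc_def)
qed

lemma fcalc_diff: "fcalc n U g - fcalc n U h = fcalc n U (\<lambda>i. g i - h i)"
  by (simp add: fcalc_def left_diff_distrib[symmetric] right_diff_distrib[symmetric] diagm_diff)

lemma fcalc_one: "fcalc n U (\<lambda>_. 1) = idm n"
  by (simp add: fcalc_def idm_mult_right[OF fits_U] UU)

lemma Tr_fcalc: "Tr (fcalc n U g) = of_real (\<Sum>i<n. g i)"
proof -
  have "Tr (fcalc n U g) = Tr (adj U * (U * diagm n (\<lambda>i. of_real (g i))))"
    unfolding fcalc_def by (rule fm.tr_comm) auto
  thus ?thesis by (simp add: mult.assoc[symmetric] UU diagm_mult Tr_diagm)
qed

lemma nrm_fcalc_sq: "(fm.nrm (fcalc n U g))\<^sup>2 = (\<Sum>i<n. (g i)\<^sup>2)"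
  unfolding fm.nrm_sq[OF UNIV_I] by (simp add: fcalc_mult Tr_fcalc power2_eq_square)

lemma bd_fcalc:
  assumes "\<And>i. i < n \<Longrightarrow> \<bar>g i\<bar> \<le> c" "0 \<le> c" shows "fm.bd c (fcalc n U g)"
proof -
  have "fm.bd (1 * c * 1) (fcalc n U g)" unfolding fcalc_def
    by (rule fm.bd_mult[OF fm.bd_mult[OF bd_U bd_diagm] fm.bd_adj[OF bd_U]]) (use assms in auto)
  thus ?thesis by simp
qed

lemma fcalc_power: "((\<lambda>T. fcalc n U g * T) ^^ k) (idm n) = fcalc n U (\<lambda>i. g i ^ k)"
  by (induction k) (simp_all add: fcalc_one fcalc_mult)

end

lemma spectral_fcalc:
  assumes "fits n n F" "adj F = F"
  obtains U g where "unitary_finmat n U" "F = fcalc n U g"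
  using spectral_theorem[OF assms] unfolding fcalc_def unitary_finmat_def by metis

text \<open>f is h(E) with h = 1 up to eigenvalue 2 and h^2 g = 2 above it. The deviation (h - 1)^2
  is 0 up to 2 and at most 1 above, hence at most (g/2)^k for every k: a Chebyshev estimate by the
  k-th moment. Bounded moments make it small for large k.\<close>

lemma clipping:
  assumes E: "fits n n E" "adj E = E" and pos: "\<And>Y. 0 \<le> Re (Tr (adj Y * E * Y))"
  obtains f where "fits n n f" "adj f = f" "fm.bd 1 f" "fm.bd 2 (f * E * f)"
    "\<And>k. (fm.nrm (f - idm n))\<^sup>2 \<le> Re (Tr (((\<lambda>T. E * T) ^^ k) (idm n))) / 2 ^ k"
proof -
  obtain U g where U: "unitary_finmat n U" and Eg: "E = fcalc n U g"
    using spectral_fcalc[OF E] .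
  interpret unitary_finmat n U by (rule U)
  have g0: "0 \<le> g i" if "i < n" for i
  proof -
    \<comment> \<open>Testing positivity at the i-th eigenvector isolates its eigenvalue.\<close>
    let ?Y = "U * unitm i i"
    have u: "fits n n (unitm i i)" using that by (auto simp: fits_def)
    have "adj ?Y * E * ?Y = adj (unitm i i) * ((adj U * U) * diagm n (\<lambda>i. of_real (g i)) * (adj U * U)) * unitm i i"
      by (simp add: Eg fcalc_def adj_mult mult.assoc)
    also have "\<dots> = adj (unitm i i) * (diagm n (\<lambda>i. of_real (g i)) * unitm i i)"
      by (simp add: UU diagm_mult mult.assoc)
    also have "\<dots> = of_real (g i) \<star> unitm i i"
    proof (rule finmat_eqI)
      fix a b
      show "ent (adj (unitm i i) * (diagm n (\<lambda>i. of_real (g i)) * unitm i i)) a b =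
          ent (complex_of_real (g i) \<star> unitm i i) a b"
      proof -
        have "ent (adj (unitm i i) * (diagm n (\<lambda>i. of_real (g i)) * unitm i i)) a b =
            (\<Sum>k<n. if k = i then if a = i \<and> b = i then of_real (g i) else 0 else 0)"
          unfolding ent_mult_left[OF fits_adj[OF u]] by (rule sum.cong) (auto simp: diagm_mult_ent)
        thus ?thesis using that by simp
      qed
    qed
    also have "Tr \<dots> = of_real (g i)"
      using that by (simp add: fm.tr_cscale Tr_eq[OF u, of n])
    finally show ?thesis using pos[of ?Y] by simp
  qed
  define h where "h i = (if g i \<le> 2 then 1 else sqrt (2 / g i))" for i
  have h01: "0 \<le> h i" "h i \<le> 1" for i by (auto simp: h_def)
  show thesis
  proof (rule that[of "fcalc n U h"])
    show "fm.bd 1 (fcalc n U h)" using h01 by (intro bd_fcalc) auto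
    have "fcalc n U h * E * fcalc n U h = fcalc n U (\<lambda>i. h i * g i * h i)"
      by (simp add: Eg fcalc_mult)
    moreover have "\<bar>h i * g i * h i\<bar> \<le> 2" if "i < n" for i
    proof (cases "g i \<le> 2")
      case False
      have "h i * g i * h i = g i * (h i)\<^sup>2" by (simp add: power2_eq_square)
      also have "\<dots> = 2" using False by (simp add: h_def)
      finally show ?thesis by simp
    qed (use g0[OF that] in \<open>simp add: h_def\<close>)
    ultimately show "fm.bd 2 (fcalc n U h * E * fcalc n U h)" by (simp add: bd_fcalc)
    fix k
    have "(fm.nrm (fcalc n U h - idm n))\<^sup>2 = (\<Sum>i<n. (h i - 1)\<^sup>2)"
      by (simp add: fcalc_one[symmetric] fcalc_diff nrm_fcalc_sq)
    also have "\<dots> \<le> (\<Sum>i<n. (g i / 2) ^ k)"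
    proof (rule sum_mono)
      fix i assume "i \<in> {..<n}"
      hence i: "0 \<le> g i" using g0 by simp
      show "(h i - 1)\<^sup>2 \<le> (g i / 2) ^ k"
      proof (cases "g i \<le> 2")
        case False
        have "(h i - 1)\<^sup>2 \<le> 1" using h01[of i] by (simp add: abs_square_le_1)
        also have "1 \<le> (g i / 2) ^ k" using False by (intro one_le_power) simp
        finally show ?thesis .
      qed (use i in \<open>simp add: h_def\<close>)
    qed
    also have "\<dots> = Re (Tr (((\<lambda>T. E * T) ^^ k) (idm n))) / 2 ^ k"
      by (simp add: Eg fcalc_power Tr_fcalc power_divide sum_divide_distrib)
    finally show "(fm.nrm (fcalc n U h - idm n))\<^sup>2 \<le> Re (Tr (((\<lambda>T. E * T) ^^ k) (idm n))) / 2 ^ k" .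
  qed (use fits_fcalc in auto)
qed

lemma square_sum_le: "(x + y)\<^sup>2 \<le> 2 * x\<^sup>2 + 2 * y\<^sup>2" for x y :: real
  using sum_squares_bound[of x y] by (simp add: power2_sum)

text \<open>An almost projection H is rounded to a projection of prescribed rank n: keep the
  eigenvectors with eigenvalue above 1/2 and add or drop some until n are left. The bound must not
  involve N, since N will be s m with s unbounded. This is why the rank is compared with Tr(H H) and
  not with Tr(H): the factor |g| makes Cauchy-Schwarz end in the 2-norms of H H - H and H, without
  the 2-norm of the identity.\<close>

lemma spectral_isometry:
  assumes H: "fits N N H" "adj H = H" and n: "n \<le> N"
  obtains A where "fits N n A" "adj A * A = idm n"
    "(fm.nrm (A * adj A - H))\<^sup>2 \<le> 8 * (fm.nrm (H * H - H))\<^sup>2 +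
      2 * (\<bar>real n - Re (Tr (H * H))\<bar> + 6 * fm.nrm (H * H - H) * fm.nrm H)"
proof -
  obtain U g where U: "unitary_finmat N U" and Hg: "H = fcalc N U g"
    using spectral_fcalc[OF H] .
  interpret unitary_finmat N U by (rule U)
  define J where "J = {i. i < N \<and> 1/2 < g i}"
  have finJ: "finite J" and JN: "J \<subseteq> {..<N}" by (auto simp: J_def)
  \<comment> \<open>Nesting I and J makes their symmetric difference as small as possible: |n - card
    J| elements.\<close>
  have "\<exists>I. I \<subseteq> {..<N} \<and> card I = n \<and> (I \<subseteq> J \<or> J \<subseteq> I)"
  proof (cases "n \<le> card J")
    case True
    then obtain I where "I \<subseteq> J" "card I = n" using obtain_subset_with_card_n by metis
    thus ?thesis using JN by blast
  next
    case False
    hence "\<exists>I. J \<subseteq> I \<and> I \<subseteq> {..<N} \<and> card I = n"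
      using n JN by (intro exists_subset_between) auto
    thus ?thesis by blast
  qed
  then obtain I where I: "I \<subseteq> {..<N}" "card I = n" "I \<subseteq> J \<or> J \<subseteq> I" by blast
  have finI: "finite I" using I(1) finite_subset by blast
  obtain b where b: "bij_betw b {..<n} I"
    using ex_bij_betw_nat_finite[OF finI] I(2) by (auto simp: lessThan_atLeast0)
  have bN: "b j < N" if "j < n" for j using b I(1) that by (auto simp: bij_betw_def)
  define S where "S = Finmat (\<lambda>i j. if j < n \<and> i = b j then 1 else 0)"
  have ent_S: "ent S i j = (if j < n \<and> i = b j then 1 else 0)" for i j
    unfolding S_def by (subst ent_Finmat[of "max N n"]) (auto dest: bN leD)
  have fS: "fits N n S" by (auto simp: fits_def ent_S dest!: bN)
  have SS: "adj S * S = idm n"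
  proof (rule finmat_eqI)
    fix i j
    have "ent (adj S * S) i j = (\<Sum>k<N. if i < n \<and> j < n \<and> k = b i \<and> k = b j then 1 else 0)"
      unfolding ent_mult_right[OF fS] by (rule sum.cong) (auto simp: ent_S)
    also have "\<dots> = (if i < n \<and> j < n \<and> b i = b j then (\<Sum>k<N. if k = b i then 1 else 0) else 0)"
      by (auto intro!: sum.cong sum.neutral)
    also have "\<dots> = ent (idm n) i j"
      using bN b by (auto simp: bij_betw_def inj_on_def)
    finally show "ent (adj S * S) i j = ent (idm n) i j" .
  qed
  have SS': "S * adj S = diagm N (\<lambda>i. of_real (indicator I i))"
  proof (rule finmat_eqI)
    fix i j
    have "ent (S * adj S) i j = (\<Sum>k<n. if i = b k \<and> j = b k then 1 else 0)"
      unfolding ent_mult_left[OF fS] by (rule sum.cong) (auto simp: ent_S)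
    also have "\<dots> = (\<Sum>k\<in>I. if i = k \<and> j = k then 1 else 0)"
      by (rule sum.reindex_bij_betw[OF b])
    also have "\<dots> = (if i = j then (\<Sum>k\<in>I. if i = k then 1 else 0) else 0)"
      by (auto intro!: sum.cong sum.neutral)
    also have "\<dots> = ent (diagm N (\<lambda>i. of_real (indicator I i))) i j"
      using I(1) finI by (auto simp: indicator_def)
    finally show "ent (S * adj S) i j = ent (diagm N (\<lambda>i. of_real (indicator I i))) i j" .
  qed
  define A where "A = U * S"
  have AA: "A * adj A = fcalc N U (indicator I)"
  proof -
    have "A * adj A = U * (S * adj S) * adj U" by (simp add: A_def adj_mult mult.assoc)
    thus ?thesis by (simp only: SS' fcalc_def)
  qed
  let ?q = "\<lambda>i. (g i)\<^sup>2 - g i"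
  have HH: "H * H = fcalc N U (\<lambda>i. (g i)\<^sup>2)" by (simp add: Hg fcalc_mult power2_eq_square)
  have nHH: "(fm.nrm (H * H - H))\<^sup>2 = (\<Sum>i<N. (?q i)\<^sup>2)"
    unfolding HH by (simp add: Hg fcalc_diff nrm_fcalc_sq)
  have p1: "\<bar>indicator J i - g i\<bar> \<le> 2 * \<bar>?q i\<bar>" if "i < N" for i
  proof (cases "g i > 1/2")
    case True
    have "1 * \<bar>1 - g i\<bar> \<le> (2 * g i) * \<bar>1 - g i\<bar>" using True by (intro mult_right_mono) auto
    also have "\<dots> = 2 * \<bar>?q i\<bar>"
      using True abs_mult[of "g i" "1 - g i"] by (simp add: power2_eq_square algebra_simps abs_minus_commute)
    finally show ?thesis using True that by (simp add: J_def)
  next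
    case False
    have "\<bar>g i\<bar> * 1 \<le> \<bar>g i\<bar> * (2 * \<bar>1 - g i\<bar>)" using False by (intro mult_left_mono) auto
    also have "\<dots> = 2 * \<bar>?q i\<bar>"
      using abs_mult[of "g i" "1 - g i"] by (simp add: power2_eq_square algebra_simps abs_minus_commute)
    finally show ?thesis using False by (simp add: J_def)
  qed
  \<comment> \<open>Summed over i, this bounds the difference of card J and Tr(H H) by a sum of
    products |g^2 - g| |g|. The constant 6 comes from 1 + g <= 6 g^2 for g > 1/2; below 1/2 it is
    ample.\<close>
  have p2: "\<bar>indicator J i - (g i)\<^sup>2\<bar> \<le> 6 * (\<bar>?q i\<bar> * \<bar>g i\<bar>)" if "i < N" for i
  proof -
    have q: "\<bar>?q i\<bar> = \<bar>g i\<bar> * \<bar>1 - g i\<bar>"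
      unfolding abs_mult[symmetric] by (simp add: power2_eq_square algebra_simps abs_minus_commute)
    show ?thesis
    proof (cases "g i > 1/2")
      case True
      have "0 \<le> (2 * g i - 1) * (3 * g i + 1)" using True by (intro mult_nonneg_nonneg) auto
      hence "1 + g i \<le> 6 * (g i)\<^sup>2" by (simp add: power2_eq_square algebra_simps)
      hence "\<bar>1 - g i\<bar> * (1 + g i) \<le> \<bar>1 - g i\<bar> * (6 * (g i)\<^sup>2)" by (intro mult_left_mono) auto
      moreover have "\<bar>1 - (g i)\<^sup>2\<bar> = \<bar>1 - g i\<bar> * (1 + g i)"
        using True abs_mult[of "1 - g i" "1 + g i"] by (simp add: power2_eq_square algebra_simps)
      moreover have "\<bar>1 - g i\<bar> * (6 * (g i)\<^sup>2) = 6 * (\<bar>?q i\<bar> * \<bar>g i\<bar>)"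
        unfolding q using True by (simp add: power2_eq_square)
      ultimately show ?thesis using True that by (simp add: J_def)
    next
      case False
      have "(g i)\<^sup>2 * 1 \<le> (g i)\<^sup>2 * (6 * \<bar>1 - g i\<bar>)" using False by (intro mult_left_mono) auto
      also have "\<dots> = 6 * (\<bar>?q i\<bar> * \<bar>g i\<bar>)"
        unfolding q by (simp add: power2_eq_square mult_ac) 
      finally show ?thesis using False by (simp add: J_def)
    qed
  qed
  have sum_ind: "(\<Sum>i<N. indicator T i) = real (card T)" if "T \<subseteq> {..<N}" for T
  proof -
    have "(\<Sum>i<N. indicator T i) = (\<Sum>i\<in>T. 1 :: real)"
      using that by (intro sum.mono_neutral_cong_right) auto
    thus ?thesis by simp
  qed
  note cJ = sum_ind[OF JN]
  have "\<bar>real (card J) - Re (Tr (H * H))\<bar> = \<bar>\<Sum>i<N. indicator J i - (g i)\<^sup>2\<bar>"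
    by (simp add: cJ[symmetric] HH Tr_fcalc sum_subtractf)
  also have "\<dots> \<le> (\<Sum>i<N. \<bar>indicator J i - (g i)\<^sup>2\<bar>)" by (rule sum_abs)
  also have "\<dots> \<le> (\<Sum>i<N. 6 * (\<bar>?q i\<bar> * \<bar>g i\<bar>))" by (intro sum_mono p2) auto
  also have "\<dots> = 6 * (\<Sum>i<N. \<bar>?q i\<bar> * \<bar>g i\<bar>)" by (simp add: sum_distrib_left)
  also have "\<dots> \<le> 6 * (L2_set ?q {..<N} * L2_set g {..<N})"
    by (intro mult_left_mono L2_set_mult_ineq) auto
  also have "L2_set ?q {..<N} = fm.nrm (H * H - H)"
    unfolding L2_set_def nHH[symmetric] by simp
  also have "L2_set g {..<N} = fm.nrm H"
    unfolding L2_set_def Hg nrm_fcalc_sq[symmetric] by simp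
  finally have cardJ: "\<bar>real (card J) - Re (Tr (H * H))\<bar> \<le> 6 * fm.nrm (H * H - H) * fm.nrm H"
    by (simp add: mult.assoc)
  have IJ: "(\<Sum>i<N. \<bar>indicator I i - indicator J i\<bar>) = \<bar>real n - real (card J)\<bar>"
  proof -
    have cI: "(\<Sum>i<N. indicator I i) = real n"
      using sum_ind[OF I(1)] I(2) by simp
    from I(3) show ?thesis
    proof
      assume IJ: "I \<subseteq> J"
      have "(\<Sum>i<N. \<bar>indicator I i - indicator J i\<bar>) = (\<Sum>i<N. indicator J i - (indicator I i :: real))"
        using IJ by (intro sum.cong) (auto simp: indicator_def)
      moreover have "n \<le> card J" using card_mono[OF finJ IJ] I(2) by simp
      ultimately show ?thesis by (simp add: sum_subtractf cI cJ)
    next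
      assume IJ: "J \<subseteq> I"
      have "(\<Sum>i<N. \<bar>indicator I i - indicator J i\<bar>) = (\<Sum>i<N. indicator I i - (indicator J i :: real))"
        using IJ by (intro sum.cong) (auto simp: indicator_def)
      moreover have "card J \<le> n" using card_mono[OF finI IJ] I(2) by simp
      ultimately show ?thesis by (simp add: sum_subtractf cI cJ)
    qed
  qed
  have "(fm.nrm (A * adj A - H))\<^sup>2 = (\<Sum>i<N. (indicator I i - g i)\<^sup>2)"
    by (simp add: AA Hg fcalc_diff nrm_fcalc_sq)
  also have "\<dots> \<le> (\<Sum>i<N. 8 * (?q i)\<^sup>2 + 2 * \<bar>indicator I i - indicator J i\<bar>)"
  proof (rule sum_mono)
    fix i assume i: "i \<in> {..<N}"
    let ?x = "indicator I i - indicator J i :: real" and ?y = "indicator J i - g i"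
    have "(indicator I i - g i)\<^sup>2 = (?x + ?y)\<^sup>2" by simp
    also have "\<dots> \<le> 2 * ?x\<^sup>2 + 2 * ?y\<^sup>2"
      by (rule square_sum_le)
    also have "?y\<^sup>2 \<le> (2 * \<bar>?q i\<bar>)\<^sup>2"
      using p1[of i] i by (intro power2_le_iff_abs_le[THEN iffD2]) auto
    also have "(2 * \<bar>?q i\<bar>)\<^sup>2 = 4 * (?q i)\<^sup>2" by (simp add: power_mult_distrib)
    also have "?x\<^sup>2 = \<bar>?x\<bar>" by (auto simp: indicator_def)
    finally show "(indicator I i - g i)\<^sup>2 \<le> 8 * (?q i)\<^sup>2 + 2 * \<bar>indicator I i - indicator J i\<bar>" by simp
  qed
  also have "\<dots> = 8 * (fm.nrm (H * H - H))\<^sup>2 + 2 * \<bar>real n - real (card J)\<bar>"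
    by (simp add: sum.distrib sum_distrib_left[symmetric] nHH IJ)
  also have "\<dots> \<le> 8 * (fm.nrm (H * H - H))\<^sup>2 +
      2 * (\<bar>real n - Re (Tr (H * H))\<bar> + 6 * fm.nrm (H * H - H) * fm.nrm H)"
  proof -
    have "\<bar>real n - real (card J)\<bar> \<le> \<bar>real n - Re (Tr (H * H))\<bar> + \<bar>real (card J) - Re (Tr (H * H))\<bar>"
      by linarith
    with cardJ show ?thesis by (intro add_mono mult_left_mono) auto
  qed
  finally have "(fm.nrm (A * adj A - H))\<^sup>2 \<le> \<dots>" .
  moreover have "adj A * A = idm n"
  proof -
    have "adj A * A = adj S * ((adj U * U) * S)" by (simp add: A_def adj_mult mult.assoc)
    thus ?thesis using idm_mult_left[OF fS] by (simp add: UU SS)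
  qed
  ultimately show thesis using that[of A] fits_mult[OF fits_U fS] by (simp add: A_def)
qed

section \<open>Replacing an almost unitary matrix by a unitary one\<close>

lemma finmat_left_inverse_right:
  assumes "fits n n A" "fits n n B" "A * B = idm n" shows "B * A = idm n"
proof -
  have "emb (tomat n A * tomat n B) = emb (1\<^sub>m n)"
    using assms by (subst emb_mult[OF tomat_carrier tomat_carrier]) (simp add: emb_tomat emb_one)
  hence "tomat n A * tomat n B = 1\<^sub>m n"
    by (intro emb_inj[OF mult_carrier_mat[OF tomat_carrier tomat_carrier] one_carrier_mat])
  hence "tomat n B * tomat n A = 1\<^sub>m n"
    by (rule mat_mult_left_right_inverse[OF tomat_carrier tomat_carrier])
  from arg_cong[OF this, of emb] assms show ?thesis
    by (simp add: emb_mult[OF tomat_carrier tomat_carrier] emb_tomat emb_one)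
qed

text \<open>D + \<epsilon> has a kernel only if -\<epsilon> is one of the finitely many roots of the
  characteristic polynomial.\<close>

lemma invertible_perturbation:
  assumes D: "fits m m D" and "0 < \<eta>"
  obtains \<epsilon> :: real where "0 < \<epsilon>" "\<epsilon> < \<eta>"
    "\<And>v. fits m 1 v \<Longrightarrow> (D + of_real \<epsilon> \<star> idm m) * v = 0 \<Longrightarrow> v = 0"
proof -
  define A where "A = tomat m D"
  have A: "A \<in> carrier_mat m m" by (simp add: A_def)
  have "monic (char_poly A)" using degree_monic_char_poly[OF A] by simp
  hence "char_poly A \<noteq> 0" by auto
  hence "finite {z. poly (char_poly A) z = 0}" by (rule poly_roots_finite)
  hence "finite ((\<lambda>z. - Re z) ` {z. poly (char_poly A) z = 0})" by (rule finite_imageI)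
  moreover have "infinite {0<..<\<eta>}" using assms(2) by (simp add: infinite_Ioo)
  ultimately have "\<not> {0<..<\<eta>} \<subseteq> (\<lambda>z. - Re z) ` {z. poly (char_poly A) z = 0}"
    using finite_subset by blast
  then obtain \<epsilon> where \<epsilon>: "\<epsilon> \<in> {0<..<\<eta>}" "\<epsilon> \<notin> (\<lambda>z. - Re z) ` {z. poly (char_poly A) z = 0}"
    by blast
  have "poly (char_poly A) (- complex_of_real \<epsilon>) \<noteq> 0"
  proof
    assume "poly (char_poly A) (- complex_of_real \<epsilon>) = 0"
    hence "- Re (- complex_of_real \<epsilon>) \<in> (\<lambda>z. - Re z) ` {z. poly (char_poly A) z = 0}" by blast
    thus False using \<epsilon>(2) by simp
  qed
  hence ne: "\<not> eigenvalue A (- complex_of_real \<epsilon>)" by (simp add: eigenvalue_root_char_poly[OF A])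
  show thesis
  proof (rule that[of \<epsilon>])
    fix v assume v: "fits m 1 v" "(D + of_real \<epsilon> \<star> idm m) * v = 0"
    have Dv: "D * v = - complex_of_real \<epsilon> \<star> v"
      using v(2) idm_mult_left[OF v(1)]
      by (simp add: distrib_right cscale_mult_left cscale_minus_left eq_neg_iff_add_eq_0)
    define w where "w = Matrix.vec m (\<lambda>i. ent v i 0)"
    have w: "w \<in> carrier_vec m" by (simp add: w_def)
    have "A *\<^sub>v w = (- complex_of_real \<epsilon>) \<cdot>\<^sub>v w"
    proof (rule eq_vecI)
      fix i assume "i < dim_vec ((- complex_of_real \<epsilon>) \<cdot>\<^sub>v w)"
      hence i: "i < m" by (simp add: w_def)
      have "(A *\<^sub>v w) $ i = ent (D * v) i 0"
        using i by (simp add: ent_mult_left[OF D] A_def w_def tomat_def scalar_prod_def lessThan_atLeast0)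
      thus "(A *\<^sub>v w) $ i = ((- complex_of_real \<epsilon>) \<cdot>\<^sub>v w) $ i"
        using i by (simp add: Dv w_def)
    qed (simp add: w_def A_def tomat_def)
    hence w0: "w = 0\<^sub>v m" using ne w A by (auto simp: eigenvalue_def eigenvector_def)
    have z: "ent v i 0 = 0" if "i < m" for i
      using arg_cong[of w _ "\<lambda>u. u $ i", OF w0] that by (simp add: w_def)
    show "v = 0"
    proof (rule finmat_eqI)
      fix i j show "ent v i j = ent 0 i j"
      proof (cases "i < m \<and> j = 0")
        case True thus ?thesis using z by simp
      next
        case False
        hence "m \<le> i \<or> 1 \<le> j" by auto
        thus ?thesis using v(1) unfolding fits_def by (metis ent_zero)
      qed
    qed
  qed (use \<epsilon> in auto)
qed

text \<open>V is G |G|^-1, defined because injectivity makes all eigenvalues g of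
  \<open>adj G * G\<close> positive. The distance estimate is |sqrt g - 1| <= |g - 1| for each
  eigenvalue.\<close>

lemma polar_of_injective:
  assumes G: "fits m m G" and inj: "\<And>v. fits m 1 v \<Longrightarrow> G * v = 0 \<Longrightarrow> v = 0"
  obtains V where "fits m m V" "adj V * V = idm m" "V * adj V = idm m"
    "fm.nrm (G - V) \<le> fm.nrm (adj G * G - idm m)"
proof -
  have GG: "fits m m (adj G * G)" "adj (adj G * G) = adj G * G"
    using fits_mult[OF fits_adj[OF G] G] by (auto simp: adj_mult)
  obtain U g where U: "unitary_finmat m U" and Gg: "adj G * G = fcalc m U g"
    using spectral_fcalc[OF GG] .
  interpret unitary_finmat m U by (rule U)
  have pos: "g i > 0" if i: "i < m" for i
  proof -
    define u where "u = U * unitm i 0"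
    have fu0: "fits m 1 (unitm i 0)" using i by (auto simp: fits_def)
    have fu: "fits m 1 u" unfolding u_def by (rule fits_mult[OF fits_U fu0])
    have "adj U * u = unitm i 0"
      by (simp add: u_def mult.assoc[symmetric] UU idm_mult_left[OF fu0])
    have "u \<noteq> 0"
    proof
      assume "u = 0"
      hence "ent (unitm i 0) i 0 = ent 0 i 0" using \<open>adj U * u = unitm i 0\<close> by simp
      thus False by simp
    qed
    hence "G * u \<noteq> 0" using inj[OF fu] by blast
    hence "0 < (fm.nrm (G * u))\<^sup>2" by (simp add: nrm_finmat_eq_0)
    also have "(fm.nrm (G * u))\<^sup>2 = Re (Tr (adj u * (adj G * G) * u))"
      by (simp add: fm.nrm_sq adj_mult mult.assoc)
    also have "adj u * (adj G * G) * u =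
        adj (unitm i 0) * ((adj U * U) * (diagm m (\<lambda>i. of_real (g i)) * ((adj U * U) * unitm i 0)))"
      unfolding Gg fcalc_def u_def by (simp add: adj_mult mult.assoc)
    also have "\<dots> = adj (unitm i 0) * (diagm m (\<lambda>i. of_real (g i)) * unitm i 0)"
    proof -
      have "idm m * (diagm m (\<lambda>i. of_real (g i)) * unitm i 0) = diagm m (\<lambda>i. of_real (g i)) * unitm i 0"
        by (rule idm_mult_left[OF fits_mult[OF fits_diagm fu0]])
      thus ?thesis by (simp only: UU idm_mult_left[OF fu0])
    qed
    also have "Tr \<dots> = ent (adj (unitm i 0) * (diagm m (\<lambda>i. of_real (g i)) * unitm i 0)) 0 0"
      using Tr_eq[OF fits_mult[OF fits_adj[OF fu0] fits_mult[OF fits_diagm fu0]], of 1] by simp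
    also have "\<dots> = (\<Sum>k<m. if k = i then of_real (g i) else 0)"
      unfolding ent_mult_left[OF fits_adj[OF fu0]] by (rule sum.cong) (auto simp: diagm_mult_ent)
    also have "\<dots> = of_real (g i)" using i by simp
    finally show ?thesis by simp
  qed
  define V where "V = G * fcalc m U (\<lambda>i. 1 / sqrt (g i))"
  have fV: "fits m m V" unfolding V_def by (rule fits_mult[OF G fits_fcalc])
  have cong: "fcalc m U h = fcalc m U h'" if "\<And>i. i < m \<Longrightarrow> h i = h' i" for h h'
  proof -
    have "diagm m (\<lambda>i. complex_of_real (h i)) = diagm m (\<lambda>i. complex_of_real (h' i))"
      by (rule finmat_eqI) (use that in auto)
    thus ?thesis by (simp add: fcalc_def)
  qed
  have "adj V * V = fcalc m U (\<lambda>i. 1 / sqrt (g i)) * (adj G * G) * fcalc m U (\<lambda>i. 1 / sqrt (g i))"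
    by (simp add: V_def adj_mult mult.assoc)
  also have "\<dots> = fcalc m U (\<lambda>i. 1 / sqrt (g i) * g i * (1 / sqrt (g i)))"
    by (simp add: Gg fcalc_mult)
  also have "\<dots> = idm m"
    unfolding fcalc_one[symmetric]
  proof (rule cong)
    fix i assume "i < m"
    from pos[OF this] show "1 / sqrt (g i) * g i * (1 / sqrt (g i)) = 1" by (simp add: field_simps)
  qed
  finally have VV: "adj V * V = idm m" .
  have VV': "V * adj V = idm m" by (rule finmat_left_inverse_right[OF fits_adj[OF fV] fV VV])
  have "V * fcalc m U (\<lambda>i. sqrt (g i)) = G * fcalc m U (\<lambda>i. 1 / sqrt (g i) * sqrt (g i))"
    by (simp add: V_def mult.assoc fcalc_mult)
  also have "fcalc m U (\<lambda>i. 1 / sqrt (g i) * sqrt (g i)) = idm m"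
    unfolding fcalc_one[symmetric] by (rule cong) (use pos in fastforce)
  finally have GV: "G = V * fcalc m U (\<lambda>i. sqrt (g i))" by (simp add: idm_mult_right[OF G])
  have "G - V = V * fcalc m U (\<lambda>i. sqrt (g i) - 1)"
    by (simp add: fcalc_diff[symmetric] right_diff_distrib GV[symmetric] fcalc_one idm_mult_right[OF fV])
  also have "fm.nrm \<dots> \<le> 1 * fm.nrm (fcalc m U (\<lambda>i. sqrt (g i) - 1))"
    by (rule fm.bdD[OF fm.bd_isometry[of _ "idm m"]]) (auto simp: VV)
  also have "\<dots> \<le> fm.nrm (fcalc m U (\<lambda>i. g i - 1))"
  proof -
    have "(\<Sum>i<m. (sqrt (g i) - 1)\<^sup>2) \<le> (\<Sum>i<m. (g i - 1)\<^sup>2)"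
    proof (rule sum_mono)
      fix i assume "i \<in> {..<m}"
      hence p: "g i > 0" using pos by simp
      have "(g i - 1)\<^sup>2 = (sqrt (g i) - 1)\<^sup>2 * (sqrt (g i) + 1)\<^sup>2"
        using p by (simp add: power_mult_distrib[symmetric] algebra_simps)
      moreover have "1 \<le> (sqrt (g i) + 1)\<^sup>2" using p by (intro one_le_power) simp
      ultimately show "(sqrt (g i) - 1)\<^sup>2 \<le> (g i - 1)\<^sup>2"
        using mult_left_mono[of 1 "(sqrt (g i) + 1)\<^sup>2" "(sqrt (g i) - 1)\<^sup>2"] by simp
    qed
    hence "(fm.nrm (fcalc m U (\<lambda>i. sqrt (g i) - 1)))\<^sup>2 \<le> (fm.nrm (fcalc m U (\<lambda>i. g i - 1)))\<^sup>2"
      by (simp add: nrm_fcalc_sq)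
    thus ?thesis by (simp add: abs_le_square_iff[symmetric])
  qed
  also have "fcalc m U (\<lambda>i. g i - 1) = adj G * G - idm m"
    by (simp add: Gg fcalc_diff[symmetric] fcalc_one)
  finally show thesis using that[OF fV VV VV'] by simp
qed

text \<open>A singular D has only a partial isometry as polar part. A shift by a small multiple of
  the identity makes it injective, and \<eta> pays for the shift.\<close>

lemma nearly_unitary:
  assumes D: "fits m m D" and \<eta>: "0 < \<eta>"
  obtains V where "fits m m V" "adj V * V = idm m" "V * adj V = idm m"
    "fm.nrm (D - V) \<le> fm.nrm (adj D * D - idm m) + \<eta>"
proof -
  \<comment> \<open>K collects the error terms of order \<epsilon>: 2 |D| + sqrt m from expanding
    \<open>adj G * G\<close>, where \<epsilon>^2 <= \<epsilon>, and sqrt m from D - G.\<close>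
  define K where "K = sqrt (real m) + 2 * fm.nrm D + sqrt (real m)"
  have K0: "0 \<le> K" by (simp add: K_def)
  define \<delta> where "\<delta> = min 1 (\<eta> / (K + 1))"
  have "0 < \<delta>" using \<eta> K0 by (simp add: \<delta>_def)
  then obtain \<epsilon> where \<epsilon>: "0 < \<epsilon>" "\<epsilon> < \<delta>"
    and inj: "\<And>v. fits m 1 v \<Longrightarrow> (D + of_real \<epsilon> \<star> idm m) * v = 0 \<Longrightarrow> v = 0"
    using invertible_perturbation[OF D] by metis
  define G where "G = D + of_real \<epsilon> \<star> idm m"
  have G: "fits m m G" unfolding G_def by (intro fits_add D fits_cscale fits_diagm)
  obtain V where V: "fits m m V" "adj V * V = idm m" "V * adj V = idm m"
    "fm.nrm (G - V) \<le> fm.nrm (adj G * G - idm m)"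
    by (rule polar_of_injective[OF G]) (use inj in \<open>auto simp: G_def\<close>)
  let ?e = "complex_of_real \<epsilon>"
  have ID: "D * idm m = D" "idm m * adj D = adj D" "idm m * D = D" "adj D * idm m = adj D"
    by (simp_all add: idm_mult_right[OF D] idm_mult_left[OF D] idm_mult_left[OF fits_adj[OF D]]
        idm_mult_right[OF fits_adj[OF D]])
  have e: "fm.nrm (?e \<star> idm m) = \<epsilon> * sqrt m"
    using \<epsilon> by (simp add: fm.nrm_cscale nrm_idm)
  have "adj G * G - idm m = (adj D * D - idm m) + (?e \<star> adj D + (?e \<star> D + (?e * ?e) \<star> idm m))"
    by (simp add: G_def adj_add adj_cscale algebra_simps cscale_mult_left cscale_mult_right ID
        cscale_cscale cscale_add_right)
  hence "fm.nrm (adj G * G - idm m) \<le> fm.nrm (adj D * D - idm m) +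
      (fm.nrm (?e \<star> adj D) + (fm.nrm (?e \<star> D) + fm.nrm ((?e * ?e) \<star> idm m)))"
    by (simp only:) (intro order_trans[OF fm.nrm_add] add_left_mono order_refl UNIV_I)
  also have "\<dots> = fm.nrm (adj D * D - idm m) + (2 * \<epsilon> * fm.nrm D + \<epsilon> * \<epsilon> * sqrt m)"
    using \<epsilon> by (simp add: fm.nrm_cscale nrm_idm fm.nrm_adj norm_mult)
  also have "\<dots> \<le> fm.nrm (adj D * D - idm m) + \<epsilon> * (2 * fm.nrm D + sqrt m)"
    using \<epsilon> mult_right_mono[of \<epsilon> 1 "\<epsilon> * sqrt m"] by (simp add: algebra_simps \<delta>_def)
  finally have 1: "fm.nrm (adj G * G - idm m) \<le> fm.nrm (adj D * D - idm m) + \<epsilon> * (2 * fm.nrm D + sqrt m)" .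
  have "fm.nrm (D - V) \<le> fm.nrm (D - G) + fm.nrm (G - V)" by (rule fm.nrm_triangle) auto
  also have "fm.nrm (D - G) = \<epsilon> * sqrt m" using e by (simp add: G_def)
  also have "\<epsilon> * sqrt m + fm.nrm (G - V) \<le> fm.nrm (adj D * D - idm m) + \<epsilon> * K"
    using V(4) 1 by (simp add: K_def algebra_simps)
  also have "\<epsilon> * K \<le> \<eta>"
  proof -
    have "\<epsilon> * K \<le> \<eta> / (K + 1) * K" using \<epsilon> K0 by (intro mult_right_mono) (auto simp: \<delta>_def)
    also have "\<dots> \<le> \<eta>" using \<eta> K0 by (simp add: field_simps)
    finally show ?thesis .
  qed
  finally show thesis using that[OF V(1-3)] by simp
qed

section \<open>Laws and entropy\<close>

text \<open>Laws are linear and hence given by their moments \<mu> on words, so operators and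
  matrices differ only in \<mu>. The value 0 outside \<open>ncpolys d\<close> matches
  \<open>law_op\<close> and \<open>law_mat\<close>.\<close>

definition law_of :: "nat \<Rightarrow> (nat list \<Rightarrow> complex) \<Rightarrow> nclaw" where
  "law_of d \<mu> = (\<lambda>f. if f \<in> ncpolys d
     then \<Sum>w\<in>Poly_Mapping.keys f. Poly_Mapping.lookup f w * \<mu> w else 0)"

lemma law_of_cong: "(\<And>w. set w \<subseteq> {..<d} \<Longrightarrow> \<mu> w = \<mu>' w) \<Longrightarrow> law_of d \<mu> = law_of d \<mu>'"
proof (rule ext)
  fix f
  assume eq: "\<And>w. set w \<subseteq> {..<d} \<Longrightarrow> \<mu> w = \<mu>' w"
  show "law_of d \<mu> f = law_of d \<mu>' f"
  proof (cases "f \<in> ncpolys d")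
    case True
    hence "\<And>w. w \<in> Poly_Mapping.keys f \<Longrightarrow> \<mu> w = \<mu>' w" using eq by (simp add: ncpolys_def)
    thus ?thesis by (simp add: law_of_def)
  qed (simp add: law_of_def)
qed

lemma law_of_single:
  assumes "set w \<subseteq> {..<d}" shows "law_of d \<mu> (Poly_Mapping.single w 1) = \<mu> w"
  using assms by (simp add: law_of_def ncpolys_def)

lemma tendsto_law_of:
  assumes "\<And>w. set w \<subseteq> {..<d} \<Longrightarrow> ((\<lambda>\<omega>. \<mu> \<omega> w) \<longlongrightarrow> \<nu> w) Fl"
  shows "((\<lambda>\<omega>. law_of d (\<mu> \<omega>)) \<longlongrightarrow> law_of d \<nu>) Fl"
proof -
  have "((\<lambda>\<omega>. law_of d (\<mu> \<omega>) f) \<longlongrightarrow> law_of d \<nu> f) Fl" for f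
  proof (cases "f \<in> ncpolys d")
    case True
    have "((\<lambda>\<omega>. \<Sum>w\<in>Poly_Mapping.keys f. Poly_Mapping.lookup f w * \<mu> \<omega> w) \<longlongrightarrow>
        (\<Sum>w\<in>Poly_Mapping.keys f. Poly_Mapping.lookup f w * \<nu> w)) Fl"
    proof (rule tendsto_sum)
      fix w assume "w \<in> Poly_Mapping.keys f"
      hence "set w \<subseteq> {..<d}" using True by (simp add: ncpolys_def)
      from tendsto_mult[OF tendsto_const assms[OF this]]
      show "((\<lambda>\<omega>. Poly_Mapping.lookup f w * \<mu> \<omega> w) \<longlongrightarrow> Poly_Mapping.lookup f w * \<nu> w) Fl" .
    qed
    thus ?thesis using True by (simp add: law_of_def)
  qed (simp add: law_of_def)
  hence "limitin (product_topology (\<lambda>_. euclidean) UNIV) (\<lambda>\<omega>. law_of d (\<mu> \<omega>)) (law_of d \<nu>) Fl"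
    by (simp add: limitin_componentwise)
  thus ?thesis by (simp add: euclidean_product_topology)
qed

lemma open_law_ball: "open {\<phi>::nclaw. cmod (\<phi> f - c) < \<eta>}"
proof -
  have "continuous_on UNIV (\<lambda>\<phi>::nclaw. \<phi> f)" by (rule continuous_on_product_coordinates)
  from continuous_on_norm[OF continuous_on_diff[OF this continuous_on_const]]
  have "continuous_on UNIV (\<lambda>\<phi>::nclaw. cmod (\<phi> f - c))" .
  thus ?thesis by (rule open_Collect_less[OF _ continuous_on_const])
qed

lemma law_mat_eq:
  assumes "set X \<subseteq> carrier_mat n n"
  shows "law_mat n X = law_of (length X)
    (\<lambda>w. Tr (foldr (\<lambda>i T. emb (X ! i) * T) w (idm n)) / of_nat n)"
proof
  fix f
  have W: "foldr (\<lambda>i A. X ! i * A) w (1\<^sub>m n) \<in> carrier_mat n n \<and>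
      emb (foldr (\<lambda>i A. X ! i * A) w (1\<^sub>m n)) = foldr (\<lambda>i T. emb (X ! i) * T) w (idm n)"
    if "set w \<subseteq> {..<length X}" for w
    using that
  proof (induction w)
    case (Cons i w)
    have i: "X ! i \<in> carrier_mat n n" using Cons.prems assms by (auto dest!: nth_mem)
    have w: "foldr (\<lambda>i A. X ! i * A) w (1\<^sub>m n) \<in> carrier_mat n n"
      "emb (foldr (\<lambda>i A. X ! i * A) w (1\<^sub>m n)) = foldr (\<lambda>i T. emb (X ! i) * T) w (idm n)"
      using Cons by auto
    show ?case using emb_mult[OF i w(1)] i w by simp
  qed (simp add: emb_one)
  show "law_mat n X f = law_of (length X)
    (\<lambda>w. Tr (foldr (\<lambda>i T. emb (X ! i) * T) w (idm n)) / of_nat n) f"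
  proof (cases "f \<in> ncpolys (length X)")
    case True
    have car: "eval_mat n X f \<in> carrier_mat n n" by (simp add: eval_mat_def)
    have "normalized_trace n (eval_mat n X f) =
        (\<Sum>w\<in>Poly_Mapping.keys f. Poly_Mapping.lookup f w *
          normalized_trace n (foldr (\<lambda>i A. X ! i * A) w (1\<^sub>m n)))"
    proof -
      have "(\<Sum>i<n. eval_mat n X f $$ (i, i)) = (\<Sum>i<n. \<Sum>w\<in>Poly_Mapping.keys f.
          Poly_Mapping.lookup f w * foldr (\<lambda>i A. X ! i * A) w (1\<^sub>m n) $$ (i, i))"
        by (rule sum.cong) (simp_all add: eval_mat_def)
      also have "\<dots> = (\<Sum>w\<in>Poly_Mapping.keys f. \<Sum>i<n.
          Poly_Mapping.lookup f w * foldr (\<lambda>i A. X ! i * A) w (1\<^sub>m n) $$ (i, i))"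
        by (rule sum.swap)
      finally show ?thesis
        by (simp add: normalized_trace_def sum_distrib_left sum_divide_distrib)
    qed
    also have "\<dots> = (\<Sum>w\<in>Poly_Mapping.keys f. Poly_Mapping.lookup f w *
        (Tr (foldr (\<lambda>i T. emb (X ! i) * T) w (idm n)) / of_nat n))"
      using True W by (intro sum.cong) (auto simp: ncpolys_def normalized_trace_emb)
    finally show ?thesis using True by (simp add: law_mat_def law_of_def)
  qed (simp add: law_mat_def law_of_def)
qed

definition covering :: "nat \<Rightarrow> nat \<Rightarrow> nat \<Rightarrow> real \<Rightarrow> nclaw set \<Rightarrow> enat" where
  "covering n d d' \<epsilon> U = orbital_covering_number n d \<epsilon> (take d ` microstates n (d + d') 2 U)"

text \<open>The entropy only depends on the self-adjoint contractions and on the laws of tuples of them.\<close>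

definition law_entropy :: "'b set \<Rightarrow> ('b list \<Rightarrow> nclaw) \<Rightarrow> ereal" where
  "law_entropy C L =
    (SUP (x, \<epsilon>) \<in> {(x, \<epsilon>). set x \<subseteq> C \<and> 0 < \<epsilon>}.
      INF (y, U) \<in> {(y, U). set y \<subseteq> C \<and> open U \<and> L (x @ y) \<in> U}.
        limsup (\<lambda>n. ereal (1 / (real n)\<^sup>2) * log_enat (covering n (length x) (length y) \<epsilon> U)))"

lemma one_bounded_entropy_eq:
  "one_bounded_entropy M e \<tau> = law_entropy (sa_contractions M) (law_op e \<tau>)"
  unfolding one_bounded_entropy_def law_entropy_def covering_def ..

text \<open>The tuple x of the supremum is carried over by f, and the tuple y of the infimum has to
  be carried back by g.\<close>

lemma law_entropy_le:
  assumes f: "f ` C \<subseteq> C'" and g: "g ` C' \<subseteq> C"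
    and L: "\<And>x. set x \<subseteq> C \<Longrightarrow> L' (map f x) = L x" and L': "\<And>x. set x \<subseteq> C' \<Longrightarrow> L (map g x) = L' x"
    and fg: "\<And>c. c \<in> C \<Longrightarrow> g (f c) = c"
  shows "law_entropy C L \<le> law_entropy C' L'"
  unfolding law_entropy_def
proof (rule SUP_mono, clarify)
  fix x and \<epsilon> :: real assume x: "set x \<subseteq> C" "0 < \<epsilon>"
  let ?A = "\<lambda>d y U. limsup (\<lambda>n. ereal (1 / (real n)\<^sup>2) * log_enat (covering n d (length y) \<epsilon> U))"
  have gfx: "map g (map f x) = x" using x fg by (simp add: map_idI subset_iff)
  have "(INF (y, U) \<in> {(y, U). set y \<subseteq> C \<and> open U \<and> L (x @ y) \<in> U}. ?A (length x) y U) \<le>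
      (INF (y, U) \<in> {(y, U). set y \<subseteq> C' \<and> open U \<and> L' (map f x @ y) \<in> U}. ?A (length (map f x)) y U)"
  proof (rule INF_mono, clarify)
    fix y U assume y: "set y \<subseteq> C'" "open U" "L' (map f x @ y) \<in> U"
    have "set (map f x @ y) \<subseteq> C'" using x y f by auto
    hence "L (x @ map g y) \<in> U" using L'[of "map f x @ y"] y(3) gfx by simp
    thus "\<exists>n\<in>{(y, U). set y \<subseteq> C \<and> open U \<and> L (x @ y) \<in> U}.
        (case n of (y, U) \<Rightarrow> ?A (length x) y U) \<le> ?A (length (map f x)) y U"
      using y g by (intro bexI[of _ "(map g y, U)"]) auto
  qed
  thus "\<exists>m\<in>{(x, \<epsilon>). set x \<subseteq> C' \<and> 0 < \<epsilon>}.
      (INF (y, U) \<in> {(y, U). set y \<subseteq> C \<and> open U \<and> L (x @ y) \<in> U}.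
        limsup (\<lambda>n. ereal (1 / (real n)\<^sup>2) * log_enat (covering n (length x) (length y) \<epsilon> U)))
      \<le> (case m of (x, \<epsilon>) \<Rightarrow> INF (y, U) \<in> {(y, U). set y \<subseteq> C' \<and> open U \<and> L' (x @ y) \<in> U}.
        limsup (\<lambda>n. ereal (1 / (real n)\<^sup>2) * log_enat (covering n (length x) (length y) \<epsilon> U)))"
    using x f by (intro bexI[of _ "(map f x, \<epsilon>)"]) auto
qed

lemma law_entropy_transfer:
  assumes f: "bij_betw f C C'" and L: "\<And>x. set x \<subseteq> C \<Longrightarrow> L' (map f x) = L x"
  shows "law_entropy C L = law_entropy C' L'"
proof (rule antisym)
  define g where "g = inv_into C f"
  have gC: "g ` C' = C" using bij_betw_inv_into[OF f] by (simp add: bij_betw_def g_def)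
  have fC: "f ` C = C'" using f by (simp add: bij_betw_def)
  have gf: "g (f c) = c" if "c \<in> C" for c using f that by (simp add: g_def bij_betw_inv_into_left)
  have fg: "f (g c) = c" if "c \<in> C'" for c using f that by (simp add: g_def bij_betw_inv_into_right)
  have L': "L (map g x) = L' x" if x: "set x \<subseteq> C'" for x
  proof -
    have "map f (map g x) = x" using x fg by (simp add: map_idI subset_iff)
    moreover have "set (map g x) \<subseteq> C" using x gC by auto
    ultimately show ?thesis using L[of "map g x"] by simp
  qed
  show "law_entropy C L \<le> law_entropy C' L'"
    by (rule law_entropy_le[of f C C' g]) (use fC gC L L' gf in auto)
  show "law_entropy C' L' \<le> law_entropy C L"
    by (rule law_entropy_le[of g C' C f]) (use fC gC L L' fg in auto)
qed

lemma log_enat_mono: "k \<le> l \<Longrightarrow> log_enat k \<le> log_enat l"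
  by (cases k; cases l) (auto simp: log_enat_def)

text \<open>With n = n(m), the floor of m \<rho>, the quantity v(n) / m^2 is (n/m)^2 times v(n) /
  n^2, and n/m tends to \<rho> while n tends to infinity.\<close>

lemma limsup_rescaled_le:
  fixes u v :: "nat \<Rightarrow> ereal"
  assumes \<rho>: "0 < \<rho>" and le: "\<forall>\<^sub>F m in sequentially. u m \<le> v (nat \<lfloor>real m * \<rho>\<rfloor>)"
  shows "limsup (\<lambda>m. ereal (1 / (real m)\<^sup>2) * u m) \<le>
    ereal (\<rho>\<^sup>2) * limsup (\<lambda>n. ereal (1 / (real n)\<^sup>2) * v n)"
proof -
  define n where "n m = nat \<lfloor>real m * \<rho>\<rfloor>" for m
  define L where "L = limsup (\<lambda>n. ereal (1 / (real n)\<^sup>2) * v n)"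
  have c: "0 < ereal (\<rho>\<^sup>2)" "ereal (\<rho>\<^sup>2) \<noteq> \<infinity>" using \<rho> by auto
  have n_bounds: "real m * \<rho> - 1 \<le> real (n m)" "real (n m) \<le> real m * \<rho>" for m
    using \<rho> by (auto simp: n_def)
  have ratio: "(\<lambda>m. real (n m) / real m) \<longlonglongrightarrow> \<rho>"
  proof (rule tendsto_sandwich)
    show "\<forall>\<^sub>F m in sequentially. \<rho> - 1 / real m \<le> real (n m) / real m"
      using eventually_gt_at_top[of 0]
    proof eventually_elim
      case (elim m)
      have "\<rho> - 1 / real m = (real m * \<rho> - 1) / real m" using elim by (simp add: field_simps)
      also have "\<dots> \<le> real (n m) / real m" using n_bounds(1)[of m] by (rule divide_right_mono) simp
      finally show ?case .
    qed
    show "\<forall>\<^sub>F m in sequentially. real (n m) / real m \<le> \<rho>"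
      using eventually_gt_at_top[of 0]
    proof eventually_elim
      case (elim m)
        thus ?case using n_bounds(2)[of m] by (simp add: field_simps)
    qed
    show "(\<lambda>m. \<rho> - 1 / real m) \<longlonglongrightarrow> \<rho>"
      using tendsto_diff[OF tendsto_const lim_1_over_n, of \<rho>] by simp
  qed simp
  have "filterlim (\<lambda>m. - 1 + \<rho> * real m) at_top sequentially"
    by (intro filterlim_tendsto_add_at_top[OF tendsto_const]
        filterlim_tendsto_pos_mult_at_top[OF tendsto_const \<rho>] filterlim_real_sequentially)
  hence "filterlim (\<lambda>m. real (n m)) at_top sequentially"
    by (rule filterlim_at_top_mono) (use n_bounds(1) in \<open>auto simp: algebra_simps\<close>)
  hence n_inf: "filterlim n at_top sequentially"
    by (simp add: filterlim_sequentially_iff_filterlim_real)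
  have "limsup (\<lambda>m. ereal (1 / (real m)\<^sup>2) * u m) \<le> ereal (\<rho>\<^sup>2) * L"
    unfolding Limsup_le_iff
  proof (intro allI impI)
    fix y assume "ereal (\<rho>\<^sup>2) * L < y"
    hence "L < y / ereal (\<rho>\<^sup>2)" using c by (simp add: ereal_less_divide_pos mult.commute)
    \<comment> \<open>The limsup may be infinite or negative; a real z between it and the target
      keeps the convergence of (n/m)^2 z within the reals.\<close>
    then obtain z where z: "L < ereal z" "ereal z < y / ereal (\<rho>\<^sup>2)" using ereal_dense2 by blast
    have zy: "ereal (\<rho>\<^sup>2 * z) < y"
      using z(2) c by (simp add: ereal_less_divide_pos mult.commute)
    have "\<forall>\<^sub>F k in sequentially. ereal (1 / (real k)\<^sup>2) * v k < ereal z"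
      using z(1) unfolding L_def by (rule Limsup_lessD)
    hence ev: "\<forall>\<^sub>F m in sequentially. ereal (1 / (real (n m))\<^sup>2) * v (n m) < ereal z"
      using n_inf by (rule eventually_compose_filterlim)
    have "(\<lambda>m. ereal ((real (n m) / real m)\<^sup>2 * z)) \<longlonglongrightarrow> ereal (\<rho>\<^sup>2 * z)"
      by (rule tendsto_ereal[OF tendsto_mult[OF tendsto_power[OF ratio] tendsto_const]])
    hence ev2: "\<forall>\<^sub>F m in sequentially. ereal ((real (n m) / real m)\<^sup>2 * z) < y"
      using zy by (rule order_tendstoD)
    have ev3: "\<forall>\<^sub>F m in sequentially. 0 < n m"
      using n_inf by (rule eventually_compose_filterlim[OF eventually_gt_at_top])
    show "\<forall>\<^sub>F m in sequentially. ereal (1 / (real m)\<^sup>2) * u m < y"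
      using le ev ev2 ev3
    proof eventually_elim
      case (elim m)
      have "ereal (1 / (real m)\<^sup>2) * u m \<le> ereal (1 / (real m)\<^sup>2) * v (n m)"
        using elim(1) by (intro ereal_mult_left_mono) (auto simp: n_def)
      also have "\<dots> = ereal ((real (n m) / real m)\<^sup>2) * (ereal (1 / (real (n m))\<^sup>2) * v (n m))"
        using elim(4) by (simp add: mult.assoc[symmetric] power_divide)
      also have "\<dots> \<le> ereal ((real (n m) / real m)\<^sup>2) * ereal z"
        using elim(2) by (intro ereal_mult_left_mono) auto
      also have "\<dots> < y" using elim(3) by simp
      finally show ?case .
    qed
  qed
  thus ?thesis by (simp add: L_def)
qed

text \<open>The quantifiers follow the supremum and infimum: x' and \<epsilon>' are found from x and
  \<epsilon> alone, then y and U answer arbitrary y' and U'.\<close>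

lemma law_entropy_compare:
  assumes \<rho>: "0 < \<rho>"
    and core: "\<And>x \<epsilon>. set x \<subseteq> C \<Longrightarrow> 0 < \<epsilon> \<Longrightarrow> \<exists>x' \<epsilon>'. set x' \<subseteq> C' \<and> 0 < \<epsilon>' \<and>
      (\<forall>y' U'. set y' \<subseteq> C' \<and> open U' \<and> L' (x' @ y') \<in> U' \<longrightarrow>
        (\<exists>y U. set y \<subseteq> C \<and> open U \<and> L (x @ y) \<in> U \<and>
          (\<forall>\<^sub>F m in sequentially. covering m (length x) (length y) \<epsilon> U \<le>
            covering (nat \<lfloor>real m * \<rho>\<rfloor>) (length x') (length y') \<epsilon>' U')))"
  shows "law_entropy C L \<le> ereal (\<rho>\<^sup>2) * law_entropy C' L'"
  unfolding law_entropy_def[of C L]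
proof (rule SUP_least, clarify)
  fix x and \<epsilon> :: real assume "set x \<subseteq> C" "0 < \<epsilon>"
  from core[OF this] obtain x' \<epsilon>' where x': "set x' \<subseteq> C'" "0 < \<epsilon>'"
    and all: "\<forall>y' U'. set y' \<subseteq> C' \<and> open U' \<and> L' (x' @ y') \<in> U' \<longrightarrow>
        (\<exists>y U. set y \<subseteq> C \<and> open U \<and> L (x @ y) \<in> U \<and>
          (\<forall>\<^sub>F m in sequentially. covering m (length x) (length y) \<epsilon> U \<le>
            covering (nat \<lfloor>real m * \<rho>\<rfloor>) (length x') (length y') \<epsilon>' U'))"
    by (elim exE conjE)
  note core' = all[rule_format, OF conjI[OF _ conjI]]
  have c: "0 < ereal (\<rho>\<^sup>2)" "ereal (\<rho>\<^sup>2) \<noteq> \<infinity>" using \<rho> by auto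
  let ?S = "\<lambda>d y \<epsilon> U. limsup (\<lambda>n. ereal (1 / (real n)\<^sup>2) * log_enat (covering n d (length y) \<epsilon> U))"
  let ?I = "INF (y, U) \<in> {(y, U). set y \<subseteq> C \<and> open U \<and> L (x @ y) \<in> U}. ?S (length x) y \<epsilon> U"
  let ?I' = "INF (y, U) \<in> {(y, U). set y \<subseteq> C' \<and> open U \<and> L' (x' @ y) \<in> U}. ?S (length x') y \<epsilon>' U"
  \<comment> \<open>Dividing by \<rho>^2 on the left avoids pulling a factor out of an infimum of
    extended reals.\<close>
  have "?I / ereal (\<rho>\<^sup>2) \<le> ?I'"
  proof (rule INF_greatest, clarify)
    fix y' U' assume "set y' \<subseteq> C'" "open U'" "L' (x' @ y') \<in> U'"
    from core'[OF this] obtain y U where y: "set y \<subseteq> C" "open U" "L (x @ y) \<in> U"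
      and le: "\<forall>\<^sub>F m in sequentially. covering m (length x) (length y) \<epsilon> U \<le>
            covering (nat \<lfloor>real m * \<rho>\<rfloor>) (length x') (length y') \<epsilon>' U'" by blast
    have "?I \<le> ?S (length x) y \<epsilon> U"
      using y by (intro INF_lower2[of "(y, U)"]) auto
    also have "\<dots> \<le> ereal (\<rho>\<^sup>2) * ?S (length x') y' \<epsilon>' U'"
      by (rule limsup_rescaled_le[OF \<rho>], rule eventually_mono[OF le]) (rule log_enat_mono)
    finally show "?I / ereal (\<rho>\<^sup>2) \<le> ?S (length x') y' \<epsilon>' U'"
      using c by (simp add: ereal_divide_le_pos)
  qed
  hence "?I \<le> ereal (\<rho>\<^sup>2) * ?I'" using c by (simp add: ereal_divide_le_pos)
  also have "?I' \<le> law_entropy C' L'"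
    unfolding law_entropy_def using x' by (intro SUP_upper2[of "(x', \<epsilon>')"]) auto
  finally show "?I \<le> ereal (\<rho>\<^sup>2) * law_entropy C' L'"
    using c by (simp add: ereal_mult_left_mono)
qed

section \<open>Transfer of orbital coverings\<close>

text \<open>One entry of a row is at most the whole row, which gives sqrt 2; it is rounded up to 2
  to match the bound for the microstates.\<close>

lemma (in tracial) bd_row_element:
  assumes I: "finite I" "i \<in> I" and b: "\<And>i. i \<in> I \<Longrightarrow> b i \<in> P" and "bd 2 (\<Sum>i\<in>I. b i * adj (b i))"
  shows "bd 2 (b i)"
proof -
  have "bd 2 (adj (b i))"
  proof (rule bdI)
    fix y assume y: "y \<in> P"
    have "(nrm (adj (b i) * y))\<^sup>2 \<le> (\<Sum>i\<in>I. (nrm (adj (b i) * y))\<^sup>2)"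
      using I by (intro member_le_sum) auto
    also have "\<dots> \<le> 2 * (nrm y)\<^sup>2" by (rule col_bound[OF b assms(4) y])
    also have "\<dots> \<le> (2 * nrm y)\<^sup>2" by (simp add: power_mult_distrib)
    finally have "(nrm (adj (b i) * y))\<^sup>2 \<le> (2 * nrm y)\<^sup>2" .
    thus "nrm (adj (b i) * y) \<le> 2 * nrm y" by (rule power2_le_imp_le) (use y in auto)
  qed (use b I in auto)
  thus ?thesis using bd_adj by fastforce
qed

text \<open>The sum D of the B1_i V B2_i^* intertwines the tuples. If E is the sum of the B1_i
  B1_i^*, then D X2_j D^* is close to E X1_j E, which is close to X1_j as E is close to 1. At j = d
  both tuples carry the identity, so D D^* is close to 1, and D is close to a unitary W that
  conjugates X2 nearly into X1.\<close>

lemma orbit_transfer: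
  fixes X1 X2 B1 B2 :: "nat \<Rightarrow> finmat"
  assumes X1: "\<And>j. j \<le> d \<Longrightarrow> fits m m (X1 j)" "\<And>j. j \<le> d \<Longrightarrow> fm.bd 2 (X1 j)" "X1 d = idm m"
    and X2: "\<And>j. j \<le> d \<Longrightarrow> fits m m (X2 j)" "\<And>j. j \<le> d \<Longrightarrow> fm.bd 2 (X2 j)" "X2 d = idm m"
    and B1: "\<And>i. i < r \<Longrightarrow> fits m n (B1 i)" "fm.bd 2 (\<Sum>i<r. B1 i * adj (B1 i))"
      "fm.nrm ((\<Sum>i<r. B1 i * adj (B1 i)) - idm m) \<le> \<delta>"
    and B2: "\<And>i. i < r \<Longrightarrow> fits m n (B2 i)" "fm.bd 2 (\<Sum>i<r. B2 i * adj (B2 i))"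
    and V: "fits n n V" "adj V * V = idm n"
    and close: "\<And>i i' j. i < r \<Longrightarrow> i' < r \<Longrightarrow> j \<le> d \<Longrightarrow>
      fm.nrm (adj (B1 i) * X1 j * B1 i' - V * (adj (B2 i) * X2 j * B2 i') * adj V) \<le> \<theta>"
    and \<eta>: "0 < \<eta>"
  obtains W where "fits m m W" "adj W * W = idm m" "W * adj W = idm m"
    "\<And>j. j < d \<Longrightarrow> fm.nrm (X1 j - W * X2 j * adj W) \<le> 7 * (4 * (real r)\<^sup>2 * \<theta> + 6 * \<delta>) + 6 * \<eta>"
proof -
  \<comment> \<open>There are r^2 terms, each \<theta> times the bound 2 on either side; replacing E
    X1_j E by X1_j costs 4 \<delta> for the left E and 2 \<delta> for the right one.\<close>
  define q where "q = 4 * (real r)\<^sup>2 * \<theta> + 6 * \<delta>"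
  define D where "D = (\<Sum>i<r. B1 i * V * adj (B2 i))"
  define E where "E = (\<Sum>i<r. B1 i * adj (B1 i))"
  have bV: "fm.bd 1 V" by (rule fm.bd_isometry[of _ "idm n"]) (auto simp: V)
  have bD: "fm.bd 2 D" unfolding D_def
    using fm.bd_sandwich_sum[OF _ B1(2) _ B2(2) bV] by simp
  have bE: "fm.bd 2 E" using B1(2) by (simp add: E_def)
  have bB: "fm.bd 2 (B1 i)" if "i < r" for i
    using fm.bd_row_element[OF _ _ _ B1(2)] that by auto
  have fD: "fits m m D" unfolding D_def
    by (intro fits_sum fits_mult[OF fits_mult[OF _ V(1)] fits_adj]) (auto intro: B1 B2)
  have aE: "adj E = E" by (simp add: E_def adj_sum adj_mult)
  have DX: "fm.nrm (D * X2 j * adj D - X1 j) \<le> q" if j: "j \<le> d" for j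
  proof -
    let ?\<Delta> = "\<lambda>i i'. adj (B1 i) * X1 j * B1 i' - V * (adj (B2 i) * X2 j * B2 i') * adj V"
    have "E * X1 j * E - D * X2 j * adj D = (\<Sum>i<r. \<Sum>i'<r. B1 i * ?\<Delta> i i' * adj (B1 i'))"
    proof -
      have "E * X1 j * E = (\<Sum>i<r. \<Sum>i'<r. B1 i * (adj (B1 i) * X1 j * B1 i') * adj (B1 i'))"
        unfolding E_def
        by (simp add: sum_product sum_distrib_left sum_distrib_right mult.assoc) (rule sum.swap)
      moreover have "D * X2 j * adj D =
          (\<Sum>i<r. \<Sum>i'<r. B1 i * (V * (adj (B2 i) * X2 j * B2 i') * adj V) * adj (B1 i'))"
        unfolding D_def adj_sum
        by (simp add: sum_product sum_distrib_left sum_distrib_right adj_mult mult.assoc) (rule sum.swap)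
      ultimately show ?thesis
        by (simp add: right_diff_distrib left_diff_distrib sum_subtractf)
    qed
    moreover have "fm.nrm (\<Sum>i<r. \<Sum>i'<r. B1 i * ?\<Delta> i i' * adj (B1 i')) \<le> (\<Sum>i<r. \<Sum>i'<r. 4 * \<theta>)"
    proof (intro order_trans[OF fm.nrm_sum] sum_mono UNIV_I)
      fix i i' assume "i \<in> {..<r}" "i' \<in> {..<r}"
      hence i: "i < r" "i' < r" by auto
      have "fm.nrm (B1 i * ?\<Delta> i i' * adj (B1 i')) \<le> 2 * fm.nrm (B1 i * ?\<Delta> i i')"
        by (rule fm.bdD_right[OF fm.bd_adj[OF bB[OF i(2)]]]) simp
      also have "\<dots> \<le> 2 * (2 * fm.nrm (?\<Delta> i i'))" by (intro mult_left_mono fm.bdD[OF bB[OF i(1)]]) auto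
      also have "\<dots> \<le> 4 * \<theta>" using close[OF i j] by simp
      finally show "fm.nrm (B1 i * ?\<Delta> i i' * adj (B1 i')) \<le> 4 * \<theta>" .
    qed
    ultimately have 1: "fm.nrm (E * X1 j * E - D * X2 j * adj D) \<le> 4 * (real r)\<^sup>2 * \<theta>"
      by (simp add: power2_eq_square mult_ac)
    have "E * X1 j * E - X1 j = (E - idm m) * (X1 j * E) + X1 j * (E - idm m)"
      using idm_mult_left[OF X1(1)[OF j]] idm_mult_right[OF X1(1)[OF j]]
      by (simp add: left_diff_distrib right_diff_distrib mult.assoc[symmetric])
    hence "fm.nrm (E * X1 j * E - X1 j) \<le> fm.nrm ((E - idm m) * (X1 j * E)) + fm.nrm (X1 j * (E - idm m))"
      by (simp add: fm.nrm_add)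
    also have "\<dots> \<le> (2 * 2) * fm.nrm (E - idm m) + 2 * fm.nrm (E - idm m)"
      by (intro add_mono fm.bdD_right[OF fm.bd_mult] fm.bdD X1(2)[OF j] bE UNIV_I)
    also have "\<dots> \<le> 6 * \<delta>" using B1(3) by (simp add: E_def)
    finally have 2: "fm.nrm (E * X1 j * E - X1 j) \<le> 6 * \<delta>" .
    have "fm.nrm (D * X2 j * adj D - X1 j) \<le>
        fm.nrm (D * X2 j * adj D - E * X1 j * E) + fm.nrm (E * X1 j * E - X1 j)"
      by (rule fm.nrm_triangle) auto
    thus ?thesis using 1 2 by (simp add: q_def fm.nrm_minus_commute)
  qed
  \<comment> \<open>Applied to the adjoint of D, since D D^*, and not D^* D, is known to be near the
    identity.\<close>
  obtain V' where V': "fits m m V'" "adj V' * V' = idm m" "V' * adj V' = idm m"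
    "fm.nrm (adj D - V') \<le> fm.nrm (adj (adj D) * adj D - idm m) + \<eta>"
    using nearly_unitary[OF fits_adj[OF fD] \<eta>] .
  have "fm.nrm (adj (adj D) * adj D - idm m) \<le> q"
    using DX[of d] idm_mult_right[OF fD] by (simp add: X1(3) X2(3))
  define W where "W = adj V'"
  have W: "fits m m W" "adj W * W = idm m" "W * adj W = idm m"
    using V' by (auto simp: W_def fits_adj)
  have bW: "fm.bd 1 W" by (rule fm.bd_isometry[of _ "idm m"]) (auto simp: W)
  have DW: "fm.nrm (W - D) \<le> q + \<eta>"
  proof -
    have "fm.nrm (W - D) = fm.nrm (adj (adj D - V'))"
      by (simp add: W_def adj_diff fm.nrm_minus_commute)
    also have "\<dots> = fm.nrm (adj D - V')" by (rule fm.nrm_adj) simp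
    finally show ?thesis using V'(4) \<open>fm.nrm (adj (adj D) * adj D - idm m) \<le> q\<close> by simp
  qed
  show thesis
  proof (rule that[OF W])
    fix j assume "j < d"
    hence j: "j \<le> d" by simp
    have "W * X2 j * adj W - X1 j = (W - D) * (X2 j * adj W) + (D * X2 j * adj (W - D) + (D * X2 j * adj D - X1 j))"
      by (simp add: algebra_simps adj_diff)
    hence "fm.nrm (W * X2 j * adj W - X1 j) \<le> fm.nrm ((W - D) * (X2 j * adj W)) +
        (fm.nrm (D * X2 j * adj (W - D)) + fm.nrm (D * X2 j * adj D - X1 j))"
      by (simp only:) (intro order_trans[OF fm.nrm_add] add_left_mono order_refl UNIV_I)
    \<comment> \<open>Exchanging D for W costs 2 and 4 times |W - D| <= q + \<eta>; with q for the
      last term this gives 7 q + 6 \<eta>.\<close>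
    also have "\<dots> \<le> (2 * 1) * fm.nrm (W - D) + ((2 * 2) * fm.nrm (adj (W - D)) + q)"
      by (intro add_mono fm.bdD_right[OF fm.bd_mult] fm.bdD[OF fm.bd_mult] fm.bd_adj X2(2)[OF j] bW bD DX[OF j] UNIV_I)
    also have "\<dots> \<le> 7 * q + 6 * \<eta>" using DW fm.nrm_adj[of "W - D"] by simp
    finally show "fm.nrm (X1 j - W * X2 j * adj W) \<le> 7 * (4 * (real r)\<^sup>2 * \<theta> + 6 * \<delta>) + 6 * \<eta>"
      by (simp add: q_def fm.nrm_minus_commute)
  qed
qed

text \<open>Every tuple produced by \<open>Zf\<close> determines the orbit of the microstate it comes from, because the
  products \<open>B\<^sub>i\<^sup>* X\<^sub>j B\<^sub>i'\<close> are read off from it.\<close>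

lemma covering_transfer:
  fixes Zf :: "complex Matrix.mat list \<Rightarrow> complex Matrix.mat list"
    and Bf :: "complex Matrix.mat list \<Rightarrow> nat \<Rightarrow> finmat"
    and tr ti :: "nat \<Rightarrow> nat \<Rightarrow> nat \<Rightarrow> nat" and m d :: nat
  defines "X' X j \<equiv> (if j < d then emb (X ! j) else idm m)"
  assumes m: "0 < m" and n: "0 < n" "real n \<le> \<rho> * real m" and \<rho>: "0 < \<rho>" and \<epsilon>: "0 < \<epsilon>" and \<epsilon>': "0 < \<epsilon>'"
    and small: "84 * ((real r)\<^sup>2 + 1) * (32 * \<epsilon>' * sqrt \<rho>) \<le> \<epsilon> / real (d + 1)"
    and good: "\<And>X. X \<in> microstates m (d + dy) 2 U \<Longrightarrow> Zf X \<in> microstates n (d' + dy') 2 U'"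
      "\<And>X i. X \<in> microstates m (d + dy) 2 U \<Longrightarrow> i < r \<Longrightarrow> fits m n (Bf X i)"
      "\<And>X. X \<in> microstates m (d + dy) 2 U \<Longrightarrow> fm.bd 2 (\<Sum>i<r. Bf X i * adj (Bf X i))"
      "\<And>X. X \<in> microstates m (d + dy) 2 U \<Longrightarrow>
        fm.nrm ((\<Sum>i<r. Bf X i * adj (Bf X i)) - idm m) \<le> \<epsilon> / real (d + 1) / 126 * sqrt m"
      "\<And>X i i' j. X \<in> microstates m (d + dy) 2 U \<Longrightarrow> i < r \<Longrightarrow> i' < r \<Longrightarrow> j \<le> d \<Longrightarrow>
        adj (Bf X i) * X' X j * Bf X i' =
          8 \<star> (emb (Zf X ! tr i i' j) + \<i> \<star> emb (Zf X ! ti i i' j))"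
    and idx: "\<And>i i' j. i < r \<Longrightarrow> i' < r \<Longrightarrow> j \<le> d \<Longrightarrow> tr i i' j < d' \<and> ti i i' j < d'"
  shows "covering m d dy \<epsilon> U \<le> covering n d' dy' \<epsilon>' U'"
proof -
  let ?G = "microstates m (d + dy) 2 U" and ?G' = "microstates n (d' + dy') 2 U'"
  \<comment> \<open>The error allowed per coordinate. Since d < (d + 1)^2, d coordinates with error
    c stay below \<epsilon> in the 2-norm of the tuple.\<close>
  define c where "c = \<epsilon> / real (d + 1)"
  have c: "0 < c" using \<epsilon> by (simp add: c_def)
  have close2: "\<exists>V. unitary_mat m V \<and> tuple_norm2 m (map2 (\<lambda>A B. A - V * B * mat_adjoint V) (take d X1) (take d X2)) < \<epsilon>"
    if X1: "X1 \<in> ?G" and X2: "X2 \<in> ?G" and \<xi>: "\<xi> \<in> mat_tuples n d'" and V1: "unitary_mat n V1" and V2: "unitary_mat n V2"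
      and n1: "tuple_norm2 n (map2 (\<lambda>A B. A - V1 * B * mat_adjoint V1) (take d' (Zf X1)) \<xi>) < \<epsilon>'"
      and n2: "tuple_norm2 n (map2 (\<lambda>A B. A - V2 * B * mat_adjoint V2) (take d' (Zf X2)) \<xi>) < \<epsilon>'"
    for X1 X2 \<xi> V1 V2
  proof -
    have letter: "fm.nrm (emb (Zf X ! t) - emb V * emb (\<xi> ! t) * adj (emb V)) \<le> \<epsilon>' * sqrt n"
      if X: "X \<in> ?G" and V: "unitary_mat n V" and t: "t < d'"
        and nn: "tuple_norm2 n (map2 (\<lambda>A B. A - V * B * mat_adjoint V) (take d' (Zf X)) \<xi>) < \<epsilon>'" for X V t
    proof -
      let ?L = "map2 (\<lambda>A B. A - V * B * mat_adjoint V) (take d' (Zf X)) \<xi>"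
      have Z: "length (Zf X) = d' + dy'" "set (Zf X) \<subseteq> carrier_mat n n"
        using good(1)[OF X] by (auto simp: microstates_def mat_tuples_def)
      have xi: "length \<xi> = d'" "set \<xi> \<subseteq> carrier_mat n n" using \<xi> by (auto simp: mat_tuples_def)
      have Vc: "V \<in> carrier_mat n n" using V by (simp add: unitary_mat_def)
      have len: "length ?L = d'" using Z xi by simp
      have entry: "?L ! s = Zf X ! s - V * (\<xi> ! s) * mat_adjoint V" if "s < d'" for s
        using that Z xi by simp
      have car: "Zf X ! s \<in> carrier_mat n n" "\<xi> ! s \<in> carrier_mat n n" if "s < d'" for s
        using that Z xi nth_mem[of s "Zf X"] nth_mem[of s \<xi>] by auto
      have aV: "mat_adjoint V \<in> carrier_mat n n" by (rule mat_adjoint_carrier[OF Vc])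
      have ecar: "?L ! s \<in> carrier_mat n n" if "s < d'" for s
        unfolding entry[OF that] by (intro minus_carrier_mat mult_carrier_mat[OF mult_carrier_mat[OF Vc car(2)[OF that]] aV])
      have setL: "set ?L \<subseteq> carrier_mat n n"
        using ecar len by (metis in_set_conv_nth subsetI)
      have embL: "emb (?L ! t) = emb (Zf X ! t) - emb V * emb (\<xi> ! t) * adj (emb V)"
        unfolding entry[OF t]
        by (simp add: emb_minus[OF car(1)[OF t] mult_carrier_mat[OF mult_carrier_mat[OF Vc car(2)[OF t]] aV]]
            emb_mult[OF mult_carrier_mat[OF Vc car(2)[OF t]] aV] emb_mult[OF Vc car(2)[OF t]] emb_adjoint)
      have "(fm.nrm (emb (?L ! t)))\<^sup>2 / real n \<le> (\<Sum>A\<leftarrow>?L. (fm.nrm (emb A))\<^sup>2 / real n)"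
        using t len by (intro member_le_sum_list) (auto intro!: image_eqI nth_mem)
      also have "\<dots> < \<epsilon>'\<^sup>2"
      proof -
        have "sqrt (\<Sum>A\<leftarrow>?L. (fm.nrm (emb A))\<^sup>2 / real n) < \<epsilon>'"
          using nn unfolding tuple_norm2_emb[OF setL] .
        thus ?thesis using \<epsilon>' by (metis real_sqrt_abs abs_of_pos real_sqrt_less_iff)
      qed
      finally have "(fm.nrm (emb (?L ! t)))\<^sup>2 \<le> (\<epsilon>' * sqrt n)\<^sup>2"
        using n by (simp add: power_mult_distrib field_simps)
      hence "fm.nrm (emb (?L ! t)) \<le> \<epsilon>' * sqrt n"
        using \<epsilon>' by (simp add: abs_le_square_iff[symmetric])
      thus ?thesis unfolding embL .
    qed
    \<comment> \<open>Both compressed tuples lie near orbits of the same centre; V passes from the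
      second through the centre to the first.\<close>
    define V where "V = emb V1 * adj (emb V2)"
    have U1: "fits n n (emb V1)" "adj (emb V1) * emb V1 = idm n"
      using V1 by (auto simp: unitary_mat_emb fits_emb)
    have U2: "fits n n (emb V2)" "adj (emb V2) * emb V2 = idm n" "emb V2 * adj (emb V2) = idm n"
      using V2 by (auto simp: unitary_mat_emb fits_emb)
    have fV: "fits n n V" unfolding V_def by (rule fits_mult[OF U1(1) fits_adj[OF U2(1)]])
    have VV: "adj V * V = idm n"
    proof -
      have "adj V * V = emb V2 * ((adj (emb V1) * emb V1) * adj (emb V2))"
        by (simp add: V_def adj_mult mult.assoc)
      thus ?thesis by (simp add: U1(2) idm_mult_left[OF fits_adj[OF U2(1)]] U2(3))
    qed
    have bV: "fm.bd 1 V" by (rule fm.bd_isometry[of _ "idm n"]) (auto simp: VV)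
    have letters: "fm.nrm (emb (Zf X1 ! t) - V * emb (Zf X2 ! t) * adj V) \<le> 2 * (\<epsilon>' * sqrt n)" if t: "t < d'" for t
    proof -
      have xi: "\<xi> ! t \<in> carrier_mat n n" using \<xi> t by (auto simp: mat_tuples_def)
      have f\<xi>: "fits n n (emb (\<xi> ! t))" by (rule fits_emb[OF xi])
      have "V * (emb V2 * emb (\<xi> ! t) * adj (emb V2)) * adj V =
          emb V1 * ((adj (emb V2) * emb V2) * emb (\<xi> ! t) * (adj (emb V2) * emb V2)) * adj (emb V1)"
        by (simp add: V_def adj_mult mult.assoc)
      also have "\<dots> = emb V1 * emb (\<xi> ! t) * adj (emb V1)"
        by (simp add: U2(2) idm_mult_left[OF f\<xi>] idm_mult_right[OF f\<xi>])
      finally have "emb (Zf X1 ! t) - V * emb (Zf X2 ! t) * adj V =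
          (emb (Zf X1 ! t) - emb V1 * emb (\<xi> ! t) * adj (emb V1))
          - V * (emb (Zf X2 ! t) - emb V2 * emb (\<xi> ! t) * adj (emb V2)) * adj V"
        by (simp add: left_diff_distrib right_diff_distrib)
      hence "fm.nrm (emb (Zf X1 ! t) - V * emb (Zf X2 ! t) * adj V) \<le>
          fm.nrm (emb (Zf X1 ! t) - emb V1 * emb (\<xi> ! t) * adj (emb V1))
          + fm.nrm (V * (emb (Zf X2 ! t) - emb V2 * emb (\<xi> ! t) * adj (emb V2)) * adj V)"
        by (simp only:) (rule fm.nrm_diff[OF UNIV_I UNIV_I])
      also have "\<dots> \<le> \<epsilon>' * sqrt n + 1 * (1 * (\<epsilon>' * sqrt n))"
        by (intro add_mono letter[OF X1 V1 t n1] order_trans[OF fm.bdD_right[OF fm.bd_adj[OF bV]]]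
            mult_left_mono order_trans[OF fm.bdD[OF bV]] letter[OF X2 V2 t n2] UNIV_I zero_le_one)
      finally show ?thesis by simp
    qed
    have Xf: "fits m m (X' X j)" "fm.bd 2 (X' X j)" if "X \<in> ?G" "j \<le> d" for X j
    proof -
      have "fits m m (emb (X ! j)) \<and> fm.bd 2 (emb (X ! j))" if "j < d"
      proof -
        have "X ! j \<in> set X" using that \<open>X \<in> ?G\<close> by (auto simp: microstates_def mat_tuples_def)
        thus ?thesis using \<open>X \<in> ?G\<close> mat_op_norm_le_iff[of "X ! j" m 2] fits_emb
          by (auto simp: microstates_def mat_tuples_def)
      qed
      thus "fits m m (X' X j)" "fm.bd 2 (X' X j)"
        using fm.bd_mono[OF bd_idm] by (auto simp: X'_def fits_diagm)
    qed
    \<comment> \<open>The constant 32 is the factor 8 times two self-adjoint parts, each with error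
      2 \<epsilon>' sqrt n.\<close>
    have \<theta>: "fm.nrm (adj (Bf X1 i) * X' X1 j * Bf X1 i' - V * (adj (Bf X2 i) * X' X2 j * Bf X2 i') * adj V)
        \<le> 32 * \<epsilon>' * sqrt \<rho> * sqrt m" if i: "i < r" "i' < r" "j \<le> d" for i i' j
    proof -
      let ?t = "tr i i' j" and ?t' = "ti i i' j"
      let ?d = "\<lambda>t. emb (Zf X1 ! t) - V * emb (Zf X2 ! t) * adj V"
      have "adj (Bf X1 i) * X' X1 j * Bf X1 i' - V * (adj (Bf X2 i) * X' X2 j * Bf X2 i') * adj V
          = 8 \<star> (?d ?t + \<i> \<star> ?d ?t')"
        unfolding good(5)[OF X1 i] good(5)[OF X2 i]
        by (simp add: algebra_simps cscale_mult_left cscale_mult_right cscale_diff_right cscale_add_right)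
      hence "fm.nrm (adj (Bf X1 i) * X' X1 j * Bf X1 i' - V * (adj (Bf X2 i) * X' X2 j * Bf X2 i') * adj V)
          = 8 * fm.nrm (?d ?t + \<i> \<star> ?d ?t')" by (simp add: fm.nrm_cscale)
      also have "\<dots> \<le> 8 * (fm.nrm (?d ?t) + fm.nrm (?d ?t'))"
        using fm.nrm_add[of "?d ?t" "\<i> \<star> ?d ?t'"] by (simp add: fm.nrm_cscale)
      also have "\<dots> \<le> 8 * (2 * (\<epsilon>' * sqrt n) + 2 * (\<epsilon>' * sqrt n))"
        using letters idx[OF i] by (intro mult_left_mono add_mono) auto
      also have "\<dots> = 32 * \<epsilon>' * sqrt n" by simp
      also have "sqrt n \<le> sqrt \<rho> * sqrt m" using n(2) by (simp add: real_sqrt_mult[symmetric])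
      finally show ?thesis using \<epsilon>' by (simp add: mult.assoc)
    qed
    \<comment> \<open>The budget in units of c sqrt m: the \<theta> part 28 r^2 \<theta> is at most
      1/3 by \<open>small\<close>, the \<delta> part is 42/126 = 1/3, and 6 \<eta> is 1/6.\<close>
    have \<eta>: "0 < c / 36 * sqrt m" using c m by simp
    obtain W where W: "fits m m W" "adj W * W = idm m" "W * adj W = idm m"
      and XW: "\<And>j. j < d \<Longrightarrow> fm.nrm (X' X1 j - W * X' X2 j * adj W) \<le>
        7 * (4 * (real r)\<^sup>2 * (32 * \<epsilon>' * sqrt \<rho> * sqrt m) + 6 * (\<epsilon> / real (d + 1) / 126 * sqrt m)) + 6 * (c / 36 * sqrt m)"
    proof (rule orbit_transfer[where ?X1.0 = "X' X1" and ?X2.0 = "X' X2" and ?B1.0 = "Bf X1" and ?B2.0 = "Bf X2" and d = d and r = r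
          and \<eta> = "c / 36 * sqrt m" and \<delta> = "\<epsilon> / real (d + 1) / 126 * sqrt m" and \<theta> = "32 * \<epsilon>' * sqrt \<rho> * sqrt m" and V = V and m = m and n = n])
      show "X' X1 d = idm m" "X' X2 d = idm m" by (simp_all add: X'_def)
    qed (use Xf[OF X1] Xf[OF X2] good(2-4)[OF X1] good(2,3)[OF X2] fV VV \<theta> \<eta> in auto)
    have comp: "fm.nrm (emb (X1 ! j) - W * emb (X2 ! j) * adj W) \<le> c * sqrt m" if "j < d" for j
    proof -
      have "28 * (real r)\<^sup>2 * (32 * \<epsilon>' * sqrt \<rho>) \<le> 28 * ((real r)\<^sup>2 + 1) * (32 * \<epsilon>' * sqrt \<rho>)"
        using \<epsilon>' \<rho> by (intro mult_right_mono) auto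
      also have "\<dots> \<le> c / 3" using small unfolding c_def[symmetric] by linarith
      finally have "28 * (real r)\<^sup>2 * (32 * \<epsilon>' * sqrt \<rho>) * sqrt m \<le> c / 3 * sqrt m"
        by (rule mult_right_mono) simp
      moreover have "\<epsilon> / real (d + 1) = c" by (simp add: c_def)
      moreover have "0 < c * sqrt m" using c m by simp
      ultimately show ?thesis using XW[OF that] that by (simp add: X'_def)
    qed
    define T where "T = tomat m W"
    have T: "unitary_mat m T" using W by (simp add: unitary_mat_emb T_def emb_tomat)
    have Tc: "T \<in> carrier_mat m m" "mat_adjoint T \<in> carrier_mat m m"
      using mat_adjoint_carrier[of T m m] by (auto simp: T_def)
    have lens: "length X1 = d + dy" "length X2 = d + dy" and Xcar: "set X1 \<subseteq> carrier_mat m m" "set X2 \<subseteq> carrier_mat m m"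
      using X1 X2 by (auto simp: microstates_def mat_tuples_def)
    let ?L = "map2 (\<lambda>A B. A - T * B * mat_adjoint T) (take d X1) (take d X2)"
    have entry: "?L ! s = X1 ! s - T * (X2 ! s) * mat_adjoint T" if "s < d" for s
      using that lens by simp
    have car: "X1 ! s \<in> carrier_mat m m" "X2 ! s \<in> carrier_mat m m" if "s < d" for s
      using that lens Xcar nth_mem[of s X1] nth_mem[of s X2] by auto
    have prod_car: "T * (X2 ! s) * mat_adjoint T \<in> carrier_mat m m" if "s < d" for s
      by (rule mult_carrier_mat[OF mult_carrier_mat[OF Tc(1) car(2)[OF that]] Tc(2)])
    have lenL: "length ?L = d" using lens by simp
    have setL: "set ?L \<subseteq> carrier_mat m m"
    proof
      fix A assume "A \<in> set ?L"
      then obtain s where s: "s < d" "A = ?L ! s" using lenL by (metis in_set_conv_nth)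
      show "A \<in> carrier_mat m m" unfolding s(2) entry[OF s(1)] by (rule minus_carrier_mat[OF prod_car[OF s(1)]])
    qed
    have "(\<Sum>A\<leftarrow>?L. (fm.nrm (emb A))\<^sup>2 / real m) \<le> (\<Sum>A\<leftarrow>?L. c\<^sup>2)"
    proof (rule sum_list_mono)
      fix A assume "A \<in> set ?L"
      then obtain s where s: "s < d" "A = ?L ! s" using lenL by (metis in_set_conv_nth)
      have "emb A = emb (X1 ! s) - W * emb (X2 ! s) * adj W"
        unfolding s(2) entry[OF s(1)] emb_minus[OF car(1)[OF s(1)] prod_car[OF s(1)]]
          emb_mult[OF mult_carrier_mat[OF Tc(1) car(2)[OF s(1)]] Tc(2)] emb_mult[OF Tc(1) car(2)[OF s(1)]]
        by (simp add: emb_adjoint T_def emb_tomat[OF W(1)])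
      hence "(fm.nrm (emb A))\<^sup>2 \<le> (c * sqrt m)\<^sup>2" using comp[OF s(1)] by (intro power_mono) auto
      thus "(fm.nrm (emb A))\<^sup>2 / real m \<le> c\<^sup>2" using m by (simp add: power_mult_distrib field_simps)
    qed
    also have "\<dots> = real d * c\<^sup>2" using lenL by (simp add: sum_list_triv)
    also have "\<dots> < \<epsilon>\<^sup>2"
    proof -
      have "real d < (real (d + 1))\<^sup>2" by (simp add: power2_eq_square algebra_simps add_pos_nonneg)
      hence "real d * c\<^sup>2 < (real (d + 1))\<^sup>2 * c\<^sup>2" using c by (intro mult_strict_right_mono) auto
      also have "\<dots> = \<epsilon>\<^sup>2" by (simp add: c_def power_divide del: of_nat_add)
      finally show ?thesis .
    qed
    finally have "tuple_norm2 m ?L < \<epsilon>"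
      unfolding tuple_norm2_emb[OF setL] using \<epsilon> real_sqrt_less_mono by fastforce
    thus ?thesis using T by blast
  qed
  show ?thesis
    unfolding covering_def orbital_covering_number_def
  proof (rule Inf_greatest, clarify)
    fix \<Xi> assume \<Xi>: "finite \<Xi>" "orbital_cover n d' \<epsilon>' (take d' ` ?G') \<Xi>"
    define near where "near X \<xi> \<longleftrightarrow> X \<in> ?G \<and> (\<exists>V. unitary_mat n V \<and>
        tuple_norm2 n (map2 (\<lambda>A B. A - V * B * mat_adjoint V) (take d' (Zf X)) \<xi>) < \<epsilon>')" for X \<xi>
    \<comment> \<open>Centres for the large matrices: every centre near a compressed microstate is
      replaced by one chosen microstate with that property, so the cardinality does not
      grow.\<close>
    define \<Xi>' where "\<Xi>' = (\<lambda>\<xi>. take d (SOME X. near X \<xi>)) ` {\<xi> \<in> \<Xi>. \<exists>X. near X \<xi>}"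
    have fin: "finite \<Xi>'" using \<Xi>(1) by (simp add: \<Xi>'_def)
    have card: "card \<Xi>' \<le> card \<Xi>"
      unfolding \<Xi>'_def using \<Xi>(1)
      by (intro order_trans[OF card_image_le] card_mono) auto
    have "orbital_cover m d \<epsilon> (take d ` ?G) \<Xi>'"
      unfolding orbital_cover_def
    proof (intro conjI ballI subsetI)
      fix B assume "B \<in> \<Xi>'"
      then obtain \<xi> where ex: "\<exists>X. near X \<xi>" and B: "B = take d (SOME X. near X \<xi>)"
        by (auto simp: \<Xi>'_def)
      from someI_ex[OF ex] have "(SOME X. near X \<xi>) \<in> ?G" by (simp add: near_def)
      thus "B \<in> mat_tuples m d" unfolding B
        by (auto simp: microstates_def mat_tuples_def dest!: in_set_takeD)
    next
      fix A assume "A \<in> take d ` ?G"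
      then obtain X where X: "X \<in> ?G" "A = take d X" by blast
      obtain \<xi> where \<xi>: "\<xi> \<in> \<Xi>" "near X \<xi>"
        using \<Xi>(2) good(1)[OF X(1)] X(1) unfolding orbital_cover_def near_def by blast
      define X2 where "X2 = (SOME X. near X \<xi>)"
      have X2: "near X2 \<xi>" unfolding X2_def using \<xi>(2) by (rule someI)
      have "\<xi> \<in> mat_tuples n d'" using \<xi>(1) \<Xi>(2) by (auto simp: orbital_cover_def)
      with X2 \<xi>(2) have "\<exists>V. unitary_mat m V \<and>
          tuple_norm2 m (map2 (\<lambda>A B. A - V * B * mat_adjoint V) (take d X) (take d X2)) < \<epsilon>"
        unfolding near_def using close2 by blast
      moreover have "take d X2 \<in> \<Xi>'" using \<xi> unfolding \<Xi>'_def X2_def by blast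
      ultimately show "\<exists>B\<in>\<Xi>'. \<exists>V. unitary_mat m V \<and>
          tuple_norm2 m (map2 (\<lambda>A\<^sub>j B\<^sub>j. A\<^sub>j - V * B\<^sub>j * mat_adjoint V) A B) < \<epsilon>"
        unfolding X(2) by blast
    qed
    hence "Inf {enat (card \<Xi>) |\<Xi>. finite \<Xi> \<and> orbital_cover m d \<epsilon> (take d ` ?G) \<Xi>} \<le> enat (card \<Xi>')"
      using fin by (intro Inf_lower) blast
    also have "\<dots> \<le> enat (card \<Xi>)" using card by simp
    finally show "Inf {enat (card \<Xi>) |\<Xi>. finite \<Xi> \<and> orbital_cover m d \<epsilon> (take d ` ?G) \<Xi>} \<le> enat (card \<Xi>)" .
  qed
qed

section \<open>Words, polynomials and block matrices\<close>

definition wd :: "(nat \<Rightarrow> 'a) \<Rightarrow> 'a \<Rightarrow> nat list \<Rightarrow> 'a::ring" where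
  "wd V E w = foldr (\<lambda>k T. V k * T) w E"

lemma wd_Nil [simp]: "wd V E [] = E" and wd_Cons [simp]: "wd V E (k # w) = V k * wd V E w"
  by (simp_all add: wd_def)

lemma wd_append: "wd V E (w @ w') = wd V (wd V E w') w"
  by (simp add: wd_def)

lemma wd_mult_right: "wd V E w * Y = wd V (E * Y) w"
  by (induction w) (simp_all add: mult.assoc)

definition letters :: "nat \<Rightarrow> (nat \<Rightarrow> 'a) \<Rightarrow> 'a::complex_star_algebra \<Rightarrow> bool" where
  "letters D V E \<longleftrightarrow> E * E = E \<and> adj E = E \<and> (\<forall>k<D. adj (V k) = V k \<and> E * V k = V k \<and> V k * E = V k)"

lemma letters_unit: "letters D V E \<Longrightarrow> set w \<subseteq> {..<D} \<Longrightarrow> E * wd V E w = wd V E w"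
  by (cases w) (auto simp: letters_def mult.assoc[symmetric])

lemma letters_mult:
  assumes "letters D V E" "set w' \<subseteq> {..<D}" shows "wd V E w * wd V E w' = wd V E (w @ w')"
  by (simp add: wd_mult_right letters_unit[OF assms] wd_append)

lemma letters_adj:
  assumes L: "letters D V E" shows "set w \<subseteq> {..<D} \<Longrightarrow> adj (wd V E w) = wd V E (rev w)"
proof (induction w)
  case (Cons k w)
  have k: "adj (V k) = V k" "E * V k = V k" "V k * E = V k" using L Cons.prems by (auto simp: letters_def)
  have "adj (wd V E (k # w)) = wd V E (rev w) * V k" using Cons by (simp add: adj_mult k)
  thus ?case by (simp add: wd_mult_right k wd_append)
qed (use L in \<open>simp add: letters_def\<close>)

text \<open>Formal polynomials as lists of terms with repetitions allowed: addition is
  concatenation, and identities of values need no normal form.\<close>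

type_synonym poly_list = "(complex \<times> nat list) list"

definition pok :: "nat \<Rightarrow> poly_list \<Rightarrow> bool" where
  "pok D ps \<longleftrightarrow> (\<forall>(c, w)\<in>set ps. set w \<subseteq> {..<D})"

definition peval :: "(nat \<Rightarrow> 'a) \<Rightarrow> 'a \<Rightarrow> poly_list \<Rightarrow> 'a::complex_star_algebra" where
  "peval V E ps = (\<Sum>(c, w)\<leftarrow>ps. c \<star> wd V E w)"

definition pmul :: "poly_list \<Rightarrow> poly_list \<Rightarrow> poly_list" where
  "pmul ps qs = concat (map (\<lambda>(c, w). map (\<lambda>(c', w'). (c * c', w @ w')) qs) ps)"

lemma peval_Nil [simp]: "peval V E [] = 0"
  and peval_Cons [simp]: "peval V E ((c, w) # ps) = c \<star> wd V E w + peval V E ps"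
  and peval_append: "peval V E (ps @ qs) = peval V E ps + peval V E qs"
  by (simp_all add: peval_def)

lemma pok_append: "pok D (ps @ qs) \<longleftrightarrow> pok D ps \<and> pok D qs"
  and pok_Cons: "pok D ((c, w) # ps) \<longleftrightarrow> set w \<subseteq> {..<D} \<and> pok D ps"
  and pok_Nil: "pok D []"
  by (auto simp: pok_def)

lemma pok_pmul: "pok D ps \<Longrightarrow> pok D qs \<Longrightarrow> pok D (pmul ps qs)"
  unfolding pok_def pmul_def by fastforce

lemma peval_map_mult:
  assumes "letters D V E" "pok D qs"
  shows "peval V E (map (\<lambda>(c', w'). (c * c', w @ w')) qs) = (c \<star> wd V E w) * peval V E qs"
  using assms(2)
proof (induction qs)
  case (Cons q qs)
  obtain c' w' where q: "q = (c', w')" by (cases q)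
  show ?case using Cons letters_mult[OF assms(1), of w' w]
    by (simp add: q pok_Cons distrib_left cscale_mult_left cscale_mult_right cscale_cscale
        mult.commute[of c c'])
qed simp

lemma peval_mult:
  assumes "letters D V E" "pok D qs" shows "peval V E (pmul ps qs) = peval V E ps * peval V E qs"
proof (induction ps)
  case (Cons q ps)
  obtain c w where q: "q = (c, w)" by (cases q)
  have "pmul (q # ps) qs = map (\<lambda>(c', w'). (c * c', w @ w')) qs @ pmul ps qs" by (simp add: pmul_def q)
  thus ?case using Cons by (simp add: peval_append peval_map_mult[OF assms] q distrib_right)
qed (simp add: pmul_def)

lemma peval_adj:
  assumes "letters D V E" "pok D ps"
  shows "peval V E (map (\<lambda>(c, w). (cnj c, rev w)) ps) = adj (peval V E ps)"
  using assms(2)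
proof (induction ps)
  case (Cons q ps)
  obtain c w where q: "q = (c, w)" by (cases q)
  show ?case using Cons letters_adj[OF assms(1), of w] by (simp add: q pok_Cons adj_add adj_cscale)
qed simp

lemma peval_cscale: "peval V E (map (\<lambda>(c, w). (a * c, w)) ps) = a \<star> peval V E ps"
  by (induction ps) (auto simp: cscale_add_right cscale_cscale)

text \<open>The coisometry onto the l-th of consecutive blocks of size m. Its adjoint puts an m x m
  matrix into row block l, which turns block matrices into sums of products in
  \<open>finmat\<close>.\<close>

definition shiftm :: "nat \<Rightarrow> nat \<Rightarrow> finmat" where
  "shiftm m l = Finmat (\<lambda>i j. if i < m \<and> j = l * m + i then 1 else 0)"

lemma ent_shiftm: "ent (shiftm m l) i j = (if i < m \<and> j = l * m + i then 1 else 0)"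
  unfolding shiftm_def by (subst ent_Finmat[of "Suc l * m"]) auto

lemma fits_shiftm: assumes "l < s" shows "fits m (s * m) (shiftm m l)"
proof -
  have "l * m + i < s * m" if "i < m" for i
  proof -
    have "l * m + i < Suc l * m" using that by simp
    also have "\<dots> \<le> s * m" using assms by (intro mult_right_mono) auto
    finally show ?thesis .
  qed
  thus ?thesis by (auto simp: fits_def ent_shiftm dest: leD)
qed

lemma shiftm_mult_adj: "shiftm m l * adj (shiftm m l') = (if l = l' then idm m else 0)"
proof (rule finmat_eqI)
  fix i j
  have eq: "l * m + i = l' * m + j \<longleftrightarrow> l = l' \<and> i = j" if "i < m" "j < m"
  proof
    assume h: "l * m + i = l' * m + j"
    have "(l * m + i) div m = l" "(l' * m + j) div m = l'" using that by auto
    thus "l = l' \<and> i = j" using h by auto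
  qed auto
  have "ent (shiftm m l * adj (shiftm m l')) i j =
      (\<Sum>k<Suc l * m. if i < m \<and> j < m \<and> k = l * m + i \<and> k = l' * m + j then 1 else 0)"
    unfolding ent_mult_left[OF fits_shiftm[of l "Suc l" m, simplified]]
    by (rule sum.cong) (auto simp: ent_shiftm)
  also have "\<dots> = (if i < m \<and> j < m \<and> l * m + i = l' * m + j then \<Sum>k<Suc l * m. if k = l * m + i then 1 else 0 else 0)"
    by (auto intro!: sum.cong sum.neutral)
  also have "\<dots> = ent (if l = l' then idm m else 0) i j"
    using eq by auto
  finally show "ent (shiftm m l * adj (shiftm m l')) i j = ent (if l = l' then idm m else 0) i j" .
qed

lemma bd_shiftm: "fm.bd 1 (shiftm m l)"
proof -
  have "fm.bd 1 (adj (shiftm m l))"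
    by (rule fm.bd_isometry[of _ "idm m"]) (auto simp: shiftm_mult_adj)
  thus ?thesis using fm.bd_adj by fastforce
qed

definition blk :: "nat \<Rightarrow> nat \<Rightarrow> (nat \<Rightarrow> nat \<Rightarrow> finmat) \<Rightarrow> finmat" where
  "blk s m F = (\<Sum>l<s. \<Sum>l'<s. adj (shiftm m l) * F l l' * shiftm m l')"

definition rowb :: "nat \<Rightarrow> nat \<Rightarrow> (nat \<Rightarrow> finmat) \<Rightarrow> finmat" where
  "rowb s m T = (\<Sum>l<s. T l * shiftm m l)"

lemma fits_blk: "(\<And>l l'. l < s \<Longrightarrow> l' < s \<Longrightarrow> fits m m (F l l')) \<Longrightarrow> fits (s * m) (s * m) (blk s m F)"
  unfolding blk_def by (auto intro!: fits_sum fits_mult[OF fits_mult[OF fits_adj]] fits_shiftm)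

lemma fits_rowb: "(\<And>l. l < s \<Longrightarrow> fits k m (T l)) \<Longrightarrow> fits k (s * m) (rowb s m T)"
  unfolding rowb_def by (auto intro!: fits_sum fits_mult fits_shiftm)

lemma adj_blk: "adj (blk s m F) = blk s m (\<lambda>l l'. adj (F l' l))"
  unfolding blk_def by (simp add: adj_sum adj_mult mult.assoc) (rule sum.swap)

lemma blk_add: "blk s m F + blk s m G = blk s m (\<lambda>l l'. F l l' + G l l')"
  unfolding blk_def by (simp add: distrib_left distrib_right sum.distrib)

lemma cscale_blk: "c \<star> blk s m F = blk s m (\<lambda>l l'. c \<star> F l l')"
  unfolding blk_def by (simp add: cscale_sum cscale_mult_left cscale_mult_right)

lemma sum_shift_collapse:
  assumes "l < s" "A * idm m = A"
  shows "(\<Sum>k<s. A * (shiftm m l * adj (shiftm m k)) * f k) = A * f l"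
proof -
  have "(\<Sum>k<s. A * (shiftm m l * adj (shiftm m k)) * f k) = (\<Sum>k<s. if k = l then A * f l else 0)"
    using assms(2) by (intro sum.cong) (auto simp: shiftm_mult_adj)
  thus ?thesis using assms(1) by simp
qed

lemma rowb_mult_adj:
  assumes "\<And>l. l < s \<Longrightarrow> T l * idm m = T l"
  shows "rowb s m T * adj (rowb s m T') = (\<Sum>l<s. T l * adj (T' l))"
proof -
  have "rowb s m T * adj (rowb s m T') =
      (\<Sum>l<s. \<Sum>k<s. T l * (shiftm m l * adj (shiftm m k)) * adj (T' k))"
    unfolding rowb_def by (simp add: adj_sum adj_mult sum_product mult.assoc)
  thus ?thesis using sum_shift_collapse assms by simp
qed

lemma adj_rowb_mult: "adj (rowb s m T) * F * rowb s m T' = blk s m (\<lambda>l l'. adj (T l) * F * T' l')"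
proof -
  have "adj (rowb s m T) * F * rowb s m T' =
      (\<Sum>l<s. \<Sum>l'<s. (adj (T l * shiftm m l) * F) * (T' l' * shiftm m l'))"
    unfolding rowb_def adj_sum sum_distrib_right sum_distrib_left by (rule sum.swap)
  thus ?thesis unfolding blk_def by (simp add: adj_mult mult.assoc)
qed

lemma rowb_mult_blk:
  assumes "\<And>l. l < s \<Longrightarrow> T l * idm m = T l"
  shows "rowb s m T * blk s m F = rowb s m (\<lambda>l'. \<Sum>l<s. T l * F l l')"
proof -
  have "rowb s m T * blk s m F =
      (\<Sum>l<s. \<Sum>k<s. T l * (shiftm m l * adj (shiftm m k)) * (\<Sum>l'<s. F k l' * shiftm m l'))"
  proof -
    have "blk s m F = (\<Sum>k<s. adj (shiftm m k) * (\<Sum>l'<s. F k l' * shiftm m l'))"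
      unfolding blk_def by (simp add: sum_distrib_left mult.assoc)
    thus ?thesis unfolding rowb_def by (simp only: sum_product mult.assoc)
  qed
  also have "\<dots> = (\<Sum>l<s. T l * (\<Sum>l'<s. F l l' * shiftm m l'))"
    using sum_shift_collapse assms by (intro sum.cong) auto
  also have "\<dots> = (\<Sum>l'<s. \<Sum>l<s. T l * F l l' * shiftm m l')"
    by (simp add: sum_distrib_left mult.assoc) (rule sum.swap)
  finally show ?thesis by (simp add: rowb_def sum_distrib_right)
qed

lemma blk_mult:
  assumes "\<And>l l'. l < s \<Longrightarrow> l' < s \<Longrightarrow> F l l' * idm m = F l l'"
  shows "blk s m F * blk s m G = blk s m (\<lambda>l l'. \<Sum>k<s. F l k * G k l')"
proof -
  have b: "blk s m H = (\<Sum>l<s. adj (shiftm m l) * rowb s m (H l))" for H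
    unfolding blk_def rowb_def by (simp add: sum_distrib_left mult.assoc)
  have "blk s m F * blk s m G = (\<Sum>l<s. adj (shiftm m l) * (rowb s m (F l) * blk s m G))"
    by (simp add: b[of F] sum_distrib_right mult.assoc)
  also have "\<dots> = (\<Sum>l<s. adj (shiftm m l) * rowb s m (\<lambda>l'. \<Sum>k<s. F l k * G k l'))"
    using rowb_mult_blk assms by (intro sum.cong) auto
  finally show ?thesis by (simp add: b)
qed

lemma Tr_blk:
  assumes "\<And>l l'. l < s \<Longrightarrow> l' < s \<Longrightarrow> F l l' * idm m = F l l'"
  shows "Tr (blk s m F) = (\<Sum>l<s. Tr (F l l))"
proof -
  have "Tr (adj (shiftm m l) * F l l' * shiftm m l') = (if l' = l then Tr (F l l) else 0)"
    if "l < s" "l' < s" for l l'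
  proof -
    have "Tr (adj (shiftm m l) * F l l' * shiftm m l') = Tr ((F l l' * shiftm m l') * adj (shiftm m l))"
      using fm.tr_comm[of "adj (shiftm m l)" "F l l' * shiftm m l'"] by (simp add: mult.assoc)
    thus ?thesis using assms[OF that] by (cases "l' = l") (simp_all add: mult.assoc shiftm_mult_adj)
  qed
  thus ?thesis unfolding blk_def by (simp add: fm.tr_sum)
qed

section \<open>Asymptotic models of corners\<close>

text \<open>For each fixed k the squared rescaled distance of f from the identity is eventually
  below (C + 1) / 2^k by \<open>clipping\<close>. The bound C for the limiting moments does not
  depend on k, so k may be taken large.\<close>

lemma clip_family:
  fixes E :: "'w \<Rightarrow> finmat" and N :: "'w \<Rightarrow> nat" and \<kappa> :: "'w \<Rightarrow> real"
  assumes \<kappa>: "\<And>\<omega>. 0 \<le> \<kappa> \<omega>"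
    and E: "\<forall>\<^sub>F \<omega> in Fl. fits (N \<omega>) (N \<omega>) (E \<omega>) \<and> adj (E \<omega>) = E \<omega> \<and> (\<forall>Y. 0 \<le> Re (Tr (adj Y * E \<omega> * Y)))"
    and lim: "\<And>k. 0 < k \<Longrightarrow> ((\<lambda>\<omega>. Tr (((\<lambda>T. E \<omega> * T) ^^ k) (idm (N \<omega>))) / of_real (\<kappa> \<omega>)) \<longlongrightarrow> c k) Fl"
    and c: "\<And>k. 0 < k \<Longrightarrow> cmod (c k) \<le> C"
  shows "\<exists>f. (\<forall>\<omega>. adj (f \<omega>) = f \<omega>) \<and> (\<forall>\<omega>. fm.bd 1 (f \<omega>)) \<and>
    (\<forall>\<^sub>F \<omega> in Fl. fits (N \<omega>) (N \<omega>) (f \<omega>) \<and> fm.bd 2 (f \<omega> * E \<omega> * f \<omega>)) \<and>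
    fm.null \<kappa> Fl (\<lambda>\<omega>. f \<omega> - idm (N \<omega>))"
proof -
  define good where "good \<omega> f \<longleftrightarrow> fits (N \<omega>) (N \<omega>) f \<and> adj f = f \<and> fm.bd 1 f \<and> fm.bd 2 (f * E \<omega> * f) \<and>
      (\<forall>k. (fm.nrm (f - idm (N \<omega>)))\<^sup>2 \<le> Re (Tr (((\<lambda>T. E \<omega> * T) ^^ k) (idm (N \<omega>)))) / 2 ^ k)" for \<omega> f
  \<comment> \<open>The default 0 keeps self-adjointness and norm at most 1 also at the \<omega>
    where \<open>clipping\<close> does not apply.\<close>
  define f where "f \<omega> = (if \<exists>f. good \<omega> f then SOME f. good \<omega> f else 0)" for \<omega>
  have ev: "\<forall>\<^sub>F \<omega> in Fl. good \<omega> (f \<omega>)"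
    using E
  proof eventually_elim
    case (elim \<omega>)
    hence "\<exists>f. good \<omega> f" unfolding good_def by (elim conjE) (rule clipping, blast+)
    thus ?case by (simp add: f_def someI_ex)
  qed
  have f_cases: "good \<omega> (f \<omega>) \<or> f \<omega> = 0" for \<omega> by (simp add: f_def someI_ex)
  show ?thesis
  proof (intro exI[of _ f] conjI allI)
    show "adj (f \<omega>) = f \<omega>" for \<omega> using f_cases[of \<omega>] by (auto simp: good_def)
    show "fm.bd 1 (f \<omega>)" for \<omega> using f_cases[of \<omega>] by (auto simp: good_def fm.bd_zero)
    show "\<forall>\<^sub>F \<omega> in Fl. fits (N \<omega>) (N \<omega>) (f \<omega>) \<and> fm.bd 2 (f \<omega> * E \<omega> * f \<omega>)"
      using ev by eventually_elim (auto simp: good_def)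
    show "fm.null \<kappa> Fl (\<lambda>\<omega>. f \<omega> - idm (N \<omega>))"
      unfolding fm.null_def
    proof (intro conjI allI UNIV_I tendstoI)
      fix \<epsilon> :: real assume \<epsilon>: "0 < \<epsilon>"
      have C0: "0 \<le> C" using c[of 1] norm_ge_zero[of "c 1"] by linarith
      have "(\<lambda>k. (C + 1) * (1 / 2) ^ k) \<longlonglongrightarrow> (C + 1) * 0"
        by (intro tendsto_mult tendsto_const LIMSEQ_realpow_zero) auto
      hence "\<forall>\<^sub>F k in sequentially. (C + 1) * (1 / 2) ^ k < \<epsilon>\<^sup>2"
        using \<epsilon> by (intro order_tendstoD) auto
      hence "\<forall>\<^sub>F k in sequentially. (C + 1) * (1 / 2) ^ k < \<epsilon>\<^sup>2 \<and> 0 < k"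
        using eventually_gt_at_top[of 0] by eventually_elim auto
      then obtain k where k: "(C + 1) * (1 / 2) ^ k < \<epsilon>\<^sup>2" "0 < k"
        using eventually_happens'[OF sequentially_bot] by blast
      let ?T = "\<lambda>\<omega>. Tr (((\<lambda>T. E \<omega> * T) ^^ k) (idm (N \<omega>)))"
      have "((\<lambda>\<omega>. Re (?T \<omega> / of_real (\<kappa> \<omega>))) \<longlongrightarrow> Re (c k)) Fl"
        by (intro tendsto_Re lim k)
      moreover have "Re (c k) < C + 1" using c[OF k(2)] complex_Re_le_cmod[of "c k"] by linarith
      ultimately have "\<forall>\<^sub>F \<omega> in Fl. Re (?T \<omega> / of_real (\<kappa> \<omega>)) < C + 1" by (rule order_tendstoD)
      thus "\<forall>\<^sub>F \<omega> in Fl. dist (fm.nrm (f \<omega> - idm (N \<omega>)) / sqrt \<bar>\<kappa> \<omega>\<bar>) 0 < \<epsilon>"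
        using ev
      proof eventually_elim
        case (elim \<omega>)
        have "(fm.nrm (f \<omega> - idm (N \<omega>)) / sqrt \<bar>\<kappa> \<omega>\<bar>)\<^sup>2 = (fm.nrm (f \<omega> - idm (N \<omega>)))\<^sup>2 / \<kappa> \<omega>"
          using \<kappa>[of \<omega>] by (simp add: power_divide)
        also have "\<dots> \<le> Re (?T \<omega>) / 2 ^ k / \<kappa> \<omega>"
          using elim(2) \<kappa>[of \<omega>] by (intro divide_right_mono) (auto simp: good_def)
        also have "\<dots> = Re (?T \<omega> / of_real (\<kappa> \<omega>)) * (1 / 2) ^ k" by (simp add: power_divide)
        also have "\<dots> \<le> (C + 1) * (1 / 2) ^ k" using elim(1) by (intro mult_right_mono) auto
        also have "\<dots> < \<epsilon>\<^sup>2" by (rule k)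
        finally have "fm.nrm (f \<omega> - idm (N \<omega>)) / sqrt \<bar>\<kappa> \<omega>\<bar> < \<epsilon>"
          using \<epsilon> by (rule_tac power2_less_imp_less) auto
        thus ?case by (simp add: dist_real_def)
      qed
    qed
  qed
qed

text \<open>\<open>con\<close> stands for the unit ball in operator norm, from which the tuples in
  the entropy are taken. It implies the bound \<open>bd 1\<close> used by the calculus; averages and
  scalars are there to form real and imaginary parts.\<close>

locale linked = tracial P \<tau> for P :: "'a::complex_star_algebra set" and \<tau> +
  fixes con :: "'a \<Rightarrow> bool"
  assumes con_bd: "con x \<Longrightarrow> bd 1 x"
    and con_mult: "con x \<Longrightarrow> con y \<Longrightarrow> con (x * y)"
    and con_adj: "con x \<Longrightarrow> con (adj x)"
    and con_cscale: "con x \<Longrightarrow> cmod c \<le> 1 \<Longrightarrow> con (c \<star> x)"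
    and con_avg: "con x \<Longrightarrow> con y \<Longrightarrow> con ((1 / 2) \<star> (x + y))"
begin

lemma con_P: "con x \<Longrightarrow> x \<in> P"
  using con_bd bd_P by blast

definition tproj :: "'a \<Rightarrow> bool" where
  "tproj q \<longleftrightarrow> con q \<and> q * q = q \<and> adj q = q \<and> Im (\<tau> q) = 0 \<and> 0 < Re (\<tau> q)"

definition sac :: "'a \<Rightarrow> 'a set" where
  "sac q = {x. con x \<and> adj x = x \<and> q * x = x \<and> x * q = x}"

definition lawq :: "'a \<Rightarrow> 'a list \<Rightarrow> nclaw" where
  "lawq q x = law_of (length x) (\<lambda>w. \<tau> (wd ((!) x) q w) / \<tau> q)"

lemma tproj_P: "tproj q \<Longrightarrow> q \<in> P"
  by (simp add: tproj_def con_P)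

lemma sac_P: "x \<in> sac q \<Longrightarrow> x \<in> P"
  by (simp add: sac_def con_P)

lemma letters_nth: "tproj q \<Longrightarrow> set x \<subseteq> sac q \<Longrightarrow> letters (length x) ((!) x) q"
proof -
  assume q: "tproj q" and x: "set x \<subseteq> sac q"
  have "x ! k \<in> sac q" if "k < length x" for k using x nth_mem[OF that] by blast
  thus ?thesis using q by (simp add: letters_def tproj_def sac_def)
qed

lemma wd_P: "q \<in> P \<Longrightarrow> (\<And>k. k \<in> set w \<Longrightarrow> V k \<in> P) \<Longrightarrow> wd V q w \<in> P"
  by (induction w) auto

end

type_synonym state = "nat \<times> complex Matrix.mat list"

abbreviation dm :: "state \<Rightarrow> nat" where "dm \<omega> \<equiv> fst \<omega>"
abbreviation unit_at :: "state \<Rightarrow> finmat" where "unit_at \<omega> \<equiv> idm (dm \<omega>)"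
abbreviation coord :: "state \<Rightarrow> nat \<Rightarrow> finmat" where "coord \<omega> k \<equiv> emb (snd \<omega> ! k)"

context linked
begin

text \<open>Normalised so that the m x m identity, of trace m, gets the value \<tau>(p).\<close>

definition kapp :: "'a \<Rightarrow> state \<Rightarrow> real" where "kapp p \<omega> = real (dm \<omega>) / Re (\<tau> p)"

text \<open>Limits along this filter express that a microstate of v in p N p becomes large and its
  law approaches that of v. They take the place of an ultraproduct; if some neighbourhood has no
  large microstates, every property holds eventually.\<close>

definition mfilter :: "'a \<Rightarrow> 'a list \<Rightarrow> state filter" where
  "mfilter p v = Abs_filter (\<lambda>Q. \<exists>U N. open U \<and> lawq p v \<in> U \<and>
     (\<forall>m\<ge>N. \<forall>X\<in>microstates m (length v) 2 U. Q (m, X)))"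

end

locale microstates_of = linked +
  fixes p :: 'a and v :: "'a list"
  assumes p: "tproj p" and v: "set v \<subseteq> sac p"
begin

abbreviation kap :: "state \<Rightarrow> real" where "kap \<equiv> kapp p"

abbreviation Fl :: "state filter" where "Fl \<equiv> mfilter p v"

lemma kap_ge0: "0 \<le> kap \<omega>"
  using p by (simp add: kapp_def tproj_def)

lemma eventually_Fl: "eventually Q Fl \<longleftrightarrow> (\<exists>U N. open U \<and> lawq p v \<in> U \<and>
     (\<forall>m\<ge>N. \<forall>X\<in>microstates m (length v) 2 U. Q (m, X)))"
  unfolding mfilter_def
proof (rule eventually_Abs_filter, rule is_filter.intro)
  show "\<exists>U N. open U \<and> lawq p v \<in> U \<and> (\<forall>m\<ge>N. \<forall>X\<in>microstates m (length v) 2 U. True)"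
    by (rule exI[of _ UNIV]) auto
next
  fix Q R :: "state \<Rightarrow> bool"
  assume "\<exists>U N. open U \<and> lawq p v \<in> U \<and> (\<forall>m\<ge>N. \<forall>X\<in>microstates m (length v) 2 U. Q (m, X))"
  then obtain U N where U: "open U" "lawq p v \<in> U" "\<forall>m\<ge>N. \<forall>X\<in>microstates m (length v) 2 U. Q (m, X)"
    by blast
  assume "\<exists>U N. open U \<and> lawq p v \<in> U \<and> (\<forall>m\<ge>N. \<forall>X\<in>microstates m (length v) 2 U. R (m, X))"
  then obtain U' N' where U': "open U'" "lawq p v \<in> U'" "\<forall>m\<ge>N'. \<forall>X\<in>microstates m (length v) 2 U'. R (m, X)"
    by blast
  show "\<exists>U N. open U \<and> lawq p v \<in> U \<and>
      (\<forall>m\<ge>N. \<forall>X\<in>microstates m (length v) 2 U. Q (m, X) \<and> R (m, X))"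
    using U U' by (intro exI[of _ "U \<inter> U'"] exI[of _ "max N N'"]) (auto simp: microstates_def)
next
  fix Q R :: "state \<Rightarrow> bool"
  assume le: "\<forall>\<omega>. Q \<omega> \<longrightarrow> R \<omega>"
  assume "\<exists>U N. open U \<and> lawq p v \<in> U \<and> (\<forall>m\<ge>N. \<forall>X\<in>microstates m (length v) 2 U. Q (m, X))"
  then obtain U N where U: "open U" "lawq p v \<in> U" "\<forall>m\<ge>N. \<forall>X\<in>microstates m (length v) 2 U. Q (m, X)"
    by blast
  show "\<exists>U N. open U \<and> lawq p v \<in> U \<and> (\<forall>m\<ge>N. \<forall>X\<in>microstates m (length v) 2 U. R (m, X))"
    by (rule exI[of _ U], rule exI[of _ N]) (use U le in auto)
qed

lemma ev_dim: "\<forall>\<^sub>F \<omega> in Fl. N \<le> dm \<omega>"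
  unfolding eventually_Fl by (rule exI[of _ UNIV], rule exI[of _ N]) auto

lemma ev_coord: "\<forall>\<^sub>F \<omega> in Fl. \<forall>k<length v. fits (dm \<omega>) (dm \<omega>) (coord \<omega> k) \<and>
    adj (coord \<omega> k) = coord \<omega> k \<and> fm.bd 2 (coord \<omega> k)"
  unfolding eventually_Fl
proof (rule exI[of _ UNIV], rule exI[of _ 0], intro conjI allI impI ballI)
  fix m X k assume X: "X \<in> microstates m (length v) 2 UNIV" "k < length v"
  have k: "X ! k \<in> set X" and car: "X ! k \<in> carrier_mat m m"
    using X nth_mem[of k X] by (auto simp: microstates_def mat_tuples_def)
  have sa: "mat_adjoint (X ! k) = X ! k" "mat_op_norm (X ! k) \<le> 2"
    using X k by (auto simp: microstates_def)
  show "fits (dm (m, X)) (dm (m, X)) (coord (m, X) k)" using car by (simp add: fits_emb)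
  show "adj (coord (m, X) k) = coord (m, X) k" using sa(1) emb_adjoint[of "X ! k"] by simp
  show "fm.bd 2 (coord (m, X) k)" using sa(2) mat_op_norm_le_iff[OF car, of 2] by simp
qed auto

lemma ev_letters: "\<forall>\<^sub>F \<omega> in Fl. letters (length v) (coord \<omega>) (unit_at \<omega>)"
  using ev_coord by eventually_elim (auto simp: letters_def idm_mult_left idm_mult_right)

lemma v_letters: "letters (length v) ((!) v) p"
  by (rule letters_nth[OF p v])

lemma v_P: "k < length v \<Longrightarrow> v ! k \<in> P"
  using v sac_P nth_mem by blast

lemma p_P: "p \<in> P"
  by (rule tproj_P[OF p])

text \<open>Evaluating a law at a monomial is continuous, so a ball around the wanted moment is an
  admissible neighbourhood. The factor \<tau>(p) converts the normalised trace into Tr /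
  \<open>kap\<close>.\<close>

lemma word_limit:
  assumes w: "set w \<subseteq> {..<length v}"
  shows "((\<lambda>\<omega>. Tr (wd (coord \<omega>) (unit_at \<omega>) w) / of_real (kap \<omega>)) \<longlongrightarrow> \<tau> (wd ((!) v) p w)) Fl"
proof -
  let ?l = "\<tau> (wd ((!) v) p w) / \<tau> p"
  have \<tau>p: "\<tau> p = of_real (Re (\<tau> p))" "Re (\<tau> p) \<noteq> 0" using p by (auto simp: tproj_def complex_eq_iff)
  have lim: "((\<lambda>\<omega>. Tr (wd (coord \<omega>) (unit_at \<omega>) w) / of_nat (dm \<omega>)) \<longlongrightarrow> ?l) Fl"
  proof (rule tendstoI)
    fix \<eta> :: real assume \<eta>: "0 < \<eta>"
    define U where "U = {\<phi>::nclaw. cmod (\<phi> (Poly_Mapping.single w 1) - ?l) < \<eta>}"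
    have "open U" unfolding U_def by (rule open_law_ball)
    moreover have "lawq p v \<in> U" using \<eta> by (simp add: U_def lawq_def law_of_single[OF w])
    moreover have "dist (Tr (wd (coord (m, X)) (unit_at (m, X)) w) / of_nat (dm (m, X))) ?l < \<eta>"
      if X: "X \<in> microstates m (length v) 2 U" for m X
    proof -
      have "set X \<subseteq> carrier_mat m m" "length X = length v" "law_mat m X \<in> U"
        using X by (auto simp: microstates_def mat_tuples_def)
      thus ?thesis using law_mat_eq[of X m] law_of_single[OF w]
        by (simp add: U_def dist_norm wd_def)
    qed
    ultimately show "\<forall>\<^sub>F \<omega> in Fl. dist (Tr (wd (coord \<omega>) (unit_at \<omega>) w) / of_nat (dm \<omega>)) ?l < \<eta>"
      unfolding eventually_Fl by blast
  qed
  have "\<tau> p \<noteq> 0" using \<tau>p by auto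
  hence "\<tau> p * ?l = \<tau> (wd ((!) v) p w)" by simp
  with tendsto_mult[OF tendsto_const lim, of "\<tau> p"]
  have "((\<lambda>\<omega>. \<tau> p * (Tr (wd (coord \<omega>) (unit_at \<omega>) w) / of_nat (dm \<omega>))) \<longlongrightarrow> \<tau> (wd ((!) v) p w)) Fl"
    by simp
  moreover have "\<tau> p * (Tr (wd (coord \<omega>) (unit_at \<omega>) w) / of_nat (dm \<omega>)) =
      Tr (wd (coord \<omega>) (unit_at \<omega>) w) / of_real (kap \<omega>)" for \<omega>
    by (subst \<tau>p(1)) (simp add: kapp_def)
  ultimately show ?thesis by simp
qed

text \<open>A relation and not a map: the same element may be given by several polynomials in v,
  whose values at a microstate differ.\<close>

definition models :: "'a \<Rightarrow> (state \<Rightarrow> finmat) \<Rightarrow> bool" where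
  "models f F \<longleftrightarrow> (\<exists>ps. pok (length v) ps \<and> f = peval ((!) v) p ps \<and>
     (\<forall>\<^sub>F \<omega> in Fl. F \<omega> = peval (coord \<omega>) (unit_at \<omega>) ps))"

lemma models_cong: "models f F \<Longrightarrow> \<forall>\<^sub>F \<omega> in Fl. F \<omega> = G \<omega> \<Longrightarrow> models f G"
  unfolding models_def
proof (elim exE conjE)
  fix ps assume ps: "pok (length v) ps" "f = peval ((!) v) p ps"
    and 1: "\<forall>\<^sub>F \<omega> in Fl. F \<omega> = peval (coord \<omega>) (unit_at \<omega>) ps" and 2: "\<forall>\<^sub>F \<omega> in Fl. F \<omega> = G \<omega>"
  have "\<forall>\<^sub>F \<omega> in Fl. G \<omega> = peval (coord \<omega>) (unit_at \<omega>) ps" using 1 2 by eventually_elim simp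
  thus "\<exists>ps. pok (length v) ps \<and> f = peval ((!) v) p ps \<and>
     (\<forall>\<^sub>F \<omega> in Fl. G \<omega> = peval (coord \<omega>) (unit_at \<omega>) ps)" using ps by blast
qed

lemma models_unit: "models p unit_at"
  unfolding models_def by (rule exI[of _ "[(1, [])]"]) (simp add: pok_def)

lemma models_letter: "k < length v \<Longrightarrow> models (v ! k) (\<lambda>\<omega>. coord \<omega> k)"
  unfolding models_def
proof (rule exI[of _ "[(1, [k])]"], intro conjI)
  assume k: "k < length v"
  thus "pok (length v) [(1, [k])]" by (simp add: pok_def)
  show "v ! k = peval ((!) v) p [(1, [k])]" using v_letters k by (simp add: letters_def)
  show "\<forall>\<^sub>F \<omega> in Fl. coord \<omega> k = peval (coord \<omega>) (unit_at \<omega>) [(1, [k])]"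
    using ev_letters by eventually_elim (use k in \<open>simp add: letters_def\<close>)
qed

lemma models_add:
  assumes "models f F" "models g G" shows "models (f + g) (\<lambda>\<omega>. F \<omega> + G \<omega>)"
proof -
  obtain ps qs where *: "pok (length v) ps" "f = peval ((!) v) p ps" "pok (length v) qs" "g = peval ((!) v) p qs"
    and 1: "\<forall>\<^sub>F \<omega> in Fl. F \<omega> = peval (coord \<omega>) (unit_at \<omega>) ps"
    and 2: "\<forall>\<^sub>F \<omega> in Fl. G \<omega> = peval (coord \<omega>) (unit_at \<omega>) qs"
    using assms unfolding models_def by blast
  have "\<forall>\<^sub>F \<omega> in Fl. F \<omega> + G \<omega> = peval (coord \<omega>) (unit_at \<omega>) (ps @ qs)"
    using 1 2 by eventually_elim (simp add: peval_append)
  moreover have "pok (length v) (ps @ qs)" "f + g = peval ((!) v) p (ps @ qs)"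
    using * by (auto simp: pok_append peval_append)
  ultimately show ?thesis unfolding models_def by blast
qed

lemma models_cscale:
  assumes "models f F" shows "models (c \<star> f) (\<lambda>\<omega>. c \<star> F \<omega>)"
proof -
  obtain ps where *: "pok (length v) ps" "f = peval ((!) v) p ps"
    and 1: "\<forall>\<^sub>F \<omega> in Fl. F \<omega> = peval (coord \<omega>) (unit_at \<omega>) ps"
    using assms unfolding models_def by blast
  let ?qs = "map (\<lambda>(c', w). (c * c', w)) ps"
  have "\<forall>\<^sub>F \<omega> in Fl. c \<star> F \<omega> = peval (coord \<omega>) (unit_at \<omega>) ?qs"
    using 1 by eventually_elim (simp add: peval_cscale)
  moreover have "pok (length v) ?qs" "c \<star> f = peval ((!) v) p ?qs"
    using * by (auto simp: pok_def peval_cscale)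
  ultimately show ?thesis unfolding models_def by blast
qed

lemma models_mult:
  assumes "models f F" "models g G" shows "models (f * g) (\<lambda>\<omega>. F \<omega> * G \<omega>)"
proof -
  obtain ps qs where *: "pok (length v) ps" "f = peval ((!) v) p ps" "pok (length v) qs" "g = peval ((!) v) p qs"
    and 1: "\<forall>\<^sub>F \<omega> in Fl. F \<omega> = peval (coord \<omega>) (unit_at \<omega>) ps"
    and 2: "\<forall>\<^sub>F \<omega> in Fl. G \<omega> = peval (coord \<omega>) (unit_at \<omega>) qs"
    using assms unfolding models_def by blast
  have "\<forall>\<^sub>F \<omega> in Fl. F \<omega> * G \<omega> = peval (coord \<omega>) (unit_at \<omega>) (pmul ps qs)"
    using 1 2 ev_letters by eventually_elim (simp add: peval_mult[OF _ *(3)])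
  moreover have "pok (length v) (pmul ps qs)" "f * g = peval ((!) v) p (pmul ps qs)"
    using * by (auto simp: pok_pmul peval_mult[OF v_letters])
  ultimately show ?thesis unfolding models_def by blast
qed

lemma models_adj:
  assumes "models f F" shows "models (adj f) (\<lambda>\<omega>. adj (F \<omega>))"
proof -
  obtain ps where *: "pok (length v) ps" "f = peval ((!) v) p ps"
    and 1: "\<forall>\<^sub>F \<omega> in Fl. F \<omega> = peval (coord \<omega>) (unit_at \<omega>) ps"
    using assms unfolding models_def by blast
  let ?qs = "map (\<lambda>(c, w). (cnj c, rev w)) ps"
  have "\<forall>\<^sub>F \<omega> in Fl. adj (F \<omega>) = peval (coord \<omega>) (unit_at \<omega>) ?qs"
    using 1 ev_letters by eventually_elim (simp add: peval_adj[OF _ *(1)])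
  moreover have "pok (length v) ?qs" "adj f = peval ((!) v) p ?qs"
    using * by (auto 0 3 simp: pok_def peval_adj[OF v_letters])
  ultimately show ?thesis unfolding models_def by blast
qed

lemma models_zero: "models 0 (\<lambda>\<omega>. 0)"
  unfolding models_def by (rule exI[of _ "[]"]) (simp add: pok_def)

lemma models_sum:
  "(\<And>k. k \<in> A \<Longrightarrow> models (f k) (F k)) \<Longrightarrow> models (\<Sum>k\<in>A. f k) (\<lambda>\<omega>. \<Sum>k\<in>A. F k \<omega>)"
  by (induction A rule: infinite_finite_induct) (auto intro: models_zero models_add)

lemma models_diff:
  assumes "models f F" "models g G" shows "models (f - g) (\<lambda>\<omega>. F \<omega> - G \<omega>)"
  using models_add[OF assms(1) models_cscale[OF assms(2), of "-1"]] by (simp add: cscale_minus_one)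

lemma models_power: "models f F \<Longrightarrow> models (((\<lambda>x. f * x) ^^ k) p) (\<lambda>\<omega>. ((\<lambda>T. F \<omega> * T) ^^ k) (unit_at \<omega>))"
  by (induction k) (auto intro: models_unit models_mult)

lemma models_facts:
  assumes "models f F"
  shows models_P: "f \<in> P" and models_left: "p * f = f" and models_right: "f * p = f"
    and models_bnd: "fm.bnd Fl F" and models_fits: "\<forall>\<^sub>F \<omega> in Fl. fits (dm \<omega>) (dm \<omega>) (F \<omega>)"
    and models_trace: "((\<lambda>\<omega>. Tr (F \<omega>) / of_real (kap \<omega>)) \<longlongrightarrow> \<tau> f) Fl"
proof -
  obtain ps where ps: "pok (length v) ps" "f = peval ((!) v) p ps"
    and F: "\<forall>\<^sub>F \<omega> in Fl. F \<omega> = peval (coord \<omega>) (unit_at \<omega>) ps"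
    using assms unfolding models_def by blast
  have pp: "p * p = p" using p by (simp add: tproj_def)
  show "f \<in> P" unfolding ps(2) using ps(1)
  proof (induction ps)
    case (Cons q ps)
    thus ?case using p_P v_P by (cases q) (auto simp: pok_Cons intro!: wd_P)
  qed simp
  show "p * f = f" unfolding ps(2) using ps(1)
  proof (induction ps)
    case (Cons q ps)
    thus ?case using letters_unit[OF v_letters]
      by (cases q) (auto simp: pok_Cons distrib_left cscale_mult_right)
  qed simp
  show "f * p = f" unfolding ps(2)
  proof (induction ps)
    case (Cons q ps)
    thus ?case by (cases q) (auto simp: distrib_right cscale_mult_left wd_mult_right pp)
  qed simp
  have words: "fm.bd (2 ^ length w) (wd (coord \<omega>) (unit_at \<omega>) w) \<and> fits (dm \<omega>) (dm \<omega>) (wd (coord \<omega>) (unit_at \<omega>) w)"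
    if "\<forall>k<length v. fits (dm \<omega>) (dm \<omega>) (coord \<omega> k) \<and> adj (coord \<omega> k) = coord \<omega> k \<and> fm.bd 2 (coord \<omega> k)"
      "set w \<subseteq> {..<length v}" for \<omega> w
    using that(2)
  proof (induction w)
    case (Cons k w)
    thus ?case using that(1) by (auto intro: fm.bd_mult fits_mult)
  qed (simp add: bd_idm fits_diagm)
  have "\<forall>\<^sub>F \<omega> in Fl. fm.bd (\<Sum>(c, w)\<leftarrow>ps. cmod c * 2 ^ length w) (F \<omega>) \<and> fits (dm \<omega>) (dm \<omega>) (F \<omega>)"
    using F ev_coord
  proof eventually_elim
    case (elim \<omega>)
    show ?case unfolding elim(1) using ps(1)
    proof (induction ps)
      case (Cons q ps)
      obtain c w where q: "q = (c, w)" by (cases q)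
      show ?case using Cons words[OF elim(2), of w]
        by (auto simp: q pok_Cons intro!: fm.bd_add fm.bd_cscale fits_add fits_cscale)
    qed (simp add: fm.bd_zero)
  qed
  thus "fm.bnd Fl F" "\<forall>\<^sub>F \<omega> in Fl. fits (dm \<omega>) (dm \<omega>) (F \<omega>)"
    unfolding fm.bnd_def by (auto elim: eventually_mono)
  have "((\<lambda>\<omega>. Tr (peval (coord \<omega>) (unit_at \<omega>) ps) / of_real (kap \<omega>)) \<longlongrightarrow> \<tau> (peval ((!) v) p ps)) Fl"
    using ps(1)
  proof (induction ps)
    case (Cons q ps)
    obtain c w where q: "q = (c, w)" by (cases q)
    have w: "set w \<subseteq> {..<length v}" and pk: "pok (length v) ps" using Cons.prems by (auto simp: q pok_Cons)
    have "peval ((!) v) p ps' \<in> P" if "pok (length v) ps'" for ps'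
      using that
    proof (induction ps')
      case (Cons q ps)
      thus ?case using p_P v_P by (cases q) (auto simp: pok_Cons intro!: wd_P)
    qed simp
    moreover have "wd ((!) v) p w \<in> P" using p_P v_P w by (intro wd_P) auto
    ultimately have "\<tau> (peval ((!) v) p (q # ps)) = c * \<tau> (wd ((!) v) p w) + \<tau> (peval ((!) v) p ps)"
      using pk by (simp add: q tr_add tr_cscale)
    moreover have "((\<lambda>\<omega>. c * (Tr (wd (coord \<omega>) (unit_at \<omega>) w) / of_real (kap \<omega>)) +
        Tr (peval (coord \<omega>) (unit_at \<omega>) ps) / of_real (kap \<omega>)) \<longlongrightarrow>
        c * \<tau> (wd ((!) v) p w) + \<tau> (peval ((!) v) p ps)) Fl"
      by (rule tendsto_add[OF tendsto_mult[OF tendsto_const word_limit[OF w]] Cons.IH[OF pk]])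
    ultimately show ?case by (simp add: q fm.tr_add fm.tr_cscale add_divide_distrib)
  qed simp
  moreover have "\<forall>\<^sub>F \<omega> in Fl. Tr (F \<omega>) / of_real (kap \<omega>) = Tr (peval (coord \<omega>) (unit_at \<omega>) ps) / of_real (kap \<omega>)"
    using F by eventually_elim simp
  ultimately show "((\<lambda>\<omega>. Tr (F \<omega>) / of_real (kap \<omega>)) \<longlongrightarrow> \<tau> f) Fl"
    unfolding ps(2) by (simp only: tendsto_cong)
qed

lemma models_nrm:
  assumes "models f F"
  shows "((\<lambda>\<omega>. fm.nrm (F \<omega>) / sqrt \<bar>kap \<omega>\<bar>) \<longlongrightarrow> nrm f) Fl"
  unfolding nrm_def[of f]
  by (rule fm.trace_bound_limit[OF UNIV_I models_trace[OF models_mult[OF models_adj[OF assms] assms]] kap_ge0])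

end

lemma (in tracial) null_cong:
  assumes "null \<kappa> Fl F" "\<forall>\<^sub>F \<omega> in Fl. F \<omega> = G \<omega>" "\<And>\<omega>. G \<omega> \<in> P"
  shows "null \<kappa> Fl G"
proof -
  have ev: "\<forall>\<^sub>F \<omega> in Fl. nrm (F \<omega>) / sqrt \<bar>\<kappa> \<omega>\<bar> = nrm (G \<omega>) / sqrt \<bar>\<kappa> \<omega>\<bar>"
    using assms(2) by eventually_elim simp
  have "((\<lambda>\<omega>. nrm (G \<omega>) / sqrt \<bar>\<kappa> \<omega>\<bar>) \<longlongrightarrow> 0) Fl"
    by (rule Lim_transform_eventually[OF null_limit[OF assms(1)] ev])
  thus ?thesis using assms(3) by (simp add: null_def)
qed

lemma (in tracial) bnd_cong:
  assumes "bnd Fl F" "\<forall>\<^sub>F \<omega> in Fl. F \<omega> = G \<omega>" "\<And>\<omega>. G \<omega> \<in> P"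
  shows "bnd Fl G"
proof -
  obtain c where "\<forall>\<^sub>F \<omega> in Fl. bd c (F \<omega>)" using assms(1) by (auto simp: bnd_def)
  with assms(2) have "\<forall>\<^sub>F \<omega> in Fl. bd c (G \<omega>)" by eventually_elim simp
  thus ?thesis using assms(3) by (auto simp: bnd_def)
qed

definition gram :: "(nat \<Rightarrow> 'a::complex_star_algebra) \<Rightarrow> nat \<Rightarrow> 'a" where
  "gram a s = (\<Sum>l<s. adj (a l) * a l)"

locale blocks = microstates_of +
  fixes e :: 'a and a :: "nat \<Rightarrow> 'a" and s :: nat
  assumes e: "tproj e" and a: "\<And>l. con (a l)" "\<And>l. p * a l = a l" "\<And>l. a l * e = a l"
    and dd_bd1: "bd 1 (gram a s)"
begin

abbreviation dd :: 'a where "dd \<equiv> gram a s"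

lemmas dd_def = gram_def[of a s]

lemma a_P: "a l \<in> P" using a(1) con_P by blast
lemma e_P: "e \<in> P" by (rule tproj_P[OF e])
lemma dd_P: "dd \<in> P" by (simp add: dd_def a_P)

lemma adj_a: "adj (a l) * p = adj (a l)" "e * adj (a l) = adj (a l)"
  using arg_cong[OF a(2), of adj] arg_cong[OF a(3), of adj] p e
  by (simp_all add: adj_mult tproj_def)

lemma dd_e: "dd * e = dd" "e * dd = dd"
  by (simp_all add: dd_def sum_distrib_left sum_distrib_right mult.assoc a(3))
    (simp add: mult.assoc[symmetric] adj_a)

lemma adj_dd: "adj dd = dd"
  by (simp add: dd_def adj_sum adj_mult)

lemma ev_fits2:
  assumes "\<forall>l<s. \<forall>l'<s. models (f l l') (F l l')"
  shows "\<forall>\<^sub>F \<omega> in Fl. \<forall>l<s. \<forall>l'<s. fits (dm \<omega>) (dm \<omega>) (F l l' \<omega>)"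
proof -
  have "\<forall>\<^sub>F \<omega> in Fl. \<forall>l\<in>{..<s}. \<forall>l'\<in>{..<s}. fits (dm \<omega>) (dm \<omega>) (F l l' \<omega>)"
    by (intro eventually_ball_finite ballI finite_lessThan) (use assms models_fits in auto)
  thus ?thesis by (rule eventually_mono) auto
qed

lemma ev_fits1:
  assumes "\<forall>l<s. models (f l) (F l)"
  shows "\<forall>\<^sub>F \<omega> in Fl. \<forall>l<s. fits (dm \<omega>) (dm \<omega>) (F l \<omega>)"
proof -
  have "\<forall>\<^sub>F \<omega> in Fl. \<forall>l\<in>{..<s}. fits (dm \<omega>) (dm \<omega>) (F l \<omega>)"
    by (intro eventually_ball_finite ballI finite_lessThan) (use assms models_fits in auto)
  thus ?thesis by (rule eventually_mono) auto
qed

text \<open>The matrices \<open>(a\<^sub>l u a\<^sub>l'\<^sup>*)\<close> are multiplied by the rule \<open>u \<cdot> dd \<cdot> u'\<close>, and \<open>dd\<close> is close to the unit \<open>e\<close>.\<close>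

definition bmodels :: "'a \<Rightarrow> (state \<Rightarrow> finmat) \<Rightarrow> bool" where
  "bmodels u U \<longleftrightarrow> u \<in> P \<and> (\<exists>F. (\<forall>l<s. \<forall>l'<s. models (a l * u * adj (a l')) (F l l')) \<and>
     (\<forall>\<^sub>F \<omega> in Fl. U \<omega> = blk s (dm \<omega>) (\<lambda>l l'. F l l' \<omega>)))"

text \<open>For b in p N e the row with entries b a_l^*. A row times the adjoint of a row is b
  \<open>dd\<close> b'^* and models an element of p N p; the adjoint of a row times a row is a block
  matrix, with middle element b^* f b'.\<close>

definition rmodels :: "'a \<Rightarrow> (state \<Rightarrow> finmat) \<Rightarrow> bool" where
  "rmodels b T \<longleftrightarrow> b \<in> P \<and> (\<exists>F. (\<forall>l<s. models (b * adj (a l)) (F l)) \<and>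
     (\<forall>\<^sub>F \<omega> in Fl. T \<omega> = rowb s (dm \<omega>) (\<lambda>l. F l \<omega>)))"

lemma bmodels_P: "bmodels u U \<Longrightarrow> u \<in> P" by (simp add: bmodels_def)
lemma rmodels_P: "rmodels u U \<Longrightarrow> u \<in> P" by (simp add: rmodels_def)

lemma bmodelsE:
  assumes "bmodels u U"
  obtains F where "\<forall>l<s. \<forall>l'<s. models (a l * u * adj (a l')) (F l l')"
    "\<forall>\<^sub>F \<omega> in Fl. U \<omega> = blk s (dm \<omega>) (\<lambda>l l'. F l l' \<omega>)"
  using assms unfolding bmodels_def by blast

lemma rmodelsE:
  assumes "rmodels u U"
  obtains F where "\<forall>l<s. models (u * adj (a l)) (F l)"
    "\<forall>\<^sub>F \<omega> in Fl. U \<omega> = rowb s (dm \<omega>) (\<lambda>l. F l \<omega>)"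
  using assms unfolding rmodels_def by blast

lemma bmodels_mult:
  assumes "bmodels u U" "bmodels w W" shows "bmodels (u * dd * w) (\<lambda>\<omega>. U \<omega> * W \<omega>)"
proof -
  obtain F where F: "\<forall>l<s. \<forall>l'<s. models (a l * u * adj (a l')) (F l l')"
    "\<forall>\<^sub>F \<omega> in Fl. U \<omega> = blk s (dm \<omega>) (\<lambda>l l'. F l l' \<omega>)" using assms(1) by (rule bmodelsE)
  obtain G where G: "\<forall>l<s. \<forall>l'<s. models (a l * w * adj (a l')) (G l l')"
    "\<forall>\<^sub>F \<omega> in Fl. W \<omega> = blk s (dm \<omega>) (\<lambda>l l'. G l l' \<omega>)" using assms(2) by (rule bmodelsE)
  have "models (a l * (u * dd * w) * adj (a l')) (\<lambda>\<omega>. \<Sum>k<s. F l k \<omega> * G k l' \<omega>)" if "l < s" "l' < s" for l l'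
  proof -
    have "a l * (u * dd * w) * adj (a l') = (\<Sum>k<s. (a l * u * adj (a k)) * (a k * w * adj (a l')))"
      by (simp add: dd_def sum_distrib_left sum_distrib_right mult.assoc)
    thus ?thesis using that by (auto intro!: models_sum models_mult F(1)[rule_format] G(1)[rule_format])
  qed
  moreover have "\<forall>\<^sub>F \<omega> in Fl. U \<omega> * W \<omega> = blk s (dm \<omega>) (\<lambda>l l'. \<Sum>k<s. F l k \<omega> * G k l' \<omega>)"
    using F(2) G(2) ev_fits2[OF F(1)]
  proof eventually_elim
    case (elim \<omega>)
    have "F l l' \<omega> * unit_at \<omega> = F l l' \<omega>" if "l < s" "l' < s" for l l'
      using elim(3) that by (intro idm_mult_right) blast
    thus ?case using blk_mult[of s "\<lambda>l l'. F l l' \<omega>" "dm \<omega>" "\<lambda>l l'. G l l' \<omega>"] elim by simp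
  qed
  ultimately show ?thesis using assms dd_P unfolding bmodels_def
    by (intro conjI exI[of _ "\<lambda>l l' \<omega>. \<Sum>k<s. F l k \<omega> * G k l' \<omega>"]) auto
qed

lemma bmodels_add:
  assumes "bmodels u U" "bmodels w W" shows "bmodels (u + w) (\<lambda>\<omega>. U \<omega> + W \<omega>)"
proof -
  obtain F where F: "\<forall>l<s. \<forall>l'<s. models (a l * u * adj (a l')) (F l l')"
    "\<forall>\<^sub>F \<omega> in Fl. U \<omega> = blk s (dm \<omega>) (\<lambda>l l'. F l l' \<omega>)" using assms(1) by (rule bmodelsE)
  obtain G where G: "\<forall>l<s. \<forall>l'<s. models (a l * w * adj (a l')) (G l l')"
    "\<forall>\<^sub>F \<omega> in Fl. W \<omega> = blk s (dm \<omega>) (\<lambda>l l'. G l l' \<omega>)" using assms(2) by (rule bmodelsE)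
  have "models (a l * (u + w) * adj (a l')) (\<lambda>\<omega>. F l l' \<omega> + G l l' \<omega>)" if "l < s" "l' < s" for l l'
    using models_add[OF F(1)[rule_format, OF that] G(1)[rule_format, OF that]] by (simp add: distrib_left distrib_right)
  moreover have "\<forall>\<^sub>F \<omega> in Fl. U \<omega> + W \<omega> = blk s (dm \<omega>) (\<lambda>l l'. F l l' \<omega> + G l l' \<omega>)"
    using F(2) G(2) by eventually_elim (simp add: blk_add)
  ultimately show ?thesis using assms unfolding bmodels_def
    by (intro conjI exI[of _ "\<lambda>l l' \<omega>. F l l' \<omega> + G l l' \<omega>"]) auto
qed

lemma bmodels_cscale:
  assumes "bmodels u U" shows "bmodels (c \<star> u) (\<lambda>\<omega>. c \<star> U \<omega>)"
proof -
  obtain F where F: "\<forall>l<s. \<forall>l'<s. models (a l * u * adj (a l')) (F l l')"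
    "\<forall>\<^sub>F \<omega> in Fl. U \<omega> = blk s (dm \<omega>) (\<lambda>l l'. F l l' \<omega>)" using assms(1) by (rule bmodelsE)
  have "models (a l * (c \<star> u) * adj (a l')) (\<lambda>\<omega>. c \<star> F l l' \<omega>)" if "l < s" "l' < s" for l l'
    using models_cscale[OF F(1)[rule_format, OF that], of c] by (simp add: cscale_mult_left cscale_mult_right)
  moreover have "\<forall>\<^sub>F \<omega> in Fl. c \<star> U \<omega> = blk s (dm \<omega>) (\<lambda>l l'. c \<star> F l l' \<omega>)"
    using F(2) by eventually_elim (simp add: cscale_blk)
  ultimately show ?thesis using assms unfolding bmodels_def
    by (intro conjI exI[of _ "\<lambda>l l' \<omega>. c \<star> F l l' \<omega>"]) auto
qed

lemma bmodels_adj: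
  assumes "bmodels u U" shows "bmodels (adj u) (\<lambda>\<omega>. adj (U \<omega>))"
proof -
  obtain F where F: "\<forall>l<s. \<forall>l'<s. models (a l * u * adj (a l')) (F l l')"
    "\<forall>\<^sub>F \<omega> in Fl. U \<omega> = blk s (dm \<omega>) (\<lambda>l l'. F l l' \<omega>)" using assms(1) by (rule bmodelsE)
  have "models (a l * adj u * adj (a l')) (\<lambda>\<omega>. adj (F l' l \<omega>))" if "l < s" "l' < s" for l l'
    using models_adj[OF F(1)[rule_format, OF that(2,1)]] by (simp add: adj_mult mult.assoc)
  moreover have "\<forall>\<^sub>F \<omega> in Fl. adj (U \<omega>) = blk s (dm \<omega>) (\<lambda>l l'. adj (F l' l \<omega>))"
    using F(2) by eventually_elim (simp add: adj_blk)
  ultimately show ?thesis using assms unfolding bmodels_def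
    by (intro conjI exI[of _ "\<lambda>l l' \<omega>. adj (F l' l \<omega>)"]) auto
qed

lemma bmodels_diff:
  assumes "bmodels u U" "bmodels w W" shows "bmodels (u - w) (\<lambda>\<omega>. U \<omega> - W \<omega>)"
  using bmodels_add[OF assms(1) bmodels_cscale[OF assms(2), of "-1"]] by (simp add: cscale_minus_one)

lemma bmodels_facts:
  assumes "bmodels u U"
  shows bmodels_bnd: "fm.bnd Fl U" and bmodels_fits: "\<forall>\<^sub>F \<omega> in Fl. fits (s * dm \<omega>) (s * dm \<omega>) (U \<omega>)"
    and bmodels_trace: "((\<lambda>\<omega>. Tr (U \<omega>) / of_real (kap \<omega>)) \<longlongrightarrow> \<tau> (u * dd)) Fl"
proof -
  obtain F where F: "\<forall>l<s. \<forall>l'<s. models (a l * u * adj (a l')) (F l l')"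
    and U: "\<forall>\<^sub>F \<omega> in Fl. U \<omega> = blk s (dm \<omega>) (\<lambda>l l'. F l l' \<omega>)" using assms(1) by (rule bmodelsE)
  have sh: "fm.bnd Fl (\<lambda>\<omega>. shiftm (dm \<omega>) l)" for l
    by (rule fm.bndI[of _ 1]) (auto simp: bd_shiftm)
  have "fm.bnd Fl (\<lambda>\<omega>. blk s (dm \<omega>) (\<lambda>l l'. F l l' \<omega>))"
    unfolding blk_def
    by (intro fm.bnd_sum fm.bnd_mult fm.bnd_adj sh models_bnd[OF F[rule_format]]) auto
  thus "fm.bnd Fl U" by (rule fm.bnd_cong) (use U in \<open>auto elim: eventually_mono\<close>)
  show "\<forall>\<^sub>F \<omega> in Fl. fits (s * dm \<omega>) (s * dm \<omega>) (U \<omega>)"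
    using U ev_fits2[OF F] by eventually_elim (auto intro!: fits_blk)
  have "((\<lambda>\<omega>. \<Sum>l<s. Tr (F l l \<omega>) / of_real (kap \<omega>)) \<longlongrightarrow> (\<Sum>l<s. \<tau> (a l * u * adj (a l)))) Fl"
    by (intro tendsto_sum models_trace[OF F[rule_format]]) auto
  moreover have "(\<Sum>l<s. \<tau> (a l * u * adj (a l))) = \<tau> (u * dd)"
  proof -
    have "\<tau> (a l * u * adj (a l)) = \<tau> (u * (adj (a l) * a l))" for l
      using tr_comm[of "a l" "u * adj (a l)"] a_P bmodels_P[OF assms] by (simp add: mult.assoc)
    thus ?thesis using a_P bmodels_P[OF assms] by (simp add: dd_def sum_distrib_left tr_sum)
  qed
  moreover have "\<forall>\<^sub>F \<omega> in Fl. (\<Sum>l<s. Tr (F l l \<omega>) / of_real (kap \<omega>)) = Tr (U \<omega>) / of_real (kap \<omega>)"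
    using U ev_fits2[OF F]
  proof eventually_elim
    case (elim \<omega>)
    have "F l l' \<omega> * unit_at \<omega> = F l l' \<omega>" if "l < s" "l' < s" for l l'
      using elim(2) that by (intro idm_mult_right) blast
    thus ?case using Tr_blk[of s "\<lambda>l l'. F l l' \<omega>" "dm \<omega>"] elim
      by (simp add: sum_divide_distrib)
  qed
  ultimately show "((\<lambda>\<omega>. Tr (U \<omega>) / of_real (kap \<omega>)) \<longlongrightarrow> \<tau> (u * dd)) Fl"
    using Lim_transform_eventually by fastforce
qed

lemma bmodels_nrm:
  assumes "bmodels u U"
  shows "((\<lambda>\<omega>. fm.nrm (U \<omega>) / sqrt \<bar>kap \<omega>\<bar>) \<longlongrightarrow> sqrt (Re (\<tau> (adj u * dd * u * dd)))) Fl"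
  by (rule fm.trace_bound_limit[OF UNIV_I bmodels_trace[OF bmodels_mult[OF bmodels_adj[OF assms] assms]] kap_ge0])

lemma bmodels_sbd: "bmodels u U \<Longrightarrow> fm.sbd kap Fl U"
  by (rule fm.sbd_of_limit[OF UNIV_I bmodels_nrm])

lemma rmodels_bnd: assumes "rmodels b T" shows "fm.bnd Fl T"
proof -
  obtain F where F: "\<forall>l<s. models (b * adj (a l)) (F l)"
    and T: "\<forall>\<^sub>F \<omega> in Fl. T \<omega> = rowb s (dm \<omega>) (\<lambda>l. F l \<omega>)" using assms by (rule rmodelsE)
  have sh: "fm.bnd Fl (\<lambda>\<omega>. shiftm (dm \<omega>) l)" for l
    by (rule fm.bndI[of _ 1]) (auto simp: bd_shiftm)
  have "fm.bnd Fl (\<lambda>\<omega>. rowb s (dm \<omega>) (\<lambda>l. F l \<omega>))"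
    unfolding rowb_def by (intro fm.bnd_sum fm.bnd_mult sh models_bnd[OF F[rule_format]]) auto
  thus ?thesis by (rule fm.bnd_cong) (use T in \<open>auto elim: eventually_mono\<close>)
qed

lemma rmodels_fits: assumes "rmodels b T" shows "\<forall>\<^sub>F \<omega> in Fl. fits (dm \<omega>) (s * dm \<omega>) (T \<omega>)"
proof -
  obtain F where F: "\<forall>l<s. models (b * adj (a l)) (F l)"
    and T: "\<forall>\<^sub>F \<omega> in Fl. T \<omega> = rowb s (dm \<omega>) (\<lambda>l. F l \<omega>)" using assms by (rule rmodelsE)
  show ?thesis using T ev_fits1[OF F] by eventually_elim (auto intro!: fits_rowb)
qed

lemma rmodels_adj_mult:
  assumes "rmodels b T" "rmodels b' T'" "models f F"
  shows "bmodels (adj b * f * b') (\<lambda>\<omega>. adj (T \<omega>) * F \<omega> * T' \<omega>)"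
proof -
  obtain G where G: "\<forall>l<s. models (b * adj (a l)) (G l)"
    "\<forall>\<^sub>F \<omega> in Fl. T \<omega> = rowb s (dm \<omega>) (\<lambda>l. G l \<omega>)" using assms(1) by (rule rmodelsE)
  obtain G' where G': "\<forall>l<s. models (b' * adj (a l)) (G' l)"
    "\<forall>\<^sub>F \<omega> in Fl. T' \<omega> = rowb s (dm \<omega>) (\<lambda>l. G' l \<omega>)" using assms(2) by (rule rmodelsE)
  have "models (a l * (adj b * f * b') * adj (a l')) (\<lambda>\<omega>. adj (G l \<omega>) * F \<omega> * G' l' \<omega>)" if "l < s" "l' < s" for l l'
    using models_mult[OF models_mult[OF models_adj[OF G(1)[rule_format, OF that(1)]] assms(3)] G'(1)[rule_format, OF that(2)]]
    by (simp add: adj_mult mult.assoc)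
  moreover have "\<forall>\<^sub>F \<omega> in Fl. adj (T \<omega>) * F \<omega> * T' \<omega> = blk s (dm \<omega>) (\<lambda>l l'. adj (G l \<omega>) * F \<omega> * G' l' \<omega>)"
    using G(2) G'(2) by eventually_elim (simp add: adj_rowb_mult)
  ultimately show ?thesis using rmodels_P[OF assms(1)] rmodels_P[OF assms(2)] models_P[OF assms(3)]
    unfolding bmodels_def by (intro conjI exI[of _ "\<lambda>l l' \<omega>. adj (G l \<omega>) * F \<omega> * G' l' \<omega>"]) auto
qed

lemma rmodels_mult_adj:
  assumes "rmodels b T" "rmodels b' T'"
  shows "models (b * dd * adj b') (\<lambda>\<omega>. T \<omega> * adj (T' \<omega>))"
proof -
  obtain G where G: "\<forall>l<s. models (b * adj (a l)) (G l)"
    "\<forall>\<^sub>F \<omega> in Fl. T \<omega> = rowb s (dm \<omega>) (\<lambda>l. G l \<omega>)" using assms(1) by (rule rmodelsE)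
  obtain G' where G': "\<forall>l<s. models (b' * adj (a l)) (G' l)"
    "\<forall>\<^sub>F \<omega> in Fl. T' \<omega> = rowb s (dm \<omega>) (\<lambda>l. G' l \<omega>)" using assms(2) by (rule rmodelsE)
  have "b * dd * adj b' = (\<Sum>l<s. (b * adj (a l)) * adj (b' * adj (a l)))"
    by (simp add: dd_def sum_distrib_left sum_distrib_right adj_mult mult.assoc)
  hence "models (b * dd * adj b') (\<lambda>\<omega>. \<Sum>l<s. G l \<omega> * adj (G' l \<omega>))"
    by (auto intro!: models_sum models_mult models_adj G(1)[rule_format] G'(1)[rule_format])
  moreover have "\<forall>\<^sub>F \<omega> in Fl. (\<Sum>l<s. G l \<omega> * adj (G' l \<omega>)) = T \<omega> * adj (T' \<omega>)"
    using G(2) G'(2) ev_fits1[OF G(1)]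
  proof eventually_elim
    case (elim \<omega>)
    have "G l \<omega> * unit_at \<omega> = G l \<omega>" if "l < s" for l
      using elim(3) that by (intro idm_mult_right) blast
    thus ?case using rowb_mult_adj[of s "\<lambda>l. G l \<omega>" "dm \<omega>" "\<lambda>l. G' l \<omega>"] elim by simp
  qed
  ultimately show ?thesis by (rule models_cong)
qed

lemma rmodels_mult_bmodels:
  assumes "rmodels b T" "bmodels u U"
  shows "rmodels (b * dd * u) (\<lambda>\<omega>. T \<omega> * U \<omega>)"
proof -
  obtain G where G: "\<forall>l<s. models (b * adj (a l)) (G l)"
    "\<forall>\<^sub>F \<omega> in Fl. T \<omega> = rowb s (dm \<omega>) (\<lambda>l. G l \<omega>)" using assms(1) by (rule rmodelsE)
  obtain F where F: "\<forall>l<s. \<forall>l'<s. models (a l * u * adj (a l')) (F l l')"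
    "\<forall>\<^sub>F \<omega> in Fl. U \<omega> = blk s (dm \<omega>) (\<lambda>l l'. F l l' \<omega>)" using assms(2) by (rule bmodelsE)
  have "models (b * dd * u * adj (a l')) (\<lambda>\<omega>. \<Sum>l<s. G l \<omega> * F l l' \<omega>)" if "l' < s" for l'
  proof -
    have "b * dd * u * adj (a l') = (\<Sum>l<s. (b * adj (a l)) * (a l * u * adj (a l')))"
      by (simp add: dd_def sum_distrib_left sum_distrib_right mult.assoc)
    thus ?thesis using that by (auto intro!: models_sum models_mult F(1)[rule_format] G(1)[rule_format])
  qed
  moreover have "\<forall>\<^sub>F \<omega> in Fl. T \<omega> * U \<omega> = rowb s (dm \<omega>) (\<lambda>l'. \<Sum>l<s. G l \<omega> * F l l' \<omega>)"
    using G(2) F(2) ev_fits1[OF G(1)]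
  proof eventually_elim
    case (elim \<omega>)
    have "G l \<omega> * unit_at \<omega> = G l \<omega>" if "l < s" for l
      using elim(3) that by (intro idm_mult_right) blast
    thus ?case using rowb_mult_blk[of s "\<lambda>l. G l \<omega>" "dm \<omega>" "\<lambda>l l'. F l l' \<omega>"] elim by simp
  qed
  ultimately show ?thesis using rmodels_P[OF assms(1)] bmodels_P[OF assms(2)] dd_P
    unfolding rmodels_def by (intro conjI exI[of _ "\<lambda>l' \<omega>. \<Sum>l<s. G l \<omega> * F l l' \<omega>"]) auto
qed

text \<open>The polynomials for the entries (l, l') and (l', l) are chosen independently, so the
  resulting matrix need not be self-adjoint; its self-adjoint part models u as well.\<close>

lemma bmodels_exist:
  assumes u: "u \<in> P" "adj u = u" and ex: "\<And>l l'. l < s \<Longrightarrow> l' < s \<Longrightarrow> \<exists>F. models (a l * u * adj (a l')) F"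
  obtains U where "bmodels u U" "\<And>\<omega>. adj (U \<omega>) = U \<omega>"
proof -
  from ex have "\<forall>l l'. \<exists>F. l < s \<longrightarrow> l' < s \<longrightarrow> models (a l * u * adj (a l')) F" by blast
  then obtain F where F: "\<And>l l'. l < s \<Longrightarrow> l' < s \<Longrightarrow> models (a l * u * adj (a l')) (F l l')"
    by metis
  define U0 where "U0 \<omega> = blk s (dm \<omega>) (\<lambda>l l'. F l l' \<omega>)" for \<omega>
  have U0: "bmodels u U0" unfolding bmodels_def
  proof (intro conjI u exI[of _ F] allI impI)
    show "\<forall>\<^sub>F \<omega> in Fl. U0 \<omega> = blk s (dm \<omega>) (\<lambda>l l'. F l l' \<omega>)" by (simp add: U0_def)
  qed (rule F)
  have half: "(1 / 2) \<star> (u + u) = u"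
    using cscale_add_left[of "1 / 2" "1 / 2" u] by (simp add: cscale_add_right)
  have "bmodels ((1 / 2) \<star> (u + adj u)) (\<lambda>\<omega>. (1 / 2) \<star> (U0 \<omega> + adj (U0 \<omega>)))"
    by (intro bmodels_cscale bmodels_add bmodels_adj U0)
  hence "bmodels u (\<lambda>\<omega>. (1 / 2) \<star> (U0 \<omega> + adj (U0 \<omega>)))" by (simp add: u half)
  thus thesis by (rule that) (simp add: adj_cscale adj_add add.commute)
qed

lemma rmodels_exist:
  assumes b: "b \<in> P" and ex: "\<And>l. l < s \<Longrightarrow> \<exists>F. models (b * adj (a l)) F"
  obtains T where "rmodels b T"
proof -
  from ex have "\<forall>l. \<exists>F. l < s \<longrightarrow> models (b * adj (a l)) F" by blast
  then obtain F where F: "\<And>l. l < s \<Longrightarrow> models (b * adj (a l)) (F l)" by metis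
  have "rmodels b (\<lambda>\<omega>. rowb s (dm \<omega>) (\<lambda>l. F l \<omega>))"
    unfolding rmodels_def by (intro conjI b exI[of _ F] allI impI F) auto
  thus thesis by (rule that)
qed

text \<open>A contraction in e N e has trace at most |e|^2, by Cauchy-Schwarz after inserting e on
  both sides. This is the bound, uniform in the power, that \<open>clip_family\<close> asks of the
  moments.\<close>

lemma trace_corner_bound:
  assumes "x \<in> P" "e * x = x" "bd 1 (x * y)" "y * e = y" "y \<in> P" "x * y * e = x * y"
  shows "cmod (\<tau> (x * y)) \<le> (nrm e)\<^sup>2"
proof -
  have "\<tau> (x * y) = \<tau> (e * (x * y * e))" using assms by (simp add: mult.assoc[symmetric])
  hence "cmod (\<tau> (x * y)) \<le> nrm e * nrm (x * y * e)"
    using Cauchy_Schwarz[of e "x * y * e"] assms e_P by simp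
  also have "\<dots> \<le> nrm e * (1 * nrm e)" using e_P by (intro mult_left_mono bdD assms) auto
  finally show ?thesis by (simp add: power2_eq_square)
qed

text \<open>The clipping f of the positive matrix Y Y gives f Y Y f norm at most 2, hence f Y norm
  at most 2, and Y' = f Y f. The raw Y is bounded too, but only by a constant depending on s; the
  bound 2 survives the passage to better approximations of e.\<close>

lemma clip_block:
  assumes Y: "bmodels y Y" "\<And>\<omega>. adj (Y \<omega>) = Y \<omega>" and y: "bd 1 y" "e * y = y" "y * e = y"
  obtains Y' where "\<And>\<omega>. adj (Y' \<omega>) = Y' \<omega>"
    "\<forall>\<^sub>F \<omega> in Fl. fits (s * dm \<omega>) (s * dm \<omega>) (Y' \<omega>) \<and> fm.bd 2 (Y' \<omega>)" "fm.asy kap Fl Y' Y"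
proof -
  have yP: "y \<in> P" using y(1) by (rule bd_P)
  \<comment> \<open>u k is modelled by the power k + 1 of Y Y, with \<open>dd\<close> inserted at
    every block product. Powers start at Y Y, which is a block model, so the k-th moment belongs to
    \<open>u (k - 1)\<close>.\<close>
  define u where "u k = ((\<lambda>x. (y * dd * y) * dd * x) ^^ k) (y * dd * y)" for k
  have u: "bmodels (u k) (\<lambda>\<omega>. ((\<lambda>T. (Y \<omega> * Y \<omega>) * T) ^^ k) (Y \<omega> * Y \<omega>))" for k
    unfolding u_def by (induction k) (auto intro!: bmodels_mult Y)
  have ubd: "bd 1 (u k) \<and> e * u k = u k \<and> u k * e = u k" for k
  proof -
    have yy: "bd 1 (y * dd * y)" using bd_mult[OF bd_mult[OF y(1) dd_bd1] y(1)] by simp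
    show ?thesis unfolding u_def
    proof (induction k)
      case 0
      have "e * (y * dd * y) = (e * y) * dd * y" by (simp only: mult.assoc)
      thus ?case using yy y by (simp add: mult.assoc)
    next
      case (Suc k)
      let ?T = "((\<lambda>x. (y * dd * y) * dd * x) ^^ k) (y * dd * y)"
      have "bd 1 ((y * dd * y) * dd * ?T)" using bd_mult[OF bd_mult[OF yy dd_bd1], of 1 ?T] Suc by simp
      moreover have "e * ((y * dd * y) * dd * ?T) = (e * y) * dd * y * dd * ?T" by (simp only: mult.assoc)
      ultimately show ?case using Suc y by (simp add: mult.assoc)
    qed
  qed
  have "\<exists>f. (\<forall>\<omega>. adj (f \<omega>) = f \<omega>) \<and> (\<forall>\<omega>. fm.bd 1 (f \<omega>)) \<and>
    (\<forall>\<^sub>F \<omega> in Fl. fits (s * dm \<omega>) (s * dm \<omega>) (f \<omega>) \<and> fm.bd 2 (f \<omega> * (Y \<omega> * Y \<omega>) * f \<omega>)) \<and>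
    fm.null kap Fl (\<lambda>\<omega>. f \<omega> - idm (s * dm \<omega>))"
  proof (rule clip_family[where E = "\<lambda>\<omega>. Y \<omega> * Y \<omega>" and N = "\<lambda>\<omega>. s * dm \<omega>" and Fl = Fl and \<kappa> = kap
        and C = "(nrm e)\<^sup>2" and c = "\<lambda>k. \<tau> (u (k - 1) * dd)"])
    show "0 \<le> kap \<omega>" for \<omega> by (rule kap_ge0)
    show "\<forall>\<^sub>F \<omega> in Fl. fits (s * dm \<omega>) (s * dm \<omega>) (Y \<omega> * Y \<omega>) \<and> adj (Y \<omega> * Y \<omega>) = Y \<omega> * Y \<omega> \<and>
        (\<forall>Z. 0 \<le> Re (Tr (adj Z * (Y \<omega> * Y \<omega>) * Z)))"
      using bmodels_fits[OF Y(1)]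
    proof eventually_elim
      case (elim \<omega>)
      have "0 \<le> Re (Tr (adj Z * (Y \<omega> * Y \<omega>) * Z))" for Z
        using fm.tr_pos[of "Y \<omega> * Z"] by (simp add: adj_mult Y(2) mult.assoc)
      thus ?case using elim by (auto simp: adj_mult Y(2) intro: fits_mult)
    qed
    fix k :: nat assume k: "0 < k"
    then obtain k' where k': "k = Suc k'" by (cases k) auto
    have "\<forall>\<^sub>F \<omega> in Fl. ((\<lambda>T. (Y \<omega> * Y \<omega>) * T) ^^ k') (Y \<omega> * Y \<omega>) = ((\<lambda>T. Y \<omega> * Y \<omega> * T) ^^ k) (idm (s * dm \<omega>))"
      using bmodels_fits[OF Y(1)]
    proof eventually_elim
      case (elim \<omega>)
      show ?case unfolding k' funpow_Suc_right using idm_mult_right[OF fits_mult[OF elim elim]] by simp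
    qed
    hence "\<forall>\<^sub>F \<omega> in Fl. Tr (((\<lambda>T. (Y \<omega> * Y \<omega>) * T) ^^ k') (Y \<omega> * Y \<omega>)) / of_real (kap \<omega>) =
        Tr (((\<lambda>T. Y \<omega> * Y \<omega> * T) ^^ k) (idm (s * dm \<omega>))) / of_real (kap \<omega>)"
      by eventually_elim simp
    from Lim_transform_eventually[OF bmodels_trace[OF u[of k']] this]
    show "((\<lambda>\<omega>. Tr (((\<lambda>T. Y \<omega> * Y \<omega> * T) ^^ k) (idm (s * dm \<omega>))) / of_real (kap \<omega>)) \<longlongrightarrow> \<tau> (u (k - 1) * dd)) Fl"
      by (simp add: k')
    have "bd 1 (u (k - 1) * dd)" using bd_mult[OF conjunct1[OF ubd[of "k - 1"]] dd_bd1] by simp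
    thus "cmod (\<tau> (u (k - 1) * dd)) \<le> (nrm e)\<^sup>2"
      using ubd[of "k - 1"] by (intro trace_corner_bound) (auto simp: mult.assoc dd_e dd_P bd_P)
  qed
  then obtain f where f: "\<And>\<omega>. adj (f \<omega>) = f \<omega>" "\<And>\<omega>. fm.bd 1 (f \<omega>)"
    "\<forall>\<^sub>F \<omega> in Fl. fits (s * dm \<omega>) (s * dm \<omega>) (f \<omega>) \<and> fm.bd 2 (f \<omega> * (Y \<omega> * Y \<omega>) * f \<omega>)"
    "fm.null kap Fl (\<lambda>\<omega>. f \<omega> - idm (s * dm \<omega>))"
    by auto
  define Y' where "Y' \<omega> = f \<omega> * Y \<omega> * f \<omega>" for \<omega>
  have bdY': "\<forall>\<^sub>F \<omega> in Fl. fits (s * dm \<omega>) (s * dm \<omega>) (Y' \<omega>) \<and> fm.bd 2 (Y' \<omega>)"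
    using f(3) bmodels_fits[OF Y(1)]
  proof eventually_elim
    case (elim \<omega>)
    have "adj (adj (f \<omega> * Y \<omega>)) * adj (f \<omega> * Y \<omega>) = f \<omega> * (Y \<omega> * Y \<omega>) * f \<omega>"
      by (simp add: adj_mult f(1) Y(2) mult.assoc)
    hence "fm.bd (2\<^sup>2) (adj (adj (f \<omega> * Y \<omega>)) * adj (f \<omega> * Y \<omega>))"
      using fm.bd_mono[of 2 "f \<omega> * (Y \<omega> * Y \<omega>) * f \<omega>" 4] elim(1) by simp
    hence "fm.bd 2 (adj (f \<omega> * Y \<omega>))" by (rule fm.bd_of_adj_mult[OF UNIV_I zero_le_numeral])
    from fm.bd_adj[OF this] have "fm.bd 2 (f \<omega> * Y \<omega>)" by simp
    from fm.bd_mult[OF this f(2)] show ?case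
      using fits_mult[OF fits_mult[OF conjunct1[OF elim(1)] elim(2)] conjunct1[OF elim(1)]]
      by (simp add: Y'_def)
  qed
  have bf: "fm.bnd Fl f" by (rule fm.bndI[of _ 1]) (auto simp: f(2))
  have "fm.null kap Fl (\<lambda>\<omega>. (f \<omega> - idm (s * dm \<omega>)) * (Y \<omega> * f \<omega>) + Y \<omega> * (f \<omega> - idm (s * dm \<omega>)))"
    by (rule fm.null_add[OF fm.null_mult_right[OF fm.bnd_mult[OF bmodels_bnd[OF Y(1)] bf] f(4)]
        fm.null_mult_left[OF bmodels_bnd[OF Y(1)] f(4)]])
  hence "fm.null kap Fl (\<lambda>\<omega>. Y' \<omega> - Y \<omega>)"
  proof (rule fm.null_cong)
    show "\<forall>\<^sub>F \<omega> in Fl. (f \<omega> - idm (s * dm \<omega>)) * (Y \<omega> * f \<omega>) + Y \<omega> * (f \<omega> - idm (s * dm \<omega>)) = Y' \<omega> - Y \<omega>"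
      using bmodels_fits[OF Y(1)]
      by eventually_elim
        (simp add: Y'_def left_diff_distrib right_diff_distrib mult.assoc[symmetric] idm_mult_left idm_mult_right)
  qed auto
  hence "fm.asy kap Fl Y' Y" by (simp add: fm.asy_def)
  moreover have "adj (Y' \<omega>) = Y' \<omega>" for \<omega> by (simp add: Y'_def adj_mult f(1) Y(2) mult.assoc)
  ultimately show thesis using bdY' by (intro that)
qed

text \<open>All rows are multiplied from the left by the same clipping f of the sum E of the T_j
  T_j^*, so that the new sum is f E f.\<close>

lemma clip_rows:
  assumes T: "\<And>j. j < r \<Longrightarrow> rmodels (b j) (T j)"
    and b: "bd 1 (\<Sum>j<r. b j * adj (b j))"
  obtains T' where "\<And>j. j < r \<Longrightarrow> \<forall>\<^sub>F \<omega> in Fl. fits (dm \<omega>) (s * dm \<omega>) (T' j \<omega>)"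
    "\<forall>\<^sub>F \<omega> in Fl. fm.bd 2 (\<Sum>j<r. T' j \<omega> * adj (T' j \<omega>))" "\<And>j. j < r \<Longrightarrow> fm.asy kap Fl (T' j) (T j)"
proof -
  define \<epsilon> where "\<epsilon> = (\<Sum>j<r. b j * dd * adj (b j))"
  define E where "E \<omega> = (\<Sum>j<r. T j \<omega> * adj (T j \<omega>))" for \<omega>
  have bP: "b j \<in> P" if "j < r" for j using rmodels_P[OF T[OF that]] .
  have mE: "models \<epsilon> E" unfolding \<epsilon>_def E_def
    by (intro models_sum rmodels_mult_adj T) auto
  have bde: "bd 1 \<epsilon>"
    unfolding \<epsilon>_def using bd_sandwich_sum[OF _ b _ b dd_bd1] bP by simp
  have pw: "bd 1 (((\<lambda>x. \<epsilon> * x) ^^ k) p)" for k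
  proof (induction k)
    case 0 show ?case using p con_bd by (simp add: tproj_def)
  next
    case (Suc k) thus ?case using bd_mult[OF bde] by fastforce
  qed
  have pw2: "p * ((\<lambda>x. \<epsilon> * x) ^^ k) p = ((\<lambda>x. \<epsilon> * x) ^^ k) p" for k
    using models_left[OF models_power[OF mE]] .
  have pw3: "((\<lambda>x. \<epsilon> * x) ^^ k) p * p = ((\<lambda>x. \<epsilon> * x) ^^ k) p" for k
    using models_right[OF models_power[OF mE]] .
  have "\<exists>f. (\<forall>\<omega>. adj (f \<omega>) = f \<omega>) \<and> (\<forall>\<omega>. fm.bd 1 (f \<omega>)) \<and>
    (\<forall>\<^sub>F \<omega> in Fl. fits (dm \<omega>) (dm \<omega>) (f \<omega>) \<and> fm.bd 2 (f \<omega> * E \<omega> * f \<omega>)) \<and>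
    fm.null kap Fl (\<lambda>\<omega>. f \<omega> - idm (dm \<omega>))"
  proof (rule clip_family[where E = E and N = dm and Fl = Fl and \<kappa> = kap and C = "(nrm p)\<^sup>2"
        and c = "\<lambda>k. \<tau> (((\<lambda>x. \<epsilon> * x) ^^ k) p)"])
    show "0 \<le> kap \<omega>" for \<omega> by (rule kap_ge0)
    show "\<forall>\<^sub>F \<omega> in Fl. fits (dm \<omega>) (dm \<omega>) (E \<omega>) \<and> adj (E \<omega>) = E \<omega> \<and> (\<forall>Z. 0 \<le> Re (Tr (adj Z * E \<omega> * Z)))"
      using models_fits[OF mE]
    proof eventually_elim
      case (elim \<omega>)
      have "0 \<le> Re (Tr (adj Z * E \<omega> * Z))" for Z
      proof -
        have "adj Z * E \<omega> * Z = (\<Sum>j<r. adj (adj (T j \<omega>) * Z) * (adj (T j \<omega>) * Z))"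
          by (simp add: E_def sum_distrib_left sum_distrib_right adj_mult mult.assoc)
        thus ?thesis using fm.tr_pos by (simp add: fm.tr_sum sum_nonneg)
      qed
      thus ?case using elim by (auto simp: E_def adj_sum adj_mult)
    qed
    fix k :: nat assume "0 < k"
    show "((\<lambda>\<omega>. Tr (((\<lambda>T. E \<omega> * T) ^^ k) (idm (dm \<omega>))) / of_real (kap \<omega>)) \<longlongrightarrow> \<tau> (((\<lambda>x. \<epsilon> * x) ^^ k) p)) Fl"
      by (rule models_trace[OF models_power[OF mE]])
    have "cmod (\<tau> (p * ((\<lambda>x. \<epsilon> * x) ^^ k) p)) \<le> nrm p * nrm (((\<lambda>x. \<epsilon> * x) ^^ k) p * p)"
      using Cauchy_Schwarz[of p "((\<lambda>x. \<epsilon> * x) ^^ k) p"] p_P bd_P[OF pw] by (simp add: pw3)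
    also have "\<dots> \<le> nrm p * (1 * nrm p)" using p_P by (intro mult_left_mono bdD[OF pw]) auto
    finally show "cmod (\<tau> (((\<lambda>x. \<epsilon> * x) ^^ k) p)) \<le> (nrm p)\<^sup>2" by (simp add: pw2 power2_eq_square)
  qed
  then obtain f where f: "\<And>\<omega>. adj (f \<omega>) = f \<omega>" "\<And>\<omega>. fm.bd 1 (f \<omega>)"
    "\<forall>\<^sub>F \<omega> in Fl. fits (dm \<omega>) (dm \<omega>) (f \<omega>) \<and> fm.bd 2 (f \<omega> * E \<omega> * f \<omega>)"
    "fm.null kap Fl (\<lambda>\<omega>. f \<omega> - idm (dm \<omega>))"
    by auto
  show thesis
  proof (rule that[of "\<lambda>j \<omega>. f \<omega> * T j \<omega>"])
    fix j assume j: "j < r"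
    show "\<forall>\<^sub>F \<omega> in Fl. fits (dm \<omega>) (s * dm \<omega>) (f \<omega> * T j \<omega>)"
      using f(3) rmodels_fits[OF T[OF j]] by eventually_elim (auto intro: fits_mult)
    have "fm.null kap Fl (\<lambda>\<omega>. (f \<omega> - idm (dm \<omega>)) * T j \<omega>)"
      by (rule fm.null_mult_right[OF rmodels_bnd[OF T[OF j]] f(4)])
    hence "fm.null kap Fl (\<lambda>\<omega>. f \<omega> * T j \<omega> - T j \<omega>)"
    proof (rule fm.null_cong)
      show "\<forall>\<^sub>F \<omega> in Fl. (f \<omega> - idm (dm \<omega>)) * T j \<omega> = f \<omega> * T j \<omega> - T j \<omega>"
        using rmodels_fits[OF T[OF j]] by eventually_elim (simp add: left_diff_distrib idm_mult_left)
    qed auto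
    thus "fm.asy kap Fl (\<lambda>\<omega>. f \<omega> * T j \<omega>) (T j)" by (simp add: fm.asy_def)
  next
    show "\<forall>\<^sub>F \<omega> in Fl. fm.bd 2 (\<Sum>j<r. f \<omega> * T j \<omega> * adj (f \<omega> * T j \<omega>))"
      using f(3)
    proof eventually_elim
      case (elim \<omega>)
      have "(\<Sum>j<r. f \<omega> * T j \<omega> * adj (f \<omega> * T j \<omega>)) = f \<omega> * E \<omega> * f \<omega>"
        by (simp add: E_def adj_mult f(1) sum_distrib_left sum_distrib_right mult.assoc)
      thus ?case using elim by simp
    qed
  qed
qed

end

section \<open>Assembling the data for one approximation of the unit\<close>

lemma (in tracial) asy_wd:
  assumes "\<And>k. k \<in> set w \<Longrightarrow> asy \<kappa> Fl (V k) (V' k) \<and> bnd Fl (V k) \<and> bnd Fl (V' k)"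
    and "asy \<kappa> Fl F F'" "bnd Fl F" "bnd Fl F'"
  shows "asy \<kappa> Fl (\<lambda>\<omega>. wd (\<lambda>k. V k \<omega>) (F \<omega>) w) (\<lambda>\<omega>. wd (\<lambda>k. V' k \<omega>) (F' \<omega>) w) \<and>
    bnd Fl (\<lambda>\<omega>. wd (\<lambda>k. V k \<omega>) (F \<omega>) w) \<and> bnd Fl (\<lambda>\<omega>. wd (\<lambda>k. V' k \<omega>) (F' \<omega>) w)"
  using assms(1)
proof (induction w)
  case Nil
  thus ?case using assms by simp
next
  case (Cons k w)
  have "asy \<kappa> Fl (V k) (V' k) \<and> bnd Fl (V k) \<and> bnd Fl (V' k)" using Cons.prems by simp
  moreover have "asy \<kappa> Fl (\<lambda>\<omega>. wd (\<lambda>k. V k \<omega>) (F \<omega>) w) (\<lambda>\<omega>. wd (\<lambda>k. V' k \<omega>) (F' \<omega>) w) \<and>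
    bnd Fl (\<lambda>\<omega>. wd (\<lambda>k. V k \<omega>) (F \<omega>) w) \<and> bnd Fl (\<lambda>\<omega>. wd (\<lambda>k. V' k \<omega>) (F' \<omega>) w)"
    by (rule Cons.IH) (use Cons.prems in simp)
  ultimately show ?case by (auto intro: asy_mult bnd_mult)
qed

definition rp :: "'a::complex_star_algebra \<Rightarrow> 'a" where
  "rp u = (1 / 2) \<star> (u + adj u)"

lemma adj_rp: "adj (rp u) = rp u"
  by (simp add: rp_def adj_cscale adj_add add.commute)

lemma rp_sandwich: "adj v * rp u * v = rp (adj v * u * v)"
  by (simp add: rp_def cscale_mult_left cscale_mult_right adj_mult distrib_left distrib_right mult.assoc)

lemma rp_parts: "rp u + \<i> \<star> rp ((- \<i>) \<star> u) = u"
proof -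
  have "\<i> \<star> rp ((- \<i>) \<star> u) = (1 / 2) \<star> u + (- (1 / 2)) \<star> adj u"
    by (simp add: rp_def adj_cscale cscale_add_right cscale_cscale)
  hence "rp u + \<i> \<star> rp ((- \<i>) \<star> u) = ((1 / 2) \<star> u + (1 / 2) \<star> u) + ((1 / 2) \<star> adj u + (- (1 / 2)) \<star> adj u)"
    by (simp add: rp_def cscale_add_right)
  also have "\<dots> = u" by (simp only: cscale_add_left[symmetric]) simp
  finally show ?thesis .
qed

lemma (in linked) rp_sac:
  assumes q: "tproj q" and u: "con u" "q * u = u" "u * q = u" shows "rp u \<in> sac q"
proof -
  have aq: "adj q = q" using q by (simp add: tproj_def)
  have "q * adj u = adj u" "adj u * q = adj u"
    using arg_cong[OF u(2), of adj] arg_cong[OF u(3), of adj] by (simp_all add: adj_mult aq)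
  thus ?thesis using u con_avg[OF u(1) con_adj[OF u(1)]]
    by (simp add: sac_def adj_rp)
      (simp add: rp_def cscale_mult_left cscale_mult_right distrib_left distrib_right)
qed

lemma (in tracial) bd_rp: assumes "bd c u" shows "bd c (rp u)"
proof -
  have "bd (cmod (1 / 2) * (c + c)) (rp u)"
    unfolding rp_def by (intro bd_cscale bd_add bd_adj assms)
  thus ?thesis by (simp add: norm_divide)
qed

lemma (in tracial) asy_rp: "asy \<kappa> Fl F G \<Longrightarrow> asy \<kappa> Fl (\<lambda>\<omega>. rp (F \<omega>)) (\<lambda>\<omega>. rp (G \<omega>))"
  unfolding rp_def by (intro asy_cscale asy_add asy_adj)

lemma fits_rp: "fits n n F \<Longrightarrow> fits n n (rp F)"
  unfolding rp_def by (intro fits_cscale fits_add fits_adj)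

text \<open>The index \<open>d\<close> stands for the unit.\<close>

definition xmat :: "nat \<Rightarrow> nat \<Rightarrow> state \<Rightarrow> finmat" where
  "xmat d q \<omega> = (if q < d then coord \<omega> q else unit_at \<omega>)"

lemma (in blocks) bmodels_rp: "bmodels u U \<Longrightarrow> bmodels (rp u) (\<lambda>\<omega>. rp (U \<omega>))"
  unfolding rp_def by (intro bmodels_cscale bmodels_add bmodels_adj)

type_synonym stage = "(state \<Rightarrow> finmat) \<times> (state \<Rightarrow> finmat) \<times> (nat \<Rightarrow> state \<Rightarrow> finmat) \<times> (nat \<Rightarrow> state \<Rightarrow> finmat)"

text \<open>Parts of \<open>b\<^sub>j\<^sup>* x\<^sub>q b\<^sub>j'\<close>; with \<open>c = 1 / 8\<close> and \<open>c = - \<i> / 8\<close> they are contractions even when \<open>b\<close> and \<open>x\<close>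
  are replaced by matrices of norm at most 2.\<close>

definition compressed_letter ::
  "(nat \<Rightarrow> 'b::complex_star_algebra) \<Rightarrow> (nat \<Rightarrow> 'b) \<Rightarrow> nat \<times> nat \<times> nat \<times> complex \<Rightarrow> 'b" where
  "compressed_letter b x = (\<lambda>(j, j', q, c). rp (c \<star> (adj (b j) * x q * b j')))"

text \<open>What is kept for a fixed family a: H models e as the block matrix of the a_l a_l'^*, H'
  is H clipped at 2, K t models the t-th letter of v' and T j the row of b_j. H is the matrix to be
  rounded to a projection, H' serves in products because its bound does not depend on s. Limits are
  stated in \<open>gram a s\<close>, which tends to e later. The letters belonging to ks are equal,
  not only asymptotic, to expressions in T and the microstate, since the covering argument reads
  products off from them exactly.\<close>

definition (in linked) stage_ok ::
  "'a \<Rightarrow> 'a list \<Rightarrow> 'a \<Rightarrow> (nat \<Rightarrow> 'a) \<Rightarrow> nat \<Rightarrow> (nat \<Rightarrow> 'a) \<Rightarrow> nat \<Rightarrow> nat \<Rightarrow> (nat \<times> nat \<times> nat \<times> complex) list \<Rightarrow>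
     'a list \<Rightarrow> stage \<Rightarrow> bool" where
  "stage_ok p v e a s b r d ks v' = (\<lambda>(H, H', K, T).
     (\<forall>\<omega>. adj (H \<omega>) = H \<omega>) \<and>
     (\<forall>\<^sub>F \<omega> in mfilter p v. fits (s * dm \<omega>) (s * dm \<omega>) (H \<omega>)) \<and>
     (\<forall>\<^sub>F \<omega> in mfilter p v. fits (s * dm \<omega>) (s * dm \<omega>) (H' \<omega>) \<and> fm.bd 2 (H' \<omega>)) \<and>
     fm.asy (kapp p) (mfilter p v) H' H \<and>
     ((\<lambda>\<omega>. fm.nrm (H \<omega> * H \<omega> - H \<omega>) / sqrt \<bar>kapp p \<omega>\<bar>) \<longlongrightarrow>
       sqrt (Re (\<tau> ((gram a s - e) * gram a s * (gram a s - e) * gram a s)))) (mfilter p v) \<and>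
     ((\<lambda>\<omega>. Tr (H \<omega> * H \<omega>) / of_real (kapp p \<omega>)) \<longlongrightarrow> \<tau> (gram a s * gram a s)) (mfilter p v) \<and>
     (\<forall>t<length v'. (\<forall>\<omega>. adj (K t \<omega>) = K t \<omega>) \<and>
       (\<forall>\<^sub>F \<omega> in mfilter p v. fits (s * dm \<omega>) (s * dm \<omega>) (K t \<omega>) \<and> fm.bd 2 (K t \<omega>))) \<and>
     (\<forall>w. set w \<subseteq> {..<length v'} \<longrightarrow>
       ((\<lambda>\<omega>. Tr (wd (\<lambda>t. H' \<omega> * K t \<omega>) (H' \<omega>) w * H' \<omega>) / of_real (kapp p \<omega>)) \<longlongrightarrow>
         \<tau> (wd (\<lambda>t. e * gram a s * v' ! t * gram a s) e w * gram a s * e * gram a s)) (mfilter p v)) \<and>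
     (\<forall>j<r. \<forall>\<^sub>F \<omega> in mfilter p v. fits (dm \<omega>) (s * dm \<omega>) (T j \<omega>)) \<and>
     (\<forall>\<^sub>F \<omega> in mfilter p v. fm.bd 2 (\<Sum>j<r. T j \<omega> * adj (T j \<omega>))) \<and>
     ((\<lambda>\<omega>. fm.nrm ((\<Sum>j<r. T j \<omega> * H' \<omega> * adj (T j \<omega>)) - unit_at \<omega>) / sqrt \<bar>kapp p \<omega>\<bar>) \<longlongrightarrow>
       nrm ((\<Sum>j<r. b j * gram a s * e * gram a s * adj (b j)) - p)) (mfilter p v) \<and>
     (\<forall>t<length ks. \<forall>\<omega>. K t \<omega> = compressed_letter (\<lambda>j. T j \<omega>) (\<lambda>q. xmat d q \<omega>) (ks ! t)))"

lemma diff_diff_diff: "(x - u) - (y - u) = x - y" for x y u :: "'a::ab_group_add"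
  by simp

lemma choice_below: "(\<And>k::nat. k < N \<Longrightarrow> \<exists>y. R k y) \<Longrightarrow> \<exists>y. \<forall>k<N. R k (y k)"
  by metis

lemma (in tracial) bnd_row:
  fixes r j :: nat
  assumes bd: "\<forall>\<^sub>F \<omega> in Fl. bd 2 (\<Sum>j<r. T j \<omega> * adj (T j \<omega>))" and P: "\<And>j \<omega>. T j \<omega> \<in> P" and j: "j < r"
  shows "\<forall>\<^sub>F \<omega> in Fl. bd 2 (T j \<omega>)" "bnd Fl (T j)"
proof -
  show 1: "\<forall>\<^sub>F \<omega> in Fl. bd 2 (T j \<omega>)"
    using bd
  proof eventually_elim
    case (elim \<omega>)
    show ?case by (rule bd_row_element[of "{..<r}" j "\<lambda>j. T j \<omega>"]) (use P j elim in simp_all)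
  qed
  show "bnd Fl (T j)" by (rule bndI[OF P 1])
qed

lemma (in blocks) xmat_bd:
  assumes "d \<le> length v" shows "\<forall>\<^sub>F \<omega> in Fl. fits (dm \<omega>) (dm \<omega>) (xmat d q \<omega>) \<and> fm.bd 2 (xmat d q \<omega>)"
  using ev_coord
proof eventually_elim
  case (elim \<omega>)
  show ?case
  proof (cases "q < d")
    case True thus ?thesis using elim assms by (auto simp: xmat_def)
  next
    case False thus ?thesis using fm.bd_mono[OF bd_idm[of "dm \<omega>"], of 2] by (simp add: xmat_def fits_diagm)
  qed
qed

text \<open>The hypotheses \<open>ex\<close> say that the entries of all block matrices and rows are
  polynomials in v; v will contain their real and imaginary parts. Everything is then modelled
  entrywise and clipped.\<close>

lemma (in blocks) stage_exists:
  assumes v': "set v' \<subseteq> sac e" and d: "d \<le> length v"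
    and x: "\<And>q. q \<le> d \<Longrightarrow> models (x q) (xmat d q)"
    and b: "\<And>j. con (b j)" "bd 1 (\<Sum>j<r. b j * adj (b j))"
    and ex: "\<And>l l'. l < s \<Longrightarrow> l' < s \<Longrightarrow> \<exists>F. models (a l * adj (a l')) F"
      "\<And>k l l'. k < length v' \<Longrightarrow> l < s \<Longrightarrow> l' < s \<Longrightarrow> \<exists>F. models (a l * v' ! k * adj (a l')) F"
      "\<And>j l. j < r \<Longrightarrow> l < s \<Longrightarrow> \<exists>F. models (b j * adj (a l)) F"
    and ks: "length ks \<le> length v'" "\<And>t. t < length ks \<Longrightarrow> v' ! t = compressed_letter b x (ks ! t)"
      "\<And>j j' q c. (j, j', q, c) \<in> set ks \<Longrightarrow> j < r \<and> j' < r \<and> q \<le> d \<and> cmod c \<le> 1 / 8"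
  shows "\<exists>S. stage_ok p v e a s b r d ks v' S"
proof -
  have ee: "e * e = e" "adj e = e" "bd 1 e" using e con_bd by (auto simp: tproj_def)
  obtain H where H: "bmodels e H" "\<And>\<omega>. adj (H \<omega>) = H \<omega>"
  proof (rule bmodels_exist)
    show "\<exists>F. models (a l * e * adj (a l')) F" if "l < s" "l' < s" for l l'
      using ex(1)[OF that] by (simp add: a(3))
  qed (use e_P ee in auto)
  obtain H' where H': "\<And>\<omega>. adj (H' \<omega>) = H' \<omega>"
    "\<forall>\<^sub>F \<omega> in Fl. fits (s * dm \<omega>) (s * dm \<omega>) (H' \<omega>) \<and> fm.bd 2 (H' \<omega>)" "fm.asy kap Fl H' H"
    by (rule clip_block[OF H]) (use ee in auto)
  have v'k: "bd 1 (v' ! k) \<and> e * v' ! k = v' ! k \<and> v' ! k * e = v' ! k \<and> adj (v' ! k) = v' ! k" if "k < length v'" for k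
    using v' nth_mem[OF that] con_bd by (auto simp: sac_def)
  have "\<exists>Y. (\<forall>\<omega>. adj (Y \<omega>) = Y \<omega>) \<and> (\<forall>\<^sub>F \<omega> in Fl. fits (s * dm \<omega>) (s * dm \<omega>) (Y \<omega>) \<and> fm.bd 2 (Y \<omega>)) \<and>
      (\<exists>Y0. bmodels (v' ! k) Y0 \<and> fm.asy kap Fl Y Y0)" if k: "k < length v'" for k
  proof -
    obtain Y0 where Y0: "bmodels (v' ! k) Y0" "\<And>\<omega>. adj (Y0 \<omega>) = Y0 \<omega>"
      by (rule bmodels_exist[of "v' ! k", OF bd_P]) (use v'k[OF k] ex(2)[OF k] in blast)+
    obtain Y where "\<And>\<omega>. adj (Y \<omega>) = Y \<omega>"
      "\<forall>\<^sub>F \<omega> in Fl. fits (s * dm \<omega>) (s * dm \<omega>) (Y \<omega>) \<and> fm.bd 2 (Y \<omega>)" "fm.asy kap Fl Y Y0"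
      by (rule clip_block[OF Y0]) (use v'k[OF k] in blast)+
    thus ?thesis using Y0(1) by (intro exI[of _ Y] conjI exI[of _ Y0]) auto
  qed
  from choice_below[OF this] obtain Y where "\<forall>k<length v'. (\<forall>\<omega>. adj (Y k \<omega>) = Y k \<omega>) \<and>
      (\<forall>\<^sub>F \<omega> in Fl. fits (s * dm \<omega>) (s * dm \<omega>) (Y k \<omega>) \<and> fm.bd 2 (Y k \<omega>)) \<and>
      (\<exists>Y0. bmodels (v' ! k) Y0 \<and> fm.asy kap Fl (Y k) Y0)" ..
  note Y = this[rule_format]
  have "\<exists>T. rmodels (b j) T" if j: "j < r" for j
    by (rule rmodels_exist[of "b j", OF con_P[OF b(1)] ex(3)[OF j]]) blast+
  from choice_below[OF this] obtain T0 where "\<forall>j<r. rmodels (b j) (T0 j)" ..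
  note T0 = this[rule_format]
  obtain T where T: "\<And>j. j < r \<Longrightarrow> \<forall>\<^sub>F \<omega> in Fl. fits (dm \<omega>) (s * dm \<omega>) (T j \<omega>)"
    "\<forall>\<^sub>F \<omega> in Fl. fm.bd 2 (\<Sum>j<r. T j \<omega> * adj (T j \<omega>))" "\<And>j. j < r \<Longrightarrow> fm.asy kap Fl (T j) (T0 j)"
    by (rule clip_rows[OF T0 b(2)]) blast+
  note Tb = fm.bnd_row[OF T(2) UNIV_I]
  \<comment> \<open>Letters belonging to ks are built from the clipped rows and not clipped on their
    own, which would destroy the exact formula. Their norm is under control anyway: |c| is at most
    1/8 and the three factors have norm at most 2.\<close>
  define K where "K t \<omega> = (if t < length ks then compressed_letter (\<lambda>j. T j \<omega>) (\<lambda>q. xmat d q \<omega>) (ks ! t) else Y t \<omega>)" for t \<omega>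
  have K: "(\<forall>\<omega>. adj (K t \<omega>) = K t \<omega>) \<and> (\<forall>\<^sub>F \<omega> in Fl. fits (s * dm \<omega>) (s * dm \<omega>) (K t \<omega>) \<and> fm.bd 2 (K t \<omega>)) \<and>
      (\<exists>Y0. bmodels (v' ! t) Y0 \<and> fm.asy kap Fl (K t) Y0)" if t: "t < length v'" for t
  proof (cases "t < length ks")
    case False
    hence "K t = Y t" by (simp add: K_def fun_eq_iff)
    thus ?thesis using Y[OF t] by simp
  next
    case True
    obtain j j' q c where kt: "ks ! t = (j, j', q, c)" by (cases "ks ! t") auto
    have jq: "j < r" "j' < r" "q \<le> d" "cmod c \<le> 1 / 8" using ks(3)[of j j' q c] nth_mem[OF True] kt by auto
    have Kt: "K t = (\<lambda>\<omega>. rp (c \<star> (adj (T j \<omega>) * xmat d q \<omega> * T j' \<omega>)))"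
      by (simp add: fun_eq_iff K_def True compressed_letter_def kt)
    have "\<forall>\<^sub>F \<omega> in Fl. fits (s * dm \<omega>) (s * dm \<omega>) (K t \<omega>) \<and> fm.bd 2 (K t \<omega>)"
      using Tb(1)[OF jq(1)] Tb(1)[OF jq(2)] T(1)[OF jq(1)] T(1)[OF jq(2)] xmat_bd[OF d, of q]
    proof eventually_elim
      case (elim \<omega>)
      have "fm.bd (cmod c * (2 * 2 * 2)) (c \<star> (adj (T j \<omega>) * xmat d q \<omega> * T j' \<omega>))"
        by (intro fm.bd_cscale fm.bd_mult fm.bd_adj) (use elim in auto)
      hence "fm.bd 2 (c \<star> (adj (T j \<omega>) * xmat d q \<omega> * T j' \<omega>))" by (rule fm.bd_mono) (use jq(4) in simp)
      moreover have "fits (s * dm \<omega>) (s * dm \<omega>) (c \<star> (adj (T j \<omega>) * xmat d q \<omega> * T j' \<omega>))"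
        using fits_mult[OF fits_mult[OF fits_adj[OF elim(3)] conjunct1[OF elim(5)]] elim(4)] by (rule fits_cscale)
      ultimately show ?case by (simp add: Kt fits_rp fm.bd_rp)
    qed
    moreover have "bmodels (v' ! t) (\<lambda>\<omega>. rp (c \<star> (adj (T0 j \<omega>) * xmat d q \<omega> * T0 j' \<omega>)))"
      using bmodels_rp[OF bmodels_cscale[OF rmodels_adj_mult[OF T0[OF jq(1)] T0[OF jq(2)] x[OF jq(3)]]]] ks(2)[OF True]
      by (simp add: compressed_letter_def kt)
    moreover have "fm.asy kap Fl (K t) (\<lambda>\<omega>. rp (c \<star> (adj (T0 j \<omega>) * xmat d q \<omega> * T0 j' \<omega>)))"
    proof -
      have bx: "fm.bnd Fl (xmat d q)" by (rule fm.bndI[of _ 2]) (use xmat_bd[OF d, of q] in \<open>auto elim: eventually_mono\<close>)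
      show ?thesis unfolding Kt
        by (intro fm.asy_rp fm.asy_cscale fm.asy_mult fm.asy_adj T(3) jq fm.asy_refl fm.bnd_mult fm.bnd_adj bx
            rmodels_bnd[OF T0] Tb(2)) auto
    qed
    ultimately show ?thesis by (auto simp: Kt adj_rp)
  qed
  from choice_below[OF conjunct2[OF conjunct2[OF this]]]
  obtain K0 where "\<forall>t<length v'. bmodels (v' ! t) (K0 t) \<and> fm.asy kap Fl (K t) (K0 t)" ..
  note K0 = this[rule_format]
  have bH': "fm.bnd Fl H'" by (rule fm.bndI[of _ 2]) (use H'(2) in \<open>auto elim: eventually_mono\<close>)
  have bK: "fm.bnd Fl (K t)" if "t < length v'" for t
    by (rule fm.bndI[of _ 2]) (use K[OF that] in \<open>auto elim: eventually_mono\<close>)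
  have dde: "e * dd * e = dd" by (simp add: mult.assoc dd_e)
  show ?thesis
  proof (rule exI[of _ "(H, H', K, T)"], unfold stage_ok_def prod.case, intro conjI allI impI)
    show "adj (H \<omega>) = H \<omega>" for \<omega> by (rule H)
    show "\<forall>\<^sub>F \<omega> in Fl. fits (s * dm \<omega>) (s * dm \<omega>) (H \<omega>)" by (rule bmodels_fits[OF H(1)])
    show "\<forall>\<^sub>F \<omega> in Fl. fits (s * dm \<omega>) (s * dm \<omega>) (H' \<omega>) \<and> fm.bd 2 (H' \<omega>)" "fm.asy kap Fl H' H" by (rule H')+
    have adj_u: "adj (dd - e) = dd - e" by (simp add: adj_diff adj_dd ee)
    have "bmodels (dd - e) (\<lambda>\<omega>. H \<omega> * H \<omega> - H \<omega>)"
      using bmodels_diff[OF bmodels_mult[OF H(1) H(1)] H(1)] by (simp add: dde)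
    from bmodels_nrm[OF this]
    show "((\<lambda>\<omega>. fm.nrm (H \<omega> * H \<omega> - H \<omega>) / sqrt \<bar>kap \<omega>\<bar>) \<longlongrightarrow> sqrt (Re (\<tau> ((dd - e) * dd * (dd - e) * dd)))) Fl"
      by (simp only: adj_u)
    show "((\<lambda>\<omega>. Tr (H \<omega> * H \<omega>) / of_real (kap \<omega>)) \<longlongrightarrow> \<tau> (dd * dd)) Fl"
      using bmodels_trace[OF bmodels_mult[OF H(1) H(1)]] by (simp only: dde)
    show "adj (K t \<omega>) = K t \<omega>" if "t < length v'" for t \<omega> using K[OF that] by blast
    show "\<forall>\<^sub>F \<omega> in Fl. fits (s * dm \<omega>) (s * dm \<omega>) (K t \<omega>) \<and> fm.bd 2 (K t \<omega>)" if "t < length v'" for t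
      using K[OF that] by blast
    show "\<forall>\<^sub>F \<omega> in Fl. fits (dm \<omega>) (s * dm \<omega>) (T j \<omega>)" if "j < r" for j by (rule T(1)[OF that])
    show "\<forall>\<^sub>F \<omega> in Fl. fm.bd 2 (\<Sum>j<r. T j \<omega> * adj (T j \<omega>))" by (rule T(2))
    show "K t \<omega> = compressed_letter (\<lambda>j. T j \<omega>) (\<lambda>q. xmat d q \<omega>) (ks ! t)" if "t < length ks" for t \<omega>
      using that by (simp add: K_def)
  next
    fix w assume w: "set w \<subseteq> {..<length v'}"
    have m: "bmodels (wd (\<lambda>t. e * dd * v' ! t * dd) e w) (\<lambda>\<omega>. wd (\<lambda>t. H \<omega> * K0 t \<omega>) (H \<omega>) w)"
      using w by (induction w) (auto intro!: bmodels_mult H(1) K0[THEN conjunct1])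
    have a: "fm.asy kap Fl (\<lambda>\<omega>. wd (\<lambda>t. H' \<omega> * K t \<omega>) (H' \<omega>) w) (\<lambda>\<omega>. wd (\<lambda>t. H \<omega> * K0 t \<omega>) (H \<omega>) w)"
    proof (rule fm.asy_wd[THEN conjunct1])
      fix t assume "t \<in> set w"
      hence t: "t < length v'" using w by auto
      show "fm.asy kap Fl (\<lambda>\<omega>. H' \<omega> * K t \<omega>) (\<lambda>\<omega>. H \<omega> * K0 t \<omega>) \<and> fm.bnd Fl (\<lambda>\<omega>. H' \<omega> * K t \<omega>) \<and> fm.bnd Fl (\<lambda>\<omega>. H \<omega> * K0 t \<omega>)"
        using K0[OF t] by (intro conjI fm.asy_mult fm.bnd_mult H'(3) bH' bK[OF t] bmodels_bnd[OF H(1)] bmodels_bnd) auto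
    qed (use H'(3) bH' bmodels_bnd[OF H(1)] in auto)
    show "((\<lambda>\<omega>. Tr (wd (\<lambda>t. H' \<omega> * K t \<omega>) (H' \<omega>) w * H' \<omega>) / of_real (kap \<omega>)) \<longlongrightarrow>
        \<tau> (wd (\<lambda>t. e * dd * v' ! t * dd) e w * dd * e * dd)) Fl"
      by (rule fm.trace_asy_limit[OF a H'(3) bmodels_sbd[OF m] fm.sbd_asy[OF H'(3) bmodels_sbd[OF H(1)]]])
        (rule bmodels_trace[OF bmodels_mult[OF m H(1)]])
  next
    have m: "models ((\<Sum>j<r. b j * dd * e * dd * adj (b j)) - p) (\<lambda>\<omega>. (\<Sum>j<r. T0 j \<omega> * H \<omega> * adj (T0 j \<omega>)) - unit_at \<omega>)"
      by (intro models_diff models_sum models_unit rmodels_mult_adj rmodels_mult_bmodels T0 H(1)) auto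
    have null: "fm.null kap Fl (\<lambda>\<omega>. (\<Sum>j<r. T j \<omega> * H' \<omega> * adj (T j \<omega>)) - (\<Sum>j<r. T0 j \<omega> * H \<omega> * adj (T0 j \<omega>)))"
    proof -
      have "fm.asy kap Fl (\<lambda>\<omega>. T j \<omega> * H' \<omega> * adj (T j \<omega>)) (\<lambda>\<omega>. T0 j \<omega> * H \<omega> * adj (T0 j \<omega>))" if j: "j < r" for j
        by (intro fm.asy_mult fm.asy_adj fm.bnd_mult fm.bnd_adj T(3)[OF j] H'(3) bH' bmodels_bnd[OF H(1)]
          rmodels_bnd[OF T0[OF j]] Tb(2)[OF j])
      hence "fm.asy kap Fl (\<lambda>\<omega>. \<Sum>j<r. T j \<omega> * H' \<omega> * adj (T j \<omega>)) (\<lambda>\<omega>. \<Sum>j<r. T0 j \<omega> * H \<omega> * adj (T0 j \<omega>))"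
        by (intro fm.asy_sum) simp
      thus ?thesis unfolding fm.asy_def by (elim conjE)
    qed
    have "fm.asy kap Fl (\<lambda>\<omega>. (\<Sum>j<r. T j \<omega> * H' \<omega> * adj (T j \<omega>)) - unit_at \<omega>) (\<lambda>\<omega>. (\<Sum>j<r. T0 j \<omega> * H \<omega> * adj (T0 j \<omega>)) - unit_at \<omega>)"
      using null unfolding fm.asy_def by (simp only: diff_diff_diff UNIV_I simp_thms)
    from fm.nrm_asy_limit[OF this models_nrm[OF m]]
    show "((\<lambda>\<omega>. fm.nrm ((\<Sum>j<r. T j \<omega> * H' \<omega> * adj (T j \<omega>)) - unit_at \<omega>) / sqrt \<bar>kap \<omega>\<bar>) \<longlongrightarrow>
       nrm ((\<Sum>j<r. b j * dd * e * dd * adj (b j)) - p)) Fl" .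
  qed
qed

section \<open>Compression of microstates\<close>

text \<open>Limits along \<open>iter F\<close> are iterated limits: the size of the microstates tends to infinity for a fixed
  approximation \<open>i\<close> of the unit, and then the approximation improves.\<close>

definition iter :: "(nat \<Rightarrow> 'w filter) \<Rightarrow> (nat \<times> 'w) filter" where
  "iter F = Abs_filter (\<lambda>Q. \<forall>\<^sub>F i in sequentially. \<forall>\<^sub>F \<omega> in F i. Q (i, \<omega>))"

lemma eventually_iter:
  fixes Q :: "nat \<times> 'w \<Rightarrow> bool"
  shows "eventually Q (iter F) \<longleftrightarrow> (\<forall>\<^sub>F i in sequentially. \<forall>\<^sub>F \<omega> in F i. Q (i, \<omega>))"
  unfolding iter_def
proof (rule eventually_Abs_filter, rule is_filter.intro)
  show "\<forall>\<^sub>F i in sequentially. \<forall>\<^sub>F \<omega> in F i. True" by simp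
next
  fix Q R :: "nat \<times> 'w \<Rightarrow> bool"
  assume "\<forall>\<^sub>F i in sequentially. \<forall>\<^sub>F \<omega> in F i. Q (i, \<omega>)" "\<forall>\<^sub>F i in sequentially. \<forall>\<^sub>F \<omega> in F i. R (i, \<omega>)"
  thus "\<forall>\<^sub>F i in sequentially. \<forall>\<^sub>F \<omega> in F i. Q (i, \<omega>) \<and> R (i, \<omega>)"
    by eventually_elim (auto elim: eventually_elim2)
next
  fix Q R :: "nat \<times> 'w \<Rightarrow> bool"
  assume "\<forall>z. Q z \<longrightarrow> R z" "\<forall>\<^sub>F i in sequentially. \<forall>\<^sub>F \<omega> in F i. Q (i, \<omega>)"
  thus "\<forall>\<^sub>F i in sequentially. \<forall>\<^sub>F \<omega> in F i. R (i, \<omega>)"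
    by (auto elim!: eventually_mono)
qed

lemma eventually_iterI: "(\<And>i. \<forall>\<^sub>F \<omega> in F i. Q (i, \<omega>)) \<Longrightarrow> eventually Q (iter F)"
  by (simp add: eventually_iter)

lemma tendsto_iter:
  fixes l :: "'b::metric_space"
  assumes g: "\<And>i. ((\<lambda>\<omega>. g (i, \<omega>)) \<longlongrightarrow> L i) (F i)" and L: "L \<longlonglongrightarrow> l"
  shows "(g \<longlongrightarrow> l) (iter F)"
proof (rule tendstoI)
  fix \<epsilon> :: real assume \<epsilon>: "0 < \<epsilon>"
  have "\<forall>\<^sub>F i in sequentially. dist (L i) l < \<epsilon> / 2" using \<epsilon> by (intro tendstoD[OF L]) simp
  thus "\<forall>\<^sub>F z in iter F. dist (g z) l < \<epsilon>"
    unfolding eventually_iter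
  proof eventually_elim
    case (elim i)
    have "\<forall>\<^sub>F \<omega> in F i. dist (g (i, \<omega>)) (L i) < \<epsilon> / 2" using \<epsilon> by (intro tendstoD[OF g]) simp
    thus ?case
    proof eventually_elim
      case (elim \<omega>)
      thus ?case using \<open>dist (L i) l < \<epsilon> / 2\<close> dist_triangle[of "g (i, \<omega>)" l "L i"] by linarith
    qed
  qed
qed

text \<open>The inner limits are all 0, so errors need no uniformity in i, in contrast to
  bounds.\<close>

lemma (in tracial) asy_iter:
  assumes "\<And>i. asy (\<lambda>\<omega>. \<kappa> (i, \<omega>)) (Fl i) (\<lambda>\<omega>. F (i, \<omega>)) (\<lambda>\<omega>. G (i, \<omega>))"
  shows "asy \<kappa> (iter Fl) F G"
  unfolding asy_def null_def
proof (intro conjI allI)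
  show P: "F z \<in> P" "G z \<in> P" for z using assms[of "fst z"] by (cases z; auto simp: asy_def)+
  show "F z - G z \<in> P" for z using P by auto
  show "((\<lambda>z. nrm (F z - G z) / sqrt \<bar>\<kappa> z\<bar>) \<longlongrightarrow> 0) (iter Fl)"
    by (rule tendsto_iter[where L = "\<lambda>_. 0"]) (use assms in \<open>auto simp: asy_def null_def\<close>)
qed

text \<open>A sequence of stages with \<open>gram (a i) (s i)\<close> tending to e; b, ks and v' are
  common to all of them. Pairs of a stage and a microstate index everything, and limits are taken
  along \<open>iter\<close>. The condition \<open>s_large\<close> leaves room for an isometry from
  dimension n into dimension s m.\<close>

locale compression = linked +
  fixes p e :: 'a and a :: "nat \<Rightarrow> nat \<Rightarrow> 'a" and s :: "nat \<Rightarrow> nat" and b :: "nat \<Rightarrow> 'a" and r d :: nat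
    and ks :: "(nat \<times> nat \<times> nat \<times> complex) list" and v' :: "'a list" and v :: "nat \<Rightarrow> 'a list"
    and H H' :: "nat \<times> state \<Rightarrow> finmat" and K T :: "nat \<Rightarrow> nat \<times> state \<Rightarrow> finmat"
  assumes p: "tproj p" and e: "tproj e" and v': "set v' \<subseteq> sac e" and v: "set (v i) \<subseteq> sac p"
    and a: "con (a i l)" "p * a i l = a i l" "a i l * e = a i l"
    and g_bd: "bd 1 (gram (a i) (s i))" and g_lim: "(\<lambda>i. nrm (gram (a i) (s i) - e)) \<longlonglongrightarrow> 0"
    and b: "con (b j)" "b j * e = b j"
    and s_large: "Re (\<tau> e) / Re (\<tau> p) \<le> real (s i)"
    and ok: "stage_ok p (v i) e (a i) (s i) b r d ks v'
      (\<lambda>\<omega>. H (i, \<omega>), \<lambda>\<omega>. H' (i, \<omega>), \<lambda>t \<omega>. K t (i, \<omega>), \<lambda>j \<omega>. T j (i, \<omega>))"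
begin

definition "\<rho> = Re (\<tau> e) / Re (\<tau> p)"
definition "\<kappa> z = kapp p (snd z)"
definition "J = iter (\<lambda>i. mfilter p (v i))"
definition "sz z = nat \<lfloor>real (dm (snd z)) * \<rho>\<rfloor>" for z :: "nat \<times> state"
definition "big z = s (fst z) * dm (snd z)"

lemma mstate: "microstates_of P \<tau> con p (v i)"
  by unfold_locales (use p v in auto)

lemma te: "0 < Re (\<tau> e)" "Im (\<tau> e) = 0" and tp: "0 < Re (\<tau> p)"
  and ee: "e * e = e" "adj e = e" and e_P: "e \<in> P" and p_P: "p \<in> P"
  using e p tproj_P by (auto simp: tproj_def)

lemma \<rho>0: "0 < \<rho>" using te tp by (simp add: \<rho>_def)

lemmas ok' = ok[unfolded stage_ok_def prod.case]

lemma H_sa: "adj (H z) = H z"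
  using ok' by (cases z) simp

lemma H_fits: "\<forall>\<^sub>F z in J. fits (big z) (big z) (H z)"
  unfolding J_def by (rule eventually_iterI) (use ok' in \<open>simp add: big_def\<close>)

lemma H'_fits: "\<forall>\<^sub>F z in J. fits (big z) (big z) (H' z) \<and> fm.bd 2 (H' z)"
  unfolding J_def by (rule eventually_iterI) (use ok' in \<open>simp add: big_def\<close>)

lemma H'_asy: "fm.asy \<kappa> J H' H"
  unfolding J_def by (rule fm.asy_iter) (use ok' in \<open>simp add: \<kappa>_def\<close>)

lemma K_fits: "t < length v' \<Longrightarrow> \<forall>\<^sub>F z in J. fits (big z) (big z) (K t z) \<and> fm.bd 2 (K t z)"
  unfolding J_def by (rule eventually_iterI) (use ok' in \<open>simp add: big_def\<close>)

lemma K_sa: "t < length v' \<Longrightarrow> adj (K t z) = K t z"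
  using ok' by (cases z) simp

lemma T_fits: "j < r \<Longrightarrow> \<forall>\<^sub>F z in J. fits (dm (snd z)) (big z) (T j z)"
  unfolding J_def by (rule eventually_iterI) (use ok' in \<open>simp add: big_def\<close>)

lemma T_bd: "\<forall>\<^sub>F z in J. fm.bd 2 (\<Sum>j<r. T j z * adj (T j z))"
  unfolding J_def by (rule eventually_iterI) (use ok' in simp)

lemma K_compressed: "t < length ks \<Longrightarrow> K t z = compressed_letter (\<lambda>j. T j z) (\<lambda>q. xmat d q (snd z)) (ks ! t)"
  using ok' by (cases z) simp

lemma \<kappa>_ge0: "0 \<le> \<kappa> z"
  using tp by (simp add: \<kappa>_def kapp_def)

lemma dim_lim: "filterlim (\<lambda>z. dm (snd z)) at_top J"
  unfolding filterlim_at_top J_def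
proof (intro allI eventually_iterI)
  fix N i show "\<forall>\<^sub>F \<omega> in mfilter p (v i). N \<le> dm (snd (i, \<omega>))"
    using microstates_of.ev_dim[OF mstate, of N i] by simp
qed

definition g :: "nat \<Rightarrow> 'a" where "g i = gram (a i) (s i)"

lemma g_P: "g i \<in> P" using g_bd[of i] bd_P by (simp add: g_def)

lemma g_asy: "asy (\<lambda>_. 1) sequentially g (\<lambda>_. e)"
  unfolding asy_def null_def using g_lim g_P e_P by (simp add: g_def)

lemma e_bd: "bd 1 e" using e con_bd by (simp add: tproj_def)

lemma g_bnd: "bnd sequentially g" "bnd sequentially (\<lambda>_. e)"
  using g_bd e_bd by (auto intro!: bndI[of _ 1] g_P e_P simp: g_def)

lemma c_asy: "x \<in> P \<Longrightarrow> asy (\<lambda>_. 1) sequentially (\<lambda>_. x) (\<lambda>_. x)"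
  by (rule asy_refl)

lemma c_sbd: "x \<in> P \<Longrightarrow> sbd (\<lambda>_. 1) sequentially (\<lambda>_. x)"
  by (auto simp: sbd_def)

lemma trace_seq:
  assumes F: "asy (\<lambda>_. 1) sequentially F (\<lambda>_. x)" and G: "asy (\<lambda>_. 1) sequentially G (\<lambda>_. y)"
  shows "(\<lambda>i. \<tau> (F i * G i)) \<longlonglongrightarrow> \<tau> (x * y)"
proof -
  have "x \<in> P" "y \<in> P" using F G by (auto simp: asy_def)
  hence "((\<lambda>i. \<tau> (F i * G i) / of_real 1) \<longlongrightarrow> \<tau> (x * y)) sequentially"
    by (intro trace_asy_limit[OF F G c_sbd sbd_asy[OF G c_sbd]]) auto
  thus ?thesis by simp
qed

lemma defect_lim: "((\<lambda>z. fm.nrm (H z * H z - H z) / sqrt \<bar>\<kappa> z\<bar>) \<longlongrightarrow> 0) J"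
  unfolding J_def
proof (rule tendsto_iter)
  show "((\<lambda>\<omega>. fm.nrm (H (i, \<omega>) * H (i, \<omega>) - H (i, \<omega>)) / sqrt \<bar>\<kappa> (i, \<omega>)\<bar>) \<longlongrightarrow>
      sqrt (Re (\<tau> ((g i - e) * (g i * (g i - e) * g i))))) (mfilter p (v i))" for i
    using ok'[of i] by (simp add: \<kappa>_def g_def mult.assoc)
  have e0: "asy (\<lambda>_. 1) sequentially (\<lambda>i. g i - e) (\<lambda>_. 0)"
    using g_asy by (simp add: asy_def)
  have be: "bnd sequentially (\<lambda>i. g i - e)" by (intro bnd_diff g_bnd)
  have b0: "bnd sequentially (\<lambda>i. 0 :: 'a)" by (intro bnd_const[of 0] bd_zero) simp
  have "(\<lambda>i. \<tau> ((g i - e) * (g i * (g i - e) * g i))) \<longlonglongrightarrow> \<tau> (0 * (e * 0 * e))"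
    by (intro trace_seq asy_mult e0 g_asy bnd_mult g_bnd be b0)
  hence "(\<lambda>i. sqrt (Re (\<tau> ((g i - e) * (g i * (g i - e) * g i))))) \<longlonglongrightarrow> sqrt (Re (\<tau> (0 * (e * 0 * e))))"
    by (intro tendsto_intros)
  thus "(\<lambda>i. sqrt (Re (\<tau> ((g i - e) * (g i * (g i - e) * g i))))) \<longlonglongrightarrow> 0" by simp
qed

lemma square_lim: "((\<lambda>z. Tr (H z * H z) / of_real (\<kappa> z)) \<longlongrightarrow> \<tau> e) J"
  unfolding J_def
proof (rule tendsto_iter)
  show "((\<lambda>\<omega>. Tr (H (i, \<omega>) * H (i, \<omega>)) / of_real (\<kappa> (i, \<omega>))) \<longlongrightarrow> \<tau> (g i * g i)) (mfilter p (v i))" for i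
    using ok'[of i] by (simp add: \<kappa>_def g_def)
  show "(\<lambda>i. \<tau> (g i * g i)) \<longlonglongrightarrow> \<tau> e"
    using trace_seq[OF g_asy g_asy] by (simp add: ee)
qed

lemma v'k: assumes "k < length v'" shows "bd 1 (v' ! k) \<and> e * v' ! k = v' ! k \<and> v' ! k * e = v' ! k"
proof -
  have "v' ! k \<in> sac e" using v' nth_mem[OF assms] by blast
  thus ?thesis using con_bd by (auto simp: sac_def)
qed

text \<open>For each stage the limit still contains the factors \<open>g i\<close> produced by block
  products. They tend to e in the 2-norm with operator norm at most 1, and e is absorbed by the
  letters.\<close>

lemma words_lim:
  assumes w: "set w \<subseteq> {..<length v'}"
  shows "((\<lambda>z. Tr (wd (\<lambda>t. H' z * K t z) (H' z) w * H' z) / of_real (\<kappa> z)) \<longlongrightarrow> \<tau> (wd ((!) v') e w)) J"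
  unfolding J_def
proof (rule tendsto_iter)
  let ?W = "\<lambda>i. wd (\<lambda>t. e * g i * v' ! t * g i) e w"
  show "((\<lambda>\<omega>. Tr (wd (\<lambda>t. H' (i, \<omega>) * K t (i, \<omega>)) (H' (i, \<omega>)) w * H' (i, \<omega>)) / of_real (\<kappa> (i, \<omega>))) \<longlongrightarrow>
      \<tau> (?W i * (g i * e * g i))) (mfilter p (v i))" for i
    using ok'[of i] w by (simp add: \<kappa>_def g_def mult.assoc)
  have "asy (\<lambda>_. 1) sequentially ?W (\<lambda>_. wd (\<lambda>t. e * e * v' ! t * e) e w)"
  proof (rule asy_wd[THEN conjunct1])
    fix k assume "k \<in> set w"
    hence k: "bd 1 (v' ! k)" using w v'k by auto
    note bk = bnd_const[OF k, of sequentially] and be = bnd_const[OF e_bd, of sequentially]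
    show "asy (\<lambda>_. 1) sequentially (\<lambda>i. e * g i * v' ! k * g i) (\<lambda>_. e * e * v' ! k * e) \<and>
      bnd sequentially (\<lambda>i. e * g i * v' ! k * g i) \<and> bnd sequentially (\<lambda>_. e * e * v' ! k * e)"
      by (intro conjI asy_mult bnd_mult c_asy g_asy g_bnd bk be e_P bd_P[OF k])
  qed (use c_asy e_P g_bnd in auto)
  moreover have "asy (\<lambda>_. 1) sequentially (\<lambda>i. g i * e * g i) (\<lambda>_. e * e * e)"
    by (intro asy_mult bnd_mult c_asy g_asy g_bnd e_P)
  ultimately have "(\<lambda>i. \<tau> (?W i * (g i * e * g i))) \<longlonglongrightarrow> \<tau> (wd (\<lambda>t. e * e * v' ! t * e) e w * (e * e * e))"
    by (rule trace_seq)
  moreover have "wd (\<lambda>t. e * e * v' ! t * e) e w = wd ((!) v') e w" using w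
  proof (induction w)
    case (Cons k w)
    hence k: "e * v' ! k = v' ! k" "v' ! k * e = v' ! k" using v'k by auto
    thus ?case using Cons by (simp add: ee)
  qed simp
  ultimately show "(\<lambda>i. \<tau> (?W i * (g i * e * g i))) \<longlonglongrightarrow> \<tau> (wd ((!) v') e w)"
    by (simp add: ee wd_mult_right)
qed

lemma rows_lim:
  "((\<lambda>z. fm.nrm ((\<Sum>j<r. T j z * H' z * adj (T j z)) - unit_at (snd z)) / sqrt \<bar>\<kappa> z\<bar>) \<longlongrightarrow>
     nrm ((\<Sum>j<r. b j * adj (b j)) - p)) J"
  unfolding J_def
proof (rule tendsto_iter)
  show "((\<lambda>\<omega>. fm.nrm ((\<Sum>j<r. T j (i, \<omega>) * H' (i, \<omega>) * adj (T j (i, \<omega>))) - unit_at (snd (i, \<omega>))) / sqrt \<bar>\<kappa> (i, \<omega>)\<bar>) \<longlongrightarrow>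
     nrm ((\<Sum>j<r. b j * g i * e * g i * adj (b j)) - p)) (mfilter p (v i))" for i
    using ok'[of i] by (simp add: \<kappa>_def g_def)
  have bP: "b j \<in> P" for j using b(1) con_P by blast
  have bb: "bnd sequentially (\<lambda>_. b j)" "bnd sequentially (\<lambda>_. adj (b j))" for j
    using bnd_const[OF con_bd[OF b(1)]] bnd_const[OF bd_adj[OF con_bd[OF b(1)]]] by auto
  have "asy (\<lambda>_. 1) sequentially (\<lambda>i. (\<Sum>j<r. b j * g i * e * g i * adj (b j)) + (- p)) (\<lambda>i. (\<Sum>j<r. b j * e * e * e * adj (b j)) + (- p))"
    by (intro asy_add asy_sum asy_mult bnd_mult c_asy g_asy g_bnd e_P bb bP P_adj P_minus p_P)
  hence "((\<lambda>i. nrm ((\<Sum>j<r. b j * g i * e * g i * adj (b j)) + (- p)) / sqrt \<bar>1\<bar>) \<longlongrightarrow> nrm ((\<Sum>j<r. b j * e * e * e * adj (b j)) + (- p))) sequentially"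
    by (rule nrm_asy_limit) simp
  thus "(\<lambda>i. nrm ((\<Sum>j<r. b j * g i * e * g i * adj (b j)) - p)) \<longlonglongrightarrow> nrm ((\<Sum>j<r. b j * adj (b j)) - p)"
    by (simp add: b(2))
qed

lemma size_lim: "((\<lambda>z. real (sz z) / \<kappa> z) \<longlongrightarrow> Re (\<tau> e)) J"
proof -
  have "(\<lambda>m. real (nat \<lfloor>real m * \<rho>\<rfloor>) / (real m / Re (\<tau> p))) \<longlonglongrightarrow> Re (\<tau> e)"
  proof (rule tendsto_sandwich)
    have "\<rho> * Re (\<tau> p) = Re (\<tau> e)" using tp by (simp add: \<rho>_def)
    hence *: "(real m * \<rho> + c) / (real m / Re (\<tau> p)) = Re (\<tau> e) + c * Re (\<tau> p) / real m" if "0 < m" for m c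
      using that tp by (simp add: field_simps)
    show "\<forall>\<^sub>F m in sequentially. Re (\<tau> e) + (- 1) * Re (\<tau> p) / real m \<le> real (nat \<lfloor>real m * \<rho>\<rfloor>) / (real m / Re (\<tau> p))"
      using eventually_gt_at_top[of 0]
    proof eventually_elim
      case (elim m)
      have "real m * \<rho> + (- 1) \<le> real (nat \<lfloor>real m * \<rho>\<rfloor>)" using \<rho>0 by linarith
      thus ?case unfolding *[OF elim, symmetric] using tp by (intro divide_right_mono) auto
    qed
    show "\<forall>\<^sub>F m in sequentially. real (nat \<lfloor>real m * \<rho>\<rfloor>) / (real m / Re (\<tau> p)) \<le> Re (\<tau> e) + 0 * Re (\<tau> p) / real m"
      using eventually_gt_at_top[of 0]
    proof eventually_elim
      case (elim m)
      have "real (nat \<lfloor>real m * \<rho>\<rfloor>) \<le> real m * \<rho> + 0" using \<rho>0 by simp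
      thus ?case unfolding *[OF elim, symmetric] using tp by (intro divide_right_mono) auto
    qed
    have "(\<lambda>m. Re (\<tau> e) + (- 1 * Re (\<tau> p)) / real m) \<longlonglongrightarrow> Re (\<tau> e) + 0"
      by (intro tendsto_add tendsto_const lim_const_over_n)
    thus "(\<lambda>m. Re (\<tau> e) + (- 1) * Re (\<tau> p) / real m) \<longlonglongrightarrow> Re (\<tau> e)" by simp
  qed simp
  from filterlim_compose[OF this dim_lim] show ?thesis by (simp add: sz_def \<kappa>_def kapp_def)
qed

lemma \<kappa>_pos: "\<forall>\<^sub>F z in J. 0 < \<kappa> z"
  using filterlim_at_top[THEN iffD1, OF dim_lim, rule_format, of 1]
  by eventually_elim (use tp in \<open>simp add: \<kappa>_def kapp_def\<close>)

lemma H_nrm_lim: "((\<lambda>z. fm.nrm (H z) / sqrt \<bar>\<kappa> z\<bar>) \<longlongrightarrow> sqrt (Re (\<tau> e))) J"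
  by (rule fm.trace_bound_limit[OF UNIV_I _ \<kappa>_ge0]) (use square_lim in \<open>simp add: H_sa\<close>)

lemma H_sbd: "fm.sbd \<kappa> J H"
  by (rule fm.sbd_of_limit[OF UNIV_I H_nrm_lim])

definition "isometry_ok z A \<longleftrightarrow> fits (big z) (sz z) A \<and> adj A * A = idm (sz z) \<and>
  (fm.nrm (A * adj A - H z))\<^sup>2 \<le> 8 * (fm.nrm (H z * H z - H z))\<^sup>2 +
      2 * (\<bar>real (sz z) - Re (Tr (H z * H z))\<bar> + 6 * fm.nrm (H z * H z - H z) * fm.nrm (H z))"

definition "A z = (SOME A. isometry_ok z A)"

text \<open>The isometry fits because n <= m \<rho> <= s m.\<close>

lemma A_ok: "\<forall>\<^sub>F z in J. isometry_ok z (A z)"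
  using H_fits
proof eventually_elim
  case (elim z)
  have "real (dm (snd z)) * \<rho> \<le> real (big z)"
    using s_large[of "fst z"] mult_left_mono[of \<rho> "real (s (fst z))" "real (dm (snd z))"]
    by (simp add: big_def \<rho>_def mult.commute)
  hence le: "sz z \<le> big z" unfolding sz_def by linarith
  have "\<exists>A. isometry_ok z A"
    unfolding isometry_ok_def by (rule spectral_isometry[OF elim H_sa le]) blast
  thus ?case unfolding A_def by (rule someI_ex)
qed

definition "Q z = A z * adj (A z)"

lemma Q_facts: "\<forall>\<^sub>F z in J. Q z * Q z = Q z \<and> adj (A z) * Q z = adj (A z) \<and> fm.bd 1 (A z) \<and> fm.bd 1 (Q z)"
  using A_ok
proof eventually_elim
  case (elim z)
  hence AA: "adj (A z) * A z = idm (sz z)" "fits (big z) (sz z) (A z)" by (auto simp: isometry_ok_def)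
  have 1: "adj (A z) * Q z = adj (A z)"
    unfolding Q_def mult.assoc[symmetric] AA(1) by (rule idm_mult_left[OF fits_adj[OF AA(2)]])
  have 2: "Q z * Q z = Q z"
    using 1 by (simp add: Q_def mult.assoc)
  have "fm.bd 1 (A z)" by (rule fm.bd_isometry[OF _ _ _ _ AA(1)]) auto
  moreover have "fm.bd 1 (Q z)" by (rule fm.bd_projection[OF UNIV_I _ 2]) (simp add: Q_def adj_mult)
  ultimately show ?case using 1 2 by blast
qed

text \<open>Divide the estimate of \<open>spectral_isometry\<close> by \<kappa>. The defect of H
  vanishes in the limit, and both n / \<kappa> and Tr(H H) / \<kappa> tend to \<tau>(e).\<close>

lemma Q_asy: "fm.asy \<kappa> J Q H"
  unfolding fm.asy_def fm.null_def
proof (intro conjI allI UNIV_I)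
  let ?u = "\<lambda>z. fm.nrm (H z * H z - H z) / sqrt \<bar>\<kappa> z\<bar>" and ?h = "\<lambda>z. fm.nrm (H z) / sqrt \<bar>\<kappa> z\<bar>"
  let ?n = "\<lambda>z. \<bar>real (sz z) / \<kappa> z - Re (Tr (H z * H z) / of_real (\<kappa> z))\<bar>"
  let ?B = "\<lambda>z. 8 * (?u z)\<^sup>2 + 2 * (?n z + 6 * ?u z * ?h z)"
  have "(?B \<longlongrightarrow> 8 * 0\<^sup>2 + 2 * (\<bar>Re (\<tau> e) - Re (\<tau> e)\<bar> + 6 * 0 * sqrt (Re (\<tau> e)))) J"
    by (intro tendsto_intros defect_lim size_lim square_lim H_nrm_lim)
  hence "((\<lambda>z. sqrt (?B z)) \<longlongrightarrow> sqrt 0) J" by (intro tendsto_intros) simp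
  hence B: "((\<lambda>z. sqrt (?B z)) \<longlongrightarrow> 0) J" by simp
  show "((\<lambda>z. fm.nrm (Q z - H z) / sqrt \<bar>\<kappa> z\<bar>) \<longlongrightarrow> 0) J"
  proof (rule tendsto_sandwich[OF _ _ tendsto_const B])
    show "\<forall>\<^sub>F z in J. 0 \<le> fm.nrm (Q z - H z) / sqrt \<bar>\<kappa> z\<bar>" by simp
    show "\<forall>\<^sub>F z in J. fm.nrm (Q z - H z) / sqrt \<bar>\<kappa> z\<bar> \<le> sqrt (?B z)"
      using A_ok \<kappa>_pos
    proof eventually_elim
      case (elim z)
      have "(fm.nrm (Q z - H z) / sqrt \<bar>\<kappa> z\<bar>)\<^sup>2 = (fm.nrm (Q z - H z))\<^sup>2 / \<kappa> z"
        using elim(2) by (simp add: power_divide)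
      also have "\<dots> \<le> (8 * (fm.nrm (H z * H z - H z))\<^sup>2 +
          2 * (\<bar>real (sz z) - Re (Tr (H z * H z))\<bar> + 6 * fm.nrm (H z * H z - H z) * fm.nrm (H z))) / \<kappa> z"
        using elim by (intro divide_right_mono) (auto simp: isometry_ok_def Q_def)
      also have "\<dots> = ?B z"
      proof -
        have n: "\<bar>real (sz z) - Re (Tr (H z * H z))\<bar> / \<kappa> z = ?n z"
          using elim(2) by (simp add: diff_divide_distrib[symmetric])
        have uu: "(fm.nrm (H z * H z - H z))\<^sup>2 / \<kappa> z = (?u z)\<^sup>2" using elim(2) by (simp add: power_divide)
        have uh: "fm.nrm (H z * H z - H z) * fm.nrm (H z) / \<kappa> z = ?u z * ?h z" using elim(2) by simp
        have "(8 * X + 2 * (Y + 6 * U * V)) / k = 8 * (X / k) + 2 * (Y / k + 6 * (U * V / k))" for X Y U V k :: real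
          by (simp add: add_divide_distrib)
        thus ?thesis by (simp only: n uu uh mult.assoc)
      qed
      finally show ?case by (rule real_le_rsqrt)
    qed
  qed
qed

definition "Z t z = adj (A z) * K t z * A z"
definition "B j z = T j z * A z"

text \<open>Between consecutive letters the compression inserts A A^* = Q, so a word in the Z t is
  the compression of a word in the Q K t.\<close>

lemma wd_Z:
  assumes "adj (A z) * A z = idm n" "Q z * Q z = Q z" "adj (A z) * Q z = adj (A z)" "fits N n (A z)"
  shows "wd (\<lambda>t. Z t z) (idm n) w = adj (A z) * wd (\<lambda>t. Q z * K t z) (Q z) w * A z"
proof (induction w)
  case Nil
  have "adj (A z) * Q z * A z = idm n" by (simp only: assms)
  thus ?case by simp
next
  case (Cons k w)
  let ?R = "wd (\<lambda>t. Q z * K t z) (Q z) w"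
  have QR: "Q z * ?R = ?R"
    by (cases w) (simp_all add: assms(2) mult.assoc[symmetric])
  have "wd (\<lambda>t. Z t z) (idm n) (k # w) = adj (A z) * K k z * (Q z * ?R) * A z"
    by (simp add: Cons.IH) (simp add: Z_def Q_def mult.assoc)
  also have "\<dots> = (adj (A z) * Q z) * K k z * ?R * A z" by (simp only: QR assms(3))
  finally show ?case by (simp add: mult.assoc)
qed

text \<open>Q may be replaced by H' under the trace, where the limit is known. Dividing by n /
  \<kappa>, which tends to \<tau>(e), turns Tr / \<kappa> into the normalised trace of n x n
  matrices.\<close>

lemma Z_lim:
  assumes w: "set w \<subseteq> {..<length v'}"
  shows "((\<lambda>z. Tr (wd (\<lambda>t. Z t z) (idm (sz z)) w) / of_nat (sz z)) \<longlongrightarrow> \<tau> (wd ((!) v') e w) / \<tau> e) J"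
proof -
  have QH': "fm.asy \<kappa> J Q H'" by (rule fm.asy_trans[OF Q_asy fm.asy_sym[OF H'_asy]])
  have bQ: "fm.bnd J Q" by (rule fm.bndI[of _ 1]) (use Q_facts in \<open>auto elim: eventually_mono\<close>)
  have bH': "fm.bnd J H'" by (rule fm.bndI[of _ 2]) (use H'_fits in \<open>auto elim: eventually_mono\<close>)
  have bK: "fm.bnd J (K t)" if "t < length v'" for t
    by (rule fm.bndI[of _ 2]) (use K_fits[OF that] in \<open>auto elim: eventually_mono\<close>)
  have sH': "fm.sbd \<kappa> J H'" by (rule fm.sbd_asy[OF H'_asy H_sbd])
  have a: "fm.asy \<kappa> J (\<lambda>z. wd (\<lambda>t. Q z * K t z) (Q z) w) (\<lambda>z. wd (\<lambda>t. H' z * K t z) (H' z) w)"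
  proof (rule fm.asy_wd[THEN conjunct1])
    fix t assume "t \<in> set w"
    hence t: "t < length v'" using w by auto
    show "fm.asy \<kappa> J (\<lambda>z. Q z * K t z) (\<lambda>z. H' z * K t z) \<and> fm.bnd J (\<lambda>z. Q z * K t z) \<and> fm.bnd J (\<lambda>z. H' z * K t z)"
      by (intro conjI fm.asy_mult fm.bnd_mult QH' bH' bQ bK[OF t] fm.asy_refl UNIV_I)
  qed (use QH' bQ bH' in auto)
  have "fm.sbd \<kappa> J (\<lambda>z. wd (\<lambda>t. H' z * K t z) (H' z) w)" using w
  proof (induction w)
    case (Cons t w)
    have "fm.sbd \<kappa> J (\<lambda>z. (H' z * K t z) * wd (\<lambda>t. H' z * K t z) (H' z) w)"
      by (rule fm.sbd_mult_left) (use Cons bH' bK in \<open>auto intro: fm.bnd_mult\<close>)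
    thus ?case by simp
  qed (simp add: sH')
  from fm.trace_asy_limit[OF a QH' this fm.sbd_asy[OF Q_asy H_sbd] words_lim[OF w]]
  have 1: "((\<lambda>z. Tr (wd (\<lambda>t. Q z * K t z) (Q z) w * Q z) / of_real (\<kappa> z)) \<longlongrightarrow> \<tau> (wd ((!) v') e w)) J" .
  have \<tau>e: "\<tau> e = of_real (Re (\<tau> e))" using te by (simp add: complex_eq_iff)
  have 2: "((\<lambda>z. of_nat (sz z) / of_real (\<kappa> z) :: complex) \<longlongrightarrow> \<tau> e) J"
    using tendsto_of_real[OF size_lim, where 'a = complex] \<tau>e by simp
  have "\<tau> e \<noteq> 0" using te by auto
  from tendsto_divide[OF 1 2 this]
  have "((\<lambda>z. Tr (wd (\<lambda>t. Q z * K t z) (Q z) w * Q z) / of_real (\<kappa> z) / (of_nat (sz z) / of_real (\<kappa> z))) \<longlongrightarrow>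
      \<tau> (wd ((!) v') e w) / \<tau> e) J" .
  moreover have "\<forall>\<^sub>F z in J. Tr (wd (\<lambda>t. Q z * K t z) (Q z) w * Q z) / of_real (\<kappa> z) / (of_nat (sz z) / of_real (\<kappa> z)) =
      Tr (wd (\<lambda>t. Z t z) (idm (sz z)) w) / of_nat (sz z)"
    using A_ok Q_facts \<kappa>_pos
  proof eventually_elim
    case (elim z)
    let ?R = "wd (\<lambda>t. Q z * K t z) (Q z) w"
    have "Tr (wd (\<lambda>t. Z t z) (idm (sz z)) w) = Tr (adj (A z) * ?R * A z)"
      by (subst wd_Z[of z "sz z" "big z"]) (use elim in \<open>auto simp: isometry_ok_def\<close>)
    also have "\<dots> = Tr (?R * Q z)"
      using fm.tr_comm[of "adj (A z)" "?R * A z"] by (simp add: Q_def mult.assoc)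
    finally show ?case using elim(3) by simp
  qed
  ultimately show ?thesis by (rule Lim_transform_eventually)
qed

lemma B_lim:
  "((\<lambda>z. fm.nrm ((\<Sum>j<r. B j z * adj (B j z)) - unit_at (snd z)) / sqrt \<bar>\<kappa> z\<bar>) \<longlongrightarrow>
     nrm ((\<Sum>j<r. b j * adj (b j)) - p)) J"
proof (rule fm.nrm_asy_limit[OF _ rows_lim])
  have bQ: "fm.bnd J Q" by (rule fm.bndI[of _ 1]) (use Q_facts in \<open>auto elim: eventually_mono\<close>)
  have bH': "fm.bnd J H'" by (rule fm.bndI[of _ 2]) (use H'_fits in \<open>auto elim: eventually_mono\<close>)
  have bT: "fm.bnd J (T j)" if "j < r" for j by (rule fm.bnd_row(2)[OF T_bd UNIV_I that])
  have QH': "fm.asy \<kappa> J Q H'" by (rule fm.asy_trans[OF Q_asy fm.asy_sym[OF H'_asy]])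
  have "fm.asy \<kappa> J (\<lambda>z. T j z * Q z * adj (T j z)) (\<lambda>z. T j z * H' z * adj (T j z))" if j: "j < r" for j
    by (intro fm.asy_mult fm.bnd_mult fm.bnd_adj QH' bH' bQ bT[OF j] fm.asy_refl UNIV_I)
  hence "fm.asy \<kappa> J (\<lambda>z. \<Sum>j<r. T j z * Q z * adj (T j z)) (\<lambda>z. \<Sum>j<r. T j z * H' z * adj (T j z))"
    by (intro fm.asy_sum) simp
  hence "fm.asy \<kappa> J (\<lambda>z. (\<Sum>j<r. T j z * Q z * adj (T j z)) - unit_at (snd z)) (\<lambda>z. (\<Sum>j<r. T j z * H' z * adj (T j z)) - unit_at (snd z))"
    unfolding fm.asy_def by (simp only: diff_diff_diff UNIV_I simp_thms)
  moreover have "T j z * Q z * adj (T j z) = B j z * adj (B j z)" for j z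
    by (simp add: B_def Q_def adj_mult mult.assoc)
  ultimately show "fm.asy \<kappa> J (\<lambda>z. (\<Sum>j<r. B j z * adj (B j z)) - unit_at (snd z)) (\<lambda>z. (\<Sum>j<r. T j z * H' z * adj (T j z)) - unit_at (snd z))"
    by simp
qed

lemma B_ok: "\<forall>\<^sub>F z in J. (\<forall>j<r. fits (dm (snd z)) (sz z) (B j z)) \<and> fm.bd 2 (\<Sum>j<r. B j z * adj (B j z))"
proof -
  have "\<forall>\<^sub>F z in J. \<forall>j\<in>{..<r}. fits (dm (snd z)) (big z) (T j z)"
    by (intro eventually_ball_finite ballI finite_lessThan) (use T_fits in auto)
  thus ?thesis using T_bd A_ok Q_facts
  proof eventually_elim
    case (elim z)
    have "fm.bd (1 * 2) (\<Sum>j<r. T j z * Q z * adj (T j z))"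
      by (rule fm.bd_sandwich_sum) (use elim in auto)
    moreover have "T j z * Q z * adj (T j z) = B j z * adj (B j z)" for j
      by (simp add: B_def Q_def adj_mult mult.assoc)
    moreover have "fits (dm (snd z)) (sz z) (B j z)" if "j < r" for j
      unfolding B_def using elim that by (intro fits_mult[of _ "big z" _ "big z"]) (auto simp: isometry_ok_def)
    ultimately show ?case by simp
  qed
qed

lemma Z_ok: "\<forall>\<^sub>F z in J. \<forall>t<length v'. fits (sz z) (sz z) (Z t z) \<and> adj (Z t z) = Z t z \<and> fm.bd 2 (Z t z)"
proof -
  have "\<forall>\<^sub>F z in J. \<forall>t\<in>{..<length v'}. fits (big z) (big z) (K t z) \<and> fm.bd 2 (K t z)"
    by (intro eventually_ball_finite ballI finite_lessThan) (use K_fits in auto)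
  thus ?thesis using A_ok Q_facts
  proof eventually_elim
    case (elim z)
    show ?case
    proof (intro allI impI conjI)
      fix t assume t: "t < length v'"
      hence k: "fits (big z) (big z) (K t z)" "fm.bd 2 (K t z)" using elim by auto
      have A: "fits (big z) (sz z) (A z)" using elim by (simp add: isometry_ok_def)
      show "fits (sz z) (sz z) (Z t z)"
        unfolding Z_def by (rule fits_mult[OF fits_mult[OF fits_adj[OF A] k(1)] A])
      show "adj (Z t z) = Z t z" by (simp add: Z_def adj_mult K_sa[OF t] mult.assoc)
      have A1: "fm.bd 1 (A z)" using elim by blast
      have "fm.bd (1 * 2 * 1) (Z t z)" unfolding Z_def by (intro fm.bd_mult fm.bd_adj k A1)
      thus "fm.bd 2 (Z t z)" by simp
    qed
  qed
qed

text \<open>Exact, because compression by A commutes with taking real parts and is absorbed into B j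
  = T j A.\<close>

lemma Z_compressed: "t < length ks \<Longrightarrow> Z t z = compressed_letter (\<lambda>j. B j z) (\<lambda>q. xmat d q (snd z)) (ks ! t)"
  by (cases "ks ! t") (simp add: Z_def K_compressed compressed_letter_def rp_sandwich,
    simp add: B_def adj_mult mult.assoc cscale_mult_left cscale_mult_right)

end

section \<open>From compressed matrices to coverings\<close>

lemma tomat_microstates:
  assumes F: "\<And>t. t < D \<Longrightarrow> fits n n (F t) \<and> adj (F t) = F t \<and> fm.bd 2 (F t)"
    and U: "law_of D (\<lambda>w. Tr (wd F (idm n) w) / of_nat n) \<in> U"
  shows "map (\<lambda>t. tomat n (F t)) [0..<D] \<in> microstates n D 2 U"
proof -
  let ?X = "map (\<lambda>t. tomat n (F t)) [0..<D]"
  have e: "emb (tomat n (F t)) = F t" if "t < D" for t using F[OF that] by (simp add: emb_tomat)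
  have car: "set ?X \<subseteq> carrier_mat n n" by auto
  have wd: "foldr (\<lambda>i T. emb (?X ! i) * T) w (idm n) = wd F (idm n) w" if "set w \<subseteq> {..<D}" for w
    using that by (induction w) (auto simp: e wd_def)
  have "law_mat n ?X = law_of (length ?X) (\<lambda>w. Tr (wd F (idm n) w) / of_nat n)"
    unfolding law_mat_eq[OF car] by (rule law_of_cong) (subst wd, auto)
  hence "law_mat n ?X \<in> U" using U by simp
  moreover have "mat_adjoint A = A \<and> mat_op_norm A \<le> 2" if "A \<in> set ?X" for A
  proof -
    from that obtain t where t: "t < D" and A: "A = tomat n (F t)" unfolding set_map by fastforce
    have eA: "emb A = F t" using F[OF t] by (simp add: A emb_tomat)
    have cA: "A \<in> carrier_mat n n" by (simp add: A)
    have "emb (mat_adjoint A) = emb A" using F[OF t] by (simp add: emb_adjoint eA)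
    hence "mat_adjoint A = A" using emb_inj[OF mat_adjoint_carrier[OF cA] cA] by blast
    moreover have "mat_op_norm A \<le> 2" using mat_op_norm_le_iff[OF cA, of 2] F[OF t] by (simp add: eA)
    ultimately show ?thesis by blast
  qed
  ultimately show ?thesis using car by (auto simp: microstates_def mat_tuples_def)
qed

context linked begin

definition parts_of :: "'a list \<Rightarrow> 'a list" where
  "parts_of gs = concat (map (\<lambda>g. [rp g, rp ((- \<i>) \<star> g)]) gs)"

lemma parts_of_sac:
  assumes "tproj p" "\<And>g. g \<in> set gs \<Longrightarrow> con g \<and> p * g = g \<and> g * p = g"
  shows "set (parts_of gs) \<subseteq> sac p"
proof -
  have "rp g \<in> sac p" "rp ((- \<i>) \<star> g) \<in> sac p" if "g \<in> set gs" for g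
    using assms(2)[OF that] con_cscale[of g "- \<i>"]
    by (auto intro!: rp_sac[OF assms(1)] simp: cscale_mult_left cscale_mult_right)
  thus ?thesis by (auto simp: parts_of_def)
qed

end

lemma (in microstates_of) models_of_parts:
  assumes "set (parts_of gs) \<subseteq> set v" "g \<in> set gs" shows "\<exists>F. models g F"
proof -
  have "rp g \<in> set v" "rp ((- \<i>) \<star> g) \<in> set v" using assms by (auto simp: parts_of_def)
  then obtain k k' where "k < length v" "v ! k = rp g" "k' < length v" "v ! k' = rp ((- \<i>) \<star> g)"
    by (metis in_set_conv_nth)
  hence "models (rp g) (\<lambda>\<omega>. coord \<omega> k)" "models (rp ((- \<i>) \<star> g)) (\<lambda>\<omega>. coord \<omega> k')"
    using models_letter[of k] models_letter[of k'] by simp_all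
  hence "models (rp g + \<i> \<star> rp ((- \<i>) \<star> g)) (\<lambda>\<omega>. coord \<omega> k + \<i> \<star> coord \<omega> k')"
    by (intro models_add models_cscale)
  thus ?thesis unfolding rp_parts by blast
qed

text \<open>The additional letters y are the real and imaginary parts of all products a_l a_l'^*,
  a_l v'_k a_l'^* and b_j a_l^*, which makes them polynomials in x @ y. All these products lie in p
  N p, although a_l and b_j do not.\<close>

lemma (in linked) stage_for:
  assumes p: "tproj p" and e: "tproj e"
    and full_e: "\<exists>a s. (\<forall>l. con (a l) \<and> p * a l = a l \<and> a l * e = a l) \<and>
      bd 1 (gram a s) \<and> nrm (gram a s - e) < \<delta>"
    and x: "set x \<subseteq> sac p" and v': "set v' \<subseteq> sac e"
    and b: "\<And>j. con (b j)" "\<And>j. p * b j = b j" "\<And>j. b j * e = b j" "bd 1 (\<Sum>j<r. b j * adj (b j))"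
    and ks: "length ks \<le> length v'"
      "\<And>t. t < length ks \<Longrightarrow> v' ! t = compressed_letter b (\<lambda>q. if q < length x then x ! q else p) (ks ! t)"
      "\<And>j j' q c. (j, j', q, c) \<in> set ks \<Longrightarrow> j < r \<and> j' < r \<and> q \<le> length x \<and> cmod c \<le> 1 / 8"
  shows "\<exists>a s y S. (\<forall>l. con (a l) \<and> p * a l = a l \<and> a l * e = a l) \<and> bd 1 (gram a s) \<and>
    nrm (gram a s - e) < \<delta> \<and> \<rho> \<le> real s \<and> set y \<subseteq> sac p \<and> stage_ok p (x @ y) e a s b r (length x) ks v' S"
proof -
  obtain a0 s0 where a0: "\<forall>l. con (a0 l) \<and> p * a0 l = a0 l \<and> a0 l * e = a0 l"
      "bd 1 (gram a0 s0)" "nrm (gram a0 s0 - e) < \<delta>"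
    using full_e by (elim exE conjE)
  \<comment> \<open>Padding a with zeros increases s to at least \<rho> and leaves the sum of the
    a_l^* a_l unchanged.\<close>
  define s where "s = s0 + nat \<lceil>\<rho>\<rceil>"
  define a where "a l = (if l < s0 then a0 l else 0)" for l
  have con0: "con 0" using con_cscale[of "a0 0" 0] a0(1) by simp
  have a: "con (a l) \<and> p * a l = a l \<and> a l * e = a l" for l using a0(1) con0 by (simp add: a_def)
  have "gram a s = (\<Sum>l<s. if l < s0 then adj (a0 l) * a0 l else 0)"
    unfolding gram_def by (intro sum.cong) (auto simp: a_def)
  also have "\<dots> = gram a0 s0"
    unfolding gram_def by (intro sum.mono_neutral_cong_right) (auto simp: s_def)
  finally have gr: "gram a s = gram a0 s0" .
  have "finite ((\<lambda>(l, l'). a l * adj (a l')) ` ({..<s} \<times> {..<s}) \<union>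
    (\<lambda>(k, l, l'). a l * v' ! k * adj (a l')) ` ({..<length v'} \<times> {..<s} \<times> {..<s}) \<union>
    (\<lambda>(j, l). b j * adj (a l)) ` ({..<r} \<times> {..<s}))" by simp
  from finite_list[OF this] obtain gs where gs_def: "set gs = (\<lambda>(l, l'). a l * adj (a l')) ` ({..<s} \<times> {..<s}) \<union>
    (\<lambda>(k, l, l'). a l * v' ! k * adj (a l')) ` ({..<length v'} \<times> {..<s} \<times> {..<s}) \<union>
    (\<lambda>(j, l). b j * adj (a l)) ` ({..<r} \<times> {..<s})" ..
  have ap: "adj (a l) * p = adj (a l)" for l
    using arg_cong[of "p * a l" "a l" adj] a[of l] p unfolding adj_mult tproj_def by simp
  have conv: "con (v' ! k)" if "k < length v'" for k
    using v' nth_mem[OF that] by (auto simp: sac_def)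
  have gs: "con g \<and> p * g = g \<and> g * p = g" if "g \<in> set gs" for g
  proof -
    have l: "p * (a l * z) = a l * z" "p * (b l * z) = b l * z" for l z
      using a b(2) by (simp_all add: mult.assoc[symmetric])
    have "(\<exists>l l'. g = a l * adj (a l')) \<or> (\<exists>k l l'. k < length v' \<and> g = a l * v' ! k * adj (a l')) \<or>
        (\<exists>j l. g = b j * adj (a l))"
      using that unfolding gs_def by auto
    moreover have "con (a l)" for l using a by blast
    ultimately show ?thesis
      using b(1) conv by (elim disjE exE conjE) (simp_all add: mult.assoc ap l con_mult con_adj)
  qed
  define y where "y = parts_of gs"
  have y: "set y \<subseteq> sac p" unfolding y_def by (rule parts_of_sac[OF p gs])
  interpret blocks P \<tau> con p "x @ y" e a s
    by unfold_locales (simp_all add: p e x y a gr a0(2))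
  have ex: "\<exists>F. models g F" if "g \<in> set gs" for g
    by (rule models_of_parts[OF _ that]) (simp add: y_def)
  have "\<exists>S. stage_ok p (x @ y) e a s b r (length x) ks v' S"
  proof (rule stage_exists[where x = "\<lambda>q. if q < length x then x ! q else p"])
    fix q assume "q \<le> length x"
    show "models (if q < length x then x ! q else p) (xmat (length x) q)"
    proof (cases "q < length x")
      case True
      thus ?thesis using models_letter[of q] by (simp add: xmat_def[abs_def] nth_append)
    next
      case False thus ?thesis using models_unit by (simp add: xmat_def[abs_def])
    qed
  next
    show "\<exists>F. models (a l * adj (a l')) F" if "l < s" "l' < s" for l l'
      by (rule ex, unfold gs_def) (intro UnI1 image_eqI[of _ _ "(l, l')"], use that in auto)
    show "\<exists>F. models (a l * v' ! k * adj (a l')) F" if "k < length v'" "l < s" "l' < s" for k l l'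
      by (rule ex, unfold gs_def) (rule UnI1, rule UnI2, rule image_eqI[of _ _ "(k, l, l')"], use that in auto)
    show "\<exists>F. models (b j * adj (a l)) F" if "j < r" "l < s" for j l
      by (rule ex, unfold gs_def) (rule UnI2, rule image_eqI[of _ _ "(j, l)"], use that in auto)
  qed (use v' b ks in auto)
  moreover have "\<rho> \<le> real s" unfolding s_def by linarith
  ultimately show ?thesis
    by (intro exI[of _ a] exI[of _ s] exI[of _ y]) (use a a0 gr y in auto)
qed

context compression begin

text \<open>All requirements of \<open>covering_transfer\<close> hold eventually along
  \<open>J\<close>, hence for one stage i along its microstate filter. Unfolding that filter yields
  the neighbourhood U and a threshold N beyond which every microstate can be compressed.\<close>

lemma covering_le:
  assumes v: "\<And>i. v i = x @ y i" and dx: "d = length x" and ks: "length ks \<le> length v'"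
    and \<epsilon>: "0 < \<epsilon>" and \<epsilon>': "0 < \<epsilon>'" and U': "open U'" "lawq e v' \<in> U'"
    and small: "84 * ((real r)\<^sup>2 + 1) * (32 * \<epsilon>' * sqrt \<rho>) \<le> \<epsilon> / real (d + 1)"
    and full: "nrm ((\<Sum>j<r. b j * adj (b j)) - p) < \<epsilon> / real (d + 1) / 126 * sqrt (Re (\<tau> p))"
    and idx: "\<And>j j' q c. j < r \<Longrightarrow> j' < r \<Longrightarrow> q \<le> d \<Longrightarrow> c = 1 / 8 \<or> c = - \<i> / 8 \<Longrightarrow> (j, j', q, c) \<in> set ks"
  shows "\<exists>i U. open U \<and> lawq p (x @ y i) \<in> U \<and>
    (\<forall>\<^sub>F m in sequentially. covering m (length x) (length (y i)) \<epsilon> U \<le>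
       covering (nat \<lfloor>real m * \<rho>\<rfloor>) (length ks) (length v' - length ks) \<epsilon>' U')"
proof -
  \<comment> \<open>From size N0 on, m \<rho> >= 1, so the compressed matrices have size n >
    0.\<close>
  define N0 where "N0 = nat \<lceil>1 / \<rho>\<rceil> + 1"
  define good where "good z \<longleftrightarrow> N0 \<le> dm (snd z) \<and>
      (\<forall>t<length v'. fits (sz z) (sz z) (Z t z) \<and> adj (Z t z) = Z t z \<and> fm.bd 2 (Z t z)) \<and>
      law_of (length v') (\<lambda>w. Tr (wd (\<lambda>t. Z t z) (idm (sz z)) w) / of_nat (sz z)) \<in> U' \<and>
      (\<forall>j<r. fits (dm (snd z)) (sz z) (B j z)) \<and> fm.bd 2 (\<Sum>j<r. B j z * adj (B j z)) \<and>
      fm.nrm ((\<Sum>j<r. B j z * adj (B j z)) - unit_at (snd z)) \<le> \<epsilon> / real (d + 1) / 126 * sqrt (dm (snd z))" for z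
  have law: "((\<lambda>z. law_of (length v') (\<lambda>w. Tr (wd (\<lambda>t. Z t z) (idm (sz z)) w) / of_nat (sz z))) \<longlongrightarrow> lawq e v') J"
    unfolding lawq_def by (rule tendsto_law_of[OF Z_lim])
  have "\<forall>\<^sub>F z in J. good z"
    using Z_ok B_ok topological_tendstoD[OF law U'] order_tendstoD(2)[OF B_lim full] \<kappa>_pos
      filterlim_at_top[THEN iffD1, OF dim_lim, rule_format, of N0]
  proof eventually_elim
    case (elim z)
    have "sqrt (Re (\<tau> p)) * sqrt (\<kappa> z) = sqrt (dm (snd z))"
      using tp by (simp add: \<kappa>_def kapp_def real_sqrt_divide)
    moreover have "fm.nrm ((\<Sum>j<r. B j z * adj (B j z)) - unit_at (snd z)) \<le>
        \<epsilon> / real (d + 1) / 126 * sqrt (Re (\<tau> p)) * sqrt (\<kappa> z)"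
      using elim(4,5) by (simp add: pos_divide_less_eq del: of_nat_add of_nat_Suc)
    ultimately show ?case using elim by (simp add: good_def mult.assoc)
  qed
  hence "\<forall>\<^sub>F i in sequentially. \<forall>\<^sub>F \<omega> in mfilter p (v i). good (i, \<omega>)"
    by (simp add: J_def eventually_iter)
  then obtain i where "\<forall>\<^sub>F \<omega> in mfilter p (v i). good (i, \<omega>)"
    using eventually_happens'[OF sequentially_bot] by blast
  then obtain U N where U: "open U" "lawq p (v i) \<in> U"
    and good: "\<forall>m\<ge>N. \<forall>X\<in>microstates m (length (v i)) 2 U. good (i, (m, X))"
    unfolding microstates_of.eventually_Fl[OF mstate] by (elim exE conjE)
  have pick: "\<exists>t<length ks. ks ! t = (j, j', q, c)" if "(j, j', q, c) \<in> set ks" for j j' q c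
    using that by (metis in_set_conv_nth)
  \<comment> \<open>Position of a letter in the compressed tuple; c = 1/8 and c = -\<i>/8 give the
    two self-adjoint parts of an eighth of b_j^* x_q b_j'.\<close>
  define ix where "ix c j j' q = (SOME t. t < length ks \<and> ks ! t = (j, j', q, c))" for c j j' q
  have ix: "ix c j j' q < length ks \<and> ks ! ix c j j' q = (j, j', q, c)"
    if "j < r" "j' < r" "q \<le> d" "c = 1 / 8 \<or> c = - \<i> / 8" for c j j' q
    unfolding ix_def by (rule someI_ex) (rule pick[OF idx[OF that]])
  have "covering m (length x) (length (y i)) \<epsilon> U \<le>
       covering (nat \<lfloor>real m * \<rho>\<rfloor>) (length ks) (length v' - length ks) \<epsilon>' U'" if m: "max N N0 \<le> m" for m
  proof -
    define n where "n = nat \<lfloor>real m * \<rho>\<rfloor>"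
    let ?z = "\<lambda>X. (i, (m, X))"
    have szn: "sz (?z X) = n" for X by (simp add: sz_def n_def)
    have m0: "0 < m" using m by (simp add: N0_def)
    have "1 / \<rho> \<le> real m" using m by (simp add: N0_def) linarith
    hence "1 \<le> real m * \<rho>" using \<rho>0 by (simp add: pos_divide_le_eq)
    hence n0: "0 < n" unfolding n_def by linarith
    have n\<rho>: "real n \<le> \<rho> * real m" unfolding n_def using \<rho>0 by (simp add: mult.commute)
    have gd: "good (?z X)" if "X \<in> microstates m (d + length (y i)) 2 U" for X
      using good m that by (simp add: v dx)
    define Zf where "Zf X = map (\<lambda>t. tomat n (Z t (?z X))) [0..<length v']" for X
    have emb_Z: "emb (Zf X ! t) = Z t (?z X)"
      if "X \<in> microstates m (d + length (y i)) 2 U" "t < length v'" for X t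
      using gd[OF that(1)] that(2) by (simp add: Zf_def good_def szn emb_tomat)
    have "covering m d (length (y i)) \<epsilon> U \<le> covering n (length ks) (length v' - length ks) \<epsilon>' U'"
    proof (rule covering_transfer[where Zf = Zf and Bf = "\<lambda>X j. B j (?z X)" and r = r and \<rho> = \<rho>
          and tr = "ix (1 / 8)" and ti = "ix (- \<i> / 8)"])
      fix X assume X: "X \<in> microstates m (d + length (y i)) 2 U"
      note gX = gd[OF X, unfolded good_def szn snd_conv fst_conv]
      show "Zf X \<in> microstates n (length ks + (length v' - length ks)) 2 U'"
        using tomat_microstates[of "length v'" n "\<lambda>t. Z t (?z X)" U'] gX ks by (simp add: Zf_def)
      show "fm.bd 2 (\<Sum>j<r. B j (?z X) * adj (B j (?z X)))" using gX by blast
      show "fm.nrm ((\<Sum>j<r. B j (?z X) * adj (B j (?z X))) - idm m) \<le> \<epsilon> / real (d + 1) / 126 * sqrt (real m)"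
        using gX by blast
      fix j assume j: "j < r"
      show "fits m n (B j (?z X))" using gX j by blast
      fix j' q assume jq: "j' < r" "q \<le> d"
      let ?t = "ix (1 / 8) j j' q" and ?u = "ix (- \<i> / 8) j j' q"
      let ?F = "adj (B j (?z X)) * xmat d q (m, X) * B j' (?z X)"
      have t: "?t < length ks" "ks ! ?t = (j, j', q, 1 / 8)" and u: "?u < length ks" "ks ! ?u = (j, j', q, - \<i> / 8)"
        using ix[OF j jq] by auto
      have "emb (Zf X ! ?t) = rp ((1 / 8) \<star> ?F)"
        using emb_Z[OF X, of ?t] t ks Z_compressed[OF t(1), of "?z X"] by (simp add: compressed_letter_def)
      moreover have "emb (Zf X ! ?u) = rp ((- \<i>) \<star> ((1 / 8) \<star> ?F))"
        using emb_Z[OF X, of ?u] u ks Z_compressed[OF u(1), of "?z X"]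
        by (simp add: compressed_letter_def cscale_cscale)
      ultimately have "8 \<star> (emb (Zf X ! ?t) + \<i> \<star> emb (Zf X ! ?u)) = ?F"
        by (simp only: rp_parts) (simp add: cscale_cscale)
      thus "adj (B j (?z X)) * (if q < d then emb (X ! q) else idm m) * B j' (?z X) =
          8 \<star> (emb (Zf X ! ?t) + \<i> \<star> emb (Zf X ! ?u))"
        by (simp add: xmat_def)
    next
      show "ix (1 / 8) j j' q < length ks \<and> ix (- \<i> / 8) j j' q < length ks"
        if "j < r" "j' < r" "q \<le> d" for j j' q
        using ix[OF that] by blast
    qed (use m0 n0 n\<rho> \<rho>0 \<epsilon> \<epsilon>' small in auto)
    thus ?thesis by (simp add: n_def dx)
  qed
  hence "\<forall>\<^sub>F m in sequentially. covering m (length x) (length (y i)) \<epsilon> U \<le>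
       covering (nat \<lfloor>real m * \<rho>\<rfloor>) (length ks) (length v' - length ks) \<epsilon>' U'"
    unfolding eventually_sequentially by blast
  thus ?thesis using U by (intro exI[of _ i] exI[of _ U] conjI) (simp_all add: v)
qed

end

text \<open>The order of choices is what makes this work. The b_j depend on x and \<epsilon> only
  and define the compressed tuple x'; its tolerance \<epsilon>' depends on their number r. Only then
  y' and U' are given, and the a_l, the extra letters y and U may depend on these. The sum of the
  b_j b_j^* need only be near p within the fixed error, whereas the a_l come in a sequence of
  improving families.\<close>

theorem (in linked) law_entropy_compression:
  assumes p: "tproj p" and e: "tproj e"
    and full_e: "\<And>\<delta>. 0 < \<delta> \<Longrightarrow> \<exists>a s. (\<forall>l. con (a l) \<and> p * a l = a l \<and> a l * e = a l) \<and>
      bd 1 (gram a s) \<and> nrm (gram a s - e) < \<delta>"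
    and full_p: "\<And>\<delta>. 0 < \<delta> \<Longrightarrow> \<exists>(b :: nat \<Rightarrow> 'a) r. (\<forall>j. con (b j) \<and> p * b j = b j \<and> b j * e = b j) \<and>
      bd 1 (\<Sum>j<r. b j * adj (b j)) \<and> nrm ((\<Sum>j<r. b j * adj (b j)) - p) < \<delta>"
  shows "law_entropy (sac p) (lawq p) \<le> ereal ((Re (\<tau> e) / Re (\<tau> p))\<^sup>2) * law_entropy (sac e) (lawq e)"
proof (rule law_entropy_compare)
  have te: "0 < Re (\<tau> e)" and tp: "0 < Re (\<tau> p)" using p e by (auto simp: tproj_def)
  thus \<rho>: "0 < Re (\<tau> e) / Re (\<tau> p)" by simp
  let ?\<rho> = "Re (\<tau> e) / Re (\<tau> p)"
  fix x and \<epsilon> :: real assume x: "set x \<subseteq> sac p" and \<epsilon>: "0 < \<epsilon>"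
  define d where "d = length x"
  have "0 < \<epsilon> / real (d + 1) / 126 * sqrt (Re (\<tau> p))" using \<epsilon> tp by simp
  from full_p[OF this] obtain b :: "nat \<Rightarrow> 'a" and r :: nat where b: "\<And>j. con (b j)" "\<And>j. p * b j = b j" "\<And>j. b j * e = b j"
    "bd 1 (\<Sum>j<r. b j * adj (b j))"
    and full: "nrm ((\<Sum>j<r. b j * adj (b j)) - p) < \<epsilon> / real (d + 1) / 126 * sqrt (Re (\<tau> p))"
    by (elim exE conjE) blast
  have "finite ({..<r} \<times> {..<r} \<times> {..d} \<times> {1 / 8, - \<i> / 8})" by simp
  from finite_list[OF this] obtain ks where ks: "set ks = {..<r} \<times> {..<r} \<times> {..d} \<times> {1 / 8, - \<i> / 8}" ..
  define xp where "xp q = (if q < length x then x ! q else p)" for q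
  define x' where "x' = map (compressed_letter b xp) ks"
  have be: "e * (adj (b j) * z) = adj (b j) * z" for j z
    using arg_cong[OF b(3)[of j], of adj] e by (simp add: adj_mult tproj_def mult.assoc[symmetric])
  have conx: "con (xp q)" for q
  proof (cases "q < length x")
    case True
    hence "x ! q \<in> sac p" using x nth_mem by blast
    thus ?thesis using True by (simp add: xp_def sac_def)
  qed (use p in \<open>simp add: xp_def tproj_def\<close>)
  have x': "set x' \<subseteq> sac e"
  proof
    fix z assume "z \<in> set x'"
    then obtain j j' q c where kt: "(j, j', q, c) \<in> set ks" and z: "z = rp (c \<star> (adj (b j) * xp q * b j'))"
      by (auto simp: x'_def compressed_letter_def)
    have "con (c \<star> (adj (b j) * xp q * b j'))"
    proof (intro con_cscale con_mult con_adj b conx)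
      have "c = 1 / 8 \<or> c = - \<i> / 8" using kt by (simp add: ks)
      thus "cmod c \<le> 1" by (elim disjE) (hypsubst, simp add: norm_divide)+
    qed
    moreover have "e * (c \<star> (adj (b j) * xp q * b j')) = c \<star> (adj (b j) * xp q * b j')"
      using be by (simp add: cscale_mult_right mult.assoc)
    moreover have "(c \<star> (adj (b j) * xp q * b j')) * e = c \<star> (adj (b j) * xp q * b j')"
      by (simp add: cscale_mult_left mult.assoc b(3))
    ultimately show "z \<in> sac e" unfolding z by (rule rp_sac[OF e])
  qed
  \<comment> \<open>The solution of the equality in \<open>small\<close>; the summand 1 keeps the
    denominator positive for r = 0.\<close>
  define \<epsilon>' where "\<epsilon>' = (\<epsilon> / real (d + 1)) / (84 * ((real r)\<^sup>2 + 1) * 32 * sqrt ?\<rho>)"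
  have r0: "0 < (real r)\<^sup>2 + 1" using zero_le_power2[of "real r"] by linarith
  have \<epsilon>': "0 < \<epsilon>'" unfolding \<epsilon>'_def using \<epsilon> \<rho> r0 by (intro divide_pos_pos mult_pos_pos) auto
  have "0 < 84 * ((real r)\<^sup>2 + 1) * 32 * sqrt ?\<rho>"
    by (intro mult_pos_pos r0 real_sqrt_gt_zero \<rho>) simp_all
  moreover have "c * (q / c) = q" if "0 < c" for c q :: real using that by simp
  ultimately have "(84 * ((real r)\<^sup>2 + 1) * 32 * sqrt ?\<rho>) * \<epsilon>' = \<epsilon> / real (d + 1)"
    unfolding \<epsilon>'_def by blast
  moreover have "84 * u * (32 * q * w) = (84 * u * 32 * w) * q" for u q w :: real by simp
  ultimately have "84 * ((real r)\<^sup>2 + 1) * (32 * \<epsilon>' * sqrt ?\<rho>) = \<epsilon> / real (d + 1)" by (rule trans[rotated])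
  hence small: "84 * ((real r)\<^sup>2 + 1) * (32 * \<epsilon>' * sqrt ?\<rho>) \<le> \<epsilon> / real (d + 1)" by (rule eq_refl)
  show "\<exists>x' \<epsilon>'. set x' \<subseteq> sac e \<and> 0 < \<epsilon>' \<and>
      (\<forall>y' U'. set y' \<subseteq> sac e \<and> open U' \<and> lawq e (x' @ y') \<in> U' \<longrightarrow>
        (\<exists>y U. set y \<subseteq> sac p \<and> open U \<and> lawq p (x @ y) \<in> U \<and>
          (\<forall>\<^sub>F m in sequentially. covering m (length x) (length y) \<epsilon> U \<le>
            covering (nat \<lfloor>real m * ?\<rho>\<rfloor>) (length x') (length y') \<epsilon>' U')))"
  proof (rule exI[of _ x'], rule exI[of _ \<epsilon>'], intro conjI x' \<epsilon>' allI impI, elim conjE)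
    fix y' U' assume y': "set y' \<subseteq> sac e" and U': "open U'" "lawq e (x' @ y') \<in> U'"
    define v' where "v' = x' @ y'"
    have v': "set v' \<subseteq> sac e" using x' y' by (simp add: v'_def)
    have len: "length ks \<le> length v'" by (simp add: v'_def x'_def)
    have stage: "\<exists>a s y S. (\<forall>l. con (a l) \<and> p * a l = a l \<and> a l * e = a l) \<and> bd 1 (gram a s) \<and>
      nrm (gram a s - e) < \<delta> \<and> ?\<rho> \<le> real s \<and> set y \<subseteq> sac p \<and> stage_ok p (x @ y) e a s b r (length x) ks v' S"
      if "0 < \<delta>" for \<delta>
    proof (rule stage_for[OF p e full_e[OF that] x v' b len])
      show "v' ! t = compressed_letter b (\<lambda>q. if q < length x then x ! q else p) (ks ! t)" if "t < length ks" for t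
        using that by (simp add: v'_def x'_def nth_append xp_def[abs_def])
      show "j < r \<and> j' < r \<and> q \<le> length x \<and> cmod c \<le> 1 / 8" if "(j, j', q, c) \<in> set ks" for j j' q c
      proof -
        have "c = 1 / 8 \<or> c = - \<i> / 8" using that by (simp add: ks)
        hence "cmod c \<le> 1 / 8" by (elim disjE) (hypsubst, simp add: norm_divide)+
        thus ?thesis using that by (simp add: ks d_def)
      qed
    qed
    \<comment> \<open>A stage for each error 1 / (i + 1), bundled as one tuple so that a single
      choice selects all its parts.\<close>
    define R where "R i = (\<lambda>(a, s, y, S). (\<forall>l. con (a l) \<and> p * a l = a l \<and> a l * e = a l) \<and> bd 1 (gram a s) \<and>
      nrm (gram a s - e) < 1 / real (Suc i) \<and> ?\<rho> \<le> real s \<and> set y \<subseteq> sac p \<and>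
      stage_ok p (x @ y) e a s b r (length x) ks v' S)" for i
    have "\<exists>q. R i q" for i
    proof -
      have "0 < 1 / real (Suc i)" by simp
      from stage[OF this] show ?thesis unfolding R_def
        by (elim exE) (rule exI, rule case_prodI, rule case_prodI, rule case_prodI)
    qed
    hence "\<forall>i. \<exists>q. R i q" ..
    from choice[OF this] obtain f where f: "\<forall>i. R i (f i)" ..
    define a s y S where "a i = fst (f i)" and "s i = fst (snd (f i))" and "y i = fst (snd (snd (f i)))"
      and "S i = snd (snd (snd (f i)))" for i
    have R: "R i (a i, s i, y i, S i)" for i using f by (simp add: a_def s_def y_def S_def)
    note R' = R[unfolded R_def prod.case]
    have lim: "(\<lambda>i. nrm (gram (a i) (s i) - e)) \<longlonglongrightarrow> 0"
    proof (rule tendsto_sandwich[OF _ _ tendsto_const])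
      have aP: "a i l \<in> P" for i l by (rule con_P) (use R'[of i] in simp)
      have "gram (a i) (s i) \<in> P" for i using aP by (auto simp: gram_def)
      thus "\<forall>\<^sub>F i in sequentially. 0 \<le> nrm (gram (a i) (s i) - e)"
        using tproj_P[OF e] by (intro always_eventually allI nrm_ge0) auto
      show "\<forall>\<^sub>F i in sequentially. nrm (gram (a i) (s i) - e) \<le> 1 / real (Suc i)"
        by (intro always_eventually allI less_imp_le) (use R' in simp)
      show "(\<lambda>i. 1 / real (Suc i)) \<longlonglongrightarrow> 0" by (rule lim_1_over_n[THEN LIMSEQ_Suc])
    qed
    interpret compression P \<tau> con p e a s b r d ks v' "\<lambda>i. x @ y i" "\<lambda>(i, \<omega>). fst (S i) \<omega>"
      "\<lambda>(i, \<omega>). fst (snd (S i)) \<omega>" "\<lambda>t (i, \<omega>). fst (snd (snd (S i))) t \<omega>" "\<lambda>t (i, \<omega>). snd (snd (snd (S i))) t \<omega>"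
      by unfold_locales (simp_all add: p e v' x b lim R' d_def)
    have "\<exists>i U. open U \<and> lawq p (x @ y i) \<in> U \<and>
      (\<forall>\<^sub>F m in sequentially. covering m (length x) (length (y i)) \<epsilon> U \<le>
         covering (nat \<lfloor>real m * \<rho>\<rfloor>) (length ks) (length v' - length ks) \<epsilon>' U')"
    proof (rule covering_le)
      show "84 * ((real r)\<^sup>2 + 1) * (32 * \<epsilon>' * sqrt \<rho>) \<le> \<epsilon> / real (d + 1)"
        using small by (simp only: \<rho>_def)
      show "lawq e v' \<in> U'" using U'(2) by (simp only: v'_def)
      show "(j, j', q, c) \<in> set ks" if "j < r" "j' < r" "q \<le> d" "c = 1 / 8 \<or> c = - \<i> / 8" for j j' q c
        unfolding ks using that(1-3) by (intro SigmaI) (use that(4) in blast)+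
    qed (fact d_def len \<epsilon> \<epsilon>' U' full | rule refl)+
    moreover have "length ks = length x'" "length v' - length ks = length y'" by (simp_all add: v'_def x'_def)
    ultimately show "\<exists>y U. set y \<subseteq> sac p \<and> open U \<and> lawq p (x @ y) \<in> U \<and>
          (\<forall>\<^sub>F m in sequentially. covering m (length x) (length y) \<epsilon> U \<le>
            covering (nat \<lfloor>real m * ?\<rho>\<rfloor>) (length x') (length y') \<epsilon>' U')"
      unfolding \<rho>_def
    proof (elim exE conjE)
      fix i U
      assume U: "open U" "lawq p (x @ y i) \<in> U" "\<forall>\<^sub>F m in sequentially. covering m (length x) (length (y i)) \<epsilon> U \<le>
         covering (nat \<lfloor>real m * ?\<rho>\<rfloor>) (length ks) (length v' - length ks) \<epsilon>' U'"
        and len: "length ks = length x'" "length v' - length ks = length y'"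
      have "set (y i) \<subseteq> sac p" using R'[of i] by simp
      thus ?thesis
        by (intro exI[of _ "y i"] exI[of _ U] conjI U(1,2) U(3)[unfolded len(2), unfolded len(1)])
    qed
  qed
qed

section \<open>Operators on complex Hilbert spaces\<close>

lemma cinner_add_right: "cinner u (v + w) = cinner u v + cinner u w"
  by (metis cinner_commute cinner_add_left complex_cnj_add)

lemma cinner_scaleC_right: "cinner v (c *\<^sub>C w) = cnj c * cinner v w"
  by (metis cinner_commute cinner_scaleC_left complex_cnj_mult)

lemma scaleC_zero_left [simp]: "0 *\<^sub>C v = 0"
  using scaleC_of_real[of 0 v] by simp

lemma scaleC_one [simp]: "1 *\<^sub>C v = v"
  using scaleC_of_real[of 1 v] by simp

lemma scaleC_minus_one: "(- 1) *\<^sub>C v = - v"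
  using scaleC_of_real[of "- 1" v] by simp

lemma scaleC_zero_right [simp]: "c *\<^sub>C 0 = 0"
  using scaleC_add_right[of c 0 0] by simp

lemma scaleC_minus_right: "c *\<^sub>C (- v) = - (c *\<^sub>C v)"
  using scaleC_add_right[of c v "- v"] by (simp add: eq_neg_iff_add_eq_0 add.commute)

lemma scaleC_diff_right: "c *\<^sub>C (v - w) = c *\<^sub>C v - c *\<^sub>C w"
  using scaleC_add_right[of c v "- w"] by (simp add: scaleC_minus_right)

lemma cinner_zero [simp]: "cinner 0 v = 0" "cinner v 0 = 0"
  using cinner_scaleC_left[of 0 v v] cinner_scaleC_right[of v 0 v] by simp_all

lemma cinner_minus_left: "cinner (- v) w = - cinner v w"
  using cinner_scaleC_left[of "- 1" v w] by (simp add: scaleC_minus_one)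

lemma cinner_minus_right: "cinner v (- w) = - cinner v w"
  using cinner_scaleC_right[of v "- 1" w] by (simp add: scaleC_minus_one)

lemma cinner_diff_left: "cinner (u - v) w = cinner u w - cinner v w"
  using cinner_add_left[of u "- v" w] by (simp add: cinner_minus_left)

lemma cinner_diff_right: "cinner u (v - w) = cinner u v - cinner u w"
  using cinner_add_right[of u v "- w"] by (simp add: cinner_minus_right)

lemma Re_cinner_self: "Re (cinner v v) = (norm v)\<^sup>2"
  by (simp add: cinner_self)

lemma cinner_eqI: assumes "\<And>v. cinner v x = cinner v y" shows "x = y"
proof -
  have "cinner (x - y) (x - y) = 0" using assms[of "x - y"] by (simp add: cinner_diff_right)
  thus ?thesis using cinner_self[of "x - y"] by simp
qed

lemma cmod_cinner_le: "cmod (cinner v w) \<le> norm v * norm w"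
proof (cases "w = 0")
  case False
  define c where "c = cinner v w / of_real ((norm w)\<^sup>2)"
  have w: "(norm w)\<^sup>2 > 0" using False by simp
  have "0 \<le> Re (cinner (v - c *\<^sub>C w) (v - c *\<^sub>C w))" by (simp only: Re_cinner_self zero_le_power2)
  also have "cinner (v - c *\<^sub>C w) (v - c *\<^sub>C w) = of_real ((norm v)\<^sup>2) - cnj c * cinner v w - c * cnj (cinner v w)
      + c * cnj c * of_real ((norm w)\<^sup>2)"
    unfolding cinner_commute[of w v, symmetric] cinner_self[symmetric]
    by (simp only: cinner_diff_left cinner_diff_right cinner_scaleC_left cinner_scaleC_right) (simp add: algebra_simps)
  also have "c * cnj c * of_real ((norm w)\<^sup>2) = c * cnj (cinner v w)"
    using False by (simp add: c_def power2_eq_square)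
  also have "cnj c * cinner v w = of_real ((cmod (cinner v w))\<^sup>2 / (norm w)\<^sup>2)"
    using complex_norm_square[of "cinner v w"] by (simp add: c_def mult.commute)
  finally have "(cmod (cinner v w))\<^sup>2 / (norm w)\<^sup>2 \<le> (norm v)\<^sup>2" by simp
  hence "(cmod (cinner v w))\<^sup>2 \<le> (norm v * norm w)\<^sup>2"
    using w by (simp add: pos_divide_le_eq power_mult_distrib del: zero_less_power2)
  thus ?thesis by (rule power2_le_imp_le) simp
qed simp

lemma tendsto_cinner_left:
  assumes "(f \<longlongrightarrow> v) F" shows "((\<lambda>n. cinner (f n) w) \<longlongrightarrow> cinner v w) F"
proof -
  have "((\<lambda>n. norm (f n - v) * norm w) \<longlongrightarrow> 0 * norm w) F"
    by (intro tendsto_mult tendsto_const tendsto_norm_zero) (use assms in \<open>simp add: LIM_zero_iff\<close>)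
  hence "((\<lambda>n. norm (f n - v) * norm w) \<longlongrightarrow> 0) F" by simp
  hence "((\<lambda>n. cinner (f n) w - cinner v w) \<longlongrightarrow> 0) F"
    by (rule Lim_null_comparison[rotated])
      (use cmod_cinner_le in \<open>auto simp: cinner_diff_left[symmetric] intro!: always_eventually\<close>)
  thus ?thesis by (simp add: LIM_zero_iff)
qed

lemma is_adjoint_unique: "is_adjoint S T \<Longrightarrow> is_adjoint S' T \<Longrightarrow> S = S'"
  by (rule blinfun_eqI, rule cinner_eqI) (metis is_adjoint_def)

lemma is_adjoint_sym: "is_adjoint S T \<Longrightarrow> is_adjoint T S"
  unfolding is_adjoint_def by (metis cinner_commute)

lemma is_adjoint_complex_linear:
  assumes "is_adjoint S T" shows "complex_linear S"
proof -
  have "cinner v (blinfun_apply S (c *\<^sub>C w)) = cinner v (c *\<^sub>C blinfun_apply S w)" for v c w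
    using assms by (simp add: is_adjoint_def[THEN iffD1, rule_format, symmetric] cinner_scaleC_right)
  thus ?thesis unfolding complex_linear_def using cinner_eqI by blast
qed

lemma is_adjoint_add: "is_adjoint S T \<Longrightarrow> is_adjoint S' T' \<Longrightarrow> is_adjoint (S + S') (T + T')"
  by (simp add: is_adjoint_def blinfun.bilinear_simps cinner_add_left cinner_add_right)

lemma is_adjoint_diff: "is_adjoint S T \<Longrightarrow> is_adjoint S' T' \<Longrightarrow> is_adjoint (S - S') (T - T')"
  by (simp add: is_adjoint_def blinfun.bilinear_simps cinner_diff_left cinner_diff_right)

lemma is_adjoint_compose: "is_adjoint S T \<Longrightarrow> is_adjoint S' T' \<Longrightarrow> is_adjoint (S' o\<^sub>L S) (T o\<^sub>L T')"
  by (simp add: is_adjoint_def)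

lemma is_adjoint_scaleC: "is_adjoint S T \<Longrightarrow> is_adjoint (scaleC_op (cnj c) S) (scaleC_op c T)"
  by (simp add: is_adjoint_def scaleC_op.rep_eq cinner_scaleC_left cinner_scaleC_right)

lemma is_adjoint_zero: "is_adjoint 0 0"
  by (simp add: is_adjoint_def)

lemma norm_adjoint_le:
  assumes "is_adjoint S T" shows "norm S \<le> norm T"
proof (rule norm_blinfun_bound)
  fix v
  let ?w = "blinfun_apply S v"
  have "(norm ?w)\<^sup>2 = Re (cinner (blinfun_apply T ?w) v)"
    using assms by (simp add: is_adjoint_def Re_cinner_self[symmetric])
  also have "\<dots> \<le> norm (blinfun_apply T ?w) * norm v"
    using complex_Re_le_cmod cmod_cinner_le order_trans by blast
  also have "\<dots> \<le> (norm T * norm ?w) * norm v" by (intro mult_right_mono norm_blinfun) simp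
  finally have "norm ?w * norm ?w \<le> (norm T * norm v) * norm ?w" by (simp add: power2_eq_square mult_ac)
  thus "norm ?w \<le> norm T * norm v"
    by (cases "norm ?w = 0") (simp, metis mult_right_le_imp_le norm_ge_zero less_eq_real_def)
qed simp

text \<open>Having an adjoint is part of the type, which makes the involution total; elements of a
  von Neumann algebra have adjoints by definition. Complex linearity is what lets scalars pass
  through a left factor.\<close>

typedef (overloaded) 'h cop = "{T :: 'h::complex_hilbert_space operator. complex_linear T \<and> (\<exists>S. is_adjoint S T)}"
  morphisms op Cop
  by (rule exI[of _ 0]) (auto simp: complex_linear_def intro: is_adjoint_zero)

lemma cop_eqI: "(\<And>v. blinfun_apply (op A) v = blinfun_apply (op B) v) \<Longrightarrow> A = B"
  using op_inject blinfun_eqI by blast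

lemma op_linear: "complex_linear (op A)" and op_adjoint: "\<exists>S. is_adjoint S (op A)"
  using op[of A] by auto

lemma op_Cop: "complex_linear T \<Longrightarrow> is_adjoint S T \<Longrightarrow> op (Cop T) = T"
  by (rule Cop_inverse) blast

instantiation cop :: (complex_hilbert_space) complex_star_algebra
begin

definition "0 = Cop 0"
definition "A + B = Cop (op A + op B)"
definition "A - B = Cop (op A - op B)"
definition "- A = Cop (- op A)" for A :: "'a cop"
definition "A * B = Cop (op A o\<^sub>L op B)"
definition "c \<star> A = Cop (scaleC_op c (op A))"
definition "adj A = Cop (SOME S. is_adjoint S (op A))"

lemma op_zero: "op 0 = (0 :: 'a operator)"
  unfolding zero_cop_def by (rule op_Cop[OF _ is_adjoint_zero]) (simp add: complex_linear_def)

lemma op_add: "op (A + B) = op A + op B" for A B :: "'a cop"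
proof -
  obtain S S' where "is_adjoint S (op A)" "is_adjoint S' (op B)" using op_adjoint by blast
  thus ?thesis unfolding plus_cop_def using op_linear[of A] op_linear[of B]
    by (intro op_Cop[OF _ is_adjoint_add]) (auto simp: complex_linear_def blinfun.bilinear_simps scaleC_add_right)
qed

lemma op_diff: "op (A - B) = op A - op B" for A B :: "'a cop"
proof -
  obtain S S' where "is_adjoint S (op A)" "is_adjoint S' (op B)" using op_adjoint by blast
  thus ?thesis unfolding minus_cop_def using op_linear[of A] op_linear[of B]
    by (intro op_Cop[OF _ is_adjoint_diff]) (auto simp: complex_linear_def blinfun.bilinear_simps scaleC_diff_right)
qed

lemma op_uminus: "op (- A) = - op A" for A :: "'a cop"
  using op_diff[of 0 A] by (simp add: uminus_cop_def minus_cop_def op_zero)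

lemma op_mult: "op (A * B) = op A o\<^sub>L op B" for A B :: "'a cop"
proof -
  obtain S S' where "is_adjoint S (op A)" "is_adjoint S' (op B)" using op_adjoint by blast
  thus ?thesis unfolding times_cop_def using op_linear[of A] op_linear[of B]
    by (intro op_Cop[OF _ is_adjoint_compose]) (auto simp: complex_linear_def)
qed

lemma op_cscale: "op (c \<star> A) = scaleC_op c (op A)" for A :: "'a cop"
proof -
  obtain S where "is_adjoint S (op A)" using op_adjoint by blast
  thus ?thesis unfolding cscale_cop_def using op_linear[of A]
    by (intro op_Cop[OF _ is_adjoint_scaleC])
      (auto simp: complex_linear_def scaleC_op.rep_eq scaleC_scaleC mult.commute)
qed

lemma op_adj: "is_adjoint (op (adj A)) (op A)" for A :: "'a cop"
proof -
  have S: "is_adjoint (SOME S. is_adjoint S (op A)) (op A)" by (rule someI_ex[OF op_adjoint])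
  thus ?thesis unfolding adj_cop_def
    using op_Cop[OF is_adjoint_complex_linear[OF S] is_adjoint_sym[OF S]] by simp
qed

lemma op_adjI: "is_adjoint (op B) (op A) \<Longrightarrow> adj A = B" for A B :: "'a cop"
  using is_adjoint_unique[OF op_adj] op_inject by blast

instance
proof
  fix A B C :: "'a cop" and c d :: complex
  note ops = op_zero op_add op_diff op_uminus op_mult op_cscale blinfun.bilinear_simps scaleC_op.rep_eq
  show "A + B + C = A + (B + C)" "A + B = B + A" "0 + A = A" "- A + A = 0" "A - B = A + - B"
    "A * B * C = A * (B * C)" "(A + B) * C = A * C + B * C" "A * (B + C) = A * B + A * C"
    "(c + d) \<star> A = c \<star> A + d \<star> A" "c \<star> d \<star> A = (c * d) \<star> A" "1 \<star> A = A"
    "(c \<star> A) * B = c \<star> (A * B)" "c \<star> (A + B) = c \<star> A + c \<star> B"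
    by (rule cop_eqI; simp add: ops add_ac scaleC_add_left scaleC_add_right scaleC_scaleC)+
  show "A * (c \<star> B) = c \<star> (A * B)"
    using op_linear[of A] by (intro cop_eqI) (simp add: ops complex_linear_def)
  show "adj (adj A) = A" by (rule op_adjI[OF is_adjoint_sym[OF op_adj]])
  show "adj (A + B) = adj A + adj B"
    by (rule op_adjI) (simp add: op_add is_adjoint_add op_adj)
  show "adj (A * B) = adj B * adj A"
    by (rule op_adjI) (simp add: op_mult is_adjoint_compose op_adj)
  show "adj (c \<star> A) = cnj c \<star> adj A"
    by (rule op_adjI) (simp add: op_cscale is_adjoint_scaleC op_adj)
qed

end

section \<open>Norm and order estimates for operators\<close>

lemma norm_scaleC_op: "norm (scaleC_op c T) \<le> cmod c * norm T"
proof (rule norm_blinfun_bound)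
  fix v show "norm (blinfun_apply (scaleC_op c T) v) \<le> cmod c * norm T * norm v"
    using norm_blinfun[of T v] by (simp add: scaleC_op.rep_eq norm_scaleC mult.assoc mult_left_mono)
qed simp

text \<open>\<open>{A, B}\<close> is directed with supremum \<open>B\<close> if \<open>A \<le> B\<close>.\<close>

lemma normal_functional_mono:
  assumes n: "normal_functional M \<tau>" and A: "A \<in> M" "self_adjoint A" "op_le 0 A"
    and B: "B \<in> M" "self_adjoint B" "op_le A B"
  shows "Re (\<tau> A) \<le> Re (\<tau> B)"
proof -
  have "op_le 0 B" using A B by (auto simp: op_le_def intro: order_trans)
  moreover have "op_le A A" "op_le B B" by (auto simp: op_le_def)
  ultimately have "Re (\<tau> B) = (SUP T\<in>{A, B}. Re (\<tau> T))"
    using n[unfolded normal_functional_def, rule_format, of "{A, B}" B] A B by blast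
  also have "\<dots> \<ge> Re (\<tau> A)" by (rule cSUP_upper) auto
  finally show ?thesis .
qed

text \<open>z^2 <= z for 0 <= z <= 1 without a square root: positivity of z at the vector v - z v
  gives 2 |z v|^2 <= <z v, v> + <z z v, z v>, and the last term is at most |z v|^2.\<close>

lemma square_le_of_contraction:
  assumes z: "self_adjoint z" "op_le 0 z" "op_le z id_blinfun"
  shows "(norm (blinfun_apply z v))\<^sup>2 \<le> Re (cinner (blinfun_apply z v) v)"
proof -
  let ?z = "blinfun_apply z"
  have pos: "0 \<le> Re (cinner (?z v) v)" and le: "Re (cinner (?z v) v) \<le> (norm v)\<^sup>2" for v
    using z by (simp_all add: op_le_def Re_cinner_self)
  have sa: "cinner (?z v) w = cinner v (?z w)" for v w
    using z(1) by (simp add: self_adjoint_def is_adjoint_def)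
  have "0 \<le> Re (cinner (?z (v - ?z v)) (v - ?z v))" by (rule pos)
  also have "\<dots> = Re (cinner (?z v) v) - 2 * (norm (?z v))\<^sup>2 + Re (cinner (?z (?z v)) (?z v))"
    using sa[of "?z v" v] by (simp add: blinfun.bilinear_simps cinner_diff_left cinner_diff_right cinner_self)
  finally show ?thesis using le[of "?z v"] by simp
qed

lemma norm_le_1_of_contraction:
  assumes z: "self_adjoint z" "op_le 0 z" "op_le z id_blinfun" shows "norm z \<le> 1"
proof (rule norm_blinfun_bound)
  fix v
  have "(norm (blinfun_apply z v))\<^sup>2 \<le> Re (cinner (blinfun_apply z v) v)" by (rule square_le_of_contraction[OF z])
  also have "\<dots> \<le> norm (blinfun_apply z v) * norm v"
    using complex_Re_le_cmod cmod_cinner_le order_trans by blast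
  finally show "norm (blinfun_apply z v) \<le> 1 * norm v"
    by (cases "norm (blinfun_apply z v) = 0") (simp, simp add: power2_eq_square)
qed simp

section \<open>Operators on a direct sum as matrices of operators\<close>

lemma op_entry_apply: "blinfun_apply (op_entry i j T) v = vec_nth (blinfun_apply T (axis j v)) i"
  by (simp add: op_entry.rep_eq)

lemma axis_nth: "vec_nth (axis j v) i = (if i = j then v else 0)"
  by (simp add: axis_def)

lemma axis_zero: "axis j 0 = 0"
  by (simp add: Finite_Cartesian_Product.vec_eq_iff axis_nth)

lemma scaleC_nth: "vec_nth (c *\<^sub>C v) i = c *\<^sub>C vec_nth v i" for v :: "'h::complex_hilbert_space ^ 'k::finite"
  by (simp add: scaleC_vec_def)

lemma axis_scaleC: "axis j (c *\<^sub>C v) = c *\<^sub>C axis j v"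
  for v :: "'h::complex_hilbert_space" and j :: "'k::finite"
  by (simp add: Finite_Cartesian_Product.vec_eq_iff axis_nth scaleC_nth)

lemma axis_add: "axis j (v + w) = axis j v + axis j w"
  for v :: "'h::complex_hilbert_space" and j :: "'k::finite"
  by (simp add: Finite_Cartesian_Product.vec_eq_iff axis_nth)

lemma cinner_axis: "cinner (axis j v) w = cinner v (vec_nth w j)" "cinner w (axis j v) = cinner (vec_nth w j) v"
  for v :: "'h::complex_hilbert_space" and w :: "'h ^ 'k::finite"
proof -
  have "cinner (axis j v) w = (\<Sum>i\<in>UNIV. if i = j then cinner v (vec_nth w i) else 0)"
    unfolding cinner_vec_def by (intro sum.cong) (auto simp: axis_nth)
  thus 1: "cinner (axis j v) w = cinner v (vec_nth w j)" by simp
  show "cinner w (axis j v) = cinner (vec_nth w j) v"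
    unfolding cinner_commute[of w] 1 by (rule cinner_commute[symmetric])
qed

lemma norm_axis: "norm (axis j v) = norm v" for v :: "'h::complex_hilbert_space" and j :: "'k::finite"
proof -
  have "(norm (axis j v))\<^sup>2 = (norm v)\<^sup>2"
    unfolding Re_cinner_self[symmetric] by (simp add: cinner_axis axis_nth)
  thus ?thesis by simp
qed

lemma sum_axis: "(\<Sum>k\<in>UNIV. axis k (vec_nth w k)) = w" for w :: "'h::complex_hilbert_space ^ 'k::finite"
  by (simp add: Finite_Cartesian_Product.vec_eq_iff axis_nth)

lemma apply_by_entries:
  "vec_nth (blinfun_apply T w) i = (\<Sum>k\<in>UNIV. blinfun_apply (op_entry i k T) (vec_nth w k))"
proof -
  have "blinfun_apply T w = (\<Sum>k\<in>UNIV. blinfun_apply T (axis k (vec_nth w k)))"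
    by (subst sum_axis[symmetric]) (simp only: blinfun.sum_right)
  thus ?thesis by (simp add: op_entry_apply)
qed

lemma op_entry_eqI: "(\<And>i j. op_entry i j S = op_entry i j T) \<Longrightarrow> S = T"
  by (rule blinfun_eqI) (simp add: Finite_Cartesian_Product.vec_eq_iff apply_by_entries)

lemma op_entry_compose: "op_entry i j (S o\<^sub>L T) = (\<Sum>k\<in>UNIV. op_entry i k S o\<^sub>L op_entry k j T)"
proof (rule blinfun_eqI)
  fix v
  have "blinfun_apply (op_entry i j (S o\<^sub>L T)) v = vec_nth (blinfun_apply S (blinfun_apply T (axis j v))) i"
    by (simp add: op_entry_apply)
  also have "\<dots> = blinfun_apply (\<Sum>k\<in>UNIV. op_entry i k S o\<^sub>L op_entry k j T) v"
    unfolding apply_by_entries[of S] by (simp add: blinfun.sum_left op_entry_apply[of _ j T])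
  finally show "blinfun_apply (op_entry i j (S o\<^sub>L T)) v = blinfun_apply (\<Sum>k\<in>UNIV. op_entry i k S o\<^sub>L op_entry k j T) v" .
qed

lemma op_entry_linear:
  "op_entry i j (S + T) = op_entry i j S + op_entry i j T"
  "op_entry i j (S - T) = op_entry i j S - op_entry i j T"
  "op_entry i j (scaleC_op c T) = scaleC_op c (op_entry i j T)"
  "op_entry i j 0 = 0"
  by (rule blinfun_eqI, simp add: op_entry_apply blinfun.bilinear_simps scaleC_op.rep_eq scaleC_nth)+

lemma op_entry_adjoint: "is_adjoint S T \<Longrightarrow> is_adjoint (op_entry j i S) (op_entry i j T)"
  unfolding is_adjoint_def op_entry_apply cinner_axis(1)[symmetric] cinner_axis(2)[symmetric] by blast

lemma op_entry_op_le: "op_le S T \<Longrightarrow> op_le (op_entry i i S) (op_entry i i T)"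
  unfolding op_le_def op_entry_apply cinner_axis(2)[symmetric] by blast

lemma scaleC_sum: "c *\<^sub>C (\<Sum>k\<in>A. f k) = (\<Sum>k\<in>A. c *\<^sub>C f k)"
  by (induction A rule: infinite_finite_induct) (auto simp: scaleC_add_right)

lemma complex_linear_entries:
  assumes "\<And>i j. complex_linear (op_entry i j T)" shows "complex_linear T"
  unfolding complex_linear_def
proof (intro allI)
  fix c v
  have "blinfun_apply (op_entry i k T) (c *\<^sub>C vec_nth v k) = c *\<^sub>C blinfun_apply (op_entry i k T) (vec_nth v k)" for i k
    using assms by (simp add: complex_linear_def)
  thus "blinfun_apply T (c *\<^sub>C v) = c *\<^sub>C blinfun_apply T v"
    by (simp add: Finite_Cartesian_Product.vec_eq_iff apply_by_entries[of T] scaleC_nth scaleC_sum)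
qed

definition eop :: "'k::finite \<Rightarrow> 'k \<Rightarrow> 'h::complex_hilbert_space operator \<Rightarrow> ('h ^ 'k) operator" where
  "eop i j m = Blinfun (\<lambda>v. axis i (blinfun_apply m (vec_nth v j)))"

lemma eop_apply: "blinfun_apply (eop i j m) v = axis i (blinfun_apply m (vec_nth v j))"
proof -
  have "bounded_linear (\<lambda>v::'a ^ 'b. axis i (blinfun_apply m (vec_nth v j)))"
  proof (rule bounded_linear_intro[where K = "norm m"])
    fix v w :: "'a ^ 'b" and r :: real
    show "axis i (blinfun_apply m (vec_nth (v + w) j)) = axis i (blinfun_apply m (vec_nth v j)) + axis i (blinfun_apply m (vec_nth w j))"
      by (simp add: blinfun.bilinear_simps axis_add)
    show "axis i (blinfun_apply m (vec_nth (r *\<^sub>R v) j)) = r *\<^sub>R axis i (blinfun_apply m (vec_nth v j))"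
      unfolding vector_scaleR_component blinfun.scaleR_right by (simp only: scaleC_of_real[symmetric] axis_scaleC)
    have "norm (blinfun_apply m (vec_nth v j)) \<le> norm m * norm (vec_nth v j)" by (rule norm_blinfun)
    also have "\<dots> \<le> norm m * norm v" by (intro mult_left_mono Finite_Cartesian_Product.norm_nth_le) simp
    finally show "norm (axis i (blinfun_apply m (vec_nth v j))) \<le> norm v * norm m"
      by (simp add: norm_axis mult.commute)
  qed
  thus ?thesis by (simp add: eop_def bounded_linear_Blinfun_apply)
qed

lemma op_entry_eop: "op_entry a b (eop i j m) = (if a = i \<and> b = j then m else 0)"
  by (rule blinfun_eqI) (simp add: op_entry_apply eop_apply axis_nth)

lemma eop_compose: "eop i j m o\<^sub>L eop k l n = (if j = k then eop i l (m o\<^sub>L n) else 0)"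
  by (rule blinfun_eqI) (simp add: eop_apply axis_nth axis_zero)

lemma eop_adjoint: "is_adjoint S T \<Longrightarrow> is_adjoint (eop j i S) (eop i j T)"
  by (simp add: is_adjoint_def eop_apply cinner_axis)

lemma norm_eop_le: "norm (eop i j m) \<le> norm m"
proof (rule norm_blinfun_bound)
  fix v :: "'a ^ 'b"
  have "norm (blinfun_apply m (vec_nth v j)) \<le> norm m * norm (vec_nth v j)" by (rule norm_blinfun)
  also have "\<dots> \<le> norm m * norm v" by (intro mult_left_mono Finite_Cartesian_Product.norm_nth_le) simp
  finally show "norm (blinfun_apply (eop i j m) v) \<le> norm m * norm v" by (simp add: eop_apply norm_axis)
qed simp

text \<open>M and its amplification are treated as two corners of the one algebra N of matrices over
  M. The index \<open>i0\<close> selects the diagonal corner that is identified with M; the trace of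
  N is unnormalised, so it is 1 on that corner.\<close>

locale amp =
  fixes M :: "'h::complex_hilbert_space operator set" and \<tau> :: "'h operator \<Rightarrow> complex" and i0 :: "'k::finite"
  assumes vn: "tracial_von_neumann_algebra M \<tau>"
begin

lemma M_linear: "T \<in> M \<Longrightarrow> complex_linear T"
  and M_id: "id_blinfun \<in> M"
  and M_add: "S \<in> M \<Longrightarrow> T \<in> M \<Longrightarrow> S + T \<in> M"
  and M_scale: "T \<in> M \<Longrightarrow> scaleC_op c T \<in> M"
  and M_comp: "S \<in> M \<Longrightarrow> T \<in> M \<Longrightarrow> S o\<^sub>L T \<in> M"
  and M_adj_ex: "T \<in> M \<Longrightarrow> \<exists>S\<in>M. is_adjoint S T"
  and M_closed: "closedin strong_operator_topology M"
proof -
  note f = vn[unfolded tracial_von_neumann_algebra_def von_neumann_algebra_def, THEN conjunct1]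
  show "T \<in> M \<Longrightarrow> complex_linear T" "id_blinfun \<in> M" "S \<in> M \<Longrightarrow> T \<in> M \<Longrightarrow> S + T \<in> M"
    "T \<in> M \<Longrightarrow> scaleC_op c T \<in> M" "S \<in> M \<Longrightarrow> T \<in> M \<Longrightarrow> S o\<^sub>L T \<in> M"
    "T \<in> M \<Longrightarrow> \<exists>S\<in>M. is_adjoint S T" "closedin strong_operator_topology M"
    using f by (elim conjE, simp only: Ball_def)+
qed

lemma tau_add: "S \<in> M \<Longrightarrow> T \<in> M \<Longrightarrow> \<tau> (S + T) = \<tau> S + \<tau> T"
  and tau_scale: "T \<in> M \<Longrightarrow> \<tau> (scaleC_op c T) = c * \<tau> T"
  and tau_id: "\<tau> id_blinfun = 1"
  and tau_Im: "S \<in> M \<Longrightarrow> T \<in> M \<Longrightarrow> is_adjoint S T \<Longrightarrow> Im (\<tau> (S o\<^sub>L T)) = 0"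
  and tau_pos: "S \<in> M \<Longrightarrow> T \<in> M \<Longrightarrow> is_adjoint S T \<Longrightarrow> 0 \<le> Re (\<tau> (S o\<^sub>L T))"
  and tau_faithful: "S \<in> M \<Longrightarrow> T \<in> M \<Longrightarrow> is_adjoint S T \<Longrightarrow> \<tau> (S o\<^sub>L T) = 0 \<Longrightarrow> T = 0"
  and tau_comm: "S \<in> M \<Longrightarrow> T \<in> M \<Longrightarrow> \<tau> (S o\<^sub>L T) = \<tau> (T o\<^sub>L S)"
  and tau_normal: "normal_functional M \<tau>"
proof -
  note f = vn[unfolded tracial_von_neumann_algebra_def faithful_normal_tracial_state_def, THEN conjunct2]
  show "S \<in> M \<Longrightarrow> T \<in> M \<Longrightarrow> \<tau> (S + T) = \<tau> S + \<tau> T" using f by (elim conjE) simp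
  show "T \<in> M \<Longrightarrow> \<tau> (scaleC_op c T) = c * \<tau> T" using f by (elim conjE) simp
  show "\<tau> id_blinfun = 1" using f by (elim conjE)
  show "S \<in> M \<Longrightarrow> T \<in> M \<Longrightarrow> is_adjoint S T \<Longrightarrow> Im (\<tau> (S o\<^sub>L T)) = 0"
    "S \<in> M \<Longrightarrow> T \<in> M \<Longrightarrow> is_adjoint S T \<Longrightarrow> 0 \<le> Re (\<tau> (S o\<^sub>L T))"
    using f[THEN conjunct2, THEN conjunct2, THEN conjunct2, THEN conjunct1] by simp_all
  show "S \<in> M \<Longrightarrow> T \<in> M \<Longrightarrow> is_adjoint S T \<Longrightarrow> \<tau> (S o\<^sub>L T) = 0 \<Longrightarrow> T = 0"
    using f[THEN conjunct2, THEN conjunct2, THEN conjunct2, THEN conjunct2, THEN conjunct1] by simp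
  show "S \<in> M \<Longrightarrow> T \<in> M \<Longrightarrow> \<tau> (S o\<^sub>L T) = \<tau> (T o\<^sub>L S)"
    by (rule f[THEN conjunct2, THEN conjunct2, THEN conjunct2, THEN conjunct2, THEN conjunct2, THEN conjunct1, rule_format])
  show "normal_functional M \<tau>" using f by (elim conjE)
qed

lemma scaleC_op_0: "scaleC_op 0 T = 0" for T :: "'x::complex_hilbert_space operator"
  by (rule blinfun_eqI) (simp add: scaleC_op.rep_eq)

lemma scaleC_op_m1: "S + scaleC_op (-1) T = S - T" for S T :: "'x::complex_hilbert_space operator"
  by (rule blinfun_eqI) (simp add: scaleC_op.rep_eq blinfun.bilinear_simps scaleC_minus_one)

lemma M_zero: "0 \<in> M" using M_scale[OF M_id, of 0] by (simp add: scaleC_op_0)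

lemma M_diff: "S \<in> M \<Longrightarrow> T \<in> M \<Longrightarrow> S - T \<in> M"
  using M_add[OF _ M_scale[of T "-1"], of S] by (simp add: scaleC_op_m1)

lemma M_sum: "(\<And>i. i \<in> A \<Longrightarrow> f i \<in> M) \<Longrightarrow> (\<Sum>i\<in>A. f i) \<in> M"
  by (induction A rule: infinite_finite_induct) (auto intro: M_zero M_add)

lemma tau_zero: "\<tau> 0 = 0"
  using tau_scale[OF M_id, of 0] by (simp add: scaleC_op_0)

lemma tau_sum: "(\<And>i. i \<in> A \<Longrightarrow> f i \<in> M) \<Longrightarrow> \<tau> (\<Sum>i\<in>A. f i) = (\<Sum>i\<in>A. \<tau> (f i))"
  by (induction A rule: infinite_finite_induct) (auto simp: tau_add M_sum tau_zero)

lemma M_adj: "T \<in> M \<Longrightarrow> is_adjoint S T \<Longrightarrow> S \<in> M"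
proof -
  assume T: "T \<in> M" and S: "is_adjoint S T"
  obtain S' where "S' \<in> M" "is_adjoint S' T" using M_adj_ex[OF T] by (elim bexE)
  thus "S \<in> M" using is_adjoint_unique[OF S] by simp
qed

definition P :: "('h ^ 'k) cop set" where "P = {A. op A \<in> matrix_amplification M}"

definition T :: "('h ^ 'k) cop \<Rightarrow> complex" where "T A = matrix_trace \<tau> (op A)"

definition con :: "('h ^ 'k) cop \<Rightarrow> bool" where "con A \<longleftrightarrow> A \<in> P \<and> norm (op A) \<le> 1"

lemma P_iff: "A \<in> P \<longleftrightarrow> (\<forall>i j. op_entry i j (op A) \<in> M)"
  by (simp add: P_def matrix_amplification_def)

lemma entries: "A \<in> P \<Longrightarrow> op_entry i j (op A) \<in> M"
  by (simp add: P_iff)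

lemma entry_adj: "is_adjoint (op_entry j i (op (adj A))) (op_entry i j (op A))"
  by (rule op_entry_adjoint[OF op_adj])

lemma T_mult: "A \<in> P \<Longrightarrow> B \<in> P \<Longrightarrow> T (A * B) = (\<Sum>i\<in>UNIV. \<Sum>k\<in>UNIV. \<tau> (op_entry i k (op A) o\<^sub>L op_entry k i (op B)))"
  unfolding T_def matrix_trace_def op_mult op_entry_compose
  by (intro sum.cong refl tau_sum M_comp entries)

lemma T_adj_mult: "A \<in> P \<Longrightarrow> adj A \<in> P \<Longrightarrow>
    T (adj A * A) = (\<Sum>i\<in>UNIV. \<Sum>k\<in>UNIV. \<tau> (op_entry i k (op (adj A)) o\<^sub>L op_entry k i (op A)))"
  by (rule T_mult)

lemma P_adj': "A \<in> P \<Longrightarrow> adj A \<in> P"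
  unfolding P_iff by (intro allI M_adj[OF _ entry_adj]) simp

text \<open>Positivity of \<tau> is given for products S^* S, while here an operator order is
  compared. Normality supplies monotonicity for the diagonal entries, so no square root of B - A is
  taken.\<close>

lemma T_mono:
  assumes A: "A \<in> P" "adj A = A" "op_le 0 (op A)" and B: "B \<in> P" "adj B = B" "op_le (op A) (op B)"
  shows "Re (T A) \<le> Re (T B)"
proof -
  have sa: "self_adjoint (op_entry i i (op C))" if "adj C = C" for C :: "('h ^ 'k) cop" and i
    using entry_adj[of i i C] that by (simp add: self_adjoint_def)
  have "Re (\<tau> (op_entry i i (op A))) \<le> Re (\<tau> (op_entry i i (op B)))" for i
  proof (rule normal_functional_mono[OF tau_normal])
    show "op_le 0 (op_entry i i (op A))" using op_entry_op_le[OF A(3), of i] by (simp add: op_entry_linear)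
  qed (use A B sa entries op_entry_op_le in auto)
  thus ?thesis by (simp add: T_def matrix_trace_def sum_mono)
qed

lemma op_adj_mult: "Re (cinner (blinfun_apply (op (adj A * A)) v) v) = (norm (blinfun_apply (op A) v))\<^sup>2"
  using is_adjoint_sym[OF op_adj[of A]] by (simp add: op_mult is_adjoint_def Re_cinner_self)

lemma tracial_P: "tracial P T"
proof
  fix A B :: "('h ^ 'k) cop" and c
  show "0 \<in> P" by (simp add: P_iff op_zero op_entry_linear M_zero)
  assume A: "A \<in> P"
  show "c \<star> A \<in> P" using A by (simp add: P_iff op_cscale op_entry_linear M_scale)
  show aA: "adj A \<in> P" by (rule P_adj'[OF A])
  show "T (c \<star> A) = c * T A"
    using A by (simp add: T_def matrix_trace_def op_cscale op_entry_linear tau_scale entries sum_distrib_left)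
  show "Im (T (adj A * A)) = 0" "0 \<le> Re (T (adj A * A))"
    unfolding T_adj_mult[OF A aA] Im_sum Re_sum
    by (intro sum.neutral ballI sum_nonneg tau_Im tau_pos entries A aA entry_adj)+
  assume B: "B \<in> P"
  show "A + B \<in> P" using A B by (simp add: P_iff op_add op_entry_linear M_add)
  show "A * B \<in> P" using A B by (simp add: P_iff op_mult op_entry_compose M_sum M_comp)
  show "T (A + B) = T A + T B"
    using A B by (simp add: T_def matrix_trace_def op_add op_entry_linear tau_add entries sum.distrib)
  have "T (A * B) = (\<Sum>i\<in>UNIV. \<Sum>k\<in>UNIV. \<tau> (op_entry k i (op B) o\<^sub>L op_entry i k (op A)))"
    unfolding T_mult[OF A B] by (intro sum.cong refl tau_comm entries A B)
  also have "\<dots> = T (B * A)" unfolding T_mult[OF B A] by (rule sum.swap)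
  finally show "T (A * B) = T (B * A)" .
qed

sublocale tracial P T by (rule tracial_P)

sublocale linked P T con
proof
  fix A :: "('h ^ 'k) cop" assume A: "con A"
  hence AP: "A \<in> P" and n: "norm (op A) \<le> 1" by (auto simp: con_def)
  show "bd 1 A"
  proof (rule bdI[OF AP])
    fix B assume B: "B \<in> P"
    \<comment> \<open>For a contraction A the operator B^* A^* A B is at most B^* B, and
      monotonicity of the trace makes this a 2-norm estimate.\<close>
    have "Re (T (adj (A * B) * (A * B))) \<le> Re (T (adj B * B))"
    proof (rule T_mono)
      show "op_le (op (adj (A * B) * (A * B))) (op (adj B * B))"
        unfolding op_le_def op_adj_mult
      proof
        fix v
        have "norm (blinfun_apply (op (A * B)) v) \<le> norm (op A) * norm (blinfun_apply (op B) v)"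
          by (simp add: op_mult norm_blinfun)
        also have "\<dots> \<le> 1 * norm (blinfun_apply (op B) v)" by (intro mult_right_mono n) simp
        finally show "(norm (blinfun_apply (op (A * B)) v))\<^sup>2 \<le> (norm (blinfun_apply (op B) v))\<^sup>2"
          by (intro power_mono) simp_all
      qed
      show "op_le 0 (op (adj (A * B) * (A * B)))" unfolding op_le_def op_adj_mult by simp
    qed (use AP B in \<open>auto simp: adj_mult mult.assoc\<close>)
    thus "nrm (A * B) \<le> 1 * nrm B" by (simp add: nrm_def)
  qed simp
  show "con (adj A)" using n AP norm_adjoint_le[OF op_adj[of A]] by (simp add: con_def)
  show "con (c \<star> A)" if "cmod c \<le> 1" for c
  proof -
    have "norm (op (c \<star> A)) \<le> cmod c * norm (op A)" by (simp add: op_cscale norm_scaleC_op)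
    also have "\<dots> \<le> 1" using that n by (simp add: mult_le_one)
    finally show ?thesis using AP by (simp add: con_def)
  qed
  fix B assume B: "con B"
  hence BP: "B \<in> P" and nB: "norm (op B) \<le> 1" by (auto simp: con_def)
  have "norm (op (A * B)) \<le> norm (op A) * norm (op B)" by (simp add: op_mult norm_blinfun_compose)
  also have "\<dots> \<le> 1" using n nB by (simp add: mult_le_one)
  finally show "con (A * B)" using AP BP by (simp add: con_def)
  have "norm (op ((1 / 2) \<star> (A + B))) \<le> 1 / 2 * norm (op A + op B)"
    using norm_scaleC_op[of "1 / 2" "op A + op B"] by (simp add: op_cscale op_add norm_divide)
  also have "\<dots> \<le> 1" using norm_triangle_ineq[of "op A" "op B"] n nB by simp
  finally show "con ((1 / 2) \<star> (A + B))" using AP BP by (simp add: con_def)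
qed

lemma faithful: assumes "A \<in> P" "nrm A = 0" shows "A = 0"
proof -
  note aA = P_adj'[OF assms(1)]
  have "Re (T (adj A * A)) = 0" using assms by (simp add: nrm_def)
  hence "(\<Sum>i\<in>UNIV. \<Sum>k\<in>UNIV. Re (\<tau> (op_entry i k (op (adj A)) o\<^sub>L op_entry k i (op A)))) = 0"
    by (simp add: T_adj_mult[OF assms(1) aA])
  moreover have pos: "0 \<le> Re (\<tau> (op_entry i k (op (adj A)) o\<^sub>L op_entry k i (op A)))" for i k
    by (intro tau_pos entries assms(1) aA entry_adj)
  ultimately have "Re (\<tau> (op_entry i k (op (adj A)) o\<^sub>L op_entry k i (op A))) = 0" for i k
    by (simp add: sum_nonneg_eq_0_iff sum_nonneg)
  moreover have "Im (\<tau> (op_entry i k (op (adj A)) o\<^sub>L op_entry k i (op A))) = 0" for i k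
    by (intro tau_Im entries assms(1) aA entry_adj)
  ultimately have "\<tau> (op_entry i k (op (adj A)) o\<^sub>L op_entry k i (op A)) = 0" for i k
    by (simp add: complex_eq_iff)
  hence "op_entry k i (op A) = 0" for i k
    by (rule tau_faithful[OF entries[OF aA] entries[OF assms(1)] entry_adj])
  hence "op A = 0" by (intro op_entry_eqI) (simp add: op_entry_linear)
  thus ?thesis by (metis op_inject op_zero)
qed

definition U :: "'k \<Rightarrow> 'k \<Rightarrow> 'h operator \<Rightarrow> ('h ^ 'k) cop" where "U i j m = Cop (eop i j m)"

lemma op_U: assumes "m \<in> M" shows "op (U i j m) = eop i j m"
proof -
  obtain S where "is_adjoint S m" using M_adj_ex[OF assms] by blast
  moreover have "complex_linear (eop i j m)"
  proof (rule complex_linear_entries)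
    have "complex_linear (0 :: 'h operator)" by (simp add: complex_linear_def)
    thus "complex_linear (op_entry a b (eop i j m))" for a b
      using M_linear[OF assms] by (simp add: op_entry_eop)
  qed
  ultimately show ?thesis unfolding U_def using eop_adjoint by (intro op_Cop) blast+
qed

lemma U_P: "m \<in> M \<Longrightarrow> U i j m \<in> P"
  by (simp add: P_iff op_U op_entry_eop M_zero)

lemma U_con: "m \<in> M \<Longrightarrow> norm m \<le> 1 \<Longrightarrow> con (U i j m)"
  using norm_eop_le[of i j m] by (simp add: con_def U_P op_U)

lemma U_mult: "m \<in> M \<Longrightarrow> n \<in> M \<Longrightarrow> U i j m * U j l n = U i l (m o\<^sub>L n)"
  by (rule op_inject[THEN iffD1]) (simp add: op_mult op_U M_comp eop_compose)

lemma U_adj: "m \<in> M \<Longrightarrow> is_adjoint m' m \<Longrightarrow> adj (U i j m) = U j i m'"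
  by (rule op_adjI) (simp add: op_U M_adj eop_adjoint)

lemma norm_id_le: "norm (id_blinfun :: 'h operator) \<le> 1"
  by (rule norm_blinfun_bound) auto

lemma id_comp: "id_blinfun o\<^sub>L m = m" "m o\<^sub>L id_blinfun = m" for m :: "'h operator"
  by (rule blinfun_eqI, simp)+

lemma id_adjoint: "is_adjoint id_blinfun (id_blinfun :: 'h operator)"
  by (simp add: is_adjoint_def)

definition e :: "('h ^ 'k) cop" where "e = U i0 i0 id_blinfun"

lemma T_U: assumes "m \<in> M" shows "T (U i i m) = \<tau> m"
proof -
  have "T (U i i m) = (\<Sum>a\<in>UNIV. if a = i then \<tau> m else 0)"
    unfolding T_def matrix_trace_def by (intro sum.cong) (auto simp: op_U[OF assms] op_entry_eop tau_zero)
  thus ?thesis by simp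
qed

lemma tproj_e: "tproj e"
  by (simp add: tproj_def e_def U_con[OF M_id norm_id_le] U_mult M_id id_comp U_adj[OF M_id id_adjoint] T_U tau_id)

definition ent0 :: "('h ^ 'k) cop \<Rightarrow> 'h operator" where "ent0 A = op_entry i0 i0 (op A)"

lemma corner_eq_U:
  assumes "A \<in> P" "e * A = A" "A * e = A" shows "A = U i0 i0 (ent0 A)"
proof (rule op_inject[THEN iffD1], rule blinfun_eqI)
  fix v
  have oe: "op e = eop i0 i0 id_blinfun" by (simp add: e_def op_U M_id)
  have "A = e * A * e" by (simp add: assms)
  hence "op A = op e o\<^sub>L op A o\<^sub>L op e" by (simp only: op_mult[symmetric])
  hence "blinfun_apply (op A) v = blinfun_apply (op e o\<^sub>L op A o\<^sub>L op e) v" by simp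
  also have "\<dots> = axis i0 (vec_nth (blinfun_apply (op A) (axis i0 (vec_nth v i0))) i0)"
    by (simp add: oe eop_apply)
  also have "\<dots> = blinfun_apply (eop i0 i0 (ent0 A)) v"
    by (simp add: eop_apply ent0_def op_entry_apply)
  also have "eop i0 i0 (ent0 A) = op (U i0 i0 (ent0 A))"
    using op_U[OF entries[OF assms(1)]] by (simp add: ent0_def)
  finally show "blinfun_apply (op A) v = blinfun_apply (op (U i0 i0 (ent0 A))) v" .
qed

text \<open>Vigier's theorem for sequences, with convergence in the 2-norm by normality.\<close>

lemma monotone_limit:
  fixes d :: "nat \<Rightarrow> 'h operator"
  assumes d: "\<And>k. d k \<in> M" "\<And>k. self_adjoint (d k)" "op_le 0 (d 0)" "\<And>k. op_le (d k) (d (Suc k))"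
    "\<And>k. op_le (d k) id_blinfun"
  shows "\<exists>S\<in>M. self_adjoint S \<and> op_le 0 S \<and> op_le S id_blinfun \<and> (\<lambda>k. Re (\<tau> ((S - d k) o\<^sub>L (S - d k)))) \<longlonglongrightarrow> 0"
proof -
  have le: "op_le (d k) (d l)" if "k \<le> l" for k l
    using that
  proof (induction rule: dec_induct)
    case (step n) thus ?case using d(4)[of n] by (auto simp: op_le_def intro: order_trans)
  qed (simp add: op_le_def)
  have pos: "op_le 0 (d k)" for k using d(3) le[of 0 k] by (auto simp: op_le_def intro: order_trans)
  have sa_diff: "self_adjoint (A - B)" if "self_adjoint A" "self_adjoint B" for A B :: "'h operator"
    using that by (simp add: self_adjoint_def is_adjoint_diff)
  let ?f = "\<lambda>k v. Re (cinner (blinfun_apply (d k) v) v)"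
  \<comment> \<open>The difference of two members of the sequence lies between 0 and 1, so its
    square is below itself; monotone convergence of the quadratic forms then gives strong
    convergence.\<close>
  have dist: "(norm (blinfun_apply (d l) v - blinfun_apply (d k) v))\<^sup>2 \<le> ?f l v - ?f k v" if "k \<le> l" for k l v
  proof -
    have "(norm (blinfun_apply (d l - d k) v))\<^sup>2 \<le> Re (cinner (blinfun_apply (d l - d k) v) v)"
    proof (rule square_le_of_contraction[OF sa_diff[OF d(2) d(2)]])
      show "op_le 0 (d l - d k)" using le[OF that] by (simp add: op_le_def blinfun.bilinear_simps cinner_diff_left)
      show "op_le (d l - d k) id_blinfun" unfolding op_le_def
      proof
        fix w show "Re (cinner (blinfun_apply (d l - d k) w) w) \<le> Re (cinner (blinfun_apply id_blinfun w) w)"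
          using pos[of k, unfolded op_le_def, rule_format, of w] d(5)[of l, unfolded op_le_def, rule_format, of w]
          by (simp add: blinfun.bilinear_simps cinner_diff_left)
      qed
    qed
    thus ?thesis by (simp add: blinfun.bilinear_simps cinner_diff_left)
  qed
  have conv: "convergent (\<lambda>k. blinfun_apply (d k) v)" for v
  proof -
    have "incseq (\<lambda>k. ?f k v)" using le by (auto simp: incseq_def op_le_def)
    moreover have "?f k v \<le> (norm v)\<^sup>2" for k
      using d(5)[of k] by (simp add: op_le_def Re_cinner_self)
    ultimately obtain L where "(\<lambda>k. ?f k v) \<longlonglongrightarrow> L" using incseq_convergent by blast
    hence "Cauchy (\<lambda>k. ?f k v)" by (rule LIMSEQ_imp_Cauchy)
    have "Cauchy (\<lambda>k. blinfun_apply (d k) v)"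
    proof (rule metric_CauchyI)
      fix \<epsilon> :: real assume \<epsilon>: "0 < \<epsilon>"
      obtain N where N: "\<And>m n. N \<le> m \<Longrightarrow> N \<le> n \<Longrightarrow> dist (?f m v) (?f n v) < \<epsilon>\<^sup>2"
        using metric_CauchyD[OF \<open>Cauchy (\<lambda>k. ?f k v)\<close>, of "\<epsilon>\<^sup>2"] \<epsilon> by auto
      have *: "norm (blinfun_apply (d n) v - blinfun_apply (d m) v) < \<epsilon>" if "N \<le> m" "m \<le> n" for m n
      proof -
        have "(norm (blinfun_apply (d n) v - blinfun_apply (d m) v))\<^sup>2 < \<epsilon>\<^sup>2"
          using dist[OF that(2), of v] N[of n m] that by (simp add: dist_real_def)
        thus ?thesis using \<epsilon> by (rule_tac power2_less_imp_less) auto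
      qed
      have "dist (blinfun_apply (d m) v) (blinfun_apply (d n) v) < \<epsilon>" if "N \<le> m" "N \<le> n" for m n
        using *[of m n] *[of n m] that by (cases "m \<le> n") (auto simp: dist_norm norm_minus_commute)
      thus "\<exists>M. \<forall>m\<ge>M. \<forall>n\<ge>M. dist (blinfun_apply (d m) v) (blinfun_apply (d n) v) < \<epsilon>" by blast
    qed
    thus ?thesis by (rule Cauchy_convergent)
  qed
  define f where "f v = lim (\<lambda>k. blinfun_apply (d k) v)" for v
  have f: "(\<lambda>k. blinfun_apply (d k) v) \<longlonglongrightarrow> f v" for v
    unfolding f_def using conv convergent_LIMSEQ_iff by blast
  have bl: "bounded_linear f"
  proof (rule bounded_linear_intro[where K = 1])
    fix v w and r :: real
    have "(\<lambda>k. blinfun_apply (d k) (v + w)) \<longlonglongrightarrow> f v + f w"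
      unfolding blinfun.add_right by (intro tendsto_add f)
    thus "f (v + w) = f v + f w" by (rule LIMSEQ_unique[OF f])
    have "(\<lambda>k. blinfun_apply (d k) (r *\<^sub>R v)) \<longlonglongrightarrow> r *\<^sub>R f v"
      unfolding blinfun.scaleR_right by (intro tendsto_scaleR tendsto_const f)
    thus "f (r *\<^sub>R v) = r *\<^sub>R f v" by (rule LIMSEQ_unique[OF f])
    show "norm (f v) \<le> norm v * 1"
    proof (rule LIMSEQ_le_const2[OF tendsto_norm[OF f]])
      have "norm (blinfun_apply (d k) v) \<le> norm v * 1" for k
      proof -
        have "norm (blinfun_apply (d k) v) \<le> norm (d k) * norm v" by (rule norm_blinfun)
        also have "\<dots> \<le> 1 * norm v"
          by (intro mult_right_mono norm_le_1_of_contraction[OF d(2) pos d(5)]) simp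
        finally show ?thesis by simp
      qed
      thus "\<exists>N. \<forall>n\<ge>N. norm (blinfun_apply (d n) v) \<le> norm v * 1" by blast
    qed
  qed
  define S where "S = Blinfun f"
  have S: "(\<lambda>k. blinfun_apply (d k) v) \<longlonglongrightarrow> blinfun_apply S v" for v
    using f by (simp add: S_def bounded_linear_Blinfun_apply[OF bl])
  have cS: "(\<lambda>k. cinner (blinfun_apply (d k) v) w) \<longlonglongrightarrow> cinner (blinfun_apply S v) w" for v w
    by (rule tendsto_cinner_left[OF S])
  have rS: "(\<lambda>k. ?f k v) \<longlonglongrightarrow> Re (cinner (blinfun_apply S v) v)" for v
    by (intro tendsto_Re cS)
  have SM: "S \<in> M"
  proof (rule limitin_closedin[OF _ M_closed])
    show "limitin strong_operator_topology d S sequentially"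
      unfolding limitin_def
    proof (intro conjI allI impI)
      show "S \<in> topspace strong_operator_topology" by (simp add: strong_operator_topology_topspace)
      fix W assume W: "openin strong_operator_topology W \<and> S \<in> W"
      then obtain V where V: "open V" "W = blinfun_apply -` V"
        unfolding strong_operator_topology_def openin_pullback_topology by auto
      have "limitin (product_topology (\<lambda>_. euclidean) UNIV) (\<lambda>k. blinfun_apply (d k)) (blinfun_apply S) sequentially"
        using S by (simp add: limitin_componentwise)
      hence "(\<lambda>k. blinfun_apply (d k)) \<longlonglongrightarrow> blinfun_apply S" by (simp add: euclidean_product_topology)
      from topological_tendstoD[OF this V(1)] show "\<forall>\<^sub>F k in sequentially. d k \<in> W" using W V(2) by simp
    qed
  qed (use d in auto)
  have Ssa: "self_adjoint S" unfolding self_adjoint_def is_adjoint_def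
  proof (intro allI)
    fix v w
    have "(\<lambda>k. cinner (blinfun_apply (d k) v) w) \<longlonglongrightarrow> cinner v (blinfun_apply S w)"
    proof -
      have "cinner (blinfun_apply (d k) v) w = cnj (cinner (blinfun_apply (d k) w) v)" for k
      proof -
        have "cinner (blinfun_apply (d k) v) w = cinner v (blinfun_apply (d k) w)"
          using d(2)[of k] unfolding self_adjoint_def is_adjoint_def by simp
        thus ?thesis by (simp only: cinner_commute[of v])
      qed
      moreover have "(\<lambda>k. cnj (cinner (blinfun_apply (d k) w) v)) \<longlonglongrightarrow> cnj (cinner (blinfun_apply S w) v)"
        by (intro tendsto_cnj cS)
      ultimately show ?thesis by (simp only: cinner_commute[of v])
    qed
    thus "cinner (blinfun_apply S v) w = cinner v (blinfun_apply S w)" by (rule LIMSEQ_unique[OF cS])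
  qed
  have dS: "op_le (d k) S" for k unfolding op_le_def
  proof
    fix v show "?f k v \<le> Re (cinner (blinfun_apply S v) v)"
      by (rule LIMSEQ_le_const[OF rS]) (use le in \<open>auto simp: op_le_def intro!: exI[of _ k]\<close>)
  qed
  have Sle: "op_le S B" if "\<And>k. op_le (d k) B" for B unfolding op_le_def
  proof
    fix v show "Re (cinner (blinfun_apply S v) v) \<le> Re (cinner (blinfun_apply B v) v)"
      by (rule LIMSEQ_le_const2[OF rS]) (use that in \<open>auto simp: op_le_def\<close>)
  qed
  have S0: "op_le 0 S" using pos[of 0] dS[of 0] by (auto simp: op_le_def intro: order_trans)
  have "Re (\<tau> S) = (SUP A\<in>range d. Re (\<tau> A))"
  proof (rule tau_normal[unfolded normal_functional_def, rule_format], intro conjI ballI allI impI)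
    show "\<exists>A\<in>range d. op_le T1 A \<and> op_le T2 A" if "T1 \<in> range d" "T2 \<in> range d" for T1 T2
    proof -
      obtain k l where "T1 = d k" "T2 = d l" using \<open>T1 \<in> range d\<close> \<open>T2 \<in> range d\<close> by blast
      thus ?thesis using le[of k "max k l"] le[of l "max k l"] by auto
    qed
    show "self_adjoint A" if "A \<in> range d" for A using that d(2) by blast
    show "op_le 0 A" if "A \<in> range d" for A using that pos by blast
    show "op_le A S" if "A \<in> range d" for A using that dS by blast
    show "op_le S B" if "B \<in> M" "self_adjoint B \<and> (\<forall>A\<in>range d. op_le A B)" for B
      by (rule Sle) (use that in blast)
    show "range d \<subseteq> M" using d(1) by blast
  qed (use SM Ssa in auto)
  hence sup: "Re (\<tau> S) = (SUP k. Re (\<tau> (d k)))" by (simp add: image_image)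
  have mono: "Re (\<tau> (d k)) \<le> Re (\<tau> (d l))" if "k \<le> l" for k l
    by (rule normal_functional_mono[OF tau_normal d(1) d(2) pos d(1) d(2) le[OF that]])
  have bdd: "bdd_above (range (\<lambda>k. Re (\<tau> (d k))))"
    by (rule bdd_aboveI[of _ "Re (\<tau> S)"])
      (use normal_functional_mono[OF tau_normal d(1) d(2) pos SM Ssa dS] in auto)
  have "(\<lambda>k. Re (\<tau> (d k))) \<longlonglongrightarrow> Re (\<tau> S)"
    unfolding sup by (rule LIMSEQ_incseq_SUP[OF bdd]) (use mono in \<open>auto simp: incseq_def\<close>)
  from tendsto_diff[OF tendsto_const this, of "Re (\<tau> S)"]
  have lim0: "(\<lambda>k. Re (\<tau> S) - Re (\<tau> (d k))) \<longlonglongrightarrow> 0" by simp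
  have "(\<lambda>k. Re (\<tau> ((S - d k) o\<^sub>L (S - d k)))) \<longlonglongrightarrow> 0"
  proof (rule tendsto_sandwich[OF _ _ tendsto_const lim0])
    have D: "self_adjoint (S - d k)" "S - d k \<in> M" for k by (rule sa_diff[OF Ssa d(2)], rule M_diff[OF SM d(1)])
    show "\<forall>\<^sub>F k in sequentially. 0 \<le> Re (\<tau> ((S - d k) o\<^sub>L (S - d k)))"
      using D by (intro always_eventually allI tau_pos) (simp_all add: self_adjoint_def)
    \<comment> \<open>Again the square of an operator between 0 and 1 is below it. This bounds the
      squared 2-norm by \<tau>(S) - \<tau>(d k), which tends to 0 by normality.\<close>
    have "Re (\<tau> ((S - d k) o\<^sub>L (S - d k))) \<le> Re (\<tau> (S - d k))" for k
    proof (rule normal_functional_mono[OF tau_normal])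
      have ad: "is_adjoint (S - d k) (S - d k)" using D(1) by (simp add: self_adjoint_def)
      hence "cinner (blinfun_apply ((S - d k) o\<^sub>L (S - d k)) v) v = cinner (blinfun_apply (S - d k) v) (blinfun_apply (S - d k) v)" for v
        unfolding is_adjoint_def by simp
      hence nn: "Re (cinner (blinfun_apply ((S - d k) o\<^sub>L (S - d k)) v) v) = (norm (blinfun_apply (S - d k) v))\<^sup>2" for v
        by (simp only: Re_cinner_self)
      have 0: "op_le 0 (S - d k)" using dS[of k] by (simp add: op_le_def blinfun.bilinear_simps cinner_diff_left)
      have "op_le (S - d k) id_blinfun" unfolding op_le_def
      proof
        fix w show "Re (cinner (blinfun_apply (S - d k) w) w) \<le> Re (cinner (blinfun_apply id_blinfun w) w)"
          using pos[of k, unfolded op_le_def, rule_format, of w] Sle[OF d(5), unfolded op_le_def, rule_format, of w]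
          by (simp add: blinfun.bilinear_simps cinner_diff_left)
      qed
      from square_le_of_contraction[OF D(1) 0 this]
      show "op_le ((S - d k) o\<^sub>L (S - d k)) (S - d k)" unfolding op_le_def nn by blast
      show "op_le 0 ((S - d k) o\<^sub>L (S - d k))" unfolding op_le_def nn by simp
      show "self_adjoint ((S - d k) o\<^sub>L (S - d k))" using is_adjoint_compose[OF ad ad] by (simp add: self_adjoint_def)
    qed (use D M_comp in auto)
    moreover have "Re (\<tau> (S - d k)) = Re (\<tau> S) - Re (\<tau> (d k))" for k
      using tau_add[OF SM M_scale[OF d(1), of "-1"]] tau_scale[OF d(1), of "-1"] by (simp add: scaleC_op_m1)
    ultimately show "\<forall>\<^sub>F k in sequentially. Re (\<tau> ((S - d k) o\<^sub>L (S - d k))) \<le> Re (\<tau> S) - Re (\<tau> (d k))"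
      by (simp add: always_eventually)
  qed
  thus ?thesis using SM Ssa S0 Sle[OF d(5)] by blast
qed

end

section \<open>Corners of a factor are full\<close>

text \<open>The supremum need not be attained, but a value above half of it is; if the supremum were
  0, the first element would already do.\<close>

lemma nearly_maximal:
  fixes f :: "'b \<Rightarrow> real"
  assumes "m0 \<in> X" "\<And>m. m \<in> X \<Longrightarrow> 0 \<le> f m" "\<And>m. m \<in> X \<Longrightarrow> f m \<le> C"
  shows "\<exists>m\<in>X. \<forall>m'\<in>X. f m' \<le> 2 * f m"
proof (rule ccontr)
  assume "\<not> ?thesis"
  hence *: "\<exists>m'\<in>X. 2 * f m < f m'" if "m \<in> X" for m using that by (meson not_le)
  have bdd: "bdd_above (f ` X)" using assms(3) by (rule bdd_aboveI2)
  obtain m1 where m1: "m1 \<in> X" "2 * f m0 < f m1" using *[OF assms(1)] by blast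
  hence "0 < f m1" using assms(2)[OF assms(1)] by linarith
  hence pos: "0 < Sup (f ` X)" using cSUP_upper[OF m1(1) bdd] by linarith
  hence "Sup (f ` X) / 2 < Sup (f ` X)" by simp
  then obtain m where m: "m \<in> X" "Sup (f ` X) / 2 < f m"
    using less_cSup_iff[of "f ` X" "Sup (f ` X) / 2"] assms(1) bdd by auto
  obtain m' where "m' \<in> X" "2 * f m < f m'" using *[OF m(1)] by blast
  thus False using cSUP_upper[of m' X f] bdd m(2) by fastforce
qed

lemma (in amp) U_cong: assumes "m \<in> M" "n \<in> M" "U i j m = U i j n" shows "m = n"
proof -
  from arg_cong[OF assms(3), of "\<lambda>A. op_entry i j (op A)"] show ?thesis
    by (simp add: op_U assms(1,2) op_entry_eop)
qed

lemma (in amp) U_diff: "m \<in> M \<Longrightarrow> n \<in> M \<Longrightarrow> U i j m - U i j n = U i j (m - n)"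
  by (rule op_inject[THEN iffD1], rule op_entry_eqI) (simp add: op_diff op_U M_diff op_entry_linear op_entry_eop)

lemma (in amp) con_of_contraction:
  assumes "A \<in> P" "adj A = A" "op_le 0 (op A)" "op_le (op A) id_blinfun" shows "con A"
  using assms norm_le_1_of_contraction[of "op A"] op_adj[of A] by (simp add: con_def self_adjoint_def)

lemma (in amp) projection_contraction:
  assumes "adj q = q" "q * q = q" shows "op_le 0 (op q)" "op_le (op q) id_blinfun"
proof -
  have *: "Re (cinner (blinfun_apply (op q) v) v) = (norm (blinfun_apply (op q) v))\<^sup>2" for v
    using op_adj_mult[of q v] by (simp add: assms)
  show "op_le 0 (op q)" unfolding op_le_def * by simp
  have "norm (blinfun_apply (op q) v) \<le> norm v" for v
  proof -
    have "(norm (blinfun_apply (op q) v))\<^sup>2 \<le> norm (blinfun_apply (op q) v) * norm v"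
      unfolding *[symmetric] using complex_Re_le_cmod cmod_cinner_le order_trans by blast
    thus ?thesis by (cases "norm (blinfun_apply (op q) v) = 0") (simp, simp add: power2_eq_square)
  qed
  thus "op_le (op q) id_blinfun" unfolding op_le_def * by (simp add: Re_cinner_self)
qed

text \<open>The nonzero b in p N e is the seed: all elements of the exhaustion are multiples b m z
  of it, which keeps them in p N e.\<close>

locale factor_corner = amp +
  fixes p b
  assumes fac: "factor M" and p: "p * b = b" and b: "con b" "b * e = b" "b \<noteq> 0"
begin

lemma e: "e \<in> P" "con e" "adj e = e" "e * e = e"
  using tproj_e tproj_P by (auto simp: tproj_def)

definition "pick_set = {m. con m \<and> e * m = m \<and> m * e = m}"

text \<open>Greedy exhaustion of \<open>e\<close> by elements \<open>x\<^sub>l\<^sup>* x\<^sub>l\<close>. With \<open>c = m\<^sup>* b\<^sup>* b m \<le> 1\<close> the difference \<open>z - z c z\<close> stays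
  positive because \<open>z\<^sup>2 \<le> z\<close>. The limit \<open>S\<close> of \<open>e - z\<^sub>k\<close> satisfies \<open>S m (e - S) = 0\<close> for all \<open>m\<close>, so it is a
  central projection.\<close>

definition "pick z = (SOME m. m \<in> pick_set \<and> (\<forall>m'\<in>pick_set. (nrm (b * m' * z))\<^sup>2 \<le> 2 * (nrm (b * m * z))\<^sup>2))"

lemma pick: assumes "z \<in> P"
  shows "pick z \<in> pick_set" "\<And>m'. m' \<in> pick_set \<Longrightarrow> (nrm (b * m' * z))\<^sup>2 \<le> 2 * (nrm (b * pick z * z))\<^sup>2"
proof -
  have "\<exists>m\<in>pick_set. \<forall>m'\<in>pick_set. (nrm (b * m' * z))\<^sup>2 \<le> 2 * (nrm (b * m * z))\<^sup>2"
  proof (rule nearly_maximal)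
    show "e \<in> pick_set" by (simp add: pick_set_def e)
    fix m assume "m \<in> pick_set"
    hence "bd (1 * 1) (b * m)" by (intro bd_mult con_bd b) (simp add: pick_set_def)
    hence "nrm (b * m * z) \<le> 1 * nrm z" using bdD assms by fastforce
    moreover have "b * m * z \<in> P" using \<open>bd (1 * 1) (b * m)\<close> bd_P assms by blast
    ultimately show "(nrm (b * m * z))\<^sup>2 \<le> (nrm z)\<^sup>2" by (intro power_mono) auto
  qed simp
  hence "\<exists>m. m \<in> pick_set \<and> (\<forall>m'\<in>pick_set. (nrm (b * m' * z))\<^sup>2 \<le> 2 * (nrm (b * m * z))\<^sup>2)" by (rule bexE) (rule exI, rule conjI)
  from someI_ex[OF this, folded pick_def]
  show "pick z \<in> pick_set" "\<And>m'. m' \<in> pick_set \<Longrightarrow> (nrm (b * m' * z))\<^sup>2 \<le> 2 * (nrm (b * pick z * z))\<^sup>2" by blast+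
qed

primrec z :: "nat \<Rightarrow> ('a ^ 'b) cop" where
  "z 0 = e"
| "z (Suc k) = z k - adj (b * pick (z k) * z k) * (b * pick (z k) * z k)"

definition "x k = b * pick (z k) * z k"

lemma z_Suc: "z (Suc k) = z k - adj (x k) * x k"
  by (simp add: x_def)

declare z.simps(2) [simp del]

lemma z_inv: "z k \<in> P \<and> adj (z k) = z k \<and> e * z k = z k \<and> z k * e = z k \<and> op_le 0 (op (z k)) \<and> op_le (op (z k)) id_blinfun"
proof (induction k)
  case 0
  show ?case using e projection_contraction[OF e(3,4)] by simp
next
  case (Suc k)
  hence zk: "z k \<in> P" "adj (z k) = z k" "e * z k = z k" "z k * e = z k" "op_le 0 (op (z k))" "op_le (op (z k)) id_blinfun"
    by auto
  let ?c = "b * pick (z k)"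
  have c: "con ?c" by (rule con_mult[OF b(1)]) (use pick(1)[OF zk(1)] in \<open>simp add: pick_set_def\<close>)
  have xP: "x k \<in> P" unfolding x_def using con_P[OF c] zk(1) by blast
  have xe: "x k * e = x k" by (simp add: x_def mult.assoc zk)
  have ex: "e * adj (x k) = adj (x k)" using arg_cong[OF xe, of adj] by (simp add: adj_mult e)
  have form: "Re (cinner (blinfun_apply (op (z (Suc k))) v) v) =
      Re (cinner (blinfun_apply (op (z k)) v) v) - (norm (blinfun_apply (op (x k)) v))\<^sup>2" for v
    unfolding z_Suc op_adj_mult[symmetric] by (simp add: op_diff blinfun.bilinear_simps cinner_diff_left)
  have small: "(norm (blinfun_apply (op (x k)) v))\<^sup>2 \<le> Re (cinner (blinfun_apply (op (z k)) v) v)" for v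
  proof -
    have "norm (blinfun_apply (op (x k)) v) \<le> norm (op ?c) * norm (blinfun_apply (op (z k)) v)"
      by (simp only: x_def op_mult[of ?c] blinfun_apply_blinfun_compose norm_blinfun)
    also have "\<dots> \<le> 1 * norm (blinfun_apply (op (z k)) v)"
      by (intro mult_right_mono) (use c in \<open>simp_all add: con_def\<close>)
    finally have "(norm (blinfun_apply (op (x k)) v))\<^sup>2 \<le> (norm (blinfun_apply (op (z k)) v))\<^sup>2" by (intro power_mono) simp_all
    also have "\<dots> \<le> Re (cinner (blinfun_apply (op (z k)) v) v)"
      by (rule square_le_of_contraction) (use zk op_adj[of "z k"] in \<open>simp_all add: self_adjoint_def\<close>)
    finally show ?thesis .
  qed
  have "op_le 0 (op (z (Suc k)))" unfolding op_le_def form using small by simp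
  moreover have "op_le (op (z (Suc k))) id_blinfun" unfolding op_le_def form
  proof
    fix v
    show "Re (cinner (blinfun_apply (op (z k)) v) v) - (norm (blinfun_apply (op (x k)) v))\<^sup>2 \<le> Re (cinner (blinfun_apply id_blinfun v) v)"
      using zk(6)[unfolded op_le_def, rule_format, of v] zero_le_power2[of "norm (blinfun_apply (op (x k)) v)"] by linarith
  qed
  moreover have "z (Suc k) \<in> P" "adj (z (Suc k)) = z (Suc k)" "e * z (Suc k) = z (Suc k)" "z (Suc k) * e = z (Suc k)"
    unfolding z_Suc using zk xP
    by (simp_all add: adj_diff adj_mult left_diff_distrib right_diff_distrib mult.assoc xe)
      (simp add: mult.assoc[symmetric] ex)
  ultimately show ?case by blast
qed

lemma zP: "z k \<in> P" and z_sa: "adj (z k) = z k" and ez: "e * z k = z k" and ze: "z k * e = z k"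
  using z_inv[of k] by auto

lemma z_con: "con (z k)"
  using z_inv[of k] by (intro con_of_contraction) auto

lemma pick_z: "con (pick (z k))" "e * pick (z k) = pick (z k)" "pick (z k) * e = pick (z k)"
  using pick(1)[OF zP[of k]] by (auto simp: pick_set_def)

lemma x_facts: "con (x k)" "p * x k = x k" "x k * e = x k"
  unfolding x_def by (intro con_mult b pick_z z_con) (simp_all add: mult.assoc[symmetric] p, simp add: mult.assoc ze)

lemma gram_x: "gram x k = e - z k"
proof (induction k)
  case (Suc k)
  have "gram x (Suc k) = gram x k + adj (x k) * x k" by (simp add: gram_def)
  thus ?case unfolding Suc.IH z_Suc by simp
qed (simp add: gram_def)

lemma gram_contraction: "adj (e - z k) = e - z k" "op_le 0 (op (e - z k))" "op_le (op (e - z k)) id_blinfun"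
proof -
  show "adj (e - z k) = e - z k" by (simp add: adj_diff e z_sa)
  have "Re (cinner (blinfun_apply (op (gram x k)) v) v) = (\<Sum>l<k. (norm (blinfun_apply (op (x l)) v))\<^sup>2)" for v
  proof (induction k)
    case 0 show ?case by (simp add: gram_def op_zero)
  next
    case (Suc k)
    have "gram x (Suc k) = gram x k + adj (x k) * x k" by (simp add: gram_def)
    thus ?case using Suc op_adj_mult[of "x k" v] by (simp add: op_add blinfun.bilinear_simps cinner_add_left)
  qed
  thus "op_le 0 (op (e - z k))" unfolding op_le_def gram_x by (simp add: sum_nonneg)
  show "op_le (op (e - z k)) id_blinfun" unfolding op_le_def
  proof
    fix v
    have "0 \<le> Re (cinner (blinfun_apply (op (z k)) v) v)" using z_inv[of k] by (simp add: op_le_def)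
    moreover have "Re (cinner (blinfun_apply (op e) v) v) \<le> Re (cinner (blinfun_apply id_blinfun v) v)"
      using projection_contraction(2)[OF e(3,4)] unfolding op_le_def by blast
    ultimately show "Re (cinner (blinfun_apply (op (e - z k)) v) v) \<le> Re (cinner (blinfun_apply id_blinfun v) v)"
      by (simp only: op_diff blinfun.diff_left cinner_diff_left minus_complex.simps)
  qed
qed

lemma gram_con: "con (e - z k)"
  by (rule con_of_contraction) (use gram_contraction zP e in auto)

lemma limit: "\<exists>S0\<in>M. norm S0 \<le> 1 \<and> self_adjoint S0 \<and> (\<lambda>k. nrm (U i0 i0 S0 - (e - z k))) \<longlonglongrightarrow> 0"
proof -
  define D where "D k = ent0 (e - z k)" for k
  have DM: "D k \<in> M" for k unfolding D_def ent0_def by (rule entries) (use e zP in blast)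
  have UD: "e - z k = U i0 i0 (D k)" for k
    unfolding D_def by (rule corner_eq_U) (use e zP in \<open>auto simp: left_diff_distrib right_diff_distrib ez ze\<close>)
  have entid: "op_entry i0 i0 (id_blinfun :: ('a ^ 'b) operator) = id_blinfun"
    by (rule blinfun_eqI) (simp add: op_entry_apply axis_nth)
  have "\<exists>S\<in>M. self_adjoint S \<and> op_le 0 S \<and> op_le S id_blinfun \<and> (\<lambda>k. Re (\<tau> ((S - D k) o\<^sub>L (S - D k)))) \<longlonglongrightarrow> 0"
  proof (rule monotone_limit)
    show "self_adjoint (D k)" for k
      using entry_adj[of i0 i0 "e - z k"] by (simp add: gram_contraction D_def ent0_def self_adjoint_def)
    show "op_le 0 (D 0)" using op_entry_op_le[OF gram_contraction(2), of i0 0] by (simp add: D_def ent0_def op_entry_linear)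
    show "op_le (D k) id_blinfun" for k
      using op_entry_op_le[OF gram_contraction(3)[of k], of i0] by (simp add: D_def ent0_def entid)
    show "op_le (D k) (D (Suc k))" for k
      unfolding D_def ent0_def
    proof (rule op_entry_op_le)
      have eq: "e - z (Suc k) = (e - z k) + adj (x k) * x k" by (simp add: z_Suc)
      have "Re (cinner (blinfun_apply (op (e - z (Suc k))) v) v) =
          Re (cinner (blinfun_apply (op (e - z k)) v) v) + (norm (blinfun_apply (op (x k)) v))\<^sup>2" for v
        unfolding eq op_adj_mult[symmetric] by (simp only: op_add blinfun.add_left cinner_add_left plus_complex.simps)
      thus "op_le (op (e - z k)) (op (e - z (Suc k)))" by (simp add: op_le_def)
    qed
  qed (rule DM)
  then obtain S where S: "S \<in> M" "self_adjoint S" "op_le 0 S" "op_le S id_blinfun"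
    and lim: "(\<lambda>k. Re (\<tau> ((S - D k) o\<^sub>L (S - D k)))) \<longlonglongrightarrow> 0" by blast
  have D_sa: "is_adjoint (D k) (D k)" for k
    using entry_adj[of i0 i0 "e - z k"] by (simp add: gram_contraction D_def ent0_def)
  have "nrm (U i0 i0 S - (e - z k)) = sqrt (Re (\<tau> ((S - D k) o\<^sub>L (S - D k))))" for k
  proof -
    have m: "S - D k \<in> M" by (rule M_diff[OF S(1) DM])
    have "is_adjoint (S - D k) (S - D k)" using S(2) D_sa by (simp add: self_adjoint_def is_adjoint_diff)
    thus ?thesis unfolding UD U_diff[OF S(1) DM] nrm_def
      by (simp add: U_adj[OF m] U_mult[OF m m] T_U[OF M_comp[OF m m]])
  qed
  moreover have "(\<lambda>k. sqrt (Re (\<tau> ((S - D k) o\<^sub>L (S - D k))))) \<longlonglongrightarrow> sqrt 0" by (intro tendsto_real_sqrt lim)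
  ultimately show ?thesis using S norm_le_1_of_contraction[OF S(2-4)] by auto
qed

lemma z_lim: "(\<lambda>k. nrm (z k)) \<longlonglongrightarrow> 0"
proof -
  obtain S0 where S0: "S0 \<in> M" "norm S0 \<le> 1" "self_adjoint S0"
    and lim: "(\<lambda>k. nrm (U i0 i0 S0 - (e - z k))) \<longlonglongrightarrow> 0" using limit by blast
  define S where "S = U i0 i0 S0"
  define Z where "Z = e - S"
  have S: "S \<in> P" "con S" "adj S = S" "e * S = S" "S * e = S"
    using S0 by (auto simp: S_def U_P U_con U_adj self_adjoint_def e_def U_mult M_id id_comp)
  have Z: "Z \<in> P" "bd 2 Z"
    using S e bd_diff[OF con_bd[OF e(2)] con_bd[OF S(2)]] by (auto simp: Z_def)
  have zZ: "(\<lambda>k. nrm (z k - Z)) \<longlonglongrightarrow> 0"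
  proof -
    have eq: "z k - Z = U i0 i0 S0 - (e - z k)" for k by (simp add: Z_def S_def)
    show ?thesis unfolding eq by (rule lim)
  qed
  have Tlim: "(\<lambda>k. Re (T (z k))) \<longlonglongrightarrow> Re (T Z)"
  proof (rule LIM_zero_cancel, rule Lim_null_comparison)
    show "\<forall>\<^sub>F k in sequentially. norm (Re (T (z k)) - Re (T Z)) \<le> nrm e * nrm (z k - Z)"
    proof (intro always_eventually allI)
      fix k
      have "e * (z k - Z) = z k - Z" by (simp add: right_diff_distrib ez Z_def e S)
      hence "cmod (T (z k - Z)) \<le> nrm e * nrm (z k - Z)"
        using Cauchy_Schwarz[of e "z k - Z"] e zP[of k] Z by simp
      moreover have "Re (T (z k)) - Re (T Z) = Re (T (z k - Z))" using tr_diff[OF zP Z(1)] by simp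
      ultimately show "norm (Re (T (z k)) - Re (T Z)) \<le> nrm e * nrm (z k - Z)"
        using abs_Re_le_cmod[of "T (z k - Z)"] by simp
    qed
    show "(\<lambda>k. nrm e * nrm (z k - Z)) \<longlonglongrightarrow> 0" using tendsto_mult[OF tendsto_const zZ, of "nrm e"] by simp
  qed
  have xP: "x k \<in> P" for k by (rule con_P[OF x_facts(1)])
  \<comment> \<open>The traces of the z k converge, so their successive differences, the squares of
    |x k|, tend to 0: eventually even the nearly best choice of m gains nothing.\<close>
  have "(nrm (x k))\<^sup>2 = Re (T (z k)) - Re (T (z (Suc k)))" for k
    unfolding z_Suc nrm_sq[OF xP] using tr_diff[OF zP[of k], of "adj (x k) * x k"] xP by simp
  hence "(\<lambda>k. (nrm (x k))\<^sup>2) \<longlonglongrightarrow> 0"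
    using tendsto_diff[OF Tlim LIMSEQ_Suc[OF Tlim]] by simp
  hence gain: "(\<lambda>k. sqrt (2 * (nrm (x k))\<^sup>2)) \<longlonglongrightarrow> sqrt (2 * 0)" by (intro tendsto_intros)
  \<comment> \<open>Near maximality bounds |b m (z k)|^2 by 2 |x k|^2 for every admissible m, and
    the right side vanishes in the limit.\<close>
  have bmZ: "b * m * Z = 0" if m: "m \<in> pick_set" for m
  proof (rule faithful)
    have c: "con (b * m)" using m b con_mult by (simp add: pick_set_def)
    show P: "b * m * Z \<in> P" using con_P[OF c] Z by blast
    have le: "nrm (b * m * Z) \<le> sqrt (2 * (nrm (x k))\<^sup>2) + nrm (z k - Z)" for k
    proof -
      have P1: "b * m * z k \<in> P" "b * m * (z k - Z) \<in> P" using con_P[OF c] Z zP[of k] by blast+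
      have "nrm (b * m * Z) = nrm (b * m * z k - b * m * (z k - Z))" by (simp add: right_diff_distrib)
      also have "\<dots> \<le> nrm (b * m * z k) + nrm (b * m * (z k - Z))" by (rule nrm_diff[OF P1])
      also have "\<dots> \<le> sqrt (2 * (nrm (x k))\<^sup>2) + 1 * nrm (z k - Z)"
        using pick(2)[OF zP m, of k] Z zP[of k] by (intro add_mono bdD[OF con_bd[OF c]] real_le_rsqrt) (auto simp: x_def)
      finally show ?thesis by simp
    qed
    have "(\<lambda>k. sqrt (2 * (nrm (x k))\<^sup>2) + nrm (z k - Z)) \<longlonglongrightarrow> 0"
      using tendsto_add[OF gain zZ] by simp
    hence "nrm (b * m * Z) \<le> 0" by (rule LIMSEQ_le_const) (intro exI allI impI le)
    thus "nrm (b * m * Z) = 0" using nrm_ge0[OF P] by linarith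
  qed
  \<comment> \<open>Each x_l m is b m' with m' again in \<open>pick_set\<close>, so it annihilates
    Z. Hence the sums of the x_l^* x_l annihilate m Z, and so does their limit S.\<close>
  have SmZ: "S * m * Z = 0" if m: "m \<in> pick_set" for m
  proof (rule faithful)
    have mc: "con m" using m by (simp add: pick_set_def)
    show P: "S * m * Z \<in> P" using S Z con_P[OF mc] by blast
    have g0: "(e - z k) * (m * Z) = 0" for k
    proof -
      have "x l * (m * Z) = 0" for l
      proof -
        have "pick (z l) * z l * m \<in> pick_set"
          using m pick_z[of l] z_con[of l] unfolding pick_set_def
          by (auto intro!: con_mult simp: mult.assoc) (simp add: mult.assoc[symmetric])
        from bmZ[OF this] show ?thesis by (simp add: x_def mult.assoc)
      qed
      thus ?thesis unfolding gram_x[symmetric] gram_def by (simp add: sum_distrib_right mult.assoc)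
    qed
    have le: "nrm (S * m * Z) \<le> 2 * nrm (S - (e - z k))" for k
    proof -
      have "S * m * Z = (S - (e - z k)) * (m * Z)"
        using g0[of k] by (simp only: left_diff_distrib[of S] mult.assoc diff_zero)
      moreover have "bd (1 * 2) (m * Z)" by (intro bd_mult con_bd mc Z)
      ultimately show ?thesis using bdD_right[of 2 "m * Z" "S - (e - z k)"] S e zP[of k] by simp
    qed
    have "(\<lambda>k. 2 * nrm (S - (e - z k))) \<longlonglongrightarrow> 0"
      using tendsto_mult[OF tendsto_const lim, of 2] by (simp add: S_def)
    hence "nrm (S * m * Z) \<le> 0" by (rule LIMSEQ_le_const) (intro exI allI impI le)
    thus "nrm (S * m * Z) = 0" using nrm_ge0[OF P] by linarith
  qed
  have SmS: "S * m = S * m * S" if m: "m \<in> pick_set" for m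
  proof -
    have "S * m * Z = S * (m * e) - S * m * S" by (simp add: Z_def right_diff_distrib mult.assoc)
    thus ?thesis using SmZ[OF m] m by (simp add: pick_set_def)
  qed
  \<comment> \<open>From S m = S m S for m and for its adjoint, both S m and m S equal S m
    S.\<close>
  have comm: "S * m = m * S" if m: "m \<in> pick_set" for m
  proof -
    have m': "con m" "e * m = m" "m * e = m" using m by (auto simp: pick_set_def)
    have "adj m \<in> pick_set"
      using con_adj[OF m'(1)] arg_cong[OF m'(2), of adj] arg_cong[OF m'(3), of adj]
      by (simp add: pick_set_def adj_mult e)
    from arg_cong[OF SmS[OF this], of adj] have "m * S = S * (m * S)" by (simp add: adj_mult S)
    thus ?thesis using SmS[OF m] by (simp add: mult.assoc)
  qed
  have "N o\<^sub>L S0 = S0 o\<^sub>L N" if N: "N \<in> M" for N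
  proof -
    \<comment> \<open>Scaling makes N a contraction, since \<open>pick_set\<close> contains
      contractions only.\<close>
    define k where "k = 1 / (1 + norm N)"
    define c where "c = complex_of_real k"
    let ?N = "scaleC_op c N"
    have pos: "0 < 1 + norm N" using norm_ge_zero[of N] by linarith
    have k0: "0 < k" using pos by (simp add: k_def)
    have NM: "?N \<in> M" by (rule M_scale[OF N])
    have "norm ?N \<le> cmod c * norm N" by (rule norm_scaleC_op)
    also have "\<dots> = norm N / (1 + norm N)" using k0 by (simp add: c_def) (simp add: k_def)
    also have "\<dots> \<le> 1" using pos by simp
    finally have n1: "norm ?N \<le> 1" .
    have "U i0 i0 ?N \<in> pick_set"
      using U_con[OF NM n1] by (simp add: pick_set_def e_def U_mult M_id NM id_comp)
    from comm[OF this] have "U i0 i0 (S0 o\<^sub>L ?N) = U i0 i0 (?N o\<^sub>L S0)"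
      by (simp add: S_def U_mult S0 NM)
    hence eq: "S0 o\<^sub>L ?N = ?N o\<^sub>L S0" by (rule U_cong[rotated 2]) (auto intro: M_comp S0 NM)
    have c0: "c \<noteq> 0" using k0 by (simp add: c_def)
    show ?thesis
    proof (rule blinfun_eqI)
      fix v
      have "c *\<^sub>C blinfun_apply S0 (blinfun_apply N v) = c *\<^sub>C blinfun_apply N (blinfun_apply S0 v)"
        using arg_cong[OF eq, of "\<lambda>A. blinfun_apply A v"] M_linear[OF S0(1)]
        by (simp add: scaleC_op.rep_eq complex_linear_def)
      hence "(1 / c) *\<^sub>C (c *\<^sub>C blinfun_apply S0 (blinfun_apply N v)) = (1 / c) *\<^sub>C (c *\<^sub>C blinfun_apply N (blinfun_apply S0 v))"
        by simp
      thus "blinfun_apply (N o\<^sub>L S0) v = blinfun_apply (S0 o\<^sub>L N) v" using c0 by (simp add: scaleC_scaleC)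
    qed
  qed
  then obtain c where c: "S0 = scaleC_op c id_blinfun"
    using fac S0(1) unfolding factor_def by blast
  have Sc: "S = c \<star> e"
    by (rule op_inject[THEN iffD1], rule op_entry_eqI)
      (simp add: S_def e_def op_cscale op_U S0(1) M_id op_entry_linear op_entry_eop c,
       simp add: c[symmetric] op_U S0(1) op_entry_eop, rule impI, rule blinfun_eqI, simp add: scaleC_op.rep_eq)
  have e0: "e \<noteq> 0" using tproj_e by (auto simp: tproj_def)
  have "e \<in> pick_set" by (simp add: pick_set_def e)
  from SmZ[OF this] have "c \<star> e - (c * c) \<star> e = 0"
    by (simp add: Sc Z_def e cscale_mult_left right_diff_distrib cscale_mult_right cscale_diff_right cscale_cscale)
  moreover have "(c * (1 - c)) \<star> e = c \<star> e - (c * c) \<star> e"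
    using cscale_add_left[of c "- (c * c)" e] by (simp add: right_diff_distrib cscale_minus_left)
  ultimately have "(c * (1 - c)) \<star> e = 0" by simp
  hence "c * (1 - c) = 0" using cscale_eq_0D e0 by blast
  hence "c = 0 \<or> c = 1" by simp
  \<comment> \<open>With c = 0 the limit Z would be e, and \<open>bmZ\<close> at m = e would give b
    = 0.\<close>
  moreover have "c \<noteq> 0"
  proof
    assume "c = 0"
    hence "Z = e" by (simp add: Z_def Sc)
    thus False using bmZ[OF \<open>e \<in> pick_set\<close>] b by simp
  qed
  ultimately have "Z = 0" by (simp add: Z_def Sc)
  thus ?thesis using zZ by simp
qed

lemma full: assumes "0 < \<delta>"
  shows "\<exists>a s. (\<forall>l. con (a l) \<and> p * a l = a l \<and> a l * e = a l) \<and> bd 1 (gram a s) \<and> nrm (gram a s - e) < \<delta>"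
proof -
  have "\<forall>\<^sub>F k in sequentially. nrm (z k) < \<delta>" by (rule order_tendstoD(2)[OF z_lim assms])
  then obtain k where "nrm (z k) < \<delta>" using eventually_happens'[OF sequentially_bot] by blast
  moreover have "gram x k - e = - z k" by (simp add: gram_x)
  moreover have "bd 1 (gram x k)" unfolding gram_x by (rule con_bd[OF gram_con])
  ultimately show ?thesis using x_facts by (intro exI[of _ x] exI[of _ k]) simp
qed

end

section \<open>Identifying the two corners with M and its amplification\<close>

lemma op_sum: "op (\<Sum>i\<in>A. f i) = (\<Sum>i\<in>A. op (f i))"
  by (induction A rule: infinite_finite_induct) (auto simp: op_zero op_add)

lemma norm_op_entry_le: "norm (op_entry i j A) \<le> norm A"
proof (rule norm_blinfun_bound)
  fix v
  have "norm (vec_nth (blinfun_apply A (axis j v)) i) \<le> norm (blinfun_apply A (axis j v))"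
    by (rule Finite_Cartesian_Product.norm_nth_le)
  also have "\<dots> \<le> norm A * norm (axis j v)" by (rule norm_blinfun)
  finally show "norm (blinfun_apply (op_entry i j A) v) \<le> norm A * norm v" by (simp add: op_entry_apply norm_axis)
qed simp

context amp begin

lemma sum_U: "A * (\<Sum>j\<in>UNIV. U j j id_blinfun) = A"
proof (rule cop_eqI)
  fix v
  have "blinfun_apply (op (\<Sum>j\<in>UNIV. U j j id_blinfun)) v = (\<Sum>j\<in>UNIV. axis j (vec_nth v j))"
    by (simp add: op_sum blinfun.sum_left op_U M_id eop_apply)
  thus "blinfun_apply (op (A * (\<Sum>j\<in>UNIV. U j j id_blinfun))) v = blinfun_apply (op A) v"
    by (simp add: op_mult sum_axis)
qed

lemma sac_e_entropy: "law_entropy (sac e) (lawq e) = one_bounded_entropy M id_blinfun \<tau>"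
  unfolding one_bounded_entropy_eq
proof (rule law_entropy_transfer[where f = ent0])
  have oe: "x = U i0 i0 (ent0 x)" "ent0 x \<in> M" "self_adjoint (ent0 x)" "norm (ent0 x) \<le> 1" if "x \<in> sac e" for x
  proof -
    have x: "con x" "adj x = x" "e * x = x" "x * e = x" using that by (auto simp: sac_def)
    show "x = U i0 i0 (ent0 x)" by (rule corner_eq_U[OF con_P[OF x(1)] x(3,4)])
    show "ent0 x \<in> M" unfolding ent0_def by (rule entries[OF con_P[OF x(1)]])
    show "self_adjoint (ent0 x)" using entry_adj[of i0 i0 x] by (simp add: x self_adjoint_def ent0_def)
    show "norm (ent0 x) \<le> 1" using norm_op_entry_le[of i0 i0 "op x"] x(1) by (simp add: ent0_def con_def)
  qed
  have ent0_U: "ent0 (U i0 i0 N) = N" if "N \<in> M" for N using that by (simp add: ent0_def op_U op_entry_eop)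
  show "bij_betw ent0 (sac e) (sa_contractions M)"
  proof (rule bij_betw_byWitness[where f' = "U i0 i0"])
    show "\<forall>x\<in>sac e. U i0 i0 (ent0 x) = x" using oe(1) by simp
    show "\<forall>N\<in>sa_contractions M. ent0 (U i0 i0 N) = N" using ent0_U by (simp add: sa_contractions_def)
    show "ent0 ` sac e \<subseteq> sa_contractions M" using oe by (auto simp: sa_contractions_def)
    show "U i0 i0 ` sa_contractions M \<subseteq> sac e"
      by (auto simp: sa_contractions_def sac_def U_con self_adjoint_def U_adj e_def U_mult M_id id_comp)
  qed
  fix x assume x: "set x \<subseteq> sac e"
  let ?F = "\<lambda>w. foldr (\<lambda>i N. map ent0 x ! i o\<^sub>L N) w id_blinfun"
  have F: "?F w \<in> M \<and> wd ((!) x) e w = U i0 i0 (?F w)" if "set w \<subseteq> {..<length x}" for w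
    using that
  proof (induction w)
    case Nil show ?case by (simp add: e_def M_id)
  next
    case (Cons k w)
    hence k: "k < length x" and IH: "?F w \<in> M" "wd ((!) x) e w = U i0 i0 (?F w)" by auto
    have xk: "x ! k \<in> sac e" using x nth_mem[OF k] by blast
    have "x ! k * U i0 i0 (?F w) = U i0 i0 (ent0 (x ! k) o\<^sub>L ?F w)"
      using U_mult[OF oe(2)[OF xk] IH(1), of i0 i0 i0] oe(1)[OF xk] by simp
    thus ?case using IH k M_comp[OF oe(2)[OF xk] IH(1)] by simp
  qed
  have Te: "T e = 1" by (simp add: e_def T_U M_id tau_id)
  show "law_op id_blinfun \<tau> (map ent0 x) = lawq e x"
  proof (rule ext)
    fix f
    show "law_op id_blinfun \<tau> (map ent0 x) f = lawq e x f"
    proof (cases "f \<in> ncpolys (length x)")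
      case True
      hence w: "set w \<subseteq> {..<length x}" if "w \<in> Poly_Mapping.keys f" for w using that by (simp add: ncpolys_def)
      have "\<tau> (eval_op id_blinfun (map ent0 x) f) = (\<Sum>w\<in>Poly_Mapping.keys f. Poly_Mapping.lookup f w * \<tau> (?F w))"
        unfolding eval_op_def using F[OF w] by (simp add: tau_sum M_scale tau_scale)
      also have "\<dots> = (\<Sum>w\<in>Poly_Mapping.keys f. Poly_Mapping.lookup f w * (T (wd ((!) x) e w) / T e))"
        using F[OF w] by (intro sum.cong refl) (simp add: Te T_U)
      finally show ?thesis using True by (simp add: law_op_def lawq_def law_of_def)
    qed (simp add: law_op_def lawq_def law_of_def)
  qed
qed

lemma sac_entropy:
  assumes q: "tproj q" and t: "T q = of_real t" "0 < t"
  shows "law_entropy (sac q) (lawq q) = one_bounded_entropy (amplification M (op q)) (op q) (amplification_trace \<tau> t)"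
  unfolding one_bounded_entropy_eq
proof (rule law_entropy_transfer[where f = op])
  have qq: "adj q = q" "q * q = q" "q \<in> P" using q tproj_P by (auto simp: tproj_def)
  show "bij_betw op (sac q) (sa_contractions (amplification M (op q)))"
    unfolding bij_betw_def
  proof
    show "inj_on op (sac q)" by (simp add: inj_on_def op_inject)
    show "op ` sac q = sa_contractions (amplification M (op q))"
    proof (intro equalityI subsetI)
      fix N assume "N \<in> op ` sac q"
      then obtain x where x: "con x" "adj x = x" "q * x = x" "x * q = x" and N: "N = op x" by (auto simp: sac_def)
      have "N = op q o\<^sub>L op x o\<^sub>L op q" unfolding N by (simp add: op_mult[symmetric] x)
      hence "N \<in> amplification M (op q)" using con_P[OF x(1)] by (auto simp: amplification_def corner_def P_def)
      moreover have "self_adjoint N" using op_adj[of x] by (simp add: N x self_adjoint_def)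
      ultimately show "N \<in> sa_contractions (amplification M (op q))" using x(1) by (simp add: sa_contractions_def N con_def)
    next
      fix N assume "N \<in> sa_contractions (amplification M (op q))"
      then obtain N' where N': "N' \<in> matrix_amplification M" "N = op q o\<^sub>L N' o\<^sub>L op q"
        and N: "self_adjoint N" "norm N \<le> 1"
        by (auto simp: sa_contractions_def amplification_def corner_def)
      have qe: "op_entry i j (op q) \<in> M" for i j by (rule entries[OF qq(3)])
      have NM: "op_entry i j N \<in> M" for i j
        unfolding N'(2) op_entry_compose using N'(1) qe
        by (intro M_sum M_comp) (auto simp: matrix_amplification_def)
      \<comment> \<open>The corner consists of real-linear operators by type; entries in M make N
        complex linear, and N is its own adjoint, so it belongs to \<open>cop\<close>.\<close>
      have "complex_linear N" by (rule complex_linear_entries[OF M_linear[OF NM]])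
      hence opN: "op (Cop N) = N" using N(1) by (intro op_Cop) (simp_all add: self_adjoint_def)
      have "Cop N \<in> sac q"
      proof -
        have "con (Cop N)" using N(2) NM by (simp add: con_def P_iff opN)
        moreover have "adj (Cop N) = Cop N" using N(1) by (intro op_adjI) (simp add: opN self_adjoint_def)
        moreover have "op (q * q) = op q" by (simp add: qq)
        hence idem: "blinfun_apply (op q) (blinfun_apply (op q) v) = blinfun_apply (op q) v" for v
          by (metis op_mult blinfun_apply_blinfun_compose)
        have "op q o\<^sub>L N = N" "N o\<^sub>L op q = N"
          by (rule blinfun_eqI, simp add: N'(2) idem)+
        hence "q * Cop N = Cop N" "Cop N * q = Cop N"
          by (simp_all add: op_inject[symmetric] op_mult opN)
        ultimately show ?thesis by (simp add: sac_def)
      qed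
      thus "N \<in> op ` sac q" using opN by (metis image_eqI)
    qed
  qed
  fix x assume x: "set x \<subseteq> sac q"
  have F: "foldr (\<lambda>i N. map op x ! i o\<^sub>L N) w (op q) = op (wd ((!) x) q w) \<and> wd ((!) x) q w \<in> P"
    if "set w \<subseteq> {..<length x}" for w
    using that
  proof (induction w)
    case Nil show ?case by (simp add: qq)
  next
    case (Cons k w)
    hence k: "k < length x" by simp
    hence "x ! k \<in> P" using x nth_mem[OF k] sac_P by blast
    thus ?case using Cons by (simp add: op_mult)
  qed
  show "law_op (op q) (amplification_trace \<tau> t) (map op x) = lawq q x"
  proof (rule ext)
    fix f
    show "law_op (op q) (amplification_trace \<tau> t) (map op x) f = lawq q x f"
    proof (cases "f \<in> ncpolys (length x)")
      case True
      hence w: "set w \<subseteq> {..<length x}" if "w \<in> Poly_Mapping.keys f" for w using that by (simp add: ncpolys_def)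
      have "eval_op (op q) (map op x) f = op (\<Sum>w\<in>Poly_Mapping.keys f. Poly_Mapping.lookup f w \<star> wd ((!) x) q w)"
        unfolding eval_op_def op_sum op_cscale by (intro sum.cong refl) (simp add: F[OF w])
      hence "matrix_trace \<tau> (eval_op (op q) (map op x) f) = T (\<Sum>w\<in>Poly_Mapping.keys f. Poly_Mapping.lookup f w \<star> wd ((!) x) q w)"
        by (simp add: T_def)
      also have "\<dots> = (\<Sum>w\<in>Poly_Mapping.keys f. Poly_Mapping.lookup f w * T (wd ((!) x) q w))"
        using F[OF w] by (simp add: tr_sum tr_cscale)
      finally show ?thesis using True t
        by (simp add: law_op_def lawq_def law_of_def amplification_trace_def sum_divide_distrib)
    qed (simp add: law_op_def lawq_def law_of_def)
  qed
qed

text \<open>The elements c_j = q e_(j,i0), with e_(j,i0) the matrix units, satisfy exactly that the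
  sum of the c_j c_j^* is q. One of them is nonzero and starts the exhaustion that approximates e by
  sums of a_l^* a_l. Each family serves in both directions, the second time through its
  adjoints.\<close>

lemma entropy_scaling:
  assumes fac: "factor M" and q: "tproj q" and t: "T q = of_real t" "0 < t"
  shows "law_entropy (sac q) (lawq q) = ereal (1 / t\<^sup>2) * law_entropy (sac e) (lawq e)"
proof -
  have qq: "con q" "adj q = q" "q * q = q" "q \<in> P" using q tproj_P by (auto simp: tproj_def)
  have ee: "con e" "adj e = e" "e * e = e" and Te: "T e = 1"
    using tproj_e by (auto simp: tproj_def e_def T_U M_id tau_id)
  define c where "c j = q * U j i0 id_blinfun" for j
  have c: "con (c j)" "q * c j = c j" "c j * e = c j" for j
    unfolding c_def
    by (intro con_mult qq U_con M_id norm_id_le)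
      (simp_all add: mult.assoc[symmetric] qq, simp add: mult.assoc e_def U_mult M_id id_comp)
  have cc: "c j * adj (c j) = q * U j j id_blinfun * q" for j
    by (simp add: c_def adj_mult qq U_adj[OF M_id id_adjoint] mult.assoc)
      (simp add: mult.assoc[symmetric] U_mult M_id id_comp)
  have sum_c: "(\<Sum>j\<in>UNIV. c j * adj (c j)) = q"
  proof -
    have "(\<Sum>j\<in>UNIV. c j * adj (c j)) = q * (\<Sum>j\<in>UNIV. U j j id_blinfun) * q"
      by (simp add: cc sum_distrib_left sum_distrib_right)
    thus ?thesis by (simp add: sum_U qq)
  qed
  have "\<exists>j. c j \<noteq> 0"
  proof (rule ccontr)
    assume "\<not> ?thesis"
    hence "q = 0" using sum_c by simp
    thus False using t by simp
  qed
  then obtain j0 where "c j0 \<noteq> 0" by blast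
  then interpret fc: factor_corner M \<tau> i0 q "c j0"
    by unfold_locales (use fac c in auto)
  obtain h where h: "bij_betw h {0..<card (UNIV :: 'k set)} (UNIV :: 'k set)"
    using ex_bij_betw_nat_finite[OF finite_class.finite_UNIV] by blast
  let ?r = "card (UNIV :: 'k set)"
  have sum_h: "(\<Sum>j<?r. c (h j) * adj (c (h j))) = q"
    using sum.reindex_bij_betw[OF h, of "\<lambda>j. c j * adj (c j)"] sum_c by (simp add: atLeast0LessThan)
  have flip: "adj y * q = adj y" "e * adj y = adj y" if "q * y = y" "y * e = y" for y
    using arg_cong[OF that(1), of adj] arg_cong[OF that(2), of adj] by (simp_all add: adj_mult qq ee)
  have "law_entropy (sac q) (lawq q) \<le> ereal ((Re (T e) / Re (T q))\<^sup>2) * law_entropy (sac e) (lawq e)"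
  proof (rule law_entropy_compression[OF q tproj_e fc.full])
    fix \<delta> :: real assume "0 < \<delta>"
    thus "\<exists>(b :: nat \<Rightarrow> _) r. (\<forall>j. con (b j) \<and> q * b j = b j \<and> b j * e = b j) \<and>
      bd 1 (\<Sum>j<r. b j * adj (b j)) \<and> nrm ((\<Sum>j<r. b j * adj (b j)) - q) < \<delta>"
      by (intro exI[of _ "\<lambda>j. c (h j)"] exI[of _ ?r]) (simp add: c sum_h con_bd qq)
  qed
  hence 1: "law_entropy (sac q) (lawq q) \<le> ereal (1 / t\<^sup>2) * law_entropy (sac e) (lawq e)"
    by (simp add: Te t power_divide)
  \<comment> \<open>Now q and e change places: adjoints of the c_j approximate the new target unit,
    adjoints of the a_l the new source unit.\<close>
  have "law_entropy (sac e) (lawq e) \<le> ereal ((Re (T q) / Re (T e))\<^sup>2) * law_entropy (sac q) (lawq q)"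
  proof (rule law_entropy_compression[OF tproj_e q])
    fix \<delta> :: real assume \<delta>: "0 < \<delta>"
    show "\<exists>a s. (\<forall>l. con (a l) \<and> e * a l = a l \<and> a l * q = a l) \<and> bd 1 (gram a s) \<and> nrm (gram a s - q) < \<delta>"
      using \<delta> by (intro exI[of _ "\<lambda>j. adj (c (h j))"] exI[of _ ?r])
        (simp add: c con_adj flip gram_def sum_h con_bd qq)
    obtain a s where "\<forall>l. con (a l) \<and> q * a l = a l \<and> a l * e = a l" "bd 1 (gram a s)" "nrm (gram a s - e) < \<delta>"
      using fc.full[OF \<delta>] by (elim exE conjE)
    thus "\<exists>(b :: nat \<Rightarrow> _) r. (\<forall>j. con (b j) \<and> e * b j = b j \<and> b j * q = b j) \<and>
      bd 1 (\<Sum>j<r. b j * adj (b j)) \<and> nrm ((\<Sum>j<r. b j * adj (b j)) - e) < \<delta>"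
      by (intro exI[of _ "\<lambda>l. adj (a l)"] exI[of _ s]) (simp add: con_adj flip gram_def)
  qed
  hence "law_entropy (sac e) (lawq e) \<le> ereal (t\<^sup>2) * law_entropy (sac q) (lawq q)" by (simp add: Te t)
  hence "ereal (1 / t\<^sup>2) * law_entropy (sac e) (lawq e) \<le> ereal (1 / t\<^sup>2) * (ereal (t\<^sup>2) * law_entropy (sac q) (lawq q))"
    by (rule ereal_mult_left_mono) simp
  also have "\<dots> = law_entropy (sac q) (lawq q)"
    using t by (simp add: mult.assoc[symmetric] one_ereal_def[symmetric])
  finally show ?thesis using 1 by (rule antisym[rotated])
qed

end

theorem proposition1p3:
  fixes M :: "'h::complex_hilbert_space operator set"
    and \<tau> :: "'h operator \<Rightarrow> complex"
    and t :: real
    and p :: "('h ^ 'k::finite) operator"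
  assumes "II1_factor M \<tau>"
    and "0 < t"
    and "represents_amplification M \<tau> t p"
  shows "one_bounded_entropy (amplification M p) p (amplification_trace \<tau> t) =
    ereal (1 / t\<^sup>2) * one_bounded_entropy M id_blinfun \<tau>"
proof -
  \<comment> \<open>Any index may serve as \<open>i0\<close>, since every diagonal corner is a copy
    of M.\<close>
  interpret amp M \<tau> "undefined :: 'k"
    by unfold_locales (use assms(1) in \<open>simp add: II1_factor_def\<close>)
  have p: "p \<in> matrix_amplification M" "complex_linear p" "self_adjoint p" "p o\<^sub>L p = p" "matrix_trace \<tau> p = of_real t"
    using assms(3) by (auto simp: represents_amplification_def projection_def)
  define q where "q = Cop p"
  have op_q: "op q = p" unfolding q_def using p(2,3) by (intro op_Cop) (simp_all add: self_adjoint_def)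
  have q: "adj q = q" "q * q = q"
  proof -
    show "adj q = q" by (rule op_adjI) (use p(3) in \<open>simp add: op_q self_adjoint_def\<close>)
    show "q * q = q" by (rule op_inject[THEN iffD1]) (simp add: op_mult op_q p(4))
  qed
  have "con q"
    by (rule con_of_contraction[OF _ q(1) projection_contraction[OF q]]) (simp add: P_def op_q p)
  moreover have Tq: "T q = of_real t" by (simp add: T_def op_q p)
  ultimately have "tproj q" using q assms(2) by (simp add: tproj_def)
  moreover have "factor M" using assms(1) by (simp add: II1_factor_def)
  ultimately show ?thesis
    using entropy_scaling[of q t] Tq assms(2)
    unfolding sac_entropy[OF \<open>tproj q\<close> Tq assms(2)] sac_e_entropy op_q by blast
qed

end
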